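(* Let $B \subseteq [n]$ and let $\beta \in \mathrm{Braid}_n$ be a $(B,\cdot)$-boundary braid. Then there are unique braids $\mathrm{Fix}^B(\beta) \in \mathrm{Fix}_n(B)$ and $\mathrm{Move}^B(\beta)\in \mathrm{Move}_n(B,\cdot)$ such that $$\beta = \mathrm{Fix}^B(\beta)\,\mathrm{Move}^B(\beta).$$
   Context: Braids. Fix an integer $n\ge 3$ and write $[n]=\{1,\dots,n\}$; elements of $[n]$ are read modulo $n$ (so $n+1=1$). Let $p_j=e^{2\pi \sqrt{-1}\, j/n}\in\mathbb{C}$, $P=\{p_1,\dots,p_n\}$, $P_A=\{p_a: a\in A\}$ for $A\subseteq[n]$, and let $D$ be the convex hull of $P$. $\mathrm{UConf}_n(D)$ is the space of $n$-element subsets of $D$ (the quotient of the space of $n$-tuples of distinct points of $D$ by the symmetric group), and $\mathrm{Braid}_n=\pi_1(\mathrm{UConf}_n(D),P)$. A representative of a braid $\beta$ is a loop $f$ with $\beta=[f]$; the product $\alpha\beta$ is represented by first following $\alpha$, then $\beta$. The strand $f^i\colon[0,1]\to D$ of $f$ is the path followed by the point that starts at $p_i$. For $B,B'\subseteq[n]$ of equal size, $\beta$ is a $(B,B')$-boundary braid if all its strands starting in $P_B$ end in $P_{B'}$ and it has a representative $f$ such that $f^b$ stays in $\partial D$ for all $b\in B$ simultaneously; it is a $(B,\cdot)$-boundary braid if this holds for some $B'$. The corresponding sets are $\mathrm{Braid}_n(B,B')$ and $\mathrm{Braid}_n(B,\cdot)$. $\mathrm{Fix}_n(B)$ is the subgroup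 of braids having a representative $f$ with $f^b$ constant for all $b\in B$. Dual simple braids. A partition $\pi$ of $[n]$ is noncrossing if the convex hulls of the sets $P_A$, $A$ a block of $\pi$, are pairwise disjoint. $\mathrm{NC}_n$ is the set of noncrossing partitions ordered by refinement; $\mathrm{NC}_n^*$ is $\mathrm{NC}_n$ without the discrete partition. For $A\subseteq[n]$ with $|A|\ge 2$ the rotation braid $\delta_A$ is represented by the loop fixing $p_i$ for $i\notin A$ and moving simultaneously every $p_i$, $i\in A$, counterclockwise along $\partial D_A$ to the next point of $P_A$, where $D_A$ is the convex hull of $P_A$ if $|A|\geq 3$ and a thin bigon around the segment joining the two points if $|A|=2$ (having the segment itself as one side if it lies in $\partial D$). $\delta_A=1$ if $|A|\le 1$. Put $\delta_\pi=\prod_{A\in\pi}\delta_A$ (the factors commute); $\pi\mapsto\delta_\pi$ is injective. Complex of boundary braids. $\mathrm{Cplx}(\mathrm{Braid}_n)$ is the flag complex of the right Cayley graph of $\mathrm{Braid}_n$ with respect to $\{\delta_\pi:\pi\in\mathrm{NC}_n^*\}$; the edge from $\beta$ to $\beta\delta_\pi$ is oriented this way and labeled $\pi$. $\mathrm{Cplx}(\mathrm{Braid}_n(B,\cdot))$ is its full subcomplex on the vertex set $\mathrm{Braid}_n(B,\cdot)$. For $B'\subseteq[n]$, $\mathrm{NC}_n(B',\cdot)$ is the set of $\pi\in\mathrm{NC}_n$ such that every $b\in B'$ either forms a singleton block of $\pi$ or shares a block with $b+1$ (equivalently $\delta_\pi$ is a $(B',\cdot)$-boundary braid). For $\pi\in\mathrm{NC}_n(B',\cdot)$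 let $\mathrm{Fix}^{B'}(\pi)$ be obtained from $\pi$ by making every $b\in B'$ a singleton block, and let $\mathrm{Move}^{B'}(\pi)$ be the noncrossing partition $\pi'$ with $\delta_{\pi'}=\delta_{\mathrm{Fix}^{B'}(\pi)}^{-1}\delta_\pi$ (it exists). Configuration space of a cycle. Let $1\le k\le n$. $\mathbb{R}^k$ is given the simplicial structure with vertex set $\mathbb{Z}^k$ and simplices $[x,x+\mathbf 1_{C_1},\dots,x+\mathbf 1_{C_\ell}]$ with $\emptyset\ne C_1\subsetneq\dots\subsetneq C_\ell\subseteq[k]$, where $\mathbf 1_C$ is the $0/1$ indicator vector of $C$. This induces a cell structure on $\mathbb{R}^k/(n\mathbb{Z})^k=(\Gamma_n)^k$, where $\Gamma_n=\mathbb{R}/n\mathbb{Z}$ is the oriented $n$-cycle. The subcomplex of simplices disjoint from the thick diagonal (tuples with two equal entries), modulo the symmetric group on $[k]$, is $\mathrm{UConf}_k(\Gamma_n)$ (orthoscheme version). Thus its vertices are the $k$-element subsets of $[n]$, and the edges out of a vertex $B'$ correspond to nonempty $C\subseteq B'$ with $(C+1)\cap(B'\setminus C)=\emptyset$, ending at $(B'\setminus C)\cup(C+1)$. Move braids. Let $B\ne\emptyset$. The map $\mathrm{bdry}^B\colon \mathrm{Cplx}(\mathrm{Braid}_n(B,\cdot))\to\mathrm{UConf}_{|B|}(\Gamma_n)$ sends $\beta\in\mathrm{Braid}_n(B,B')$ to $B'$ and an edge out of $\beta$ labeled $\pi$ to the edge out of $B'$ given by $C=\{b\in B':\{b\}\text{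 is not a block of }\pi\}$ (to the vertex $B'$ if $C=\emptyset$). Let $\mathrm{cov}\colon\widetilde{\mathrm{UConf}}_{|B|}(\Gamma_n)\to\mathrm{UConf}_{|B|}(\Gamma_n)$ be the universal cover with a base vertex $V_0$ over $B$. There is a unique map of complexes $\mathrm{split}^B\colon\widetilde{\mathrm{UConf}}_{|B|}(\Gamma_n)\to\mathrm{Cplx}(\mathrm{Braid}_n(B,\cdot))$ with $\mathrm{bdry}^B\circ\mathrm{split}^B=\mathrm{cov}$, $\mathrm{split}^B(V_0)=1$, and such that every edge of its image starting in a vertex of $\mathrm{Braid}_n(B,B')$ has a label $\pi\in\mathrm{NC}_n(B',\cdot)$ with $\mathrm{Move}^{B'}(\pi)=\pi$. Its image is denoted $\mathrm{Cplx}(\mathrm{Move}_n(B,\cdot))$ and the vertex set of the image is $\mathrm{Move}_n(B,\cdot)$. For $B=\emptyset$ the configuration space of $0$ points is a single vertex and $\mathrm{Move}_n(\emptyset,\cdot)=\{1\}$. *)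

theory Defs
  imports "HOL-Analysis.Analysis" "HOL-Algebra.Group"
begin

section \<open>Fundamental groups and configuration spaces\<close>

definition path_homotopic :: "'a topology \<Rightarrow> (real \<Rightarrow> 'a) \<Rightarrow> (real \<Rightarrow> 'a) \<Rightarrow> bool" where
  "path_homotopic X f g \<longleftrightarrow>
     homotopic_with (\<lambda>r. r 0 = f 0 \<and> r 1 = f 1) (top_of_set {0..1}) X f g"

definition path_class :: "'a topology \<Rightarrow> (real \<Rightarrow> 'a) \<Rightarrow> (real \<Rightarrow> 'a) set" where
  "path_class X f = {g. path_homotopic X f g}"

definition path_concat :: "(real \<Rightarrow> 'a) \<Rightarrow> (real \<Rightarrow> 'a) \<Rightarrow> real \<Rightarrow> 'a" where
  "path_concat f g = (\<lambda>t. if t \<le> 1/2 then f (2 * t) else g (2 * t - 1))"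

definition class_mult ::
  "'a topology \<Rightarrow> (real \<Rightarrow> 'a) set \<Rightarrow> (real \<Rightarrow> 'a) set \<Rightarrow> (real \<Rightarrow> 'a) set" where
  "class_mult X a b = {h. \<exists>f\<in>a. \<exists>g\<in>b. path_homotopic X (path_concat f g) h}"

definition fundamental_group :: "'a topology \<Rightarrow> 'a \<Rightarrow> (real \<Rightarrow> 'a) set monoid" where
  "fundamental_group X x =
     \<lparr>carrier = {path_class X f | f. pathin X f \<and> f 0 = x \<and> f 1 = x},
      mult = class_mult X,
      one = path_class X (\<lambda>_. x)\<rparr>"

definition conf :: "nat \<Rightarrow> complex set \<Rightarrow> (nat \<Rightarrow> complex) topology" where
  "conf k S = subtopology (product_topology (\<lambda>_. top_of_set S) {1..k}) {x. inj_on x {1..k}}"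

text \<open>The points of \<open>uconf k S\<close> are the \<open>k\<close>-element subsets of \<open>S\<close>, with the
  quotient topology along \<open>x \<mapsto> {x 1, \<dots>, x k}\<close>; see \<open>quotient_map_uconf\<close> below.\<close>

definition uconf :: "nat \<Rightarrow> complex set \<Rightarrow> complex set topology" where
  "uconf k S = topology (\<lambda>U. U \<subseteq> (\<lambda>x. x ` {1..k}) ` topspace (conf k S) \<and>
     openin (conf k S) {x \<in> topspace (conf k S). x ` {1..k} \<in> U})"

lemma openin_uconf:
  "openin (uconf k S) U \<longleftrightarrow> U \<subseteq> (\<lambda>x. x ` {1..k}) ` topspace (conf k S) \<and>
     openin (conf k S) {x \<in> topspace (conf k S). x ` {1..k} \<in> U}"
proof -
  define q :: "(nat \<Rightarrow> complex) \<Rightarrow> complex set" where "q = (\<lambda>x. x ` {1..k})"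
  define T where "T = topspace (conf k S)"
  have "istopology (\<lambda>U. U \<subseteq> q ` T \<and> openin (conf k S) {x \<in> T. q x \<in> U})"
    unfolding istopology_def
  proof (intro conjI allI impI)
    fix U V
    assume UV: "U \<subseteq> q ` T \<and> openin (conf k S) {x \<in> T. q x \<in> U}"
      "V \<subseteq> q ` T \<and> openin (conf k S) {x \<in> T. q x \<in> V}"
    then show "U \<inter> V \<subseteq> q ` T" by blast
    have eq: "{x \<in> T. q x \<in> U \<inter> V} = {x \<in> T. q x \<in> U} \<inter> {x \<in> T. q x \<in> V}" by blast
    show "openin (conf k S) {x \<in> T. q x \<in> U \<inter> V}"
      unfolding eq using UV by (blast intro: openin_Int)
  next
    fix K
    assume K: "\<forall>U\<in>K. U \<subseteq> q ` T \<and> openin (conf k S) {x \<in> T. q x \<in> U}"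
    then show "\<Union>K \<subseteq> q ` T" by blast
    have eq: "{x \<in> T. q x \<in> \<Union>K} = \<Union>((\<lambda>U. {x \<in> T. q x \<in> U}) ` K)" by blast
    show "openin (conf k S) {x \<in> T. q x \<in> \<Union>K}"
      unfolding eq using K by (blast intro: openin_Union)
  qed
  then show ?thesis
    unfolding uconf_def by (simp add: topology_inverse' q_def T_def)
qed

lemma topspace_uconf_image: "topspace (uconf k S) = (\<lambda>x. x ` {1..k}) ` topspace (conf k S)"
proof (rule subset_antisym)
  show "topspace (uconf k S) \<subseteq> (\<lambda>x. x ` {1..k}) ` topspace (conf k S)"
    using openin_topspace[of "uconf k S"] unfolding openin_uconf by (rule conjunct1)
  have "{x \<in> topspace (conf k S). x ` {1..k} \<in> (\<lambda>x. x ` {1..k}) ` topspace (conf k S)} =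
      topspace (conf k S)"
    by blast
  then have "openin (uconf k S) ((\<lambda>x. x ` {1..k}) ` topspace (conf k S))"
    unfolding openin_uconf by simp
  then show "(\<lambda>x. x ` {1..k}) ` topspace (conf k S) \<subseteq> topspace (uconf k S)"
    by (rule openin_subset)
qed

lemma quotient_map_uconf: "quotient_map (conf k S) (uconf k S) (\<lambda>x. x ` {1..k})"
  unfolding quotient_map_def topspace_uconf_image by (simp add: openin_uconf)

lemma topspace_uconf: "topspace (uconf k S) = {A. A \<subseteq> S \<and> finite A \<and> card A = k}"
proof (intro equalityI subsetI)
  fix A assume "A \<in> topspace (uconf k S)"
  then obtain x where "A = x ` {1..k}" "x \<in> {1..k} \<rightarrow>\<^sub>E S" "inj_on x {1..k}"
    unfolding topspace_uconf_image conf_def by auto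
  then show "A \<in> {A. A \<subseteq> S \<and> finite A \<and> card A = k}"
    by (auto simp: PiE_iff card_image)
next
  fix A assume A: "A \<in> {A. A \<subseteq> S \<and> finite A \<and> card A = k}"
  then have "\<exists>h. bij_betw h {1..k} A"
    by (intro finite_same_card_bij) auto
  then obtain h where h: "inj_on h {1..k}" "h ` {1..k} = A"
    by (auto simp: bij_betw_def)
  define x where "x = restrict h {1..k}"
  have x: "x ` {1..k} = A" "inj_on x {1..k}"
    using h by (simp_all add: x_def)
  have "x \<in> topspace (conf k S)"
    using h A x(2) by (auto simp: conf_def x_def)
  with x(1) show "A \<in> topspace (uconf k S)"
    unfolding topspace_uconf_image by blast
qed

section \<open>Braids\<close>

definition circ :: "nat \<Rightarrow> real \<Rightarrow> complex" where
  "circ n x = cis (2 * pi * x / real n)"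

definition pt :: "nat \<Rightarrow> nat \<Rightarrow> complex" where
  "pt n j = circ n (real j)"

definition polygon :: "nat \<Rightarrow> complex set" where
  "polygon n = convex hull (pt n ` {1..n})"

definition braid_group :: "nat \<Rightarrow> (real \<Rightarrow> complex set) set monoid" where
  "braid_group n = fundamental_group (uconf n (polygon n)) (pt n ` {1..n})"

text \<open>For a loop \<open>f\<close> in the configuration space there is exactly one such \<open>g\<close> (up to its
  values outside \<open>{0..1}\<close>), since the points of \<open>f t\<close> are pairwise distinct.\<close>

definition is_strand :: "nat \<Rightarrow> (real \<Rightarrow> complex set) \<Rightarrow> nat \<Rightarrow> (real \<Rightarrow> complex) \<Rightarrow> bool" where
  "is_strand n f i g \<longleftrightarrow>
     pathin (top_of_set (polygon n)) g \<and> g 0 = pt n i \<and> (\<forall>t\<in>{0..1}. g t \<in> f t)"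

definition boundary_braids :: "nat \<Rightarrow> nat set \<Rightarrow> nat set \<Rightarrow> (real \<Rightarrow> complex set) set set" where
  "boundary_braids n B B' = {\<beta> \<in> carrier (braid_group n).
     B \<subseteq> {1..n} \<and> B' \<subseteq> {1..n} \<and> card B' = card B \<and>
     (\<forall>f\<in>\<beta>. \<forall>b\<in>B. \<forall>g. is_strand n f b g \<longrightarrow> g 1 \<in> pt n ` B') \<and>
     (\<exists>f\<in>\<beta>. \<forall>b\<in>B. \<exists>g. is_strand n f b g \<and> (\<forall>t\<in>{0..1}. g t \<in> frontier (polygon n)))}"

definition boundary_braids_from :: "nat \<Rightarrow> nat set \<Rightarrow> (real \<Rightarrow> complex set) set set" where
  "boundary_braids_from n B = (\<Union>B'. boundary_braids n B B')"

definition fix_braids :: "nat \<Rightarrow> nat set \<Rightarrow> (real \<Rightarrow> complex set) set set" where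
  "fix_braids n B = {\<beta> \<in> carrier (braid_group n).
     \<exists>f\<in>\<beta>. \<forall>b\<in>B. \<exists>g. is_strand n f b g \<and> (\<forall>t\<in>{0..1}. g t = pt n b)}"

section \<open>Dual simple braids\<close>

definition cyc_succ :: "nat \<Rightarrow> nat \<Rightarrow> nat" where
  "cyc_succ n i = i mod n + 1"

text \<open>The next element of \<open>A\<close> counterclockwise after \<open>i\<close>.\<close>

definition next_in :: "nat \<Rightarrow> nat set \<Rightarrow> nat \<Rightarrow> nat" where
  "next_in n A i = (cyc_succ n ^^ (LEAST k. 0 < k \<and> (cyc_succ n ^^ k) i \<in> A)) i"

text \<open>For \<open>card A = 2\<close> the last summand bends the motion from \<open>p\<^sub>i\<close> to \<open>p\<^sub>j\<close> away from the
  segment, towards \<open>p\<^bsub>i+1\<^esub>\<close>, hence to its right. It stays in the triangle with corners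
  \<open>p\<^sub>i\<close>, \<open>p\<^bsub>i+1\<^esub>\<close>, \<open>p\<^sub>j\<close>, so the bigon traced out lies in the polygon and contains no marked
  points besides its two corners; if \<open>j = i + 1\<close> the motion runs along the segment itself.\<close>

definition rotation_motion :: "nat \<Rightarrow> nat set \<Rightarrow> nat \<Rightarrow> real \<Rightarrow> complex" where
  "rotation_motion n A i t =
     (if i \<in> A then
        (1 - t) *\<^sub>R pt n i + t *\<^sub>R pt n (next_in n A i) +
        (if card A = 2
         then (t * (1 - t)) *\<^sub>R
                (pt n (cyc_succ n i) - midpoint (pt n i) (pt n (next_in n A i)))
         else 0)
      else pt n i)"

definition rotation_braid :: "nat \<Rightarrow> nat set \<Rightarrow> (real \<Rightarrow> complex set) set" where
  "rotation_braid n A =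
     (if card A \<le> 1 then \<one>\<^bsub>braid_group n\<^esub>
      else path_class (uconf n (polygon n)) (\<lambda>t. (\<lambda>i. rotation_motion n A i t) ` {1..n}))"

definition noncrossing :: "nat \<Rightarrow> nat set set set" where
  "noncrossing n = {\<pi>. partition_on {1..n} \<pi> \<and>
     (\<forall>A\<in>\<pi>. \<forall>A'\<in>\<pi>. A \<noteq> A' \<longrightarrow> convex hull (pt n ` A) \<inter> convex hull (pt n ` A') = {})}"

definition noncrossing_proper :: "nat \<Rightarrow> nat set set set" where
  "noncrossing_proper n = noncrossing n - {(\<lambda>i. {i}) ` {1..n}}"

text \<open>The factors commute, so the order chosen for the blocks is irrelevant.\<close>

definition dual_simple :: "nat \<Rightarrow> nat set set \<Rightarrow> (real \<Rightarrow> complex set) set" where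
  "dual_simple n \<pi> =
     foldr (\<lambda>A x. rotation_braid n A \<otimes>\<^bsub>braid_group n\<^esub> x)
       (SOME As. distinct As \<and> set As = \<pi>) \<one>\<^bsub>braid_group n\<^esub>"

definition noncrossing_boundary :: "nat \<Rightarrow> nat set \<Rightarrow> nat set set set" where
  "noncrossing_boundary n B' = {\<pi> \<in> noncrossing n.
     \<forall>b\<in>B'. {b} \<in> \<pi> \<or> (\<exists>A\<in>\<pi>. b \<in> A \<and> cyc_succ n b \<in> A)}"

definition fix_part :: "nat set \<Rightarrow> nat set set \<Rightarrow> nat set set" where
  "fix_part B' \<pi> = ((\<lambda>A. A - B') ` \<pi> - {{}}) \<union> (\<lambda>b. {b}) ` B'"

definition move_part :: "nat \<Rightarrow> nat set \<Rightarrow> nat set set \<Rightarrow> nat set set" where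
  "move_part n B' \<pi> = (THE \<pi>'. \<pi>' \<in> noncrossing n \<and>
     dual_simple n \<pi>' =
       inv\<^bsub>braid_group n\<^esub> (dual_simple n (fix_part B' \<pi>)) \<otimes>\<^bsub>braid_group n\<^esub> dual_simple n \<pi>)"

section \<open>The complex of boundary braids\<close>

definition cayley_edge ::
  "nat \<Rightarrow> (real \<Rightarrow> complex set) set \<Rightarrow> nat set set \<Rightarrow> (real \<Rightarrow> complex set) set \<Rightarrow> bool" where
  "cayley_edge n \<beta> \<pi> \<gamma> \<longleftrightarrow> \<beta> \<in> carrier (braid_group n) \<and> \<pi> \<in> noncrossing_proper n \<and>
     \<gamma> = \<beta> \<otimes>\<^bsub>braid_group n\<^esub> dual_simple n \<pi>"

text \<open>Simplicial complexes are given by their sets of simplices, and simplices by their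
  vertex sets.\<close>

definition braid_complex :: "nat \<Rightarrow> (real \<Rightarrow> complex set) set set set" where
  "braid_complex n = {S. finite S \<and> S \<noteq> {} \<and> S \<subseteq> carrier (braid_group n) \<and>
     (\<forall>\<beta>\<in>S. \<forall>\<gamma>\<in>S. \<beta> \<noteq> \<gamma> \<longrightarrow> (\<exists>\<pi>. cayley_edge n \<beta> \<pi> \<gamma> \<or> cayley_edge n \<gamma> \<pi> \<beta>))}"

definition boundary_complex :: "nat \<Rightarrow> nat set \<Rightarrow> (real \<Rightarrow> complex set) set set set" where
  "boundary_complex n B = {S \<in> braid_complex n. S \<subseteq> boundary_braids_from n B}"

definition bdry :: "nat \<Rightarrow> nat set \<Rightarrow> (real \<Rightarrow> complex set) set \<Rightarrow> nat set" where
  "bdry n B \<beta> = (THE B'. \<beta> \<in> boundary_braids n B B')"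

definition bdry_edge ::
  "nat \<Rightarrow> nat set \<Rightarrow> (real \<Rightarrow> complex set) set \<Rightarrow> nat set set \<Rightarrow> nat set" where
  "bdry_edge n B \<beta> \<pi> = {b \<in> bdry n B \<beta>. {b} \<notin> \<pi>}"

section \<open>The configuration space of a cycle\<close>

text \<open>The simplex of \<open>\<real>\<^sup>k\<close> with vertices \<open>z\<close> and \<open>z + \<one>\<^bsub>C\<^esub>\<close> for \<open>C\<close> in \<open>Cs\<close>.\<close>

definition orthoscheme :: "nat \<Rightarrow> (nat \<Rightarrow> int) \<Rightarrow> nat set list \<Rightarrow> (nat \<Rightarrow> real) set" where
  "orthoscheme k z Cs = {y. \<exists>w :: nat \<Rightarrow> real.
     (\<forall>l<length Cs. 0 \<le> w l) \<and> (\<Sum>l<length Cs. w l) \<le> 1 \<and>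
     y = (\<lambda>i\<in>{1..k}. real_of_int (z i) + (\<Sum>l<length Cs. w l * indicator (Cs ! l) i))}"

definition orthoscheme_chain :: "nat \<Rightarrow> nat set list \<Rightarrow> bool" where
  "orthoscheme_chain k Cs \<longleftrightarrow> sorted_wrt (\<subset>) Cs \<and> (\<forall>C\<in>set Cs. C \<noteq> {} \<and> C \<subseteq> {1..k})"

text \<open>The cycle \<open>\<real>/n\<int>\<close> is realized as the unit circle by means of \<open>circ n\<close>, which takes the
  vertices of the cycle to the points \<open>pt n j\<close>.\<close>

definition cycle_uconf :: "nat \<Rightarrow> nat \<Rightarrow> complex set topology" where
  "cycle_uconf n k = subtopology (uconf k (sphere 0 1))
     {(\<lambda>i. circ n (y i)) ` {1..k} | y z Cs. orthoscheme_chain k Cs \<and>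
        (\<forall>x\<in>orthoscheme k z Cs. inj_on (\<lambda>i. circ n (x i)) {1..k}) \<and> y \<in> orthoscheme k z Cs}"

definition out_edges :: "nat \<Rightarrow> nat set \<Rightarrow> nat set set" where
  "out_edges n B' = {C. C \<noteq> {} \<and> C \<subseteq> B' \<and> cyc_succ n ` C \<inter> (B' - C) = {}}"

definition edge_path :: "nat \<Rightarrow> nat set \<Rightarrow> nat set \<Rightarrow> real \<Rightarrow> complex set" where
  "edge_path n B' C t = pt n ` (B' - C) \<union> (\<lambda>c. circ n (real c + t)) ` C"

text \<open>The universal cover is the space of homotopy classes (relative to the endpoints) of paths
  starting at the base point. Its vertices are the classes of paths ending at a vertex; the edge
  over \<open>C\<close> starting at \<open>V\<close> ends at \<open>cover_step n B V C\<close>; and the simplices with first vertex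
  \<open>V\<close> correspond to the chains of edges out of \<open>cov n V\<close>.\<close>

definition cover_vertices :: "nat \<Rightarrow> nat set \<Rightarrow> (real \<Rightarrow> complex set) set set" where
  "cover_vertices n B = {path_class (cycle_uconf n (card B)) f | f.
     pathin (cycle_uconf n (card B)) f \<and> f 0 = pt n ` B \<and> (\<exists>B'\<subseteq>{1..n}. f 1 = pt n ` B')}"

definition cover_base :: "nat \<Rightarrow> nat set \<Rightarrow> (real \<Rightarrow> complex set) set" where
  "cover_base n B = path_class (cycle_uconf n (card B)) (\<lambda>_. pt n ` B)"

definition cov :: "nat \<Rightarrow> (real \<Rightarrow> complex set) set \<Rightarrow> nat set" where
  "cov n V = (THE B'. B' \<subseteq> {1..n} \<and> (\<forall>f\<in>V. f 1 = pt n ` B'))"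

definition cover_step ::
  "nat \<Rightarrow> nat set \<Rightarrow> (real \<Rightarrow> complex set) set \<Rightarrow> nat set \<Rightarrow> (real \<Rightarrow> complex set) set" where
  "cover_step n B V C = class_mult (cycle_uconf n (card B)) V
     (path_class (cycle_uconf n (card B)) (edge_path n (cov n V) C))"

definition cover_complex :: "nat \<Rightarrow> nat set \<Rightarrow> (real \<Rightarrow> complex set) set set set" where
  "cover_complex n B = {insert V (cover_step n B V ` K) | V K.
     V \<in> cover_vertices n B \<and> K \<subseteq> out_edges n (cov n V) \<and> (\<forall>C\<in>K. \<forall>C'\<in>K. C \<subseteq> C' \<or> C' \<subseteq> C)}"

section \<open>Move braids\<close>

text \<open>A simplicial map is given by its effect on vertices. The first condition makes the map
  unique as a function. The equation between \<open>bdry\<close>, \<open>split\<close> and the covering map is imposed on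
  vertices and on oriented edges, which determine the simplices of the base.\<close>

definition is_split ::
  "nat \<Rightarrow> nat set \<Rightarrow> ((real \<Rightarrow> complex set) set \<Rightarrow> (real \<Rightarrow> complex set) set) \<Rightarrow> bool" where
  "is_split n B \<phi> \<longleftrightarrow>
     \<phi> \<in> extensional (cover_vertices n B) \<and>
     (\<forall>S\<in>cover_complex n B. \<phi> ` S \<in> boundary_complex n B) \<and>
     (\<forall>V\<in>cover_vertices n B. bdry n B (\<phi> V) = cov n V) \<and>
     (\<forall>V\<in>cover_vertices n B. \<forall>C\<in>out_edges n (cov n V).
        \<exists>\<pi>. cayley_edge n (\<phi> V) \<pi> (\<phi> (cover_step n B V C)) \<and> bdry_edge n B (\<phi> V) \<pi> = C) \<and>
     \<phi> (cover_base n B) = \<one>\<^bsub>braid_group n\<^esub> \<and>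
     (\<forall>V\<in>cover_vertices n B. \<forall>C\<in>out_edges n (cov n V). \<forall>\<pi>.
        cayley_edge n (\<phi> V) \<pi> (\<phi> (cover_step n B V C)) \<longrightarrow>
        \<pi> \<in> noncrossing_boundary n (bdry n B (\<phi> V)) \<and> move_part n (bdry n B (\<phi> V)) \<pi> = \<pi>)"

definition split_map ::
  "nat \<Rightarrow> nat set \<Rightarrow> (real \<Rightarrow> complex set) set \<Rightarrow> (real \<Rightarrow> complex set) set" where
  "split_map n B = (THE \<phi>. is_split n B \<phi>)"

definition move_braids :: "nat \<Rightarrow> nat set \<Rightarrow> (real \<Rightarrow> complex set) set set" where
  "move_braids n B = split_map n B ` cover_vertices n B"

end

theory Submission
  imports Defs
begin

text \<open>Measured in the universal cover of the boundary, a boundary braid displaces the points of \<open>B\<close> by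
  integers \<open>z\<close>, which winding numbers show to depend on the braid only. If \<open>z = 0\<close>, an isotopy of the
  polygon straightens the boundary strands, so the braid lies in the fix group of \<open>B\<close>. The
  displacements that occur are the integer points of a convex set, defined by unit gaps between
  neighbours. The same convex set covers the configuration space of the cycle, so these displacements
  are also the vertices of its universal cover, and its edges raise some of the points by one.

  The partition into runs of \<open>C\<close> has a dual simple braid \<open>\<delta> C\<close> that moves exactly the points of \<open>C\<close> by one
  step, and these partitions are the only ones that are their own move part. Moreover
  \<open>\<delta> C = \<delta> C' \<delta> (C - C')\<close> if the points of \<open>C'\<close> can be moved first. Hence the product of these braids
  along an ascending path of displacements depends only on its ends, which yields a braid \<open>\<mu> z\<close> for every
  displacement \<open>z\<close>, and the move braids are exactly these. Now \<open>\<beta> = (\<beta> (\<mu> z)\<^sup>-\<^sup>1) (\<mu> z)\<close> is the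
  required product, and it is unique because \<open>\<beta>\<close> determines \<open>z\<close>.\<close>

section \<open>Homotopy classes of paths\<close>

text \<open>The end positions of a boundary braid lose the number of turns around the boundary;
  hence integral displacements. The polygon is simply connected, so the turns of one boundary strand
  are visible only relative to a second strand, whereas on the circle each point counts its turns by
  itself. Two relations between rotation braids carry the algebra: commutation for disjoint hulls,
  and cutting a corner \<open>x\<close> off a block that also contains its successor. Both need
  homotopies without collisions, and the bend of a two-element block need not stay clear of the
  other strands. So the rotations are rebuilt with bends of adjustable width \<open>e\<close>. The
  split map is given only by a description on homotopy classes. It becomes accessible because every
  vertex of the cover has a straight path as normal form, and because the label of an edge can be
  recovered from its braid: the cycles of the permutation are the blocks. Edges only raise
  displacements, while a displacement may have negative entries. Ascending paths therefore start at
  a constant displacement below both \<open>0\<close> and \<open>z\<close>, and a move braid is a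
  quotient of two ascending products.\<close>

abbreviation unit_square :: "(real \<times> real) set" where
  "unit_square \<equiv> {0..1} \<times> {0..1}"

lemma path_homotopic_iff:
  "path_homotopic X f g \<longleftrightarrow> (\<exists>h. continuous_map (top_of_set unit_square) X h \<and>
     (\<forall>t\<in>{0..1}. h (0, t) = f t) \<and> (\<forall>t\<in>{0..1}. h (1, t) = g t) \<and>
     (\<forall>s\<in>{0..1}. h (s, 0) = f 0 \<and> h (s, 1) = f 1))"
  unfolding path_homotopic_def by (subst homotopic_with) auto

lemma path_homotopicI:
  assumes "continuous_map (top_of_set unit_square) X h"
    and "\<And>t. t \<in> {0..1} \<Longrightarrow> h (0, t) = f t" "\<And>t. t \<in> {0..1} \<Longrightarrow> h (1, t) = g t"
    and "\<And>s. s \<in> {0..1} \<Longrightarrow> h (s, 0) = f 0" "\<And>s. s \<in> {0..1} \<Longrightarrow> h (s, 1) = f 1"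
  shows "path_homotopic X f g"
  unfolding path_homotopic_iff using assms by (intro exI[of _ h]) auto

lemma path_homotopicE:
  assumes "path_homotopic X f g"
  obtains h where "continuous_map (top_of_set unit_square) X h"
    "\<And>t. t \<in> {0..1} \<Longrightarrow> h (0, t) = f t" "\<And>t. t \<in> {0..1} \<Longrightarrow> h (1, t) = g t"
    "\<And>s. s \<in> {0..1} \<Longrightarrow> h (s, 0) = f 0" "\<And>s. s \<in> {0..1} \<Longrightarrow> h (s, 1) = f 1"
  using assms that unfolding path_homotopic_iff by blast

lemma path_homotopic_ends:
  assumes "path_homotopic X f g"
  shows "g 0 = f 0" "g 1 = f 1"
proof -
  obtain h where h: "\<forall>t\<in>{0..1}. h (1::real, t::real) = g t" "\<forall>s\<in>{0..1}. h (s, 0) = f 0 \<and> h (s, 1) = f 1"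
    using assms unfolding path_homotopic_iff by blast
  show "g 0 = f 0" using h(1)[rule_format, of 0] h(2)[rule_format, of 1] by simp
  show "g 1 = f 1" using h(1)[rule_format, of 1] h(2)[rule_format, of 1] by simp
qed

lemma path_homotopic_pathin:
  assumes "path_homotopic X f g"
  shows "pathin X f" "pathin X g"
  using homotopic_with_imp_continuous_maps assms unfolding path_homotopic_def pathin_def by blast+

lemma path_homotopic_sym:
  assumes "path_homotopic X f g"
  shows "path_homotopic X g f"
  using assms path_homotopic_ends[OF assms] homotopic_with_symD unfolding path_homotopic_def by fastforce

lemma path_homotopic_trans:
  assumes "path_homotopic X f g" "path_homotopic X g h"
  shows "path_homotopic X f h"
proof -
  have "homotopic_with (\<lambda>r. r 0 = f 0 \<and> r 1 = f 1) (top_of_set {0..1}) X g h"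
    using assms(2) path_homotopic_ends[OF assms(1)] unfolding path_homotopic_def by simp
  with assms(1) show ?thesis unfolding path_homotopic_def by (rule homotopic_with_trans)
qed

text \<open>Inside the convex set \<open>K\<close> the paths \<open>u\<close> and \<open>v\<close>
  are joined by straight lines, and \<open>F\<close> carries this homotopy to \<open>X\<close>.
  Reparametrisation, associativity and the commutation of independent motions are instances.\<close>

lemma path_homotopic_factor:
  fixes F :: "'b::real_normed_vector \<Rightarrow> 'a"
  assumes F: "continuous_map (top_of_set K) X F" and "convex K"
    and u: "continuous_on {0..1} u" "u ` {0..1} \<subseteq> K"
    and v: "continuous_on {0..1} v" "v ` {0..1} \<subseteq> K"
    and "u 0 = v 0" "u 1 = v 1"
    and "\<And>t. t \<in> {0..1} \<Longrightarrow> f t = F (u t)" "\<And>t. t \<in> {0..1} \<Longrightarrow> g t = F (v t)"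
  shows "path_homotopic X f g"
proof (rule path_homotopicI)
  define k where "k = (\<lambda>p::real\<times>real. (1 - fst p) *\<^sub>R u (snd p) + fst p *\<^sub>R v (snd p))"
  have "continuous_on unit_square k"
    unfolding k_def by (intro continuous_intros continuous_on_compose2[OF u(1)]
        continuous_on_compose2[OF v(1)]) auto
  moreover have "k ` unit_square \<subseteq> K"
  proof (rule image_subsetI)
    fix p assume "p \<in> unit_square"
    then have "u (snd p) \<in> K" "v (snd p) \<in> K" "0 \<le> fst p" "fst p \<le> 1" using u(2) v(2) by auto
    then show "k p \<in> K" unfolding k_def using convexD_alt[OF \<open>convex K\<close>] by blast
  qed
  ultimately have "continuous_map (top_of_set unit_square) (top_of_set K) k"
    by (simp add: image_subset_iff_funcset)
  then show "continuous_map (top_of_set unit_square) X (F \<circ> k)" using F by (rule continuous_map_compose)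
qed (use assms in \<open>auto simp: algebra_simps simp flip: scaleR_left_distrib\<close>)

lemma path_homotopic_cong:
  assumes "pathin X f" "\<And>t. t \<in> {0..1} \<Longrightarrow> f t = g t"
  shows "path_homotopic X f g"
proof (rule path_homotopicI)
  have "continuous_map (top_of_set unit_square) (top_of_set {0..1::real}) (snd :: real \<times> real \<Rightarrow> real)"
    by (auto simp: continuous_on_snd)
  then show "continuous_map (top_of_set unit_square) X (f \<circ> snd)"
    using assms(1) unfolding pathin_def by (rule continuous_map_compose)
qed (simp_all add: assms)

lemma path_homotopic_refl: "pathin X f \<Longrightarrow> path_homotopic X f f"
  by (simp add: path_homotopic_cong)

lemma path_class_eq_iff:
  assumes "pathin X f"
  shows "path_class X f = path_class X g \<longleftrightarrow> path_homotopic X f g"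
  using assms path_homotopic_refl path_homotopic_sym path_homotopic_trans unfolding path_class_def by blast

lemma mem_path_class: "g \<in> path_class X f \<longleftrightarrow> path_homotopic X f g"
  by (simp add: path_class_def)

lemma mem_path_class_self: "pathin X f \<Longrightarrow> f \<in> path_class X f"
  by (simp add: path_class_def path_homotopic_refl)

lemma path_class_eqI: "path_homotopic X f g \<Longrightarrow> path_class X f = path_class X g"
  using path_class_eq_iff path_homotopic_pathin by blast

text \<open>The parameter \<open>s\<close> lets one gluing argument serve both single paths, with
  \<open>S = {0}\<close>, and homotopies, with \<open>S = {0..1}\<close>.\<close>

lemma continuous_map_path_concat:
  assumes f: "continuous_map (top_of_set (S \<times> {0..1})) X (\<lambda>(s, t). f s t)"
    and g: "continuous_map (top_of_set (S \<times> {0..1})) X (\<lambda>(s, t). g s t)"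
    and fg: "\<And>s. s \<in> S \<Longrightarrow> f s 1 = g s 0"
  shows "continuous_map (top_of_set (S \<times> {0..1})) X (\<lambda>(s, t). path_concat (f s) (g s) t)"
proof -
  let ?T = "S \<times> {0..1::real}"
  have "continuous_map (top_of_set ?T) X
      (\<lambda>p. if snd p \<le> (\<lambda>_. 1/2) p then f (fst p) (2 * snd p) else g (fst p) (2 * snd p - 1))"
  proof (rule continuous_map_cases_le)
    have "continuous_map (top_of_set {p \<in> ?T. snd p \<le> 1/2}) (top_of_set ?T) (\<lambda>p. (fst p, 2 * snd p))"
      by (auto intro!: continuous_intros)
    from continuous_map_compose[OF this f]
    show "continuous_map (subtopology (top_of_set ?T) {p \<in> topspace (top_of_set ?T). snd p \<le> 1/2}) X
        (\<lambda>p. f (fst p) (2 * snd p))"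
      by (simp add: o_def subtopology_subtopology Int_absorb1 Collect_conj_eq split_def)
    have "continuous_map (top_of_set {p \<in> ?T. 1/2 \<le> snd p}) (top_of_set ?T) (\<lambda>p. (fst p, 2 * snd p - 1))"
      by (auto intro!: continuous_intros)
    from continuous_map_compose[OF this g]
    show "continuous_map (subtopology (top_of_set ?T) {p \<in> topspace (top_of_set ?T). 1/2 \<le> snd p}) X
        (\<lambda>p. g (fst p) (2 * snd p - 1))"
      by (simp add: o_def subtopology_subtopology Int_absorb1 Collect_conj_eq split_def)
  next
    fix p assume "p \<in> topspace (top_of_set ?T)" "snd p = 1/2"
    then have "2 * snd p = 1" "2 * snd p - 1 = 0" "fst p \<in> S" by auto
    then show "f (fst p) (2 * snd p) = g (fst p) (2 * snd p - 1)" using fg by (simp only:)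
  qed (auto intro!: continuous_intros)
  then show ?thesis by (simp add: path_concat_def split_def if_distrib cong: if_cong)
qed

lemma pathin_path_concat:
  assumes "pathin X f" "pathin X g" "f 1 = g 0"
  shows "pathin X (path_concat f g)"
proof -
  have snd: "continuous_map (top_of_set ({0::real} \<times> {0..1::real})) (top_of_set {0..1}) snd"
    by (auto intro!: continuous_intros)
  have "continuous_map (top_of_set ({0::real} \<times> {0..1})) X (\<lambda>(s, t). path_concat f g t)"
    using continuous_map_compose[OF snd, of X f] continuous_map_compose[OF snd, of X g] assms
    by (intro continuous_map_path_concat) (auto simp: pathin_def o_def split_def)
  moreover have "continuous_map (top_of_set {0..1}) (top_of_set ({0::real} \<times> {0..1::real})) (\<lambda>t. (0, t))"
    by (auto intro!: continuous_intros)
  ultimately have "continuous_map (top_of_set {0..1}) X ((\<lambda>(s, t). path_concat f g t) \<circ> (\<lambda>t. (0::real, t)))"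
    by (rule continuous_map_compose[rotated])
  then show ?thesis unfolding pathin_def by (simp add: o_def)
qed

lemma path_concat_0 [simp]: "path_concat f g 0 = f 0"
  and path_concat_1 [simp]: "path_concat f g 1 = g 1"
  by (simp_all add: path_concat_def)

lemma path_homotopic_path_concat:
  assumes "path_homotopic X f f'" "path_homotopic X g g'" "f 1 = g 0"
  shows "path_homotopic X (path_concat f g) (path_concat f' g')"
proof -
  obtain h where h: "continuous_map (top_of_set unit_square) X h"
    "\<And>t. t \<in> {0..1} \<Longrightarrow> h (0, t) = f t" "\<And>t. t \<in> {0..1} \<Longrightarrow> h (1, t) = f' t"
    "\<And>s. s \<in> {0..1} \<Longrightarrow> h (s, 0) = f 0" "\<And>s. s \<in> {0..1} \<Longrightarrow> h (s, 1) = f 1"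
    using assms(1) by (rule path_homotopicE) blast
  obtain k where k: "continuous_map (top_of_set unit_square) X k"
    "\<And>t. t \<in> {0..1} \<Longrightarrow> k (0, t) = g t" "\<And>t. t \<in> {0..1} \<Longrightarrow> k (1, t) = g' t"
    "\<And>s. s \<in> {0..1} \<Longrightarrow> k (s, 0) = g 0" "\<And>s. s \<in> {0..1} \<Longrightarrow> k (s, 1) = g 1"
    using assms(2) by (rule path_homotopicE) blast
  show ?thesis
  proof (rule path_homotopicI)
    show "continuous_map (top_of_set unit_square) X (\<lambda>(s, t). path_concat (\<lambda>t. h (s, t)) (\<lambda>t. k (s, t)) t)"
      using h k assms(3) by (intro continuous_map_path_concat) auto
  qed (use h k in \<open>auto simp: path_concat_def\<close>)
qed

lemma class_mult_path_class:
  assumes "pathin X f" "pathin X g" "f 1 = g 0"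
  shows "class_mult X (path_class X f) (path_class X g) = path_class X (path_concat f g)"
proof -
  have "path_homotopic X (path_concat f g) h"
    if "path_homotopic X f f'" "path_homotopic X g g'" "path_homotopic X (path_concat f' g') h"
    for f' g' h
    using path_homotopic_path_concat[OF that(1,2) assms(3)] that(3) path_homotopic_trans by blast
  then show ?thesis using path_homotopic_refl assms unfolding class_mult_def path_class_def by blast
qed

definition path_rev :: "(real \<Rightarrow> 'a) \<Rightarrow> real \<Rightarrow> 'a" where
  "path_rev f t = f (1 - t)"

lemma pathin_path_rev:
  assumes "pathin X f"
  shows "pathin X (path_rev f)"
proof -
  have "continuous_map (top_of_set {0..1}) (top_of_set {0..1}) (\<lambda>t. 1 - t :: real)"
    by (auto intro!: continuous_intros)
  from continuous_map_compose[OF this assms[unfolded pathin_def]]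
  show ?thesis by (simp add: pathin_def path_rev_def[abs_def] o_def)
qed

lemma path_homotopic_assoc:
  assumes "pathin X f" "pathin X g" "pathin X h" "f 1 = g 0" "g 1 = h 0"
  shows "path_homotopic X (path_concat (path_concat f g) h) (path_concat f (path_concat g h))"
proof (rule path_homotopic_factor)
  let ?F = "path_concat (path_concat f g) h"
  show "continuous_map (top_of_set {0..1}) X ?F"
    using assms by (simp flip: pathin_def add: pathin_path_concat)
  show "continuous_on {0..1} id" "id ` {0..1} \<subseteq> {0..1::real}" "convex {0..1::real}" by auto
  \<comment> \<open>The reparametrisation has slopes \<open>1/2\<close>, \<open>1\<close>,
    \<open>2\<close>. It is convex, hence the maximum of its three linear pieces, which makes
    continuity immediate.\<close>
  let ?v = "\<lambda>t::real. max (t / 2) (max (t - 1/4) (2 * t - 1))"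
  let ?w = "\<lambda>t::real. if t \<le> 1/2 then t/2 else if t \<le> 3/4 then t - 1/4 else 2 * t - 1"
  have eq: "?v t = ?w t" if "t \<in> {0..1}" for t using that by (auto simp: max_def)
  show "continuous_on {0..1} ?v" by (intro continuous_intros) auto
  show "?v ` {0..1} \<subseteq> {0..1::real}" by (auto simp: max_def)
  show "path_concat f (path_concat g h) t = ?F (?v t)" if "t \<in> {0..1}" for t unfolding eq[OF that] using that
    by (auto simp: path_concat_def field_simps intro!: arg_cong[of _ _ g])
qed (auto simp: max_def)

lemma path_homotopic_reparam:
  fixes u v :: "real \<Rightarrow> real"
  assumes "pathin X f" "continuous_on {0..1} u" "u ` {0..1} \<subseteq> {0..1}"
    and "continuous_on {0..1} v" "v ` {0..1} \<subseteq> {0..1}" "u 0 = v 0" "u 1 = v 1"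
    and "\<And>t. t \<in> {0..1} \<Longrightarrow> g t = f (u t)" "\<And>t. t \<in> {0..1} \<Longrightarrow> h t = f (v t)"
  shows "path_homotopic X g h"
  by (rule path_homotopic_factor[OF assms(1)[unfolded pathin_def] _ assms(2-9)]) auto

lemma path_homotopic_const_left:
  assumes "pathin X f"
  shows "path_homotopic X (path_concat (\<lambda>_. f 0) f) f"
proof (rule path_homotopic_reparam[OF assms])
  show "continuous_on {0..1} (\<lambda>t::real. max 0 (2 * t - 1))" "continuous_on {0..1} (\<lambda>t::real. t)"
    by (intro continuous_intros)+
qed (auto simp: path_concat_def max_def intro!: arg_cong[of _ _ f])

lemma path_homotopic_rev:
  assumes "pathin X f"
  shows "path_homotopic X (path_concat f (path_rev f)) (\<lambda>_. f 0)"
proof (rule path_homotopic_reparam[OF assms])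
  show "continuous_on {0..1} (\<lambda>t::real. min (2 * t) (2 - 2 * t))" "continuous_on {0..1} (\<lambda>t::real. 0::real)"
    by (intro continuous_intros)+
qed (auto simp: path_concat_def path_rev_def min_def)

lemma path_rev_path_rev [simp]: "path_rev (path_rev f) = f"
  by (simp add: path_rev_def fun_eq_iff)

lemma carrier_fundamental_group:
  "carrier (fundamental_group X x) = {path_class X f | f. pathin X f \<and> f 0 = x \<and> f 1 = x}"
  by (simp add: fundamental_group_def)

lemma mult_fundamental_group: "mult (fundamental_group X x) = class_mult X"
  by (simp add: fundamental_group_def)

lemma one_fundamental_group: "one (fundamental_group X x) = path_class X (\<lambda>_. x)"
  by (simp add: fundamental_group_def)

lemmas fundamental_group_simps =
  carrier_fundamental_group mult_fundamental_group one_fundamental_group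

lemma pathin_const: "x \<in> topspace X \<Longrightarrow> pathin X (\<lambda>_. x)"
  by (simp add: pathin_def)

lemma group_fundamental_group:
  assumes "x \<in> topspace X"
  shows "group (fundamental_group X x)"
proof (rule groupI)
  fix a b assume "a \<in> carrier (fundamental_group X x)" "b \<in> carrier (fundamental_group X x)"
  then show "a \<otimes>\<^bsub>fundamental_group X x\<^esub> b \<in> carrier (fundamental_group X x)" unfolding fundamental_group_simps
    by (force simp: class_mult_path_class pathin_path_concat)
next
  show "\<one>\<^bsub>fundamental_group X x\<^esub> \<in> carrier (fundamental_group X x)"
    using pathin_const[OF assms] unfolding fundamental_group_simps by blast
next
  fix a b c
  assume "a \<in> carrier (fundamental_group X x)" "b \<in> carrier (fundamental_group X x)"
    "c \<in> carrier (fundamental_group X x)"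
  then obtain f g h where fgh: "pathin X f" "f 0 = x" "f 1 = x" "pathin X g" "g 0 = x" "g 1 = x"
     "pathin X h" "h 0 = x" "h 1 = x" "a = path_class X f" "b = path_class X g" "c = path_class X h"
    unfolding fundamental_group_simps by auto
  then show "a \<otimes>\<^bsub>fundamental_group X x\<^esub> b \<otimes>\<^bsub>fundamental_group X x\<^esub> c =
      a \<otimes>\<^bsub>fundamental_group X x\<^esub> (b \<otimes>\<^bsub>fundamental_group X x\<^esub> c)"
    unfolding fundamental_group_simps
    by (simp add: class_mult_path_class pathin_path_concat path_class_eqI path_homotopic_assoc)
next
  fix a assume "a \<in> carrier (fundamental_group X x)"
  then obtain f where f: "pathin X f" "f 0 = x" "f 1 = x" "a = path_class X f"
    unfolding fundamental_group_simps by auto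
  then show "\<one>\<^bsub>fundamental_group X x\<^esub> \<otimes>\<^bsub>fundamental_group X x\<^esub> a = a" unfolding fundamental_group_simps
    using path_homotopic_const_left[of X f] assms
    by (simp add: class_mult_path_class pathin_const path_class_eqI)
  have "class_mult X (path_class X (path_rev f)) a = path_class X (\<lambda>_. x)"
    using path_homotopic_rev[of X "path_rev f"] f
    by (simp add: class_mult_path_class path_class_eqI pathin_path_rev path_rev_def[of f 0] path_rev_def[of f 1])
  then show "\<exists>b\<in>carrier (fundamental_group X x). b \<otimes>\<^bsub>fundamental_group X x\<^esub> a = \<one>\<^bsub>fundamental_group X x\<^esub>"
    unfolding fundamental_group_simps using f pathin_path_rev[OF f(1)]
    by (intro bexI[of _ "path_class X (path_rev f)"]) (auto simp: path_rev_def intro!: exI[of _ "path_rev f"])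
qed

lemma inv_path_class:
  assumes "pathin X f" "f 0 = x" "f 1 = x"
  shows "inv\<^bsub>fundamental_group X x\<^esub> (path_class X f) = path_class X (path_rev f)"
proof -
  have "x \<in> topspace X"
    using assms continuous_map_image_subset_topspace[of "top_of_set {0..1}" X f] by (auto simp: pathin_def)
  then interpret group "fundamental_group X x" by (rule group_fundamental_group)
  show ?thesis
  proof (rule inv_equality)
    show "path_class X (path_rev f) \<otimes>\<^bsub>fundamental_group X x\<^esub> path_class X f = \<one>\<^bsub>fundamental_group X x\<^esub>"
      using path_homotopic_rev[of X "path_rev f"] assms unfolding fundamental_group_simps
      by (simp add: class_mult_path_class path_class_eqI pathin_path_rev path_rev_def[of f 0] path_rev_def[of f 1])
  qed (use assms pathin_path_rev[OF assms(1)] in \<open>auto simp: fundamental_group_simps path_rev_def\<close>)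
qed

section \<open>Configuration spaces\<close>

text \<open>Families of unlabelled configurations are produced from labelled points: a bijection
  turns the index set into \<open>{1..k}\<close>, and the quotient map forgets the labels.\<close>

lemma continuous_map_uconf_image:
  assumes "\<And>i. i \<in> I \<Longrightarrow> continuous_map T (top_of_set S) (g i)"
    and "finite I" "card I = k"
    and "\<And>x. x \<in> topspace T \<Longrightarrow> inj_on (\<lambda>i. g i x) I"
  shows "continuous_map T (uconf k S) (\<lambda>x. (\<lambda>i. g i x) ` I)"
proof -
  obtain h where h: "bij_betw h {1..k} I" using finite_same_card_bij[of "{1..k}" I] assms by auto
  have "continuous_map T (conf k S) (\<lambda>x. \<lambda>j\<in>{1..k}. g (h j) x)"
    unfolding conf_def continuous_map_in_subtopology
  proof
    show "continuous_map T (product_topology (\<lambda>_. top_of_set S) {1..k}) (\<lambda>x. \<lambda>j\<in>{1..k}. g (h j) x)"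
      using h assms(1) by (auto simp: continuous_map_componentwise bij_betw_def)
    have "inj_on (\<lambda>j. g (h j) x) {1..k}" if "x \<in> topspace T" for x
      using comp_inj_on[of h "{1..k}" "\<lambda>i. g i x"] h assms(4)[OF that] by (auto simp: bij_betw_def o_def)
    then show "(\<lambda>x. \<lambda>j\<in>{1..k}. g (h j) x) \<in> topspace T \<rightarrow> {x. inj_on x {1..k}}"
      by (auto simp: inj_on_restrict_eq Pi_iff simp del: atLeastAtMost_iff)
  qed
  from continuous_map_compose[OF this quotient_imp_continuous_map[OF quotient_map_uconf]]
  have "continuous_map T (uconf k S) (\<lambda>x. (\<lambda>j\<in>{1..k}. g (h j) x) ` {1..k})" by (simp add: o_def)
  moreover have "(\<lambda>j\<in>{1..k}. g (h j) x) ` {1..k} = (\<lambda>i. g i x) ` I" for x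
  proof -
    have "(\<lambda>j\<in>{1..k}. g (h j) x) ` {1..k} = (\<lambda>i. g i x) ` (h ` {1..k})" by (auto simp: image_def)
    then show ?thesis using h by (simp add: bij_betw_def)
  qed
  ultimately show ?thesis by simp
qed

text \<open>The condition is one-sided. If the points of \<open>A\<close> are well separated and as
  many as those of \<open>A'\<close>, counting supplies the other side, so these sets suffice to
  separate the strands below.\<close>

lemma openin_uconf_near:
  assumes "finite A"
  shows "openin (uconf k S) {A' \<in> topspace (uconf k S). \<forall>a\<in>A. \<exists>a'\<in>A'. dist a a' < e}"
  unfolding openin_uconf
proof
  let ?T = "topspace (conf k S)"
  show "{A' \<in> topspace (uconf k S). \<forall>a\<in>A. \<exists>a'\<in>A'. dist a a' < e} \<subseteq> (\<lambda>x. x ` {1..k}) ` ?T"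
    by (auto simp: topspace_uconf_image)
  have "openin (conf k S) {x \<in> ?T. x i \<in> ball a e}" if "i \<in> {1..k}" for i a
  proof (rule openin_continuous_map_preimage[of _ euclidean])
    have "continuous_map (conf k S) (top_of_set S) (\<lambda>x. x i)" unfolding conf_def using that
      by (intro continuous_map_from_subtopology continuous_map_product_projection)
    then show "continuous_map (conf k S) euclidean (\<lambda>x. x i)" by (rule continuous_map_into_fulltopology)
  qed auto
  then have "openin (conf k S) (\<Union>i\<in>{1..k}. {x \<in> ?T. x i \<in> ball a e})" for a by blast
  then have "openin (conf k S) ((\<Inter>a\<in>A. \<Union>i\<in>{1..k}. {x \<in> ?T. x i \<in> ball a e}) \<inter> ?T)"
    using assms by (intro openin_INT)
  moreover have "(\<Inter>a\<in>A. \<Union>i\<in>{1..k}. {x \<in> ?T. x i \<in> ball a e}) \<inter> ?T =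
      {x \<in> ?T. x ` {1..k} \<in> {A' \<in> topspace (uconf k S). \<forall>a\<in>A. \<exists>a'\<in>A'. dist a a' < e}}"
    by (auto simp: topspace_uconf_image)
  ultimately show "openin (conf k S)
      {x \<in> ?T. x ` {1..k} \<in> {A' \<in> topspace (uconf k S). \<forall>a\<in>A. \<exists>a'\<in>A'. dist a a' < e}}"
    by simp
qed

lemma finite_separated:
  fixes A :: "'a::metric_space set"
  assumes "finite A"
  obtains e where "0 < e" "\<And>a b. a \<in> A \<Longrightarrow> b \<in> A \<Longrightarrow> a \<noteq> b \<Longrightarrow> e \<le> dist a b"
proof
  let ?D = "insert 1 ((\<lambda>(a, b). dist a b) ` {p \<in> A \<times> A. fst p \<noteq> snd p})"
  have fin: "finite ?D" using assms by auto
  show "0 < Min ?D" using fin by (subst Min_gr_iff) auto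
  show "Min ?D \<le> dist a b" if "a \<in> A" "b \<in> A" "a \<noteq> b" for a b
    using fin that by (intro Min_le) (auto intro!: image_eqI[of _ _ "(a, b)"])
qed

section \<open>Strands of a family of configurations\<close>

text \<open>The sections of this covering are the strands of the family \<open>H\<close> of configurations.\<close>

lemma covering_space_configurations:
  fixes Q :: "'q::real_normed_vector set"
  assumes H: "continuous_map (top_of_set Q) (uconf k S) H" and "k \<noteq> 0"
  shows "covering_space (Sigma Q H) fst Q"
proof (rule covering_spaceI)
  have Hq: "finite (H q)" "card (H q) = k" "H q \<in> topspace (uconf k S)" if "q \<in> Q" for q
    using continuous_map_image_subset_topspace[OF H] that by (auto simp: topspace_uconf)
  have near: "openin (top_of_set Q) {q \<in> Q. \<forall>a\<in>A. \<exists>a'\<in>H q. dist a a' < e}" if "finite A" for A e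
  proof -
    have "{q \<in> Q. \<forall>a\<in>A. \<exists>a'\<in>H q. dist a a' < e} = {q \<in> topspace (top_of_set Q).
       H q \<in> {A' \<in> topspace (uconf k S). \<forall>a\<in>A. \<exists>a'\<in>A'. dist a a' < e}}"
      using Hq(3) by auto
    then show ?thesis using openin_continuous_map_preimage[OF H openin_uconf_near[OF that]] by simp
  qed
  show "continuous_on (Sigma Q H) fst" by (intro continuous_intros)
  show "fst ` Sigma Q H = Q"
  proof
    show "Q \<subseteq> fst ` Sigma Q H"
    proof
      fix q assume q: "q \<in> Q"
      then obtain a where "a \<in> H q" using Hq(2)[OF q] \<open>k \<noteq> 0\<close> by fastforce
      with q show "q \<in> fst ` Sigma Q H" by (intro image_eqI[of _ _ "(q, a)"]) auto
    qed
  qed auto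
  fix q assume q: "q \<in> Q"
  obtain e where e: "0 < e" "\<And>a b. a \<in> H q \<Longrightarrow> b \<in> H q \<Longrightarrow> a \<noteq> b \<Longrightarrow> e \<le> dist a b"
    using finite_separated[OF Hq(1)[OF q]] by metis
  \<comment> \<open>With half the separation as radius, the points chosen near distinct elements of
    \<open>H q\<close> are distinct and exhaust \<open>H q'\<close> by counting, so \<open>T\<close>
    is evenly covered.\<close>
  define T where "T = {q' \<in> Q. \<forall>a\<in>H q. \<exists>a'\<in>H q'. dist a a' < e / 2}"
  have "openin (top_of_set Q) T" unfolding T_def using near Hq(1)[OF q] by blast
  have "q \<in> T" unfolding T_def using q e(1) by (auto intro!: bexI)
  have "\<forall>p\<in>T \<times> H q. \<exists>a'. a' \<in> H (fst p) \<and> dist (snd p) a' < e / 2" unfolding T_def by auto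
  from bchoice[OF this] obtain s0 where
    s0: "\<forall>p\<in>T \<times> H q. s0 p \<in> H (fst p) \<and> dist (snd p) (s0 p) < e / 2" ..
  define s where "s a q' = s0 (q', a)" for a q'
  have s: "s a q' \<in> H q' \<and> dist a (s a q') < e / 2" if "q' \<in> T" "a \<in> H q" for q' a
    using s0[rule_format, of "(q', a)"] that by (simp add: s_def)
  have same: "a = b" if "a \<in> H q" "b \<in> H q" "dist a x < e / 2" "dist b x < e / 2" for a b x
    using e(2)[OF that(1,2)] dist_triangle_less_add[of a x "e/2" b "e/2"] that(3,4)
    by (force simp: dist_commute)
  have surj: "(\<lambda>a. s a q') ` H q = H q'" if "q' \<in> T" for q'
  proof (rule card_subset_eq)
    have "q' \<in> Q" using that by (simp add: T_def)
    then show "finite (H q')" by (rule Hq)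
    have "inj_on (\<lambda>a. s a q') (H q)" using s[OF that] same by (auto simp: inj_on_def) metis
    then show "card ((\<lambda>a. s a q') ` H q) = card (H q')"
      using Hq(2)[OF q] Hq(2)[OF \<open>q' \<in> Q\<close>] by (simp add: card_image)
  qed (use s that in auto)
  have uniq: "x = s a q'" if q': "q' \<in> T" and a: "a \<in> H q" and x: "x \<in> H q'" "dist a x < e / 2" for q' a x
  proof -
    obtain b where b: "b \<in> H q" "x = s b q'" using surj[OF q'] x(1) by blast
    then have "b = a" using same[of b a x] s[OF q'] a x(2) by blast
    with b show ?thesis by simp
  qed
  \<comment> \<open>The sheets over \<open>T\<close> are indexed by the points of
    \<open>H q\<close>; the sheet of \<open>a\<close> is the graph of \<open>s a\<close>.\<close>
  define sheet where "sheet a = {p \<in> Sigma T H. dist a (snd p) < e / 2}" for a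
  have TQ: "T \<subseteq> Q" by (auto simp: T_def)
  have cont: "continuous_on T (s a)" if a: "a \<in> H q" for a
  proof (unfold continuous_on_iff, intro ballI allI impI)
    fix q' :: 'q and d :: real assume q': "q' \<in> T" and "0 < d"
    \<comment> \<open>A point within \<open>r\<close> of \<open>s a q'\<close> is within
      \<open>d\<close> of it and still within \<open>e / 2\<close> of \<open>a\<close>, so by
      \<open>uniq\<close> it can only be the value of \<open>s a\<close>.\<close>
    define r where "r = min d (e / 2 - dist a (s a q'))"
    have "0 < r" using s[OF q' a] \<open>0 < d\<close> by (auto simp: r_def)
    define W where "W = {q'' \<in> Q. \<forall>b\<in>{s a q'}. \<exists>a'\<in>H q''. dist b a' < r}"
    have "q' \<in> W" using q' TQ s[OF q' a] \<open>0 < r\<close> by (auto simp: W_def intro!: bexI[of _ "s a q'"])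
    moreover have "\<forall>x\<in>W. \<exists>e>0. \<forall>x'\<in>Q. dist x' x < e \<longrightarrow> x' \<in> W"
      using near[of "{s a q'}" r] unfolding openin_euclidean_subtopology_iff W_def by blast
    ultimately obtain \<delta> where \<delta>: "0 < \<delta>" "\<forall>q''\<in>Q. dist q'' q' < \<delta> \<longrightarrow> q'' \<in> W" by blast
    have "dist (s a q'') (s a q') < d" if q'': "q'' \<in> T" "dist q'' q' < \<delta>" for q''
    proof -
      obtain x where x: "x \<in> H q''" "dist (s a q') x < r" using \<delta>(2) q'' TQ unfolding W_def by blast
      have "dist a x < e / 2" using x(2) dist_triangle[of a x "s a q'"] by (simp add: r_def)
      then have "x = s a q''" using uniq q'' a x by blast
      then show ?thesis using x by (simp add: r_def dist_commute)
    qed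
    with \<delta>(1) show "\<exists>\<delta>>0. \<forall>q''\<in>T. dist q'' q' < \<delta> \<longrightarrow> dist (s a q'') (s a q') < d" by blast
  qed
  show "\<exists>T. q \<in> T \<and> openin (top_of_set Q) T \<and>
      (\<exists>v. \<Union>v = Sigma Q H \<inter> fst -` T \<and> (\<forall>u\<in>v. openin (top_of_set (Sigma Q H)) u) \<and>
       pairwise disjnt v \<and> (\<forall>u\<in>v. \<exists>q. homeomorphism u T fst q))"
  proof (intro exI[of _ T] conjI exI[of _ "sheet ` H q"] ballI)
    show "\<Union> (sheet ` H q) = Sigma Q H \<inter> fst -` T"
    proof
      show "Sigma Q H \<inter> fst -` T \<subseteq> \<Union> (sheet ` H q)"
      proof
        fix p assume "p \<in> Sigma Q H \<inter> fst -` T"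
        then have p: "fst p \<in> T" "snd p \<in> H (fst p)" by auto
        then obtain a where "a \<in> H q" "snd p = s a (fst p)" using surj[of "fst p"] by blast
        with p s[of "fst p" a] have "p \<in> sheet a" unfolding sheet_def by (cases p) simp
        with \<open>a \<in> H q\<close> show "p \<in> \<Union> (sheet ` H q)" by blast
      qed
    qed (use TQ in \<open>auto simp: sheet_def\<close>)
    show "pairwise disjnt (sheet ` H q)"
    proof (rule pairwise_imageI)
      fix a b assume "a \<in> H q" "b \<in> H q" "a \<noteq> b"
      then show "disjnt (sheet a) (sheet b)" using same[of a b] unfolding disjnt_def sheet_def by blast
    qed
    fix u assume "u \<in> sheet ` H q"
    then obtain a where a: "a \<in> H q" and u: "u = sheet a" by blast
    have "continuous_map (top_of_set (Sigma Q H)) (top_of_set Q) fst" by (auto intro!: continuous_intros)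
    from openin_continuous_map_preimage[OF this \<open>openin (top_of_set Q) T\<close>]
    have "openin (top_of_set (Sigma Q H)) {p \<in> Sigma Q H. fst p \<in> T}" by simp
    moreover have "continuous_map (top_of_set (Sigma Q H)) euclidean snd" by (auto intro!: continuous_intros)
    from openin_continuous_map_preimage[OF this, of "ball a (e / 2)"]
    have "openin (top_of_set (Sigma Q H)) {p \<in> Sigma Q H. snd p \<in> ball a (e / 2)}" by simp
    ultimately have "openin (top_of_set (Sigma Q H))
        ({p \<in> Sigma Q H. fst p \<in> T} \<inter> {p \<in> Sigma Q H. snd p \<in> ball a (e / 2)})"
      by blast
    moreover have "{p \<in> Sigma Q H. fst p \<in> T} \<inter> {p \<in> Sigma Q H. snd p \<in> ball a (e / 2)} = u"
      using TQ by (auto simp: u sheet_def)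
    ultimately show "openin (top_of_set (Sigma Q H)) u" by simp
    show "\<exists>r. homeomorphism u T fst r"
    proof (intro exI homeomorphismI)
      show "continuous_on T (\<lambda>q'. (q', s a q'))" using cont[OF a] by (intro continuous_intros)
      show "fst ` u \<subseteq> T" "(\<lambda>q'. (q', s a q')) ` T \<subseteq> u" using s a by (auto simp: u sheet_def)
      show "(fst p, s a (fst p)) = p" if "p \<in> u" for p
        using uniq[of "fst p" a "snd p"] a that by (auto simp: u sheet_def prod_eq_iff)
    qed (auto intro!: continuous_intros)
  qed fact+
qed

text \<open>A convex set is simply connected, so its identity map lifts through the covering of
  configurations; the second component of the lift is the selection.\<close>

lemma selection_exists:
  fixes Q :: "'q::real_normed_vector set"
  assumes H: "continuous_map (top_of_set Q) (uconf k S) H" and Q: "convex Q" "q0 \<in> Q" "a \<in> H q0"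
  obtains g where "continuous_on Q g" "\<And>q. q \<in> Q \<Longrightarrow> g q \<in> H q" "g q0 = a"
proof -
  have "H q0 \<in> topspace (uconf k S)" using continuous_map_image_subset_topspace[OF H] Q by auto
  then have "k \<noteq> 0" using Q by (auto simp: topspace_uconf card_gt_0_iff)
  note cov = covering_space_configurations[OF H this]
  obtain g where g: "continuous_on Q g" "g \<in> Q \<rightarrow> Sigma Q H" "g q0 = (q0, a)" "\<And>q. q \<in> Q \<Longrightarrow> fst (g q) = q"
    by (rule covering_space_lift_strong[OF cov, of "(q0, a)" q0 Q "\<lambda>q. q"])
      (use Q in \<open>auto simp: convex_imp_simply_connected convex_imp_locally_path_connected\<close>)
  show thesis
  proof
    show "continuous_on Q (\<lambda>q. snd (g q))" using g(1) by (intro continuous_intros)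
    show "snd (g q) \<in> H q" if "q \<in> Q" for q using g(2,4) that by (metis Pi_iff SigmaE2 prod.collapse)
  qed (use g in auto)
qed

lemma selection_unique:
  fixes Q :: "'q::real_normed_vector set"
  assumes H: "continuous_map (top_of_set Q) (uconf k S) H" and Q: "connected Q" "q0 \<in> Q"
    and g: "continuous_on Q g" "\<And>q. q \<in> Q \<Longrightarrow> g q \<in> H q"
    and g': "continuous_on Q g'" "\<And>q. q \<in> Q \<Longrightarrow> g' q \<in> H q"
    and "g q0 = g' q0" "q \<in> Q"
  shows "g q = g' q"
proof -
  have "H q0 \<in> topspace (uconf k S)" using continuous_map_image_subset_topspace[OF H] Q by auto
  then have "k \<noteq> 0" using g(2)[OF Q(2)] by (auto simp: topspace_uconf card_gt_0_iff)
  note cov = covering_space_configurations[OF H this]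
  have "(q, g q) = (q, g' q)"
    by (rule covering_space_lift_unique[OF cov, of "\<lambda>q. (q, g q)" q0 "\<lambda>q. (q, g' q)" Q "\<lambda>q. q"])
      (use assms in \<open>auto intro!: continuous_intros\<close>)
  then show ?thesis by simp
qed

text \<open>The lift is started at one corner and recognised side by side through uniqueness: it is
  \<open>g\<close> on the left, constant on the two sides where the configuration is constant, and
  therefore starts like \<open>g'\<close> on the right.\<close>

lemma selection_square:
  assumes H: "continuous_map (top_of_set unit_square) (uconf k S) H"
    and f: "\<And>t. t \<in> {0..1} \<Longrightarrow> H (0, t) = f t" "\<And>t. t \<in> {0..1} \<Longrightarrow> H (1, t) = f' t"
    and side: "\<And>s. s \<in> {0..1} \<Longrightarrow> H (s, 0) = f 0" "\<And>s. s \<in> {0..1} \<Longrightarrow> H (s, 1) = f 1"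
    and g: "continuous_on {0..1} g" "\<And>t. t \<in> {0..1} \<Longrightarrow> g t \<in> f t"
    and g': "continuous_on {0..1} g'" "\<And>t. t \<in> {0..1} \<Longrightarrow> g' t \<in> f' t"
    and "g 0 = g' 0"
  obtains G where "continuous_on unit_square G" "\<And>p. p \<in> unit_square \<Longrightarrow> G p \<in> H p"
    "\<And>t. t \<in> {0..1} \<Longrightarrow> G (0, t) = g t" "\<And>t. t \<in> {0..1} \<Longrightarrow> G (1, t) = g' t"
    "\<And>s. s \<in> {0..1} \<Longrightarrow> G (s, 0) = g 0" "\<And>s. s \<in> {0..1} \<Longrightarrow> G (s, 1) = g 1"
proof -
  obtain G where G: "continuous_on unit_square G" "\<And>p. p \<in> unit_square \<Longrightarrow> G p \<in> H p" "G (0, 0) = g 0"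
    using g(2)[of 0] f(1)[of 0] by (auto intro: selection_exists[OF H, of "(0, 0)" "g 0"] convex_Times)
  have H1: "continuous_map (top_of_set {0..1}) (uconf k S) (\<lambda>t. H (s, t))" if "s \<in> {0..1}" for s
  proof -
    have "continuous_map (top_of_set {0..1}) (top_of_set unit_square) (\<lambda>t. (s, t))"
      using that by (auto intro!: continuous_intros)
    from continuous_map_compose[OF this H] show ?thesis by (simp add: o_def)
  qed
  have H2: "continuous_map (top_of_set {0..1}) (uconf k S) (\<lambda>s. H (s, t))" if "t \<in> {0..1}" for t
  proof -
    have "continuous_map (top_of_set {0..1}) (top_of_set unit_square) (\<lambda>s. (s, t))"
      using that by (auto intro!: continuous_intros)
    from continuous_map_compose[OF this H] show ?thesis by (simp add: o_def)
  qed
  have G1: "continuous_on {0..1} (\<lambda>t. G (s, t))" if "s \<in> {0..1}" for s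
    using that by (intro continuous_on_compose2[OF G(1)] continuous_intros) auto
  have G2: "continuous_on {0..1} (\<lambda>s. G (s, t))" if "t \<in> {0..1}" for t
    using that by (intro continuous_on_compose2[OF G(1)] continuous_intros) auto
  have left: "G (0, t) = g t" if "t \<in> {0..1}" for t
  proof (rule selection_unique[OF H1, of 0 0 "\<lambda>t. G (0, t)"])
    show "G (0, q) \<in> H (0, q)" "g q \<in> H (0, q)" if "q \<in> {0..1}" for q
      using that G(2)[of "(0, q)"] f(1)[OF that] g(2)[OF that] by auto
  qed (use that G G1 g in auto)
  have bot: "G (s, 0) = g 0" if "s \<in> {0..1}" for s
  proof (rule selection_unique[OF H2, of 0 0 "\<lambda>s. G (s, 0)"])
    show "G (q, 0) \<in> H (q, 0)" "g 0 \<in> H (q, 0)" if "q \<in> {0..1}" for q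
      using that G(2)[of "(q, 0)"] side(1)[OF that] g(2)[of 0] by auto
  qed (use that G G2[of 0] in auto)
  have top: "G (s, 1) = g 1" if "s \<in> {0..1}" for s
  proof (rule selection_unique[OF H2, of 1 0 "\<lambda>s. G (s, 1)"])
    show "G (q, 1) \<in> H (q, 1)" "g 1 \<in> H (q, 1)" if "q \<in> {0..1}" for q
      using that G(2)[of "(q, 1)"] side(2)[OF that] g(2)[of 1] by auto
  qed (use that left[of 1] G2[of 1] in auto)
  have right: "G (1, t) = g' t" if "t \<in> {0..1}" for t
  proof (rule selection_unique[OF H1, of 1 0 "\<lambda>t. G (1, t)"])
    show "G (1, q) \<in> H (1, q)" "g' q \<in> H (1, q)" if "q \<in> {0..1}" for q
      using that G(2)[of "(1, q)"] f(2)[OF that] g'(2)[OF that] by auto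
  qed (use that bot[of 1] \<open>g 0 = g' 0\<close> G1[of 1] g'(1) in auto)
  show thesis using that G left right bot top by blast
qed

lemma homotopic_strands_end:
  assumes "path_homotopic (uconf k S) f f'"
    and "continuous_on {0..1} g" "\<And>t. t \<in> {0..1} \<Longrightarrow> g t \<in> f t"
    and "continuous_on {0..1} g'" "\<And>t. t \<in> {0..1} \<Longrightarrow> g' t \<in> f' t"
    and "g 0 = g' 0"
  shows "g 1 = g' 1"
proof -
  obtain H where H: "continuous_map (top_of_set unit_square) (uconf k S) H"
    "\<And>t. t \<in> {0..1} \<Longrightarrow> H (0, t) = f t" "\<And>t. t \<in> {0..1} \<Longrightarrow> H (1, t) = f' t"
    "\<And>s. s \<in> {0..1} \<Longrightarrow> H (s, 0) = f 0" "\<And>s. s \<in> {0..1} \<Longrightarrow> H (s, 1) = f 1"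
    using assms(1) by (rule path_homotopicE) blast
  obtain G where "\<And>t. t \<in> {0..1} \<Longrightarrow> G (1::real, t) = g' t" "\<And>s. s \<in> {0..1} \<Longrightarrow> G (s, 1) = g 1"
    using selection_square[OF H assms(2-6)] by metis
  from this(1)[of 1] this(2)[of 1] show ?thesis by simp
qed

text \<open>Two strands that start apart never meet during the homotopy. Their difference is thus a
  map of the square into the punctured plane, constant on two sides, whose winding can be compared
  on the other two.\<close>

lemma homotopic_strand_pair:
  assumes "path_homotopic (uconf k S) f f'"
    and "continuous_on {0..1} g" "\<And>t. t \<in> {0..1} \<Longrightarrow> g t \<in> f t"
    and "continuous_on {0..1} g'" "\<And>t. t \<in> {0..1} \<Longrightarrow> g' t \<in> f' t" "g 0 = g' 0"
    and "continuous_on {0..1} h" "\<And>t. t \<in> {0..1} \<Longrightarrow> h t \<in> f t"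
    and "continuous_on {0..1} h'" "\<And>t. t \<in> {0..1} \<Longrightarrow> h' t \<in> f' t" "h 0 = h' 0"
    and "g 0 \<noteq> h 0"
  obtains D where "continuous_on unit_square D" "\<And>p. p \<in> unit_square \<Longrightarrow> D p \<noteq> 0"
    "\<And>t. t \<in> {0..1} \<Longrightarrow> D (0, t) = g t - h t" "\<And>t. t \<in> {0..1} \<Longrightarrow> D (1, t) = g' t - h' t"
    "\<And>s. s \<in> {0..1} \<Longrightarrow> D (s, 0) = g 0 - h 0" "\<And>s. s \<in> {0..1} \<Longrightarrow> D (s, 1) = g 1 - h 1"
proof -
  obtain H where H: "continuous_map (top_of_set unit_square) (uconf k S) H"
    "\<And>t. t \<in> {0..1} \<Longrightarrow> H (0, t) = f t" "\<And>t. t \<in> {0..1} \<Longrightarrow> H (1, t) = f' t"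
    "\<And>s. s \<in> {0..1} \<Longrightarrow> H (s, 0) = f 0" "\<And>s. s \<in> {0..1} \<Longrightarrow> H (s, 1) = f 1"
    using assms(1) by (rule path_homotopicE) blast
  obtain G where G: "continuous_on unit_square G" "\<And>p. p \<in> unit_square \<Longrightarrow> G p \<in> H p"
    "\<And>t. t \<in> {0..1} \<Longrightarrow> G (0, t) = g t" "\<And>t. t \<in> {0..1} \<Longrightarrow> G (1, t) = g' t"
    "\<And>s. s \<in> {0..1} \<Longrightarrow> G (s, 0) = g 0" "\<And>s. s \<in> {0..1} \<Longrightarrow> G (s, 1) = g 1"
    using selection_square[OF H assms(2-6)] by metis
  obtain K where K: "continuous_on unit_square K" "\<And>p. p \<in> unit_square \<Longrightarrow> K p \<in> H p"
    "\<And>t. t \<in> {0..1} \<Longrightarrow> K (0, t) = h t" "\<And>t. t \<in> {0..1} \<Longrightarrow> K (1, t) = h' t"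
    "\<And>s. s \<in> {0..1} \<Longrightarrow> K (s, 0) = h 0" "\<And>s. s \<in> {0..1} \<Longrightarrow> K (s, 1) = h 1"
    using selection_square[OF H assms(7-11)] by metis
  have conn: "connected unit_square" by (intro convex_connected convex_Times) auto
  show thesis
  proof
    show "continuous_on unit_square (\<lambda>p. G p - K p)" using G K by (intro continuous_intros)
    show "G p - K p \<noteq> 0" if p: "p \<in> unit_square" for p
    proof
      assume "G p - K p = 0"
      then have eq: "G p = K p" by simp
      have "G (0, 0) = K (0, 0)" by (rule selection_unique[OF H(1) conn p G(1,2) K(1,2) eq]) auto
      then show False using G(3)[of 0] K(3)[of 0] assms(12) by simp
    qed
  qed (simp_all add: G(3-6) K(3-6))
qed

section \<open>Winding measured by logarithms\<close>

lemma exp_eq_imp_diff_constant: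
  fixes f g :: "'a::topological_space \<Rightarrow> complex"
  assumes "connected Q" "continuous_on Q f" "continuous_on Q g"
    and "\<And>t. t \<in> Q \<Longrightarrow> exp (f t) = exp (g t)" "a \<in> Q" "b \<in> Q"
  shows "f a - g a = f b - g b"
proof -
  have "(\<lambda>t. f t - g t) constant_on Q"
  proof (rule continuous_discrete_range_constant[OF assms(1)])
    show "continuous_on Q (\<lambda>t. f t - g t)" using assms by (intro continuous_intros)
    have int: "\<exists>m::int. f t - g t = of_real (2 * m * pi) * \<i>" if "t \<in> Q" for t
      using assms(4)[OF that] by (auto simp: exp_eq)
    fix x assume x: "x \<in> Q"
    show "\<exists>e>0. \<forall>y. y \<in> Q \<and> f y - g y \<noteq> f x - g x \<longrightarrow> e \<le> norm (f y - g y - (f x - g x))"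
    proof (intro exI[of _ 1] conjI allI impI)
      fix y assume y: "y \<in> Q \<and> f y - g y \<noteq> f x - g x"
      obtain m m' :: int where m: "f x - g x = of_real (2 * real_of_int m * pi) * \<i>"
        "f y - g y = of_real (2 * real_of_int m' * pi) * \<i>"
        using int[OF x] int[of y] y by auto
      then have "m \<noteq> m'" using y by auto
      then have "1 \<le> \<bar>real_of_int (m' - m)\<bar>" by linarith
      moreover have "f y - g y - (f x - g x) = of_real (2 * pi * real_of_int (m' - m)) * \<i>"
        unfolding m by (simp add: algebra_simps)
      then have "norm (f y - g y - (f x - g x)) = 2 * pi * \<bar>real_of_int (m' - m)\<bar>"
        by (simp only: norm_mult norm_of_real norm_ii abs_mult) simp
      moreover have "1 \<le> 2 * pi" using pi_gt3 by simp
      ultimately show "1 \<le> norm (f y - g y - (f x - g x))"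
        using mult_mono[of 1 "2*pi" 1 "\<bar>real_of_int (m' - m)\<bar>"] by simp
    qed simp
  qed
  then show ?thesis using assms by (auto simp: constant_on_def)
qed

text \<open>On the contractible square \<open>D\<close> has a logarithm. It is constant along the
  two sides where \<open>D\<close> is constant, so its increments along the other two sides agree,
  and any other logarithm on a side differs from it by a constant.\<close>

lemma homotopic_log_increment:
  assumes D: "continuous_on unit_square D" "\<And>p. p \<in> unit_square \<Longrightarrow> D p \<noteq> 0"
    "\<And>s. s \<in> {0..1} \<Longrightarrow> D (s, 0) = D (0, 0)" "\<And>s. s \<in> {0..1} \<Longrightarrow> D (s, 1) = D (0, 1)"
    and L0: "continuous_on {0..1} L0" "\<And>t. t \<in> {0..1} \<Longrightarrow> exp (L0 t) = D (0, t)"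
    and L1: "continuous_on {0..1} L1" "\<And>t. t \<in> {0..1} \<Longrightarrow> exp (L1 t) = D (1, t)"
  shows "L0 1 - L0 0 = L1 1 - (L1 0 :: complex)"
proof -
  obtain L where L: "continuous_on unit_square L" "\<And>p. p \<in> unit_square \<Longrightarrow> D p = exp (L p)"
    using continuous_logarithm_on_contractible[OF D(1)] D(2)
      convex_imp_contractible[of unit_square] by (metis convex_Times convex_real_interval(5))
  have c1: "continuous_on {0..1} (\<lambda>t. L (s, t))" if "s \<in> {0..1}" for s
    using that by (intro continuous_on_compose2[OF L(1)] continuous_intros) auto
  have c2: "continuous_on {0..1} (\<lambda>s. L (s, t))" if "t \<in> {0..1}" for t
    using that by (intro continuous_on_compose2[OF L(1)] continuous_intros) auto
  have eq: "L (0, t) - L (0, t) = L (1, t) - L (0, t)" if "t = 0 \<or> t = 1" for t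
  proof (rule exp_eq_imp_diff_constant[of "{0..1::real}" "\<lambda>s. L (s, t)" "\<lambda>s. L (0, t)"])
    show "exp (L (s, t)) = exp (L (0, t))" if "s \<in> {0..1}" for s
      using D(3)[OF that] D(4)[OF that] L(2)[of "(s, t)"] L(2)[of "(0, t)"] that \<open>t = 0 \<or> t = 1\<close>
      by (metis atLeastAtMost_iff mem_Sigma_iff order_refl zero_le_one)
  qed (use that c2 in auto)
  have "L0 1 - L (0, 1) = L0 0 - L (0, 0)" by (rule exp_eq_imp_diff_constant[of "{0..1}" L0 "\<lambda>t. L (0, t)"])
      (use L0 L c1 in auto)
  moreover have "L1 1 - L (1, 1) = L1 0 - L (1, 0)"
    by (rule exp_eq_imp_diff_constant[of "{0..1}" L1 "\<lambda>t. L (1, t)"])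
      (use L1 L c1 in auto)
  moreover have "L (1, 0) = L (0, 0)" "L (1, 1) = L (0, 1)" using eq[of 0] eq[of 1] by simp_all
  ultimately show ?thesis by algebra
qed

section \<open>Roots of unity and the polygon\<close>

lemma circ_add: "circ n (x + y) = circ n x * circ n y"
  by (simp add: circ_def cis_mult add_divide_distrib distrib_left)

lemma circ_minus: "circ n (- x) = cnj (circ n x)"
  by (simp add: circ_def cis_cnj)

lemma norm_circ [simp]: "norm (circ n x) = 1"
  by (simp add: circ_def)

lemma circ_nonzero [simp]: "circ n x \<noteq> 0"
  using norm_circ[of n x] by force

lemma circ_0 [simp]: "circ n 0 = 1"
  by (simp add: circ_def)

lemma circ_eq_exp: "circ n x = exp (\<i> * of_real (2 * pi * x / n))"
  by (simp add: circ_def cis_conv_exp)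

lemma circ_mult_cnj: "circ n x * cnj (circ n y) = circ n (x - y)"
  using circ_add[of n x "- y"] by (simp add: circ_minus)

lemma Re_circ: "Re (circ n x) = cos (2 * pi * x / n)"
  by (simp add: circ_def)

lemma continuous_on_circ [continuous_intros]:
  "continuous_on S f \<Longrightarrow> continuous_on S (\<lambda>x. circ n (f x))"
  unfolding circ_eq_exp divide_inverse by (intro continuous_intros)

lemma exp_i_eq_iff:
  "exp (\<i> * complex_of_real a) = exp (\<i> * of_real b) \<longleftrightarrow> (\<exists>m::int. a = b + 2 * real_of_int m * pi)"
  unfolding exp_eq by (simp add: complex_eq_iff)

lemma circ_eq_iff:
  fixes x y :: real
  assumes "0 < n"
  shows "circ n x = circ n y \<longleftrightarrow> (\<exists>m::int. x = y + real_of_int m * real n)"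
proof -
  have "circ n x = circ n y \<longleftrightarrow> (\<exists>m::int. 2 * pi * x / n = 2 * pi * y / n + 2 * real_of_int m * pi)"
    by (simp only: circ_eq_exp exp_i_eq_iff)
  also have "\<dots> \<longleftrightarrow> (\<exists>m::int. x = y + real_of_int m * real n)"
  proof (intro iff_exI)
    fix m :: int
    have "2 * pi * x / n = 2 * pi * y / n + 2 * real_of_int m * pi \<longleftrightarrow> (2 * pi / n) * x = (2 * pi / n) * (y + real_of_int m * real n)"
      using assms by (simp add: field_simps)
    then show "2 * pi * x / n = 2 * pi * y / n + 2 * real_of_int m * pi \<longleftrightarrow> x = y + real_of_int m * real n"
      using assms by simp
  qed
  finally show ?thesis .
qed

lemma circ_add_period:
  fixes x :: real and m :: int
  assumes "0 < n"
  shows "circ n (x + real_of_int m * real n) = circ n x"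
  unfolding circ_eq_iff[OF assms] by blast

lemma circ_eq_imp_eq:
  fixes x y :: real
  assumes "0 < n" "circ n x = circ n y" "\<bar>x - y\<bar> < n"
  shows "x = y"
proof -
  obtain m :: int where m: "x = y + real_of_int m * real n" using assms circ_eq_iff by blast
  then have "\<bar>real_of_int m\<bar> * real n < 1 * real n" using assms by (simp add: abs_mult)
  then have "\<bar>real_of_int m\<bar> < 1" using assms(1) by (subst (asm) mult_less_cancel_right_pos) auto
  then have "m = 0" by linarith
  with m show ?thesis by simp
qed

text \<open>The argument is measured in the scale in which the corners are integers; the modulus is
  left free, since only the direction of \<open>g\<close> matters. The value \<open>a\<close>
  selects the branch.\<close>

lemma circ_lift:
  fixes g :: "'q::real_normed_vector \<Rightarrow> complex"
  assumes "contractible Q" "continuous_on Q g" "\<And>q. q \<in> Q \<Longrightarrow> g q \<noteq> 0"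
    and "q0 \<in> Q" "g q0 = of_real (norm (g q0)) * circ n a" "0 < n"
  obtains y where "continuous_on Q y" "y q0 = a"
    "\<And>q. q \<in> Q \<Longrightarrow> g q = of_real (norm (g q)) * circ n (y q)"
proof -
  obtain L where L: "continuous_on Q L" "\<And>q. q \<in> Q \<Longrightarrow> g q = exp (L q)"
    using continuous_logarithm_on_contractible[OF assms(2,1,3)] by metis
  define w where "w q = Im (L q) * n / (2 * pi)" for q
  have w: "g q = of_real (norm (g q)) * circ n (w q)" if "q \<in> Q" for q
  proof -
    have "circ n (w q) = cis (Im (L q))" using \<open>0 < n\<close> by (simp add: circ_def w_def)
    then show ?thesis using L(2)[OF that] by (simp add: exp_eq_polar norm_mult)
  qed
  have "circ n a = circ n (w q0)"
  proof -
    have "of_real (norm (g q0)) * circ n a = of_real (norm (g q0)) * circ n (w q0)"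
      using w[of q0] assms(4,5) by simp
    then show ?thesis using assms(3)[OF assms(4)] by simp
  qed
  then obtain m :: int where m: "a = w q0 + real_of_int m * real n" using circ_eq_iff assms(6) by blast
  show thesis
  proof
    show "continuous_on Q (\<lambda>q. w q + real_of_int m * real n)"
      unfolding w_def using L(1) by (intro continuous_intros) auto
    show "g q = of_real (norm (g q)) * circ n (w q + real_of_int m * real n)" if "q \<in> Q" for q
      using w[OF that] circ_add_period[OF assms(6)] by simp
  qed (simp add: m)
qed

lemma sin_fraction_nonneg:
  fixes a :: real
  assumes "0 < n" "0 \<le> a" "a \<le> real n"
  shows "0 \<le> sin (pi * a / n)"
proof (rule sin_ge_zero)
  have "pi * a \<le> pi * n" using assms by simp
  then show "pi * a / n \<le> pi" using assms by (simp add: divide_le_eq)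
qed (use assms in simp)

lemma sin_fraction_pos:
  fixes a :: real
  assumes "0 < n" "0 < a" "a < real n"
  shows "0 < sin (pi * a / n)"
proof (rule sin_gt_zero)
  have "pi * a < pi * n" using assms by simp
  then show "pi * a / n < pi" using assms by (simp add: divide_less_eq)
qed (use assms in simp)

text \<open>The unit tangent of the circle at the parameter \<open>m / 2\<close>. A chord from
  \<open>a\<close> to \<open>b\<close> is parallel to the tangent halfway between them, which is why
  only the sum of the parameters enters.\<close>

definition chord_dir :: "nat \<Rightarrow> real \<Rightarrow> complex" where
  "chord_dir n m = \<i> * cis (pi * m / n)"

lemma circ_diff_eq:
  "circ n b - circ n a = of_real (2 * sin (pi * (b - a) / n)) * chord_dir n (a + b)"
proof -
  define u v where "u = pi * (a + b) / n" and "v = pi * (b - a) / n"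
  have "u + v = 2 * pi * b / n" "u - v = 2 * pi * a / n"
    by (simp_all add: u_def v_def add_divide_distrib[symmetric] diff_divide_distrib[symmetric] algebra_simps)
  then have "circ n b = cis (u + v)" "circ n a = cis (u - v)" by (simp_all add: circ_def)
  moreover have "cis (u + v) - cis (u - v) = of_real (2 * sin v) * (\<i> * cis u)"
    by (simp add: complex_eq_iff cos_add sin_add cos_diff sin_diff)
  ultimately show ?thesis by (simp add: chord_dir_def u_def v_def)
qed

lemma cos_abs_arg: "cos (c * x / d) = cos (c * \<bar>x\<bar> / d)" for c d x :: real
proof (cases "0 \<le> x")
  case False
  then have "c * \<bar>x\<bar> / d = - (c * x / d)" by simp
  then show ?thesis by (simp only: cos_minus)
qed simp

lemma cos_le_cos_arc:
  fixes a x :: real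
  assumes "0 < n" "0 \<le> a" "a \<le> x" "x \<le> real n - a"
  shows "cos (2 * pi * x / n) \<le> cos (2 * pi * a / n)"
proof (cases "x \<le> n / 2")
  case True
  then have "2 * pi * x / n \<le> pi" using assms by (simp add: field_simps)
  then show ?thesis using assms by (intro cos_monotone_0_pi_le) (auto simp: field_simps)
next
  case False
  have eq: "2 * pi * (n - x) / n = 2 * pi - 2 * pi * x / n" using assms(1) by (simp add: field_simps)
  have "cos (2 * pi * x / n) = cos (2 * pi * (n - x) / n)" unfolding eq by simp
  also have "\<dots> \<le> cos (2 * pi * a / n)"
  proof (rule cos_monotone_0_pi_le)
    show "2 * pi * a / n \<le> 2 * pi * (n - x) / n" using assms by (intro divide_right_mono mult_left_mono) auto
    have "2 * (n - x) * pi \<le> n * pi" using False by (intro mult_right_mono) auto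
    then show "2 * pi * (n - x) / n \<le> pi" using assms by (simp add: field_simps)
  qed (use assms in auto)
  finally show ?thesis .
qed

text \<open>Shifting by one before and after the reduction yields representatives
  \<open>1..n\<close> instead of \<open>0..n-1\<close>, so that multiples of \<open>n\<close> are
  labelled \<open>n\<close>, in agreement with \<open>cyc_succ\<close>.\<close>

definition residue_rep :: "nat \<Rightarrow> int \<Rightarrow> nat" where
  "residue_rep n m = nat ((m - 1) mod int n) + 1"

lemma residue_rep_mem: "0 < n \<Longrightarrow> residue_rep n m \<in> {1..n}"
  by (auto simp: residue_rep_def nat_less_iff Suc_le_eq)

lemma residue_rep_cong:
  assumes "0 < n"
  shows "\<exists>q. m = int (residue_rep n m) + q * int n"
proof
  show "m = int (residue_rep n m) + ((m - 1) div int n) * int n"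
    using assms div_mult_mod_eq[of "m - 1" "int n"] by (simp add: residue_rep_def)
qed

lemma residue_rep_of_nat: "k \<in> {1..n} \<Longrightarrow> residue_rep n (int k) = k"
  by (auto simp: residue_rep_def of_nat_diff nat_diff_distrib)

lemma residue_rep_eq_iff:
  assumes "0 < n"
  shows "residue_rep n a = residue_rep n b \<longleftrightarrow> a mod int n = b mod int n"
proof -
  have "residue_rep n a = residue_rep n b \<longleftrightarrow> (a - 1) mod int n = (b - 1) mod int n"
    using assms by (simp add: residue_rep_def eq_nat_nat_iff)
  also have "\<dots> \<longleftrightarrow> a mod int n = b mod int n" by (simp add: mod_eq_dvd_iff)
  finally show ?thesis .
qed

lemma pt_residue_rep:
  assumes "0 < n"
  shows "pt n (residue_rep n m) = circ n (of_int m)"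
proof -
  obtain q where "m = int (residue_rep n m) + q * int n" using residue_rep_cong[OF assms] by blast
  then have "real_of_int m = real_of_int (int (residue_rep n m) + q * int n)" by (rule arg_cong)
  then show ?thesis unfolding pt_def using circ_add_period[OF assms, of "real (residue_rep n m)" q] by simp
qed

lemma cyc_succ_residue_rep: "0 < n \<Longrightarrow> cyc_succ n (residue_rep n m) = residue_rep n (m + 1)"
proof -
  assume n: "0 < n"
  have "int (residue_rep n m mod n) = ((m - 1) mod int n + 1) mod int n"
    using n by (simp add: residue_rep_def zmod_int add.commute)
  also have "\<dots> = m mod int n" by (simp add: mod_add_left_eq)
  finally have "residue_rep n m mod n = nat (m mod int n)" by simp
  then show ?thesis by (simp add: cyc_succ_def residue_rep_def)
qed

lemma cyc_succ_mem: "0 < n \<Longrightarrow> cyc_succ n i \<in> {1..n}"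
  by (auto simp: cyc_succ_def Suc_le_eq)

lemma pt_cyc_succ: "0 < n \<Longrightarrow> pt n (cyc_succ n i) = circ n (real i + 1)"
  using pt_residue_rep[of n "int i + 1"] pt_residue_rep[of n "int i"] cyc_succ_residue_rep[of n "int i"]
proof -
  assume n: "0 < n"
  have "residue_rep n (int i + 1) = cyc_succ n i"
    using n by (simp add: residue_rep_def cyc_succ_def nat_mod_as_int zmod_int)
  then show ?thesis using pt_residue_rep[OF n, of "int i + 1"] by simp
qed

lemma inj_on_pt: "inj_on (pt n) {1..n}"
proof (rule inj_onI)
  fix i j assume ij: "i \<in> {1..n}" "j \<in> {1..n}" "pt n i = pt n j"
  then have "real i = real j" unfolding pt_def by (intro circ_eq_imp_eq[of n]) auto
  then show "i = j" by simp
qed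

lemma pt_eq_iff: "i \<in> {1..n} \<Longrightarrow> j \<in> {1..n} \<Longrightarrow> pt n i = pt n j \<longleftrightarrow> i = j"
  by (rule inj_on_eq_iff[OF inj_on_pt])

lemma pt_in_polygon: "i \<in> {1..n} \<Longrightarrow> pt n i \<in> polygon n"
  by (auto simp: polygon_def hull_inc)

lemma convex_polygon: "convex (polygon n)"
  by (simp add: polygon_def)

section \<open>Separating the hulls of sets of corners\<close>

lemma separated_hulls:
  assumes "\<And>i. i \<in> A \<Longrightarrow> \<theta> < Re (pt n i * cnj w)" "\<And>i. i \<in> B \<Longrightarrow> Re (pt n i * cnj w) \<le> \<theta>"
  shows "convex hull (pt n ` A) \<inter> convex hull (pt n ` B) = {}"
proof -
  have lin: "Re (z * cnj w) = w \<bullet> z" for z by (simp add: inner_complex_def)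
  have "convex hull (pt n ` A) \<subseteq> {z. \<theta> < Re (z * cnj w)}"
    using assms(1) unfolding lin by (intro hull_minimal) (auto simp: convex_halfspace_gt)
  moreover have "convex hull (pt n ` B) \<subseteq> {z. Re (z * cnj w) \<le> \<theta>}"
    using assms(2) unfolding lin by (intro hull_minimal) (auto simp: convex_halfspace_le)
  ultimately show ?thesis by fastforce
qed

text \<open>The separating line is perpendicular to the direction \<open>mid\<close> of the middle
  of the interval. Points of the interval are at most \<open>h\<close> steps away from
  \<open>mid\<close>, all other corners at least \<open>h + 1\<close>, and the cosine decreases with
  this distance.\<close>

lemma interval_hulls_disjoint:
  assumes "0 < n" "a \<le> b"
  defines "I \<equiv> residue_rep n ` {a..b}"
  shows "convex hull (pt n ` I) \<inter> convex hull (pt n ` ({1..n} - I)) = {}"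
proof (cases "I = {1..n}")
  case False
  define h where "h = real_of_int (b - a) / 2"
  define mid where "mid = real_of_int (a + b) / 2"
  have small: "b - a \<le> int n - 2"
  proof (rule ccontr)
    assume "\<not> b - a \<le> int n - 2"
    then have "{a..a + int n - 1} \<subseteq> {a..b}" by auto
    moreover have "k \<in> residue_rep n ` {a..a + int n - 1}" if k: "k \<in> {1..n}" for k
    proof
      show "k = residue_rep n (a + (int k - a) mod int n)" using residue_rep_of_nat[OF k] assms(1)
        by (metis add.commute diff_add_cancel mod_add_right_eq residue_rep_eq_iff)
      show "a + (int k - a) mod int n \<in> {a..a + int n - 1}"
        using assms(1) pos_mod_bound[of "int n" "int k - a"] by auto
    qed
    ultimately have "{1..n} \<subseteq> I" unfolding I_def by blast
    then show False using False residue_rep_mem[OF assms(1)] by (auto simp: I_def)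
  qed
  have Re_eq: "Re (pt n (residue_rep n m) * cnj (circ n mid)) = cos (2 * pi * (m - mid) / n)" for m
    using assms(1) by (simp add: pt_residue_rep circ_mult_cnj Re_circ)
  have h: "0 \<le> h" "h + 1 \<le> n / 2"
  proof -
    have "real_of_int (b - a) \<le> real n - 2" using small by linarith
    then show "0 \<le> h" "h + 1 \<le> n / 2" using assms(2) by (auto simp: h_def field_simps)
  qed
  show ?thesis
  proof (rule separated_hulls[where w = "circ n mid" and \<theta> = "cos (2 * pi * (h + 1) / n)"])
    fix i assume "i \<in> I"
    then obtain m where m: "a \<le> m" "m \<le> b" "i = residue_rep n m" by (auto simp: I_def)
    have "\<bar>m - mid\<bar> \<le> h" using m by (auto simp: mid_def h_def abs_le_iff field_simps)
    moreover have "cos (2 * pi * (m - mid) / n) = cos (2 * pi * \<bar>m - mid\<bar> / n)" by (rule cos_abs_arg)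
    moreover have "cos (2 * pi * h / n) \<le> cos (2 * pi * \<bar>m - mid\<bar> / n)" if "\<bar>m - mid\<bar> \<le> h"
      using that h assms(1) by (intro cos_le_cos_arc) auto
    moreover have "cos (2 * pi * (h + 1) / n) < cos (2 * pi * h / n)"
    proof (rule cos_monotone_0_pi)
      have "(2 * h + 2) * pi \<le> n * pi" using h by (intro mult_right_mono) auto
      then show "2 * pi * (h + 1) / n \<le> pi" using assms(1) by (simp add: field_simps)
    qed (use h assms(1) in \<open>auto simp: divide_strict_right_mono\<close>)
    ultimately show "cos (2 * pi * (h + 1) / n) < Re (pt n i * cnj (circ n mid))"
      unfolding m(3) Re_eq by linarith
  next
    fix i assume i: "i \<in> {1..n} - I"
    define m where "m = a + (int i - a) mod int n"
    have m: "a \<le> m" "m < a + int n" using assms(1) by (auto simp: m_def)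
    have im: "i = residue_rep n m" using residue_rep_of_nat[of i n] assms(1) i unfolding m_def
      by (metis DiffD1 add.commute diff_add_cancel mod_add_right_eq residue_rep_eq_iff)
    then have "b < m" using i m by (force simp: I_def)
    then have "h + 1 \<le> m - mid" "m - mid \<le> n - (h + 1)" using m by (simp_all add: h_def mid_def field_simps)
    then show "Re (pt n i * cnj (circ n mid)) \<le> cos (2 * pi * (h + 1) / n)"
      unfolding im Re_eq using h assms(1) by (intro cos_le_cos_arc) auto
  qed
qed simp

text \<open>An interval of length one shows that every corner is an extreme point.\<close>

lemma pt_notin_hull:
  assumes "i \<in> {1..n}" "i \<notin> A" "A \<subseteq> {1..n}"
  shows "pt n i \<notin> convex hull (pt n ` A)"
proof -
  have "residue_rep n ` {int i..int i} = {i}" using residue_rep_of_nat[OF assms(1)] by simp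
  with interval_hulls_disjoint[of n "int i" "int i"]
  have "convex hull (pt n ` {i}) \<inter> convex hull (pt n ` ({1..n} - {i})) = {}" using assms(1) by simp
  moreover have "convex hull (pt n ` A) \<subseteq> convex hull (pt n ` ({1..n} - {i}))"
    using assms by (intro hull_mono) auto
  ultimately show ?thesis by auto
qed

subsection \<open>The gauge of the polygon\<close>

text \<open>The Minkowski functional of the polygon: the outward normal of the edge from
  \<open>j\<close> to \<open>j + 1\<close> points to the parameter \<open>j + 1/2\<close>, and the
  edge has distance \<open>cos (pi / n)\<close> from the origin.\<close>

definition gauge_fun :: "nat \<Rightarrow> complex \<Rightarrow> real" where
  "gauge_fun n z = Max ((\<lambda>j. Re (z * cnj (circ n (real j + 1/2)))) ` {1..n}) / cos (pi / n)"

lemma cos_pi_div_pos: "n \<ge> 3 \<Longrightarrow> 0 < cos (pi / real n)"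
  by (intro cos_gt_zero) (auto simp: field_simps)

lemma gauge_fun_le_iff:
  assumes "n \<ge> 3"
  shows "gauge_fun n z \<le> r \<longleftrightarrow> (\<forall>j\<in>{1..n}. Re (z * cnj (circ n (real j + 1/2))) \<le> r * cos (pi / n))"
  using assms cos_pi_div_pos[OF assms] by (simp add: gauge_fun_def divide_le_eq)

lemma gauge_fun_scale:
  assumes "n \<ge> 3" "0 \<le> r"
  shows "gauge_fun n (of_real r * z) = r * gauge_fun n z"
proof -
  have "Re (of_real r * z * cnj w) = r * Re (z * cnj w)" for w by (simp add: algebra_simps)
  then have "Max ((\<lambda>j. Re (of_real r * z * cnj (circ n (real j + 1/2)))) ` {1..n}) =
      Max ((\<lambda>x. r * x) ` ((\<lambda>j. Re (z * cnj (circ n (real j + 1/2)))) ` {1..n}))"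
    by (simp add: image_image)
  also have "\<dots> = r * Max ((\<lambda>j. Re (z * cnj (circ n (real j + 1/2)))) ` {1..n})"
    using assms by (intro mono_Max_commute[symmetric]) (auto simp: mono_def mult_left_mono)
  finally show ?thesis by (simp add: gauge_fun_def)
qed

lemma continuous_on_Max:
  fixes f :: "'i \<Rightarrow> 'a::topological_space \<Rightarrow> real"
  assumes "finite I" "I \<noteq> {}" "\<And>i. i \<in> I \<Longrightarrow> continuous_on S (f i)"
  shows "continuous_on S (\<lambda>x. Max ((\<lambda>i. f i x) ` I))"
  using assms by (induction I rule: finite_ne_induct) (auto intro!: continuous_intros)

lemma continuous_on_Min:
  fixes f :: "'i \<Rightarrow> 'a::topological_space \<Rightarrow> real"
  assumes "finite I" "I \<noteq> {}" "\<And>i. i \<in> I \<Longrightarrow> continuous_on S (f i)"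
  shows "continuous_on S (\<lambda>x. Min ((\<lambda>i. f i x) ` I))"
  using assms by (induction I rule: finite_ne_induct) (auto intro!: continuous_intros)

lemma continuous_on_gauge_fun [continuous_intros]:
  assumes "n \<ge> 3" "continuous_on S f"
  shows "continuous_on S (\<lambda>x. gauge_fun n (f x))"
  unfolding gauge_fun_def using assms cos_pi_div_pos[of n] by (intro continuous_intros continuous_on_Max) auto

text \<open>The argument of \<open>z\<close> lies between those of two neighbouring corners, and the
  sine rule gives the coordinates with respect to them. Both corners have the same component
  \<open>cos (pi / n)\<close> along the normal of their common edge, which accounts for the last
  equation.\<close>

lemma sector_coordinates:
  assumes "n \<ge> 3"
  obtains \<alpha> \<beta> j where "0 \<le> \<alpha>" "0 \<le> \<beta>" "j \<in> {1..n}"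
    "z = of_real \<alpha> * pt n j + of_real \<beta> * pt n (cyc_succ n j)"
    "Re (z * cnj (circ n (real j + 1/2))) = (\<alpha> + \<beta>) * cos (pi / n)"
proof -
  define x where "x = Arg z * n / (2 * pi)"
  define m f where "m = \<lfloor>x\<rfloor>" and "f = x - m"
  have f: "0 \<le> f" "f \<le> 1" by (auto simp: f_def m_def) linarith
  define s where "s = sin (2 * pi / n)"
  have s: "0 < s" unfolding s_def using assms by (intro sin_gt_zero) (auto simp: field_simps)
  define \<alpha> \<beta> where "\<alpha> = norm z * sin (2 * pi * (1 - f) / n) / s"
    and "\<beta> = norm z * sin (2 * pi * f / n) / s"
  define j where "j = residue_rep n m"
  have pj: "pt n j = circ n m" "pt n (cyc_succ n j) = circ n m * circ n 1"
    using assms by (simp_all add: j_def pt_residue_rep cyc_succ_residue_rep circ_add)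
  have "2 * pi * x / n = Arg z" using assms by (simp add: x_def)
  then have "z = of_real (norm z) * circ n x" using rcis_cmod_Arg[of z] by (simp add: circ_def rcis_def)
  also have "circ n x = circ n m * circ n f" by (simp add: f_def flip: circ_add)
  also have "circ n f = of_real (sin (2 * pi * (1 - f) / n) / s) + of_real (sin (2 * pi * f / n) / s) * circ n 1"
  proof -
    have *: "2 * pi * (1 - f) / n = 2 * pi / n - 2 * pi * f / n"
      by (simp add: algebra_simps diff_divide_distrib)
    have "of_real (sin p) * cis q = of_real (sin (p - q)) + of_real (sin q) * cis p" for p q
      by (simp add: complex_eq_iff sin_diff)
    from this[of "2 * pi / n" "2 * pi * f / n"]
    have eq: "of_real s * circ n f = of_real (sin (2 * pi * (1 - f) / n)) + of_real (sin (2 * pi * f / n)) * circ n 1"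
      unfolding * by (simp add: s_def circ_def)
    have "circ n f = (of_real s * circ n f) / of_real s" using s by simp
    then show ?thesis unfolding eq by (simp add: add_divide_distrib)
  qed
  finally have z: "z = of_real \<alpha> * pt n j + of_real \<beta> * pt n (cyc_succ n j)"
    by (simp add: pj \<alpha>_def \<beta>_def algebra_simps)
  have "0 \<le> sin (2 * pi * (1 - f) / n)" "0 \<le> sin (2 * pi * f / n)"
  proof -
    have "2 * pi * (1 - f) / n \<le> pi" "2 * pi * f / n \<le> pi"
    proof -
      have "2 * (1 - f) * pi \<le> n * pi" "2 * f * pi \<le> n * pi" using f assms by (auto intro!: mult_right_mono)
      then show "2 * pi * (1 - f) / n \<le> pi" "2 * pi * f / n \<le> pi" using assms by (simp_all add: field_simps)
    qed
    then show "0 \<le> sin (2 * pi * (1 - f) / n)" "0 \<le> sin (2 * pi * f / n)"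
      using f assms by (auto intro!: sin_ge_zero)
  qed
  then have ab: "0 \<le> \<alpha>" "0 \<le> \<beta>" using s by (auto simp: \<alpha>_def \<beta>_def)
  have jn: "j \<in> {1..n}" unfolding j_def using assms by (intro residue_rep_mem) auto
  have "pt n j * cnj (circ n (real j + 1/2)) = circ n (- 1/2)" by (simp add: pt_def circ_mult_cnj)
  moreover have "pt n (cyc_succ n j) * cnj (circ n (real j + 1/2)) = circ n (1/2)"
    using assms by (simp add: pt_cyc_succ circ_mult_cnj)
  ultimately have "z * cnj (circ n (real j + 1/2)) = of_real \<alpha> * circ n (- 1/2) + of_real \<beta> * circ n (1/2)"
    by (subst z) (simp add: distrib_right mult.assoc)
  then have "Re (z * cnj (circ n (real j + 1/2))) = (\<alpha> + \<beta>) * cos (pi / n)"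
    by (simp add: Re_circ algebra_simps)
  with ab jn z show thesis using that by blast
qed

lemma gauge_fun_pos:
  assumes "n \<ge> 3" "z \<noteq> 0"
  shows "0 < gauge_fun n z"
proof -
  obtain \<alpha> \<beta> j where *: "0 \<le> \<alpha>" "0 \<le> \<beta>" "j \<in> {1..n}"
    "z = of_real \<alpha> * pt n j + of_real \<beta> * pt n (cyc_succ n j)"
    "Re (z * cnj (circ n (real j + 1/2))) = (\<alpha> + \<beta>) * cos (pi / n)"
    using sector_coordinates[OF assms(1)] .
  have "\<alpha> \<noteq> 0 \<or> \<beta> \<noteq> 0" using * assms(2) by auto
  then have "0 < \<alpha> + \<beta>" using *(1,2) by auto
  then have "0 < Re (z * cnj (circ n (real j + 1/2)))"
    unfolding *(5) using cos_pi_div_pos[OF assms(1)] by simp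
  then show ?thesis using gauge_fun_le_iff[OF assms(1), of z 0] *(3) by (auto simp: not_le[symmetric])
qed

text \<open>The sum of the corners is invariant under the rotation by \<open>circ n 1\<close>, which
  is not \<open>1\<close>, so the sum vanishes and the centre is the average of the corners.\<close>

lemma zero_in_polygon:
  assumes "n \<ge> 3"
  shows "0 \<in> polygon n"
proof -
  define S where "S = (\<Sum>j\<in>{1..n}. pt n j)"
  have "S * circ n 1 = (\<Sum>j\<in>{1..n}. circ n (real j + 1))"
    by (simp add: S_def sum_distrib_right pt_def circ_add)
  also have "\<dots> = (\<Sum>j\<in>{2..n+1}. circ n (real j))"
    by (rule sum.reindex_bij_witness[of _ "\<lambda>j. j - 1" "\<lambda>j. j + 1"]) (auto simp: add.commute)
  also have "\<dots> = S"
  proof -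
    have "{2..n+1} = insert (n + 1) {2..n}" "{1..n} = insert 1 {2..n}" using assms by auto
    moreover have "circ n (real (n + 1)) = circ n 1"
      using circ_add_period[of n 1 1] assms by (simp add: add.commute)
    ultimately show ?thesis by (simp add: S_def pt_def)
  qed
  finally have "S * (circ n 1 - 1) = 0" by (simp add: algebra_simps)
  moreover have "circ n 1 \<noteq> circ n 0" using circ_eq_imp_eq[of n 1 0] assms by auto
  ultimately have "S = 0" by simp
  have "(\<Sum>j\<in>{1..n}. (1 / n) *\<^sub>R pt n j) \<in> polygon n"
    using assms by (intro convex_sum convex_polygon) (auto intro: pt_in_polygon)
  then show ?thesis using \<open>S = 0\<close> by (simp add: S_def flip: scaleR_sum_right)
qed

lemma convex_3:
  assumes "convex S" "a \<in> S" "b \<in> S" "c \<in> S" "0 \<le> u" "0 \<le> v" "0 \<le> w" "u + v + w = 1"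
  shows "u *\<^sub>R a + v *\<^sub>R b + w *\<^sub>R c \<in> S"
proof -
  have "u *\<^sub>R a + v *\<^sub>R b + w *\<^sub>R c \<in> convex hull {a, b, c}" unfolding convex_hull_3 using assms(5-8) by blast
  also have "convex hull {a, b, c} \<subseteq> S" using assms(1-4) by (intro hull_minimal) auto
  finally show ?thesis .
qed

text \<open>One inclusion holds because the corners satisfy all edge inequalities. For the other,
  sector coordinates with sum at most one exhibit \<open>z\<close> as a convex combination of the
  centre and two neighbouring corners.\<close>

lemma polygon_eq:
  assumes "n \<ge> 3"
  shows "polygon n = {z. gauge_fun n z \<le> 1}"
proof
  have "convex {z. gauge_fun n z \<le> 1}"
  proof -
    have "{z. gauge_fun n z \<le> 1} = (\<Inter>j\<in>{1..n}. {z. circ n (real j + 1/2) \<bullet> z \<le> cos (pi / n)})"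
      by (auto simp: gauge_fun_le_iff[OF assms] inner_complex_def mult.commute)
    then show ?thesis by (auto intro!: convex_INT simp: convex_halfspace_le)
  qed
  moreover have "pt n i \<in> {z. gauge_fun n z \<le> 1}" if i: "i \<in> {1..n}" for i
  proof -
    have "Re (pt n i * cnj (circ n (real j + 1/2))) \<le> cos (pi / n)" if j: "j \<in> {1..n}" for j
    proof -
      have "Re (pt n i * cnj (circ n (real j + 1/2))) = cos (2 * pi * (real i - real j - 1/2) / n)"
        by (simp add: pt_def circ_mult_cnj Re_circ algebra_simps)
      also have "\<dots> = cos (2 * pi * \<bar>real i - real j - 1/2\<bar> / n)" by (rule cos_abs_arg)
      also have "\<dots> \<le> cos (2 * pi * (1/2) / n)"
      proof (rule cos_le_cos_arc)
        show "1/2 \<le> \<bar>real i - real j - 1/2\<bar>" by (cases "i \<le> j") (auto simp: abs_if)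
      qed (use i j in \<open>auto simp: abs_if\<close>)
      finally show ?thesis by simp
    qed
    then show ?thesis by (simp add: gauge_fun_le_iff[OF assms])
  qed
  ultimately show "polygon n \<subseteq> {z. gauge_fun n z \<le> 1}" unfolding polygon_def by (intro hull_minimal) auto
  show "{z. gauge_fun n z \<le> 1} \<subseteq> polygon n"
  proof safe
    fix z assume z: "gauge_fun n z \<le> 1"
    obtain \<alpha> \<beta> j where *: "0 \<le> \<alpha>" "0 \<le> \<beta>" "j \<in> {1..n}"
      "z = of_real \<alpha> * pt n j + of_real \<beta> * pt n (cyc_succ n j)"
      "Re (z * cnj (circ n (real j + 1/2))) = (\<alpha> + \<beta>) * cos (pi / n)"
      using sector_coordinates[OF assms] .
    have "(\<alpha> + \<beta>) * cos (pi / n) \<le> 1 * cos (pi / n)"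
      using z *(3,5) unfolding gauge_fun_le_iff[OF assms] by metis
    then have "\<alpha> + \<beta> \<le> 1" using cos_pi_div_pos[OF assms] by simp
    moreover have "pt n j \<in> polygon n" "pt n (cyc_succ n j) \<in> polygon n"
      using *(3) cyc_succ_mem[of n j] assms by (auto intro!: pt_in_polygon)
    ultimately have "(1 - \<alpha> - \<beta>) *\<^sub>R 0 + \<alpha> *\<^sub>R pt n j + \<beta> *\<^sub>R pt n (cyc_succ n j) \<in> polygon n"
      using *(1,2) zero_in_polygon[OF assms] by (intro convex_3 convex_polygon) auto
    then show "z \<in> polygon n" using *(4) by (simp add: scaleR_conv_of_real)
  qed
qed

lemma frontier_polygon:
  assumes "n \<ge> 3"
  shows "frontier (polygon n) = {z. gauge_fun n z = 1}"
proof -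
  have cont: "continuous_on UNIV (gauge_fun n)"
    using continuous_on_gauge_fun[OF assms, of UNIV "\<lambda>x. x"] by simp
  have "closed (polygon n)"
    unfolding polygon_eq[OF assms] by (rule closed_Collect_le[OF cont continuous_on_const])
  have "interior (polygon n) = {z. gauge_fun n z < 1}"
  proof
    show "{z. gauge_fun n z < 1} \<subseteq> interior (polygon n)" unfolding polygon_eq[OF assms]
      by (rule interior_maximal) (auto intro: open_Collect_less[OF cont continuous_on_const])
    show "interior (polygon n) \<subseteq> {z. gauge_fun n z < 1}"
    proof safe
      fix z assume z: "z \<in> interior (polygon n)"
      then obtain e where e: "0 < e" "ball z e \<subseteq> polygon n" by (meson mem_interior)
      show "gauge_fun n z < 1"
      proof (rule ccontr)
        assume "\<not> gauge_fun n z < 1"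
        then have g: "gauge_fun n z \<ge> 1" by simp
        \<comment> \<open>Scaling by \<open>1 + d\<close> stays within the ball of radius
          \<open>e\<close> but leaves the polygon if the gauge is at least one. The summand
          \<open>1\<close> in the denominator covers \<open>z = 0\<close>.\<close>
        define d where "d = (e / 2) / (norm z + 1)"
        have d: "0 < d" unfolding d_def using e by (intro divide_pos_pos) (auto intro: add_nonneg_pos)
        have "norm (of_real (1 + d) * z - z) = d * norm z" using d by (simp add: algebra_simps norm_mult)
        also have "\<dots> < e"
        proof -
          have "d * norm z \<le> d * (norm z + 1)" using d by simp
          also have "\<dots> = e / 2"
          proof -
            have "norm z + 1 \<noteq> 0" using norm_ge_zero[of z] by linarith
            then show ?thesis unfolding d_def by (rule nonzero_eq_divide_eq[THEN iffD1, OF _ refl])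
          qed
          finally show ?thesis using e by simp
        qed
        finally have "of_real (1 + d) * z \<in> polygon n" using e by (auto simp: dist_norm norm_minus_commute)
        then have "(1 + d) * gauge_fun n z \<le> 1"
          using d by (simp add: polygon_eq[OF assms] gauge_fun_scale[OF assms] del: of_real_add)
        moreover have "1 < (1 + d) * gauge_fun n z" using d g by (smt (verit) mult_le_cancel_left1)
        ultimately show False by simp
      qed
    qed
  qed
  then show ?thesis using \<open>closed (polygon n)\<close> by (auto simp: frontier_def polygon_eq[OF assms])
qed

text \<open>Along the whole edge the component in the direction of its outward normal is
  \<open>cos (pi / n)\<close>, so the gauge is at least one there.\<close>

lemma edge_in_frontier:
  assumes "n \<ge> 3" "j \<in> {1..n}" "0 \<le> t" "t \<le> 1"
  shows "(1 - t) *\<^sub>R pt n j + t *\<^sub>R pt n (cyc_succ n j) \<in> frontier (polygon n)"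
proof -
  let ?z = "(1 - t) *\<^sub>R pt n j + t *\<^sub>R pt n (cyc_succ n j)"
  have "?z \<in> polygon n"
    using assms cyc_succ_mem[of n j] by (intro convexD_alt convex_polygon pt_in_polygon) auto
  then have le: "gauge_fun n ?z \<le> 1" by (simp add: polygon_eq[OF assms(1)])
  have "pt n j * cnj (circ n (real j + 1/2)) = circ n (- 1/2)" by (simp add: pt_def circ_mult_cnj)
  moreover have "pt n (cyc_succ n j) * cnj (circ n (real j + 1/2)) = circ n (1/2)"
    using assms by (simp add: pt_cyc_succ circ_mult_cnj)
  ultimately have "?z * cnj (circ n (real j + 1/2)) = (1 - t) *\<^sub>R circ n (- 1/2) + t *\<^sub>R circ n (1/2)"
    by (simp only: distrib_right mult_scaleR_left)
  then have "Re (?z * cnj (circ n (real j + 1/2))) = Re ((1 - t) *\<^sub>R circ n (- 1/2) + t *\<^sub>R circ n (1/2))"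
    by (simp only:)
  also have "\<dots> = cos (pi / n)" by (simp add: Re_circ algebra_simps)
  finally have "Re (?z * cnj (circ n (real j + 1/2))) = cos (pi / n)" .
  moreover have "Re (?z * cnj (circ n (real j + 1/2))) \<le> gauge_fun n ?z * cos (pi / n)"
    using gauge_fun_le_iff[OF assms(1), of ?z "gauge_fun n ?z"] assms(2) by blast
  ultimately have "1 * cos (pi / n) \<le> gauge_fun n ?z * cos (pi / n)" by simp
  then have "1 \<le> gauge_fun n ?z" using cos_pi_div_pos[OF assms(1)] by (subst (asm) mult_le_cancel_right_pos)
  with le show ?thesis by (simp add: frontier_polygon[OF assms(1)])
qed

text \<open>The central projection onto the boundary of the polygon. Composed with
  \<open>circ n\<close> it lets a motion in the polygonal boundary be described by a real
  function.\<close>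

definition radial :: "nat \<Rightarrow> complex \<Rightarrow> complex" where
  "radial n z = z / of_real (gauge_fun n z)"

lemma gauge_radial:
  assumes "n \<ge> 3" "z \<noteq> 0"
  shows "gauge_fun n (radial n z) = 1"
proof -
  have "radial n z = of_real (1 / gauge_fun n z) * z" by (simp add: radial_def)
  then show ?thesis
    using gauge_fun_pos[OF assms] gauge_fun_scale[OF assms(1), of "1 / gauge_fun n z" z] by simp
qed

lemma radial_scale:
  assumes "n \<ge> 3" "z \<noteq> 0" "0 < r"
  shows "radial n (of_real r * z) = radial n z"
  using assms by (simp add: radial_def gauge_fun_scale)

lemma radial_frontier:
  assumes "n \<ge> 3" "z \<in> frontier (polygon n)"
  shows "radial n z = z" "z \<noteq> 0"
proof -
  have *: "gauge_fun n z = 1" using assms by (simp add: frontier_polygon)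
  then show "radial n z = z" by (simp add: radial_def)
  show "z \<noteq> 0"
  proof
    assume "z = 0"
    then have "gauge_fun n z = 0" using gauge_fun_scale[OF assms(1), of 0 z] by simp
    with * show False by simp
  qed
qed

lemma radial_circ_frontier: "n \<ge> 3 \<Longrightarrow> radial n (circ n x) \<in> frontier (polygon n)"
  by (simp add: frontier_polygon gauge_radial)

lemma frontier_subset_polygon: "n \<ge> 3 \<Longrightarrow> frontier (polygon n) \<subseteq> polygon n"
  by (subst frontier_polygon, assumption, subst polygon_eq, assumption, auto)

lemma pt_in_frontier: "n \<ge> 3 \<Longrightarrow> j \<in> {1..n} \<Longrightarrow> pt n j \<in> frontier (polygon n)"
  using edge_in_frontier[of n j 0] by simp

lemma radial_pt: "n \<ge> 3 \<Longrightarrow> j \<in> {1..n} \<Longrightarrow> radial n (pt n j) = pt n j"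
  using radial_frontier pt_in_frontier by blast

lemma radial_circ_int: "n \<ge> 3 \<Longrightarrow> radial n (circ n (of_int m)) = pt n (residue_rep n m)"
  using radial_pt[OF _ residue_rep_mem[of n m]] by (simp add: pt_residue_rep)

lemma radial_circ_eq_iff:
  assumes "n \<ge> 3"
  shows "radial n (circ n x) = radial n (circ n y) \<longleftrightarrow> circ n x = circ n y"
proof
  assume eq: "radial n (circ n x) = radial n (circ n y)"
  define a b where "a = gauge_fun n (circ n x)" and "b = gauge_fun n (circ n y)"
  have ab: "0 < a" "0 < b" using gauge_fun_pos[OF assms] by (auto simp: a_def b_def)
  have eq: "circ n x / of_real a = circ n y / of_real b" using eq by (simp add: radial_def a_def b_def)
  then have "norm (circ n x / of_real a) = norm (circ n y / of_real b)" by simp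
  then have "a = b" using ab by (simp add: norm_divide)
  with eq ab show "circ n x = circ n y" by simp
qed simp

lemma continuous_on_radial [continuous_intros]:
  assumes "n \<ge> 3" "continuous_on S f" "\<And>x. x \<in> S \<Longrightarrow> f x \<noteq> 0"
  shows "continuous_on S (\<lambda>x. radial n (f x))"
  unfolding radial_def using assms gauge_fun_pos[OF assms(1)]
  by (intro continuous_intros) (auto simp: less_imp_neq[symmetric])

section \<open>Braids with strands in the boundary\<close>

lemma card_pt_image: "A \<subseteq> {1..n} \<Longrightarrow> card (pt n ` A) = card A"
  using inj_on_pt[of n] by (meson card_image inj_on_subset)

lemma pt_image_eq_iff: "A \<subseteq> {1..n} \<Longrightarrow> A' \<subseteq> {1..n} \<Longrightarrow> pt n ` A = pt n ` A' \<longleftrightarrow> A = A'"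
  by (rule inj_on_image_eq_iff[OF inj_on_pt])

lemma base_in_topspace: "pt n ` {1..n} \<in> topspace (uconf n (polygon n))"
  by (auto simp: topspace_uconf card_pt_image pt_in_polygon)

lemma group_braid_group: "group (braid_group n)"
  unfolding braid_group_def by (rule group_fundamental_group[OF base_in_topspace])

interpretation group "braid_group n" for n
  by (rule group_braid_group)

lemma carrier_braid_group:
  "carrier (braid_group n) = {path_class (uconf n (polygon n)) f | f.
     pathin (uconf n (polygon n)) f \<and> f 0 = pt n ` {1..n} \<and> f 1 = pt n ` {1..n}}"
  by (simp add: braid_group_def carrier_fundamental_group)

lemma mem_braid:
  assumes "\<beta> \<in> carrier (braid_group n)" "f \<in> \<beta>"
  shows "pathin (uconf n (polygon n)) f" "f 0 = pt n ` {1..n}" "f 1 = pt n ` {1..n}"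
    and "\<beta> = path_class (uconf n (polygon n)) f"
proof -
  obtain f0 where f0: "pathin (uconf n (polygon n)) f0" "f0 0 = pt n ` {1..n}" "f0 1 = pt n ` {1..n}"
    "\<beta> = path_class (uconf n (polygon n)) f0"
    using assms(1) unfolding carrier_braid_group by auto
  then have hom: "path_homotopic (uconf n (polygon n)) f0 f" using assms(2) by (simp add: mem_path_class)
  show "pathin (uconf n (polygon n)) f" "f 0 = pt n ` {1..n}" "f 1 = pt n ` {1..n}"
    using path_homotopic_pathin[OF hom] path_homotopic_ends[OF hom] f0 by auto
  show "\<beta> = path_class (uconf n (polygon n)) f" using path_class_eqI[OF hom] f0 by simp
qed

lemma braid_homotopic:
  assumes "\<beta> \<in> carrier (braid_group n)" "f \<in> \<beta>" "f' \<in> \<beta>"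
  shows "path_homotopic (uconf n (polygon n)) f f'"
  using mem_braid(4)[OF assms(1,2)] assms(3) by (simp add: mem_path_class)

lemma braid_nonempty:
  assumes "\<beta> \<in> carrier (braid_group n)"
  obtains f where "f \<in> \<beta>"
  using assms mem_path_class_self unfolding carrier_braid_group by blast

lemma mult_mem_braid:
  assumes "\<beta> \<in> carrier (braid_group n)" "\<gamma> \<in> carrier (braid_group n)" "f \<in> \<beta>" "g \<in> \<gamma>"
  shows "path_concat f g \<in> \<beta> \<otimes>\<^bsub>braid_group n\<^esub> \<gamma>"
proof -
  have "path_homotopic (uconf n (polygon n)) (path_concat f g) (path_concat f g)"
    using mem_braid[OF assms(1,3)] mem_braid[OF assms(2,4)]
    by (intro path_homotopic_refl pathin_path_concat) auto
  then show ?thesis unfolding braid_group_def mult_fundamental_group class_mult_def using assms(3,4) by blast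
qed

lemma inv_mem_braid:
  assumes "\<beta> \<in> carrier (braid_group n)" "f \<in> \<beta>"
  shows "path_rev f \<in> inv\<^bsub>braid_group n\<^esub> \<beta>"
proof -
  note f = mem_braid[OF assms]
  have "inv\<^bsub>braid_group n\<^esub> \<beta> = path_class (uconf n (polygon n)) (path_rev f)"
    unfolding f(4) braid_group_def by (rule inv_path_class) (use f in auto)
  then show ?thesis using pathin_path_rev[OF f(1)] by (simp add: mem_path_class_self)
qed

lemma braid_config:
  assumes "pathin (uconf n S) f" "t \<in> {0..1}"
  shows "f t \<subseteq> S" "finite (f t)" "card (f t) = n"
proof -
  have "f t \<in> topspace (uconf n S)"
    using assms continuous_map_image_subset_topspace[of "top_of_set {0..1}" "uconf n S" f]
    unfolding pathin_def by auto
  then show "f t \<subseteq> S" "finite (f t)" "card (f t) = n" by (auto simp: topspace_uconf)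
qed

lemma strand_exists:
  assumes "pathin (uconf n S) f" "a \<in> f 0"
  obtains g where "continuous_on {0..1} g" "\<And>t. t \<in> {0..1} \<Longrightarrow> g t \<in> f t" "g 0 = a"
  using selection_exists[of "{0..1::real}" n S f 0 a] assms by (auto simp: pathin_def)

lemma strands_distinct:
  assumes "pathin (uconf n S) f"
    and "continuous_on {0..1} g" "\<And>t. t \<in> {0..1} \<Longrightarrow> g t \<in> f t"
    and "continuous_on {0..1} h" "\<And>t. t \<in> {0..1} \<Longrightarrow> h t \<in> f t"
    and "g 0 \<noteq> h 0" "t \<in> {0..1}"
  shows "g t \<noteq> h t"
proof
  assume "g t = h t"
  then have "g 0 = h 0"
    using selection_unique[of "{0..1::real}" n S f t g h 0] assms by (auto simp: pathin_def)
  then show False using assms by simp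
qed

text \<open>Labels are recovered along a path of unlabelled configurations: strands from different
  starting points never meet, and counting shows that they fill the configuration at every
  time.\<close>

lemma strands_all:
  assumes "pathin (uconf n S) f" "f 0 = a ` {1..n}"
  obtains g where "\<And>i. i \<in> {1..n} \<Longrightarrow> continuous_on {0..1} (g i)"
    "\<And>i. i \<in> {1..n} \<Longrightarrow> g i 0 = a i" "\<And>t. t \<in> {0..1} \<Longrightarrow> inj_on (\<lambda>i. g i t) {1..n}"
    "\<And>t. t \<in> {0..1} \<Longrightarrow> f t = (\<lambda>i. g i t) ` {1..n}"
proof -
  have "\<exists>g. continuous_on {0..1} g \<and> (\<forall>t\<in>{0..1}. g t \<in> f t) \<and> g 0 = a i" if "i \<in> {1..n}" for i
  proof -
    have "a i \<in> f 0" using assms(2) that by simp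
    from strand_exists[OF assms(1) this] show ?thesis by metis
  qed
  then have "\<forall>i\<in>{1..n}. \<exists>g. continuous_on {0..1} g \<and> (\<forall>t\<in>{0..1}. g t \<in> f t) \<and> g 0 = a i" by blast
  from bchoice[OF this] obtain g where "\<forall>i\<in>{1..n}. continuous_on {0..1} (g i) \<and>
      (\<forall>t\<in>{0..1}. g i t \<in> f t) \<and> g i 0 = a i" ..
  then have g: "\<And>i. i \<in> {1..n} \<Longrightarrow> continuous_on {0..1} (g i)"
    "\<And>i t. i \<in> {1..n} \<Longrightarrow> t \<in> {0..1} \<Longrightarrow> g i t \<in> f t" "\<And>i. i \<in> {1..n} \<Longrightarrow> g i 0 = a i"
    by blast+
  have inj_a: "inj_on a {1..n}"
    using braid_config(3)[OF assms(1), of 0] assms(2) by (auto intro: eq_card_imp_inj_on)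
  have inj: "inj_on (\<lambda>i. g i t) {1..n}" if "t \<in> {0..1}" for t
  proof (rule inj_onI, rule ccontr)
    fix i j assume ij: "i \<in> {1..n}" "j \<in> {1..n}" "g i t = g j t" "i \<noteq> j"
    then have "g i 0 \<noteq> g j 0" using inj_a g(3) by (auto simp: inj_on_eq_iff)
    with strands_distinct[OF assms(1) g(1,2) g(1,2), of i j t] ij that show False by blast
  qed
  have "f t = (\<lambda>i. g i t) ` {1..n}" if t: "t \<in> {0..1}" for t
  proof (rule card_subset_eq[symmetric])
    show "finite (f t)" by (rule braid_config(2)[OF assms(1) t])
    show "(\<lambda>i. g i t) ` {1..n} \<subseteq> f t" using g(2) t by blast
    show "card ((\<lambda>i. g i t) ` {1..n}) = card (f t)"
      using braid_config(3)[OF assms(1) t] card_image[OF inj[OF t]] by simp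
  qed
  with g inj show thesis using that by blast
qed

section \<open>Displacements of boundary braids\<close>

text \<open>The displacements \<open>u\<close> and \<open>z\<close> at the start and at the end are measured in the universal cover of
  the boundary, in which the corners are the integers.\<close>

definition boundary_motion ::
  "nat \<Rightarrow> nat set \<Rightarrow> (real \<Rightarrow> complex set) set \<Rightarrow> (nat \<Rightarrow> int) \<Rightarrow> (nat \<Rightarrow> int) \<Rightarrow> bool" where
  "boundary_motion n B \<beta> u z \<longleftrightarrow> (\<exists>f\<in>\<beta>. \<exists>y. \<forall>b\<in>B. continuous_on {0..1} (y b) \<and>
     y b 0 = real b + of_int (u b) \<and> y b 1 = real b + of_int (z b) \<and>
     (\<forall>t\<in>{0..1}. radial n (circ n (y b t)) \<in> f t))"

lemma boundary_motionI:
  assumes "f \<in> \<beta>" "\<And>b. b \<in> B \<Longrightarrow> continuous_on {0..1} (y b)"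
    and "\<And>b. b \<in> B \<Longrightarrow> y b 0 = real b + of_int (u b)" "\<And>b. b \<in> B \<Longrightarrow> y b 1 = real b + of_int (z b)"
    and "\<And>b t. b \<in> B \<Longrightarrow> t \<in> {0..1} \<Longrightarrow> radial n (circ n (y b t)) \<in> f t"
  shows "boundary_motion n B \<beta> u z"
  unfolding boundary_motion_def using assms by blast

lemma boundary_motionE:
  assumes "boundary_motion n B \<beta> u z"
  obtains f y where "f \<in> \<beta>" "\<And>b. b \<in> B \<Longrightarrow> continuous_on {0..1} (y b)"
    "\<And>b. b \<in> B \<Longrightarrow> y b 0 = real b + of_int (u b)" "\<And>b. b \<in> B \<Longrightarrow> y b 1 = real b + of_int (z b)"
    "\<And>b t. b \<in> B \<Longrightarrow> t \<in> {0..1} \<Longrightarrow> radial n (circ n (y b t)) \<in> f t"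
  using assms unfolding boundary_motion_def by blast

text \<open>This is what the initial displacement in \<open>boundary_motion\<close> is for: the
  second factor starts where the first one ends, while its strands keep the labels in
  \<open>B\<close>.\<close>

lemma boundary_motion_mult:
  assumes "\<beta> \<in> carrier (braid_group n)" "\<gamma> \<in> carrier (braid_group n)"
    and "boundary_motion n B \<beta> u z" "boundary_motion n B \<gamma> z w"
  shows "boundary_motion n B (\<beta> \<otimes>\<^bsub>braid_group n\<^esub> \<gamma>) u w"
proof -
  obtain f y where y: "f \<in> \<beta>" "\<And>b. b \<in> B \<Longrightarrow> continuous_on {0..1} (y b)"
    "\<And>b. b \<in> B \<Longrightarrow> y b 0 = real b + of_int (u b)" "\<And>b. b \<in> B \<Longrightarrow> y b 1 = real b + of_int (z b)"
    "\<And>b t. b \<in> B \<Longrightarrow> t \<in> {0..1} \<Longrightarrow> radial n (circ n (y b t)) \<in> f t"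
    using assms(3) by (rule boundary_motionE) blast
  obtain g x where x: "g \<in> \<gamma>" "\<And>b. b \<in> B \<Longrightarrow> continuous_on {0..1} (x b)"
    "\<And>b. b \<in> B \<Longrightarrow> x b 0 = real b + of_int (z b)" "\<And>b. b \<in> B \<Longrightarrow> x b 1 = real b + of_int (w b)"
    "\<And>b t. b \<in> B \<Longrightarrow> t \<in> {0..1} \<Longrightarrow> radial n (circ n (x b t)) \<in> g t"
    using assms(4) by (rule boundary_motionE) blast
  show ?thesis
  proof (rule boundary_motionI)
    show "path_concat f g \<in> \<beta> \<otimes>\<^bsub>braid_group n\<^esub> \<gamma>" by (rule mult_mem_braid) fact+
    show "continuous_on {0..1} (path_concat (y b) (x b))" if "b \<in> B" for b
      using pathin_path_concat[of euclideanreal "y b" "x b"] y(2,4) x(2,3) that by (simp add: pathin_def)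
    show "radial n (circ n (path_concat (y b) (x b) t)) \<in> path_concat f g t" if "b \<in> B" "t \<in> {0..1}" for b t
      using y(5)[of b "2 * t"] x(5)[of b "2 * t - 1"] that by (auto simp: path_concat_def)
  qed (use y x in auto)
qed

lemma boundary_motion_inv:
  assumes "\<beta> \<in> carrier (braid_group n)" "boundary_motion n B \<beta> u z"
  shows "boundary_motion n B (inv\<^bsub>braid_group n\<^esub> \<beta>) z u"
proof -
  obtain f y where y: "f \<in> \<beta>" "\<And>b. b \<in> B \<Longrightarrow> continuous_on {0..1} (y b)"
    "\<And>b. b \<in> B \<Longrightarrow> y b 0 = real b + of_int (u b)" "\<And>b. b \<in> B \<Longrightarrow> y b 1 = real b + of_int (z b)"
    "\<And>b t. b \<in> B \<Longrightarrow> t \<in> {0..1} \<Longrightarrow> radial n (circ n (y b t)) \<in> f t"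
    using assms(2) by (rule boundary_motionE) blast
  show ?thesis
  proof (rule boundary_motionI)
    show "path_rev f \<in> inv\<^bsub>braid_group n\<^esub> \<beta>" by (rule inv_mem_braid) fact+
    show "continuous_on {0..1} (path_rev (y b))" if "b \<in> B" for b
      using pathin_path_rev[of euclideanreal "y b"] y(2) that by (simp add: pathin_def)
    show "radial n (circ n (path_rev (y b) t)) \<in> path_rev f t" if "b \<in> B" "t \<in> {0..1}" for b t
      using y(5)[of b "1 - t"] that by (auto simp: path_rev_def)
  qed (use y in \<open>auto simp: path_rev_def\<close>)
qed

lemma one_braid_mem: "(\<lambda>_. pt n ` {1..n}) \<in> \<one>\<^bsub>braid_group n\<^esub>"
  unfolding braid_group_def one_fundamental_group by (intro mem_path_class_self pathin_const base_in_topspace)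

lemma radial_circ_displaced:
  "n \<ge> 3 \<Longrightarrow> radial n (circ n (real b + of_int m)) = pt n (residue_rep n (int b + m))"
  using radial_circ_int[of n "int b + m"] by simp

lemma boundary_motion_one:
  assumes "n \<ge> 3"
  shows "boundary_motion n B \<one>\<^bsub>braid_group n\<^esub> u u"
proof (rule boundary_motionI[OF one_braid_mem])
  show "radial n (circ n (real b + of_int (u b))) \<in> pt n ` {1..n}" for b
    unfolding radial_circ_displaced[OF assms] using residue_rep_mem[of n] assms by auto
qed auto

text \<open>Comparing with another strand, the displacement can be read off the winding of the difference
  of the two strands: seen from a boundary point \<open>g\<close>, the direction of \<open>g - h\<close> never differs from
  that of \<open>g\<close> by a half turn.\<close>

lemma boundary_motion_unique:
  assumes n: "n \<ge> 3" and \<beta>: "\<beta> \<in> carrier (braid_group n)"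
    and "boundary_motion n B \<beta> u z" "boundary_motion n B \<beta> u z'" and b: "b \<in> B"
  shows "z b = z' b"
proof -
  obtain f y where f: "f \<in> \<beta>" "continuous_on {0..1} (y b)" "y b 0 = real b + of_int (u b)"
    "y b 1 = real b + of_int (z b)" "\<And>t. t \<in> {0..1} \<Longrightarrow> radial n (circ n (y b t)) \<in> f t"
    using assms(3) b unfolding boundary_motion_def by blast
  obtain f' y' where f': "f' \<in> \<beta>" "continuous_on {0..1} (y' b)" "y' b 0 = real b + of_int (u b)"
    "y' b 1 = real b + of_int (z' b)" "\<And>t. t \<in> {0..1} \<Longrightarrow> radial n (circ n (y' b t)) \<in> f' t"
    using assms(4) b unfolding boundary_motion_def by blast
  note hom = braid_homotopic[OF \<beta> f(1) f'(1)]
  define g where "g = (\<lambda>t. radial n (circ n (y b t)))"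
  define g' where "g' = (\<lambda>t. radial n (circ n (y' b t)))"
  have cg: "continuous_on {0..1} g" "continuous_on {0..1} g'"
    unfolding g_def g'_def using f(2) f'(2) by (intro continuous_intros; simp add: n)+
  \<comment> \<open>Any corner different from the starting point of \<open>g\<close>; its strand
    \<open>h\<close> serves as the point of reference for the winding.\<close>
  define j :: nat where "j = (if residue_rep n (int b + u b) = 1 then 2 else 1)"
  have j: "j \<in> {1..n}" "j \<noteq> residue_rep n (int b + u b)" using n by (auto simp: j_def)
  have pj: "pt n j \<noteq> g 0" "pt n j \<in> f 0" "pt n j \<in> f' 0"
  proof -
    have "f 0 = pt n ` {1..n}" "f' 0 = pt n ` {1..n}" using mem_braid(2)[OF \<beta> f(1)] mem_braid(2)[OF \<beta> f'(1)] .
    then show "pt n j \<in> f 0" "pt n j \<in> f' 0" using j by blast+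
    show "pt n j \<noteq> g 0"
      using j n residue_rep_mem[of n] by (simp add: g_def f(3) radial_circ_displaced pt_eq_iff)
  qed
  obtain h where h: "continuous_on {0..1} h" "\<And>t. t \<in> {0..1} \<Longrightarrow> h t \<in> f t" "h 0 = pt n j"
    using strand_exists[OF mem_braid(1)[OF \<beta> f(1)] pj(2)] by blast
  obtain h' where h': "continuous_on {0..1} h'" "\<And>t. t \<in> {0..1} \<Longrightarrow> h' t \<in> f' t" "h' 0 = pt n j"
    using strand_exists[OF mem_braid(1)[OF \<beta> f'(1)] pj(3)] by blast
  have gf: "\<And>t. t \<in> {0..1} \<Longrightarrow> g t \<in> f t" "\<And>t. t \<in> {0..1} \<Longrightarrow> g' t \<in> f' t"
    using f(5) f'(5) by (auto simp: g_def g'_def)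
  have g0: "g 0 = g' 0" by (simp add: g_def g'_def f f')
  obtain D where D: "continuous_on unit_square D" "\<And>p. p \<in> unit_square \<Longrightarrow> D p \<noteq> 0"
    "\<And>t. t \<in> {0..1} \<Longrightarrow> D (0, t) = g t - h t" "\<And>t. t \<in> {0..1} \<Longrightarrow> D (1, t) = g' t - h' t"
    "\<And>s. s \<in> {0..1} \<Longrightarrow> D (s, 0) = g 0 - h 0" "\<And>s. s \<in> {0..1} \<Longrightarrow> D (s, 1) = g 1 - h 1"
    using homotopic_strand_pair[OF hom cg(1) gf(1) cg(2) gf(2) g0 h(1,2) h'(1,2)] h(3) h'(3) pj(1) by metis
  have g1: "g 1 = g' 1" by (rule homotopic_strands_end[OF hom cg(1) gf(1) cg(2) gf(2) g0])
  have h1: "h 1 = h' 1" by (rule homotopic_strands_end[OF hom h(1,2) h'(1,2)]) (simp_all add: h h')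
  \<comment> \<open>A logarithm of \<open>g - h\<close> is assembled from the modulus of
    \<open>g\<close>, the lifted angle \<open>y\<close>, and the principal logarithm of the quotient
    of \<open>g - h\<close> by \<open>g\<close>.\<close>
  have log: "\<exists>L. continuous_on {0..1} L \<and> (\<forall>t\<in>{0..1}. exp (L t) = g t - h t) \<and>
      (\<forall>t. L t = of_real (ln (norm (g t))) + \<i> * of_real (2 * pi * y t / n) + Ln ((g t - h t) / g t))"
    if y: "continuous_on {0..1} y" and g: "g = (\<lambda>t. radial n (circ n (y t)))"
      and h: "continuous_on {0..1} h" and f: "\<And>t. t \<in> {0..1} \<Longrightarrow> h t \<in> f t" "f \<in> \<beta>"
      and ne: "\<And>t. t \<in> {0..1} \<Longrightarrow> g t \<noteq> h t"
    for y :: "real \<Rightarrow> real" and g h :: "real \<Rightarrow> complex" and f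
  proof (intro exI conjI ballI allI)
    have gf: "g t \<in> frontier (polygon n)" for t unfolding g by (rule radial_circ_frontier[OF n])
    have gz: "g t \<noteq> 0" for t using radial_frontier(2)[OF n gf] .
    have cg: "continuous_on {0..1} g" unfolding g using y by (intro continuous_intros) (simp_all add: n)
    \<comment> \<open>A nonpositive quotient would put \<open>h\<close> on the ray through
      \<open>g\<close>, at least as far out. As \<open>g\<close> already has gauge one and
      \<open>h\<close> lies in the polygon, the two strands would meet.\<close>
    have q: "(g t - h t) / g t \<notin> \<real>\<^sub>\<le>\<^sub>0" if t: "t \<in> {0..1}" for t
    proof
      assume "(g t - h t) / g t \<in> \<real>\<^sub>\<le>\<^sub>0"
      then obtain r where r: "r \<le> 0" "(g t - h t) / g t = of_real r" by (auto elim: nonpos_Reals_cases)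
      then have h': "h t = of_real (1 - r) * g t" using gz[of t] by (simp add: field_simps)
      have "h t \<in> polygon n" using f(1)[OF t] braid_config(1)[OF mem_braid(1)[OF \<beta> f(2)] t] by auto
      then have "gauge_fun n (h t) \<le> 1" by (simp add: polygon_eq[OF n])
      moreover have "gauge_fun n (h t) = (1 - r) * gauge_fun n (g t)"
        unfolding h' using r(1) by (intro gauge_fun_scale n) simp
      moreover have "gauge_fun n (g t) = 1" using gf[of t] by (simp add: frontier_polygon[OF n])
      ultimately have "r = 0" using r(1) by simp
      then show False using h' ne[OF t] by simp
    qed
    show "continuous_on {0..1} (\<lambda>t. of_real (ln (norm (g t))) + \<i> * of_real (2 * pi * y t / n)
        + Ln ((g t - h t) / g t))"
      using cg h y gz q n by (intro continuous_intros continuous_on_Ln) auto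
    fix t :: real assume t: "t \<in> {0..1}"
    have "exp (\<i> * of_real (2 * pi * y t / n)) = circ n (y t)" by (simp only: circ_eq_exp)
    moreover have "exp (of_real (ln (norm (g t)))) = (of_real (norm (g t)) :: complex)"
      using gz[of t] by (simp add: exp_of_real)
    moreover have "of_real (norm (g t)) * circ n (y t) = g t"
    proof -
      have "0 < gauge_fun n (circ n (y t))" using gauge_fun_pos[OF n] by simp
      then show ?thesis by (simp add: g radial_def norm_divide)
    qed
    ultimately show "exp (of_real (ln (norm (g t))) + \<i> * of_real (2 * pi * y t / n)
        + Ln ((g t - h t) / g t)) = g t - h t"
      using gz[of t] ne[OF t] by (simp only: exp_add exp_Ln divide_eq_0_iff right_minus_eq) simp
  qed (rule refl)
  have ne: "g t \<noteq> h t" if "t \<in> {0..1}" for t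
    by (rule strands_distinct[OF mem_braid(1)[OF \<beta> f(1)] cg(1) gf(1) h(1,2)]) (use pj h that in auto)
  have ne': "g' t \<noteq> h' t" if "t \<in> {0..1}" for t
    by (rule strands_distinct[OF mem_braid(1)[OF \<beta> f'(1)] cg(2) gf(2) h'(1,2)]) (use g0 pj h' that in auto)
  obtain L where L: "continuous_on {0..1} L" "\<And>t. t \<in> {0..1} \<Longrightarrow> exp (L t) = g t - h t"
    "\<And>t. L t = of_real (ln (norm (g t))) + \<i> * of_real (2 * pi * y b t / n) + Ln ((g t - h t) / g t)"
    using log[OF f(2) g_def h(1,2) f(1) ne] by blast
  obtain L' where L': "continuous_on {0..1} L'" "\<And>t. t \<in> {0..1} \<Longrightarrow> exp (L' t) = g' t - h' t"
    "\<And>t. L' t = of_real (ln (norm (g' t))) + \<i> * of_real (2 * pi * y' b t / n) + Ln ((g' t - h' t) / g' t)"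
    using log[OF f'(2) g'_def h'(1,2) f'(1) ne'] by blast
  have "L 1 - L 0 = L' 1 - L' 0"
    by (rule homotopic_log_increment[OF D(1,2)]) (use D(3-6) L(1,2) L'(1,2) in auto)
  \<comment> \<open>At both ends the two pairs of strands agree, so moduli and principal logarithms
    cancel and only the angles remain.\<close>
  then have "\<i> * complex_of_real (2 * pi * y b 1 / n) = \<i> * of_real (2 * pi * y' b 1 / n)"
    unfolding L(3) L'(3) using g0 g1 h1 h(3) h'(3) f(3) f'(3) by simp
  then have "2 * pi * y b 1 / n = 2 * pi * y' b 1 / n" by (simp only: mult_cancel_left of_real_eq_iff) simp
  then show ?thesis using n f(4) f'(4) by simp
qed

text \<open>The strands from \<open>B\<close> have distinct ends, all in \<open>P_{B'}\<close>; as
  \<open>B'\<close> has the size of \<open>B\<close>, these ends are exactly the points of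
  \<open>B'\<close>.\<close>

lemma boundary_braids_unique:
  assumes n: "n \<ge> 3" and "\<beta> \<in> boundary_braids n B B'" "\<beta> \<in> boundary_braids n B B''"
  shows "B' = B''"
proof -
  have \<beta>: "\<beta> \<in> carrier (braid_group n)" and B: "B \<subseteq> {1..n}" using assms(2) by (auto simp: boundary_braids_def)
  obtain f where f: "f \<in> \<beta>" using braid_nonempty[OF \<beta>] .
  obtain g where g: "\<And>i. i \<in> {1..n} \<Longrightarrow> continuous_on {0..1} (g i)"
    "\<And>i. i \<in> {1..n} \<Longrightarrow> g i 0 = pt n i" "\<And>t. t \<in> {0..1} \<Longrightarrow> inj_on (\<lambda>i. g i t) {1..n}"
    "\<And>t. t \<in> {0..1} \<Longrightarrow> f t = (\<lambda>i. g i t) ` {1..n}"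
    using strands_all[OF mem_braid(1,2)[OF \<beta> f]] by metis
  have strand: "is_strand n f b (g b)" if "b \<in> B" for b
  proof -
    have b: "b \<in> {1..n}" using that B by blast
    have "g b t \<in> f t" if "t \<in> {0..1}" for t using g(4)[OF that] b by blast
    moreover have "g b t \<in> polygon n" if "t \<in> {0..1}" for t
      using braid_config(1)[OF mem_braid(1)[OF \<beta> f] that] calculation[OF that] by blast
    ultimately show ?thesis
      using g(1,2)[OF b] unfolding is_strand_def pathin_def continuous_map_in_subtopology
      by (auto simp: image_subset_iff)
  qed
  have "pt n ` A = (\<lambda>b. g b 1) ` B" if "\<beta> \<in> boundary_braids n B A" for A
  proof (rule card_subset_eq[symmetric])
    have A: "A \<subseteq> {1..n}" "card A = card B" "\<And>b g. b \<in> B \<Longrightarrow> is_strand n f b g \<Longrightarrow> g 1 \<in> pt n ` A"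
      using that f by (auto simp: boundary_braids_def)
    show "finite (pt n ` A)" using A(1) finite_subset by blast
    show "(\<lambda>b. g b 1) ` B \<subseteq> pt n ` A" using A(3) strand by blast
    have "inj_on (\<lambda>b. g b 1) B" using g(3)[of 1] B inj_on_subset by fastforce
    then show "card ((\<lambda>b. g b 1) ` B) = card (pt n ` A)" using A by (simp add: card_image card_pt_image)
  qed
  from this[OF assms(2)] this[OF assms(3)] have "pt n ` B' = pt n ` B''" by simp
  then show ?thesis using assms(2,3) pt_image_eq_iff by (auto simp: boundary_braids_def)
qed

lemma bdry_eq: "n \<ge> 3 \<Longrightarrow> \<beta> \<in> boundary_braids n B B' \<Longrightarrow> bdry n B \<beta> = B'"
  unfolding bdry_def by (rule the_equality) (auto dest: boundary_braids_unique)

section \<open>Spaced displacements\<close>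

definition displaced :: "nat \<Rightarrow> nat set \<Rightarrow> (nat \<Rightarrow> int) \<Rightarrow> nat set" where
  "displaced n B z = (\<lambda>b. residue_rep n (int b + z b)) ` B"

text \<open>This says that cyclic neighbours have distance at least one on the circle of length \<open>n\<close>; stated
  for all pairs, it avoids the cyclic order.\<close>

definition spaced :: "nat \<Rightarrow> nat set \<Rightarrow> (nat \<Rightarrow> real) \<Rightarrow> bool" where
  "spaced n B d \<longleftrightarrow> (\<forall>b\<in>B. \<forall>b'\<in>B. b < b' \<longrightarrow>
     1 \<le> (real b' + d b') - (real b + d b) \<and> (real b' + d b') - (real b + d b) \<le> real n - 1)"

abbreviation spaced_int :: "nat \<Rightarrow> nat set \<Rightarrow> (nat \<Rightarrow> int) \<Rightarrow> bool" where
  "spaced_int n B z \<equiv> spaced n B (\<lambda>b. real_of_int (z b))"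

text \<open>For integers, gaps of at least one are the same as strict inequalities. Strands that
  merely avoid each other give the latter, the cycle complex asks for the former.\<close>

lemma spaced_int_iff:
  "spaced_int n B z \<longleftrightarrow> (\<forall>b\<in>B. \<forall>b'\<in>B. b < b' \<longrightarrow>
     int b + z b < int b' + z b' \<and> int b' + z b' < int b + z b + int n)"
  unfolding spaced_def by (intro ball_cong imp_cong refl iffI; elim conjE; intro conjI; linarith)

lemma stays_between:
  fixes \<phi> :: "real \<Rightarrow> real"
  assumes "continuous_on {0..1} \<phi>" "\<And>t. t \<in> {0..1} \<Longrightarrow> \<phi> t \<noteq> a \<and> \<phi> t \<noteq> c"
    and "a < \<phi> 0" "\<phi> 0 < c" "t \<in> {0..1}"
  shows "a < \<phi> t" "\<phi> t < c"
proof -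
  have cont: "continuous_on {0..t} \<phi>" using assms(1,5) by (auto intro: continuous_on_subset)
  show "a < \<phi> t"
  proof (rule ccontr)
    assume "\<not> a < \<phi> t"
    then obtain s where "0 \<le> s" "s \<le> t" "\<phi> s = a" using IVT2'[OF _ _ _ cont, of a] assms(3,5) by auto
    then show False using assms(2)[of s] assms(5) by auto
  qed
  show "\<phi> t < c"
  proof (rule ccontr)
    assume "\<not> \<phi> t < c"
    then obtain s where "0 \<le> s" "s \<le> t" "\<phi> s = c" using IVT'[OF _ _ _ cont, of c] assms(4,5) by auto
    then show False using assms(2)[of s] assms(5) by auto
  qed
qed

text \<open>If the points on the circle stay distinct, the difference of their lifts avoids
  \<open>0\<close> and \<open>n\<close>, so it is trapped between these values.\<close>

lemma circ_paths_between:
  fixes y y' :: "real \<Rightarrow> real"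
  assumes "0 < n" "continuous_on {0..1} y" "continuous_on {0..1} y'"
    and "\<And>t. t \<in> {0..1} \<Longrightarrow> circ n (y t) \<noteq> circ n (y' t)"
    and "0 < y' 0 - y 0" "y' 0 - y 0 < n" "t \<in> {0..1}"
  shows "0 < y' t - y t" "y' t - y t < n"
proof -
  have ne: "y' t - y t \<noteq> 0 \<and> y' t - y t \<noteq> n" if "t \<in> {0..1}" for t
    using assms(4)[OF that] circ_add_period[OF assms(1), of "y t" 1]
    by (metis add.commute diff_add_cancel mult_1 of_int_1 right_minus_eq)
  have c: "continuous_on {0..1} (\<lambda>t. y' t - y t)" using assms by (intro continuous_intros)
  show "0 < y' t - y t" "y' t - y t < n" using stays_between[OF c ne assms(5,6,7)] by auto
qed

lemma boundary_motion_paths_between: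
  assumes n: "n \<ge> 3" and f: "pathin (uconf n (polygon n)) f" and B: "B \<subseteq> {1..n}"
    and y: "\<And>b. b \<in> B \<Longrightarrow> continuous_on {0..1} (y b)" "\<And>b. b \<in> B \<Longrightarrow> y b 0 = real b"
      "\<And>b t. b \<in> B \<Longrightarrow> t \<in> {0..1} \<Longrightarrow> radial n (circ n (y b t)) \<in> f t"
    and b: "b \<in> B" "b' \<in> B" "b < b'" "t \<in> {0..1}"
  shows "0 < y b' t - y b t" "y b' t - y b t < n"
proof -
  have c: "continuous_on {0..1} (\<lambda>t. radial n (circ n (y b t)))" if "b \<in> B" for b
    using y(1)[OF that] by (intro continuous_intros) (simp_all add: n)
  have "b \<in> {1..n}" "b' \<in> {1..n}" using b(1,2) B by blast+
  then have "pt n b \<noteq> pt n b'" using b(3) by (simp add: pt_eq_iff)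
  then have "radial n (circ n (y b 0)) \<noteq> radial n (circ n (y b' 0))"
    using b n by (simp add: y(2) radial_circ_eq_iff pt_def)
  then have "circ n (y b t) \<noteq> circ n (y b' t)" if "t \<in> {0..1}" for t
    using strands_distinct[OF f c y(3) c y(3), of b b' t] b that by auto
  moreover have "b \<in> {1..n}" "b' \<in> {1..n}" using b B by auto
  ultimately show "0 < y b' t - y b t" "y b' t - y b t < n"
    using circ_paths_between[of n "y b" "y b'" t] n y b by auto
qed

lemma boundary_motion_spaced:
  assumes n: "n \<ge> 3" and \<beta>: "\<beta> \<in> carrier (braid_group n)" and B: "B \<subseteq> {1..n}"
    and "boundary_motion n B \<beta> (\<lambda>_. 0) z"
  shows "spaced_int n B z"
proof -
  obtain f y where y: "f \<in> \<beta>" "\<And>b. b \<in> B \<Longrightarrow> continuous_on {0..1} (y b)"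
    "\<And>b. b \<in> B \<Longrightarrow> y b 0 = real b + of_int 0" "\<And>b. b \<in> B \<Longrightarrow> y b 1 = real b + of_int (z b)"
    "\<And>b t. b \<in> B \<Longrightarrow> t \<in> {0..1} \<Longrightarrow> radial n (circ n (y b t)) \<in> f t"
    using assms(4) by (rule boundary_motionE) blast
  show ?thesis unfolding spaced_int_iff
  proof (intro ballI impI)
    fix b b' assume b: "b \<in> B" "b' \<in> B" "b < b'"
    have y0: "y b 0 = real b" if "b \<in> B" for b using y(3)[OF that] by simp
    have "0 < y b' 1 - y b 1" "y b' 1 - y b 1 < n"
      by (rule boundary_motion_paths_between[OF n mem_braid(1)[OF \<beta> y(1)] B y(2) y0 y(5) b], simp_all)+
    then show "int b + z b < int b' + z b' \<and> int b' + z b' < int b + z b + int n"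
      using y(4)[OF b(1)] y(4)[OF b(2)] by linarith
  qed
qed

lemma inj_on_displaced:
  assumes "0 < n" "spaced_int n B z"
  shows "inj_on (\<lambda>b. residue_rep n (int b + z b)) B"
proof (rule linorder_inj_onI)
  fix b b' assume b: "b < b'" "b \<in> B" "b' \<in> B"
  then have "0 < (int b' + z b') - (int b + z b)" "(int b' + z b') - (int b + z b) < int n"
    using assms(2) unfolding spaced_int_iff by force+
  then have "\<not> int n dvd (int b' + z b') - (int b + z b)" using zdvd_not_zless by blast
  then show "residue_rep n (int b + z b) \<noteq> residue_rep n (int b' + z b')"
    using assms(1) by (metis mod_eq_dvd_iff residue_rep_eq_iff)
qed auto

text \<open>Being a boundary braid constrains the ends of strands in every representative; homotopic
  strands with the same start have the same end, so the representative at hand decides.\<close>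

lemma boundary_motion_imp_boundary_braid:
  assumes n: "n \<ge> 3" and \<beta>: "\<beta> \<in> carrier (braid_group n)" and B: "B \<subseteq> {1..n}"
    and bm: "boundary_motion n B \<beta> (\<lambda>_. 0) z"
  shows "\<beta> \<in> boundary_braids n B (displaced n B z)"
proof -
  obtain f y where y: "f \<in> \<beta>" "\<And>b. b \<in> B \<Longrightarrow> continuous_on {0..1} (y b)"
    "\<And>b. b \<in> B \<Longrightarrow> y b 0 = real b + of_int 0" "\<And>b. b \<in> B \<Longrightarrow> y b 1 = real b + of_int (z b)"
    "\<And>b t. b \<in> B \<Longrightarrow> t \<in> {0..1} \<Longrightarrow> radial n (circ n (y b t)) \<in> f t"
    using bm by (rule boundary_motionE) blast
  have c: "continuous_on {0..1} (\<lambda>t. radial n (circ n (y b t)))" if "b \<in> B" for b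
    using y(2)[OF that] by (intro continuous_intros) (simp_all add: n)
  have start: "radial n (circ n (y b 0)) = pt n b" if "b \<in> B" for b
    using that y(3) radial_circ_displaced[OF n, of b 0] B residue_rep_of_nat[of b n] by auto
  have "is_strand n f b (\<lambda>t. radial n (circ n (y b t)))" if "b \<in> B" for b
    using c[OF that] start[OF that] y(5) that frontier_subset_polygon[OF n] radial_circ_frontier[OF n]
    unfolding is_strand_def pathin_def by (auto simp: image_subset_iff)
  moreover have "g 1 \<in> pt n ` displaced n B z"
    if f': "f' \<in> \<beta>" and b: "b \<in> B" and g: "is_strand n f' b g" for f' b g
  proof -
    have "g 1 = radial n (circ n (y b 1))" by (rule homotopic_strands_end[OF braid_homotopic[OF \<beta> f' y(1)]])
        (use g b c y(5) start in \<open>auto simp: is_strand_def pathin_def\<close>)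
    then show ?thesis using b by (simp add: y(4) radial_circ_displaced[OF n] displaced_def)
  qed
  moreover have "displaced n B z \<subseteq> {1..n}" using residue_rep_mem[of n] n by (auto simp: displaced_def)
  moreover have "card (displaced n B z) = card B"
    unfolding displaced_def using inj_on_displaced[OF _ boundary_motion_spaced[OF n \<beta> B bm]] n
    by (intro card_image) auto
  ultimately show ?thesis using \<beta> B y(1) radial_circ_frontier[OF n] unfolding boundary_braids_def by blast
qed

lemma boundary_braid_imp_boundary_motion:
  assumes n: "n \<ge> 3" and "\<beta> \<in> boundary_braids n B B'"
  obtains z where "boundary_motion n B \<beta> (\<lambda>_. 0) z"
proof -
  have \<beta>: "\<beta> \<in> carrier (braid_group n)" and B: "B \<subseteq> {1..n}" "B' \<subseteq> {1..n}"
    using assms(2) by (auto simp: boundary_braids_def)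
  obtain f where f: "f \<in> \<beta>"
    and "\<forall>b\<in>B. \<exists>g. is_strand n f b g \<and> (\<forall>t\<in>{0..1}. g t \<in> frontier (polygon n))"
    using assms(2) unfolding boundary_braids_def by blast
  moreover have "\<forall>b\<in>B. \<forall>g. is_strand n f b g \<longrightarrow> g 1 \<in> pt n ` B'"
    using assms(2) f unfolding boundary_braids_def by blast
  ultimately have
    st: "\<And>b. b \<in> B \<Longrightarrow> \<exists>g. is_strand n f b g \<and> (\<forall>t\<in>{0..1}. g t \<in> frontier (polygon n)) \<and> g 1 \<in> pt n ` B'"
    by blast
  have "\<exists>y m. continuous_on {0..1} y \<and> y 0 = real b \<and> y 1 = real b + of_int m \<and>
      (\<forall>t\<in>{0..1}. radial n (circ n (y t)) \<in> f t)" if b: "b \<in> B" for b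
  proof -
    obtain g where g: "continuous_on {0..1} g" "g 0 = pt n b" "\<And>t. t \<in> {0..1} \<Longrightarrow> g t \<in> f t"
      "\<And>t. t \<in> {0..1} \<Longrightarrow> g t \<in> frontier (polygon n)" "g 1 \<in> pt n ` B'"
      using st[OF b] by (auto simp: is_strand_def pathin_def)
    have nz: "g t \<noteq> 0" if "t \<in> {0..1}" for t using radial_frontier(2)[OF n g(4)[OF that]] .
    obtain y where y: "continuous_on {0..1} y" "y 0 = real b"
      "\<And>t. t \<in> {0..1} \<Longrightarrow> g t = of_real (norm (g t)) * circ n (y t)"
      by (rule circ_lift[of "{0..1}" g 0 n "real b"])
        (use g nz n in \<open>auto simp: convex_imp_contractible pt_def\<close>)
    have rad: "radial n (circ n (y t)) = g t" if "t \<in> {0..1}" for t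
    proof -
      have "radial n (g t) = radial n (circ n (y t))"
        using radial_scale[OF n, of "circ n (y t)" "norm (g t)"] y(3)[OF that] nz[OF that] by simp
      then show ?thesis using radial_frontier(1)[OF n g(4)[OF that]] by simp
    qed
    obtain j where "j \<in> B'" "g 1 = pt n j" using g(5) by blast
    then have "radial n (circ n (y 1)) = radial n (circ n (real j))"
      using rad[of 1] radial_pt[OF n, of j] B by (auto simp: pt_def)
    then have "circ n (y 1) = circ n (real j)" by (simp add: radial_circ_eq_iff[OF n])
    then obtain m :: int where "y 1 = real j + of_int m * real n" using circ_eq_iff[of n "y 1"] n by auto
    then have "y 1 = real b + of_int (int j - int b + m * int n)" by simp
    with y rad g(3) show ?thesis by metis
  qed
  then obtain y z where "\<And>b. b \<in> B \<Longrightarrow> continuous_on {0..1} (y b) \<and> y b 0 = real b \<and>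
      y b 1 = real b + of_int (z b) \<and> (\<forall>t\<in>{0..1}. radial n (circ n (y b t)) \<in> f t)"
    by metis
  then have "boundary_motion n B \<beta> (\<lambda>_. 0) z" using f by (intro boundary_motionI[of f \<beta> B y]) auto
  then show thesis using that by blast
qed

lemma fix_braid_boundary_motion:
  assumes n: "n \<ge> 3" and B: "B \<subseteq> {1..n}" and "\<phi> \<in> fix_braids n B"
  shows "boundary_motion n B \<phi> (\<lambda>_. 0) (\<lambda>_. 0)"
proof -
  obtain f where f: "f \<in> \<phi>" "\<And>b. b \<in> B \<Longrightarrow> \<exists>g. is_strand n f b g \<and> (\<forall>t\<in>{0..1}. g t = pt n b)"
    using assms(3) by (auto simp: fix_braids_def)
  show ?thesis
  proof (rule boundary_motionI[OF f(1)])
    fix b and t :: real assume b: "b \<in> B" "t \<in> {0..1}"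
    have "pt n b \<in> f t" using f(2)[OF b(1)] b(2) by (auto simp: is_strand_def)
    then show "radial n (circ n (real b)) \<in> f t" using radial_pt[OF n, of b] b B by (auto simp: pt_def)
  qed auto
qed

section \<open>Straightening boundary strands\<close>

text \<open>A continuous map from a compact space to a Hausdorff space is closed, hence a quotient
  map onto its image. It will be applied to polar coordinates, which are not injective at the centre
  and at the seam.\<close>

lemma continuous_on_factor_compact:
  fixes q :: "'a::topological_space \<Rightarrow> 'b::t2_space" and k :: "'a \<Rightarrow> 'c::topological_space"
  assumes K: "compact K" and q: "continuous_on K q" and k: "continuous_on K k"
    and "\<And>x x'. x \<in> K \<Longrightarrow> x' \<in> K \<Longrightarrow> q x = q x' \<Longrightarrow> k x = k x'"
  obtains h where "continuous_on (q ` K) h" "\<And>x. x \<in> K \<Longrightarrow> h (q x) = k x"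
proof -
  define h where "h z = k (SOME x. x \<in> K \<and> q x = z)" for z
  have h: "h (q x) = k x" if "x \<in> K" for x
    unfolding h_def using someI[of "\<lambda>x'. x' \<in> K \<and> q x' = q x" x] that assms(4) by metis
  have "continuous_on (q ` K) h" unfolding continuous_on_closed_invariant
  proof (intro allI impI)
    fix C :: "'c set" assume "closed C"
    then obtain A where A: "closed A" "A \<inter> K = k -` C \<inter> K"
      using k unfolding continuous_on_closed_invariant by blast
    have "closed (q ` (A \<inter> K))"
      using A(1) K by (intro compact_imp_closed compact_continuous_image continuous_on_subset[OF q] closed_Int_compact) auto
    moreover have "q ` (A \<inter> K) \<inter> q ` K = h -` C \<inter> q ` K"
      using h A(2) by (auto simp: set_eq_iff) (metis IntI vimageI2 image_eqI Int_iff)+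
    ultimately show "\<exists>A. closed A \<and> A \<inter> q ` K = h -` C \<inter> q ` K" by blast
  qed
  with h show thesis using that by blast
qed

text \<open>The interpolation is the lower envelope of the broken lines through the data points with
  slope \<open>M\<close> to the right and slope \<open>m\<close> to the left of the point. It needs no ordering of the data.\<close>

definition broken_line :: "real \<Rightarrow> real \<Rightarrow> real \<Rightarrow> real \<Rightarrow> real \<Rightarrow> real" where
  "broken_line m M y e x = e + M * max 0 (x - y) + m * min 0 (x - y)"

definition interpolant :: "'i set \<Rightarrow> ('i \<Rightarrow> real) \<Rightarrow> ('i \<Rightarrow> real) \<Rightarrow> real \<Rightarrow> real \<Rightarrow> real \<Rightarrow> real" where
  "interpolant J y e m M x = Min ((\<lambda>i. broken_line m M (y i) (e i) x) ` J)"

lemma broken_line_strict_mono: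
  assumes "0 < m" "0 < M" "x < x'"
  shows "broken_line m M y e x < broken_line m M y e x'"
proof -
  consider "x' \<le> y" | "x < y" "y < x'" | "y \<le> x" by linarith
  then show ?thesis
  proof cases
    case 2
    have "m * (x - y) < 0" "0 < M * (x' - y)" using assms 2 by (auto simp: mult_pos_neg)
    then show ?thesis using 2 unfolding broken_line_def max_def min_def by simp
  next
    case 1
    then have "m * (x - y) < m * (x' - y)" using assms by (intro mult_strict_left_mono) auto
    then show ?thesis using 1 assms unfolding broken_line_def by (simp add: max_absorb1 min_absorb1)
  next
    case 3
    then have "M * (x - y) < M * (x' - y)" using assms by (intro mult_strict_left_mono) auto
    then show ?thesis using 3 assms unfolding broken_line_def by (simp add: max_absorb2 min_absorb2)
  qed
qed

lemma interpolant_strict_mono: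
  assumes "finite J" "J \<noteq> {}" "0 < m" "0 < M" "x < x'"
  shows "interpolant J y e m M x < interpolant J y e m M x'"
  unfolding interpolant_def using assms
  by (subst Min_gr_iff) (auto intro: le_less_trans[OF Min_le] broken_line_strict_mono)

text \<open>The assumptions bound the slopes at the data point \<open>j\<close> by \<open>m\<close>
  on its right and by \<open>M\<close> on its left. Then every broken line passes on or above the
  data point \<open>j\<close>, and its own line passes through it.\<close>

lemma interpolant_data:
  assumes "finite J" "j \<in> J"
    and "\<And>i. i \<in> J \<Longrightarrow> y j < y i \<Longrightarrow> m * (y i - y j) \<le> e i - e j"
    and "\<And>i. i \<in> J \<Longrightarrow> y i < y j \<Longrightarrow> e j - e i \<le> M * (y j - y i)"
    and "\<And>i. i \<in> J \<Longrightarrow> y i = y j \<Longrightarrow> e i = e j"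
  shows "interpolant J y e m M (y j) = e j"
  unfolding interpolant_def
proof (rule Min_eqI)
  fix x assume "x \<in> (\<lambda>i. broken_line m M (y i) (e i) (y j)) ` J"
  then obtain i where i: "i \<in> J" "x = broken_line m M (y i) (e i) (y j)" by blast
  consider "y j < y i" | "y i < y j" | "y i = y j" by linarith
  then show "e j \<le> x"
  proof cases
    case 1 then show ?thesis using assms(3)[OF i(1) 1] by (simp add: i(2) broken_line_def algebra_simps)
  next
    case 2 then show ?thesis using assms(4)[OF i(1) 2] by (simp add: i(2) broken_line_def algebra_simps)
  next
    case 3 then show ?thesis using assms(5)[OF i(1) 3] by (simp add: i(2) broken_line_def)
  qed
next
  show "e j \<in> (\<lambda>i. broken_line m M (y i) (e i) (y j)) ` J"
    using assms(2) by (intro image_eqI[of _ _ j]) (simp_all add: broken_line_def)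
  show "finite ((\<lambda>i. broken_line m M (y i) (e i) (y j)) ` J)" using assms(1) by simp
qed

lemma interpolant_id:
  assumes "finite J" "J \<noteq> {}"
  shows "interpolant J y y 1 1 x = x"
proof -
  have "broken_line 1 1 a a x = x" for a by (simp add: broken_line_def max_def min_def)
  then show ?thesis using assms by (simp add: interpolant_def)
qed

section \<open>The straightening isotopy\<close>

text \<open>The maps \<open>\<Phi> t\<close> of the circle take the boundary strands back to their starting points. The
  isotopy \<open>\<Theta>\<close> joins them to the identity and is extended radially to the polygon.\<close>

lemma boundary_motion_zero_imp_fix:
  assumes n: "n \<ge> 3" and \<beta>: "\<beta> \<in> carrier (braid_group n)" and B: "B \<subseteq> {1..n}"
    and "boundary_motion n B \<beta> (\<lambda>_. 0) (\<lambda>_. 0)"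
  shows "\<beta> \<in> fix_braids n B"
proof (cases "B = {}")
  case True
  then show ?thesis using \<beta> braid_nonempty[OF \<beta>] by (auto simp: fix_braids_def)
next
  case False
  obtain f y where f: "f \<in> \<beta>" and y: "\<And>b. b \<in> B \<Longrightarrow> continuous_on {0..1} (y b)"
    "\<And>b. b \<in> B \<Longrightarrow> y b 0 = real b" "\<And>b. b \<in> B \<Longrightarrow> y b 1 = real b"
    "\<And>b t. b \<in> B \<Longrightarrow> t \<in> {0..1} \<Longrightarrow> radial n (circ n (y b t)) \<in> f t"
  proof -
    obtain f y where fy: "f \<in> \<beta>" "\<And>b. b \<in> B \<Longrightarrow> continuous_on {0..1} (y b)"
      "\<And>b. b \<in> B \<Longrightarrow> y b 0 = real b + of_int 0" "\<And>b. b \<in> B \<Longrightarrow> y b 1 = real b + of_int 0"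
      "\<And>b t. b \<in> B \<Longrightarrow> t \<in> {0..1} \<Longrightarrow> radial n (circ n (y b t)) \<in> f t"
      using assms(4) by (rule boundary_motionE) blast
    show thesis by (rule that[OF fy(1,2) _ _ fy(5)]) (simp_all add: fy)
  qed
  note pf = mem_braid(1)[OF \<beta> f] and f0 = mem_braid(2)[OF \<beta> f] and f1 = mem_braid(3)[OF \<beta> f]
  have finB: "finite B" using B finite_subset by blast
  define b1 where "b1 = Min B"
  have b1: "b1 \<in> B" "\<And>b. b \<in> B \<Longrightarrow> b1 \<le> b" using finB False by (auto simp: b1_def)
  have B1: "1 \<le> b" "b \<le> n" if "b \<in> B" for b using B that by auto
  have btw: "0 < y b' t - y b t" "y b' t - y b t < n" if "b \<in> B" "b' \<in> B" "b < b'" "t \<in> {0..1}" for b b' t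
    using boundary_motion_paths_between[OF n pf B y(1,2,4) that] by auto
  \<comment> \<open>The index \<open>0\<close>, which is not in \<open>B\<close>, stands for the
    first point \<open>b1\<close> one full turn later. With it the interpolation covers a whole
    period and matches at the seam.\<close>
  define J where "J = insert 0 B"
  define Y where "Y i t = (if i = 0 then y b1 t + n else y i t)" for i t
  define E where "E i = (if i = 0 then real b1 + n else real i)" for i
  have J: "finite J" "J \<noteq> {}" "b1 \<in> J" "0 \<in> J" using finB b1 by (auto simp: J_def)
  have zB: "0 \<notin> B" using B1 by force
  have YE: "Y b t = y b t" "E b = b" if "b \<in> B" for b t using that zB by (auto simp: Y_def E_def)
  have Y0: "Y 0 t = y b1 t + n" "E 0 = real b1 + n" for t by (auto simp: Y_def E_def)
  have order: "Y i t < Y j t \<longleftrightarrow> E i < E j" "Y i t = Y j t \<longleftrightarrow> E i = E j"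
    if ij: "i \<in> J" "j \<in> J" and t: "t \<in> {0..1}" for i j t
  proof -
    have main: "Y i t < Y j t \<and> E i < E j" if "i \<in> J" "j \<in> J" "i \<noteq> j" "j = 0 \<or> (i \<noteq> 0 \<and> i < j)" for i j
    proof (cases "j = 0")
      case True
      then have i: "i \<in> B" using that by (auto simp: J_def)
      have "y i t < y b1 t + n" using btw[OF b1(1) i _ t] b1(2)[OF i] n by (cases "i = b1") auto
      moreover have "real i < real b1 + n" using B1[OF i] B1[OF b1(1)] by linarith
      ultimately show ?thesis using i True by (simp add: YE Y0)
    next
      case False
      then have "i \<in> B" "j \<in> B" "i < j" using that by (auto simp: J_def)
      then show ?thesis using btw[OF _ _ _ t, of i j] by (simp add: YE)
    qed
    have "i = j \<or> (i \<noteq> j \<and> (j = 0 \<or> (i \<noteq> 0 \<and> i < j))) \<or> (j \<noteq> i \<and> (i = 0 \<or> (j \<noteq> 0 \<and> j < i)))" by linarith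
    then have "i = j \<or> (Y i t < Y j t \<and> E i < E j) \<or> (Y j t < Y i t \<and> E j < E i)"
      using main[of i j] main[of j i] ij by blast
    then show "Y i t < Y j t \<longleftrightarrow> E i < E j" "Y i t = Y j t \<longleftrightarrow> E i = E j" by auto
  qed
  define PP where "PP = {p \<in> J \<times> J. E (fst p) < E (snd p)}"
  define slope where "slope p t = (E (snd p) - E (fst p)) / (Y (snd p) t - Y (fst p) t)" for p t
  have PP: "finite PP" "PP \<noteq> {}"
  proof -
    have "PP \<subseteq> J \<times> J" unfolding PP_def by blast
    then show "finite PP" using J(1) finite_subset by blast
    have "(b1, 0) \<in> PP" using J b1 n by (auto simp: PP_def YE Y0)
    then show "PP \<noteq> {}" by blast
  qed
  \<comment> \<open>The extreme slopes among all pairs of data points. They depend continuously on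
    \<open>t\<close> because the order of the data never changes, and at \<open>t = 0\<close> and
    \<open>t = 1\<close> all slopes are one, so that \<open>\<Phi> t\<close> is the
    identity.\<close>
  define m where "m t = Min ((\<lambda>p. slope p t) ` PP)" for t
  define M where "M t = Max ((\<lambda>p. slope p t) ` PP)" for t
  have slope_pos: "0 < slope p t" if "p \<in> PP" "t \<in> {0..1}" for p t
    using that order(1)[of "fst p" "snd p" t] by (auto simp: PP_def slope_def)
  have m_pos: "0 < m t" if "t \<in> {0..1}" for t
    unfolding m_def using PP slope_pos that by (subst Min_gr_iff) auto
  have M_pos: "0 < M t" if "t \<in> {0..1}" for t
  proof -
    obtain p where p: "p \<in> PP" using PP by blast
    then have "slope p t \<le> M t" unfolding M_def using PP by (intro Max_ge) auto
    then show ?thesis using slope_pos[OF p that] by linarith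
  qed
  have Yc: "continuous_on {0..1} (Y i)" if "i \<in> J" for i
    using y(1) b1(1) that unfolding Y_def J_def by (cases "i = 0") (auto intro!: continuous_intros)
  have slope_c: "continuous_on {0..1} (slope p)" if "p \<in> PP" for p
    unfolding slope_def using that order(2)[of "snd p" "fst p"]
    by (intro continuous_intros Yc) (auto simp: PP_def)
  have mc: "continuous_on {0..1} m" "continuous_on {0..1} M"
    unfolding m_def M_def using PP slope_c by (auto intro: continuous_on_Min continuous_on_Max)
  define \<Phi> where "\<Phi> t x = interpolant J (\<lambda>i. Y i t) E (m t) (M t) x" for t x
  have \<Phi>_mono: "\<Phi> t x < \<Phi> t x'" if "t \<in> {0..1}" "x < x'" for t x x'
    unfolding \<Phi>_def using J m_pos M_pos that by (intro interpolant_strict_mono) auto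
  have \<Phi>_data: "\<Phi> t (Y j t) = E j" if j: "j \<in> J" and t: "t \<in> {0..1}" for j t unfolding \<Phi>_def
  proof (rule interpolant_data)
    fix i assume i: "i \<in> J"
    show "m t * (Y i t - Y j t) \<le> E i - E j" if "Y j t < Y i t"
    proof -
      have "(j, i) \<in> PP" using i j t that order(1) by (auto simp: PP_def)
      then have "m t \<le> slope (j, i) t" unfolding m_def using PP by (intro Min_le) auto
      then show ?thesis using that by (simp add: slope_def field_simps)
    qed
    show "E j - E i \<le> M t * (Y j t - Y i t)" if "Y i t < Y j t"
    proof -
      have "(i, j) \<in> PP" using i j t that order(1) by (auto simp: PP_def)
      then have "slope (i, j) t \<le> M t" unfolding M_def using PP by (intro Max_ge) auto
      then show ?thesis using that by (simp add: slope_def field_simps)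
    qed
    show "E i = E j" if "Y i t = Y j t" using order(2)[OF i j t] that by simp
  qed (use J j in auto)
  have \<Phi>_end: "\<Phi> t x = x" if t: "t = 0 \<or> t = 1" for t x
  proof -
    have YE': "Y i t = E i" if "i \<in> J" for i using that t y(2,3) b1 by (auto simp: J_def Y_def E_def)
    have "slope p t = 1" if "p \<in> PP" for p using that YE' by (auto simp: slope_def PP_def)
    then have "m t = 1" "M t = 1" unfolding m_def M_def using PP by simp_all
    moreover have "interpolant J (\<lambda>i. Y i t) E 1 1 x = interpolant J E E 1 1 x"
      unfolding interpolant_def using YE' by (intro arg_cong[of _ _ Min] image_cong) auto
    ultimately show ?thesis using interpolant_id[OF J(1,2)] by (simp add: \<Phi>_def)
  qed
  define \<Theta> where "\<Theta> s t x = (1 - s) * x + s * \<Phi> t x" for s t x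
  have \<Theta>_mono: "\<Theta> s t x < \<Theta> s t x'" if "s \<in> {0..1}" "t \<in> {0..1}" "x < x'" for s t x x'
  proof (cases "s = 0")
    case False
    then have "s * \<Phi> t x < s * \<Phi> t x'" using \<Phi>_mono[OF that(2,3)] that(1) by simp
    moreover have "(1 - s) * x \<le> (1 - s) * x'" using that by (intro mult_left_mono) auto
    ultimately show ?thesis by (simp add: \<Theta>_def)
  qed (use that in \<open>simp add: \<Theta>_def\<close>)
  \<comment> \<open>Only one period, starting at the moving point \<open>y b1 t\<close>, is ever
    used; hence this single instance of periodicity is enough to pass to the circle.\<close>
  have \<Theta>_period: "\<Theta> s t (y b1 t + n) = \<Theta> s t (y b1 t) + n" if "t \<in> {0..1}" for s t
    using \<Phi>_data[of 0 t] \<Phi>_data[of b1 t] J that b1 by (simp add: \<Theta>_def YE Y0 algebra_simps)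
  \<comment> \<open>Coordinates are the radius \<open>r\<close>, the angle \<open>v\<close> counted
    from the strand of \<open>b1\<close>, the parameter \<open>s\<close> of the isotopy and the time
    \<open>t\<close>. The map \<open>q\<close> forgets polar coordinates, and \<open>k\<close> is
    the isotopy written in them.\<close>
  define KK where "KK = {0..1::real} \<times> {0..real n} \<times> unit_square"
  define q where "q = (\<lambda>(r, v, s, t). (of_real r * radial n (circ n (y b1 t + v)), s, t::real) :: complex \<times> real \<times> real)"
  define k where "k = (\<lambda>(r, v, s, t). of_real r * radial n (circ n (\<Theta> s t (y b1 t + v))) :: complex)"
  have gz: "gauge_fun n (of_real r * radial n (circ n x)) = r" if "0 \<le> r" for r x
    using gauge_radial[OF n] by (simp add: gauge_fun_scale[OF n that])
  have eq_cases: "v = v' \<or> {v, v'} = {0, real n}"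
    if "circ n (a + v) = circ n (a + v')" "v \<in> {0..real n}" "v' \<in> {0..real n}" for a v v' :: real
  proof (cases "\<bar>v - v'\<bar> < n")
    case True
    then show ?thesis using circ_eq_imp_eq[of n "a + v" "a + v'"] that(1) n by simp
  next
    case False
    then show ?thesis using that(2,3) by (auto simp: abs_if split: if_splits)
  qed
  have cper: "circ n (\<Theta> s t (y b1 t + v)) = circ n (\<Theta> s t (y b1 t + v'))"
    if "{v, v'} = {0, real n}" "t \<in> {0..1}" for s t v v'
    using that(1) \<Theta>_period[OF that(2), of s] circ_add_period[of n "\<Theta> s t (y b1 t)" 1] n
    by (auto simp: doubleton_eq_iff)
  have KKc: "compact KK" unfolding KK_def by (intro compact_Times compact_Icc)
  have yc: "continuous_on KK (\<lambda>p. y b1 (snd (snd (snd p))))"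
    by (rule continuous_on_compose2[OF y(1)[OF b1(1)]]) (auto simp: KK_def intro!: continuous_intros)
  have qc: "continuous_on KK q"
    unfolding q_def case_prod_beta using yc by (intro continuous_intros) (simp_all add: n)
  have kc: "continuous_on KK k"
  proof -
    have c1: "continuous_on KK (\<lambda>p. Y i (snd (snd (snd p))))" if "i \<in> J" for i
      by (rule continuous_on_compose2[OF Yc[OF that]]) (auto simp: KK_def intro!: continuous_intros)
    have c2: "continuous_on KK (\<lambda>p. m (snd (snd (snd p))))" "continuous_on KK (\<lambda>p. M (snd (snd (snd p))))"
      by (rule continuous_on_compose2[OF mc(1)] continuous_on_compose2[OF mc(2)];
          auto simp: KK_def intro!: continuous_intros)+
    have "continuous_on KK (\<lambda>p. \<Phi> (snd (snd (snd p))) (y b1 (snd (snd (snd p))) + fst (snd p)))"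
      unfolding \<Phi>_def interpolant_def broken_line_def using J c1 c2 yc
      by (intro continuous_on_Min continuous_intros) auto
    then show ?thesis
      unfolding k_def \<Theta>_def case_prod_beta using yc by (intro continuous_intros) (simp_all add: n)
  qed
  have qk: "k p = k p'" if pp: "p \<in> KK" "p' \<in> KK" "q p = q p'" for p p'
  proof -
    obtain r v s t where p: "p = (r, v, s, t)" by (cases p)
    obtain r' v' s' t' where p': "p' = (r', v', s', t')" by (cases p')
    have eq: "of_real r * radial n (circ n (y b1 t + v)) = of_real r' * radial n (circ n (y b1 t + v'))"
      "s = s'" "t = t'" using pp(3) by (auto simp: p p' q_def)
    have rng: "0 \<le> r" "0 \<le> r'" "v \<in> {0..real n}" "v' \<in> {0..real n}" "t \<in> {0..1}"
      using pp(1,2) by (auto simp: p p' KK_def)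
    have "r = r'" using gz[OF rng(1)] gz[OF rng(2)] eq(1) by metis
    show ?thesis
    proof (cases "r = 0")
      case False
      then have "circ n (y b1 t + v) = circ n (y b1 t + v')"
        using eq(1) \<open>r = r'\<close> by (simp add: radial_circ_eq_iff[OF n])
      then show ?thesis using eq_cases[of "y b1 t" v v'] cper[of v v' t s] rng eq(2,3) \<open>r = r'\<close>
        by (auto simp: p p' k_def)
    qed (use \<open>r = r'\<close> in \<open>simp add: p p' k_def\<close>)
  qed
  \<comment> \<open>By \<open>qk\<close> the isotopy does not depend on the choice of polar
    coordinates, so it descends to a continuous map on the polygon.\<close>
  obtain \<Xi> where \<Xi>: "continuous_on (q ` KK) \<Xi>" "\<And>p. p \<in> KK \<Longrightarrow> \<Xi> (q p) = k p"
    using continuous_on_factor_compact[OF KKc qc kc qk] by metis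
  have coord: "\<exists>r v. r \<in> {0..1} \<and> v \<in> {0..real n} \<and> z = of_real r * radial n (circ n (y b1 t + v))"
    if z: "z \<in> polygon n" for z t
  proof (cases "z = 0")
    case True
    then show ?thesis using n by (intro exI[of _ 0]) auto
  next
    case False
    define x where "x = Arg z * n / (2 * pi)"
    have "2 * pi * x / n = Arg z" using n by (simp add: x_def)
    then have zx: "z = of_real (norm z) * circ n x" using rcis_cmod_Arg[of z] by (simp add: circ_def rcis_def)
    define v where "v = (x - y b1 t) - of_int \<lfloor>(x - y b1 t) / n\<rfloor> * n"
    have "of_int \<lfloor>(x - y b1 t) / n\<rfloor> * n \<le> x - y b1 t" "x - y b1 t < (of_int \<lfloor>(x - y b1 t) / n\<rfloor> + 1) * n"
      using n by (simp_all flip: pos_le_divide_eq pos_divide_less_eq)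
    then have v: "v \<in> {0..real n}" by (auto simp: v_def algebra_simps)
    have "x = (y b1 t + v) + real_of_int \<lfloor>(x - y b1 t) / n\<rfloor> * real n" by (simp add: v_def)
    then have "circ n x = circ n (y b1 t + v)" using circ_eq_iff[of n x] n by auto
    then have "radial n z = radial n (circ n (y b1 t + v))"
      using radial_scale[OF n, of "circ n x" "norm z"] zx False by simp
    moreover have "z = of_real (gauge_fun n z) * radial n z"
      using gauge_fun_pos[OF n False] by (simp add: radial_def)
    moreover have "gauge_fun n z \<in> {0..1}" using gauge_fun_pos[OF n False] z by (simp add: polygon_eq[OF n])
    ultimately show ?thesis using v by metis
  qed
  have \<Xi>k: "\<Xi> (of_real r * radial n (circ n (y b1 t + v)), s, t) = of_real r * radial n (circ n (\<Theta> s t (y b1 t + v)))"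
    if "r \<in> {0..1}" "v \<in> {0..real n}" "s \<in> {0..1}" "t \<in> {0..1}" for r v s t
    using \<Xi>(2)[of "(r, v, s, t)"] that by (simp add: KK_def q_def k_def)
  have qKK: "(z, s, t) \<in> q ` KK" if "z \<in> polygon n" "s \<in> {0..1}" "t \<in> {0..1}" for z s t
    using coord[OF that(1), of t] that(2,3) by (force simp: KK_def q_def image_iff)
  have \<Xi>_polygon: "\<Xi> (z, s, t) \<in> polygon n" if z: "z \<in> polygon n" "s \<in> {0..1}" "t \<in> {0..1}" for z s t
    using coord[OF z(1), of t] \<Xi>k[OF _ _ z(2,3)] gz by (auto simp: polygon_eq[OF n])
  have \<Xi>_inj: "z = z'" if z: "z \<in> polygon n" "z' \<in> polygon n" "s \<in> {0..1}" "t \<in> {0..1}"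
    and eq: "\<Xi> (z, s, t) = \<Xi> (z', s, t)" for z z' s t
  proof -
    obtain r v where rv: "r \<in> {0..1}" "v \<in> {0..real n}" "z = of_real r * radial n (circ n (y b1 t + v))"
      using coord[OF z(1), of t] by blast
    obtain r' v' where rv': "r' \<in> {0..1}" "v' \<in> {0..real n}" "z' = of_real r' * radial n (circ n (y b1 t + v'))"
      using coord[OF z(2), of t] by blast
    have eq: "of_real r * radial n (circ n (\<Theta> s t (y b1 t + v))) = of_real r' * radial n (circ n (\<Theta> s t (y b1 t + v')))"
      using eq \<Xi>k[OF rv(1,2) z(3,4)] \<Xi>k[OF rv'(1,2) z(3,4)] rv(3) rv'(3) by simp
    have "r = r'" using eq gz[of r] gz[of r'] rv(1) rv'(1) by (metis atLeastAtMost_iff)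
    show ?thesis
    proof (cases "r = 0")
      case False
      then have c: "circ n (\<Theta> s t (y b1 t + v)) = circ n (\<Theta> s t (y b1 t + v'))"
        using eq \<open>r = r'\<close> by (simp add: radial_circ_eq_iff[OF n])
      define w w' where "w = \<Theta> s t (y b1 t + v) - \<Theta> s t (y b1 t)" and "w' = \<Theta> s t (y b1 t + v') - \<Theta> s t (y b1 t)"
      have mono: "\<Theta> s t x \<le> \<Theta> s t x'" if "x \<le> x'" for x x'
        using \<Theta>_mono[OF z(3,4), of x x'] that by (cases "x = x'") auto
      have w: "w \<in> {0..real n}" "w' \<in> {0..real n}"
        using mono[of "y b1 t" "y b1 t + v"] mono[of "y b1 t" "y b1 t + v'"] mono[of "y b1 t + v" "y b1 t + n"]
          mono[of "y b1 t + v'" "y b1 t + n"] rv(2) rv'(2) \<Theta>_period[OF z(4), of s]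
        by (auto simp: w_def w'_def)
      have inj: "a = a'" if "\<Theta> s t a = \<Theta> s t a'" for a a'
        using \<Theta>_mono[OF z(3,4), of a a'] \<Theta>_mono[OF z(3,4), of a' a] that by (cases a a' rule: linorder_cases) auto
      have "circ n (\<Theta> s t (y b1 t) + w) = circ n (\<Theta> s t (y b1 t) + w')" using c by (simp add: w_def w'_def)
      then have "w = w' \<or> {w, w'} = {0, real n}" using eq_cases w by blast
      then have "v = v' \<or> {v, v'} = {0, real n}"
      proof
        assume "w = w'"
        then show ?thesis using inj[of "y b1 t + v" "y b1 t + v'"] by (auto simp: w_def w'_def)
      next
        have zero: "a = 0" if "\<Theta> s t (y b1 t + a) = \<Theta> s t (y b1 t)" for a
          using inj[of "y b1 t + a" "y b1 t"] that by simp
        have full: "a = n" if "\<Theta> s t (y b1 t + a) - \<Theta> s t (y b1 t) = n" for a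
          using inj[of "y b1 t + a" "y b1 t + n"] that \<Theta>_period[OF z(4), of s] by simp
        assume "{w, w'} = {0, real n}"
        then show ?thesis
          using zero[of v] zero[of v'] full[of v] full[of v'] by (auto simp: doubleton_eq_iff w_def w'_def)
      qed
      then have "circ n (y b1 t + v) = circ n (y b1 t + v')"
        using circ_add_period[of n "y b1 t" 1] n by (auto simp: doubleton_eq_iff)
      then show ?thesis using rv(3) rv'(3) \<open>r = r'\<close> by simp
    qed (use rv(3) rv'(3) \<open>r = r'\<close> in simp)
  qed
  have \<Xi>_id: "\<Xi> (z, s, t) = z" if z: "z \<in> polygon n" "s \<in> {0..1}" "t \<in> {0..1}" "s = 0 \<or> t = 0 \<or> t = 1" for z s t
  proof -
    have "\<Theta> s t x = x" for x using z(4) \<Phi>_end[of t x] by (auto simp: \<Theta>_def algebra_simps)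
    then show ?thesis using coord[OF z(1), of t] \<Xi>k[OF _ _ z(2,3)] by auto
  qed
  have \<Xi>_fix: "\<Xi> (radial n (circ n (y b t)), 1, t) = pt n b" if b: "b \<in> B" and t: "t \<in> {0..1}" for b t
  proof -
    have "y b t - y b1 t \<in> {0..real n}" using btw[OF b1(1) b _ t] b1(2)[OF b] n by (cases "b = b1") auto
    from \<Xi>k[OF _ this _ t, of 1 1] have "\<Xi> (radial n (circ n (y b t)), 1, t) = radial n (circ n (\<Theta> 1 t (y b t)))"
      by simp
    also have "\<Theta> 1 t (y b t) = real b" using \<Phi>_data[of b t] b t by (simp add: \<Theta>_def YE J_def)
    also have "radial n (circ n (real b)) = pt n b" using radial_pt[OF n, of b] b B by (auto simp: pt_def)
    finally show ?thesis .
  qed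
  obtain g where g: "\<And>i. i \<in> {1..n} \<Longrightarrow> continuous_on {0..1} (g i)"
    "\<And>i. i \<in> {1..n} \<Longrightarrow> g i 0 = pt n i" "\<And>t. t \<in> {0..1} \<Longrightarrow> inj_on (\<lambda>i. g i t) {1..n}"
    "\<And>t. t \<in> {0..1} \<Longrightarrow> f t = (\<lambda>i. g i t) ` {1..n}"
    using strands_all[OF pf f0] by metis
  have gp: "g i t \<in> polygon n" if "i \<in> {1..n}" "t \<in> {0..1}" for i t
    using braid_config(1)[OF pf that(2)] g(4)[OF that(2)] that(1) by blast
  \<comment> \<open>The isotopy moves all strands at once. Injectivity at every fixed
    \<open>s\<close> and \<open>t\<close> keeps them disjoint, and for \<open>s = 1\<close> the
    strands from \<open>B\<close> stand still.\<close>
  define G where "G i p = \<Xi> (g i (snd p), fst p, snd p)" for i p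
  have Gc: "continuous_on unit_square (G i)" if i: "i \<in> {1..n}" for i unfolding G_def
  proof (rule continuous_on_compose2[OF \<Xi>(1)])
    show "continuous_on unit_square (\<lambda>p. (g i (snd p), fst p, snd p))"
      by (intro continuous_intros continuous_on_compose2[OF g(1)[OF i]]) auto
    show "(\<lambda>p. (g i (snd p), fst p, snd p)) ` unit_square \<subseteq> q ` KK" using qKK gp i by auto
  qed
  have H: "continuous_map (top_of_set unit_square) (uconf n (polygon n)) (\<lambda>p. (\<lambda>i. G i p) ` {1..n})"
  proof (rule continuous_map_uconf_image)
    show "continuous_map (top_of_set unit_square) (top_of_set (polygon n)) (G i)" if "i \<in> {1..n}" for i
      using Gc[OF that] \<Xi>_polygon gp[OF that] by (auto simp: G_def)
    show "inj_on (\<lambda>i. G i p) {1..n}" if "p \<in> topspace (top_of_set unit_square)" for p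
    proof (rule inj_onI)
      fix i j assume ij: "i \<in> {1..n}" "j \<in> {1..n}" "G i p = G j p"
      have p: "fst p \<in> {0..1}" "snd p \<in> {0..1}" using that by auto
      have "g i (snd p) = g j (snd p)"
        by (rule \<Xi>_inj[OF gp[OF ij(1) p(2)] gp[OF ij(2) p(2)] p]) (use ij(3) in \<open>simp add: G_def\<close>)
      then show "i = j" using inj_onD[OF g(3)[OF p(2)]] ij(1,2) by blast
    qed
  qed auto
  define f' where "f' t = (\<lambda>i. G i (1, t)) ` {1..n}" for t
  have "path_homotopic (uconf n (polygon n)) f f'"
  proof (rule path_homotopicI[OF H])
    show "(\<lambda>i. G i (0, t)) ` {1..n} = f t" if "t \<in> {0..1}" for t
      using g(4)[OF that] \<Xi>_id[OF gp[OF _ that], of _ 0] that by (auto simp: G_def image_iff)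
    show "(\<lambda>i. G i (s, 0)) ` {1..n} = f 0" if "s \<in> {0..1}" for s
      using g(4)[of 0] \<Xi>_id[OF gp[of _ 0], of _ s] that by (auto simp: G_def image_iff)
    show "(\<lambda>i. G i (s, 1)) ` {1..n} = f 1" if "s \<in> {0..1}" for s
      using g(4)[of 1] \<Xi>_id[OF gp[of _ 1], of _ s] that by (auto simp: G_def image_iff)
  qed (simp add: f'_def)
  then have f': "f' \<in> \<beta>" using mem_braid(4)[OF \<beta> f] by (simp add: mem_path_class)
  have "is_strand n f' b (\<lambda>_. pt n b)" if b: "b \<in> B" for b
  proof -
    have bn: "b \<in> {1..n}" using b B by blast
    have "pt n b \<in> f' t" if t: "t \<in> {0..1}" for t
    proof -
      have "radial n (circ n (y b t)) \<in> (\<lambda>i. g i t) ` {1..n}" using y(4)[OF b t] g(4)[OF t] by simp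
      then obtain i where "i \<in> {1..n}" "g i t = radial n (circ n (y b t))" by auto
      then show ?thesis using \<Xi>_fix[OF b t] unfolding f'_def G_def by (intro image_eqI[of _ _ i]) auto
    qed
    then show ?thesis using pt_in_polygon[OF bn] by (simp add: is_strand_def pathin_def)
  qed
  then show ?thesis using \<beta> f' unfolding fix_braids_def by blast
qed

section \<open>Motions of the corners\<close>

text \<open>A loop with labelled points: each label has a prescribed start, while at time one only
  the set of corners is prescribed, so a permutation is allowed. Labels make it possible to join two
  motions by straight lines.\<close>

definition corner_motion :: "nat \<Rightarrow> (nat \<Rightarrow> real \<Rightarrow> complex) \<Rightarrow> bool" where
  "corner_motion n mv \<longleftrightarrow>
     (\<forall>i\<in>{1..n}. continuous_on {0..1} (mv i) \<and> mv i 0 = pt n i \<and> (\<forall>t\<in>{0..1}. mv i t \<in> polygon n)) \<and>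
     (\<forall>t\<in>{0..1}. inj_on (\<lambda>i. mv i t) {1..n}) \<and> (\<lambda>i. mv i 1) ` {1..n} = pt n ` {1..n}"

definition motion_path :: "nat \<Rightarrow> (nat \<Rightarrow> real \<Rightarrow> complex) \<Rightarrow> real \<Rightarrow> complex set" where
  "motion_path n mv t = (\<lambda>i. mv i t) ` {1..n}"

definition motion_braid :: "nat \<Rightarrow> (nat \<Rightarrow> real \<Rightarrow> complex) \<Rightarrow> (real \<Rightarrow> complex set) set" where
  "motion_braid n mv = path_class (uconf n (polygon n)) (motion_path n mv)"

lemma corner_motionD:
  assumes "corner_motion n mv"
  shows "\<And>i. i \<in> {1..n} \<Longrightarrow> continuous_on {0..1} (mv i)" "\<And>i. i \<in> {1..n} \<Longrightarrow> mv i 0 = pt n i"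
    "\<And>i t. i \<in> {1..n} \<Longrightarrow> t \<in> {0..1} \<Longrightarrow> mv i t \<in> polygon n"
    "\<And>t. t \<in> {0..1} \<Longrightarrow> inj_on (\<lambda>i. mv i t) {1..n}" "(\<lambda>i. mv i 1) ` {1..n} = pt n ` {1..n}"
  using assms unfolding corner_motion_def by blast+

lemma continuous_map_labelled:
  fixes G :: "nat \<Rightarrow> 'a::topological_space \<Rightarrow> complex"
  assumes "\<And>i. i \<in> {1..n} \<Longrightarrow> continuous_on K (G i)"
    and "\<And>i p. i \<in> {1..n} \<Longrightarrow> p \<in> K \<Longrightarrow> G i p \<in> S"
    and "\<And>p. p \<in> K \<Longrightarrow> inj_on (\<lambda>i. G i p) {1..n}"
  shows "continuous_map (top_of_set K) (uconf n S) (\<lambda>p. (\<lambda>i. G i p) ` {1..n})"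
  by (rule continuous_map_uconf_image) (use assms in \<open>auto simp: image_subset_iff\<close>)

lemma pathin_motion_path:
  assumes "corner_motion n mv"
  shows "pathin (uconf n (polygon n)) (motion_path n mv)"
  unfolding pathin_def motion_path_def[abs_def]
  using corner_motionD[OF assms] by (intro continuous_map_labelled) auto

lemma motion_path_ends:
  assumes "corner_motion n mv"
  shows "motion_path n mv 0 = pt n ` {1..n}" "motion_path n mv 1 = pt n ` {1..n}"
  using corner_motionD(2,5)[OF assms] by (auto simp: motion_path_def)

lemma motion_path_mem: "corner_motion n mv \<Longrightarrow> motion_path n mv \<in> motion_braid n mv"
  unfolding motion_braid_def by (intro mem_path_class_self pathin_motion_path)

lemma motion_braid_carrier: "corner_motion n mv \<Longrightarrow> motion_braid n mv \<in> carrier (braid_group n)"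
  unfolding motion_braid_def carrier_braid_group using pathin_motion_path motion_path_ends by blast

lemma motion_braid_family:
  assumes "\<And>i. i \<in> {1..n} \<Longrightarrow> continuous_on unit_square (G i)"
    and "\<And>i p. i \<in> {1..n} \<Longrightarrow> p \<in> unit_square \<Longrightarrow> G i p \<in> polygon n"
    and "\<And>p. p \<in> unit_square \<Longrightarrow> inj_on (\<lambda>i. G i p) {1..n}"
    and "\<And>i s. i \<in> {1..n} \<Longrightarrow> s \<in> {0..1} \<Longrightarrow> G i (s, 0) = G i (0, 0)"
    and "\<And>i s. i \<in> {1..n} \<Longrightarrow> s \<in> {0..1} \<Longrightarrow> G i (s, 1) = G i (0, 1)"
    and "\<And>i t. i \<in> {1..n} \<Longrightarrow> t \<in> {0..1} \<Longrightarrow> mv i t = G i (0, t)"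
    and "\<And>i t. i \<in> {1..n} \<Longrightarrow> t \<in> {0..1} \<Longrightarrow> mv' i t = G i (1, t)"
  shows "motion_braid n mv = motion_braid n mv'"
  unfolding motion_braid_def
proof (intro path_class_eqI path_homotopicI)
  show "continuous_map (top_of_set unit_square) (uconf n (polygon n)) (\<lambda>p. (\<lambda>i. G i p) ` {1..n})"
    using assms(1-3) by (rule continuous_map_labelled)
  show "(\<lambda>i. G i (0, t)) ` {1..n} = motion_path n mv t" if "t \<in> {0..1}" for t
    unfolding motion_path_def by (intro image_cong refl) (simp only: assms(6)[OF _ that])
  show "(\<lambda>i. G i (1, t)) ` {1..n} = motion_path n mv' t" if "t \<in> {0..1}" for t
    unfolding motion_path_def by (intro image_cong refl) (simp only: assms(7)[OF _ that])
  have t01: "(0::real) \<in> {0..1}" "(1::real) \<in> {0..1}" by auto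
  show "(\<lambda>i. G i (s, 0)) ` {1..n} = motion_path n mv 0" if "s \<in> {0..1}" for s unfolding motion_path_def
    by (intro image_cong refl) (simp only: assms(4)[OF _ that] assms(6)[OF _ t01(1)])
  show "(\<lambda>i. G i (s, 1)) ` {1..n} = motion_path n mv 1" if "s \<in> {0..1}" for s unfolding motion_path_def
    by (intro image_cong refl) (simp only: assms(5)[OF _ that] assms(6)[OF _ t01(2)])
qed

text \<open>Straight lines between corresponding points stay in the convex polygon. Two points
  collide exactly when the interpolated difference vanishes, which is excluded.\<close>

lemma motion_braid_linear:
  assumes mv: "corner_motion n mv" and mv': "corner_motion n mv'"
    and "\<And>i. i \<in> {1..n} \<Longrightarrow> mv i 1 = mv' i 1"
    and ne: "\<And>i j s t. i \<in> {1..n} \<Longrightarrow> j \<in> {1..n} \<Longrightarrow> i \<noteq> j \<Longrightarrow> s \<in> {0..1} \<Longrightarrow> t \<in> {0..1} \<Longrightarrow>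
      (1 - s) *\<^sub>R (mv j t - mv i t) + s *\<^sub>R (mv' j t - mv' i t) \<noteq> 0"
  shows "motion_braid n mv = motion_braid n mv'"
proof (rule motion_braid_family)
  define G where "G i p = (1 - fst p) *\<^sub>R mv i (snd p) + fst p *\<^sub>R mv' i (snd p)" for i p
  note m = corner_motionD[OF mv] and m' = corner_motionD[OF mv']
  show "continuous_on unit_square (G i)" if "i \<in> {1..n}" for i
  proof -
    have "continuous_on unit_square (\<lambda>p. mv i (snd p))"
      by (rule continuous_on_compose2[OF m(1)[OF that]]) (auto intro!: continuous_intros)
    moreover have "continuous_on unit_square (\<lambda>p. mv' i (snd p))"
      by (rule continuous_on_compose2[OF m'(1)[OF that]]) (auto intro!: continuous_intros)
    ultimately show ?thesis unfolding G_def by (intro continuous_intros)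
  qed
  show "G i p \<in> polygon n" if "i \<in> {1..n}" "p \<in> unit_square" for i p
    unfolding G_def using m(3)[OF that(1)] m'(3)[OF that(1)] that(2)
    by (intro convexD_alt convex_polygon) auto
  show "inj_on (\<lambda>i. G i p) {1..n}" if p: "p \<in> unit_square" for p
  proof (rule inj_onI, rule ccontr)
    fix i j assume ij: "i \<in> {1..n}" "j \<in> {1..n}" "G i p = G j p" "i \<noteq> j"
    have "G j p - G i p = (1 - fst p) *\<^sub>R (mv j (snd p) - mv i (snd p)) + fst p *\<^sub>R (mv' j (snd p) - mv' i (snd p))"
      by (simp add: G_def algebra_simps)
    then show False using ne[OF ij(1,2,4), of "fst p" "snd p"] p ij(3) by auto
  qed
  show "G i (s, 0) = G i (0, 0)" "G i (s, 1) = G i (0, 1)" if "i \<in> {1..n}" for i s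
    using m(2)[OF that] m'(2)[OF that] assms(3)[OF that]
    by (simp_all add: G_def algebra_simps flip: scaleR_add_left)
qed auto

text \<open>The second motion is labelled by the corners where it starts, so in the product it has
  to be relabelled along the permutation \<open>\<tau>\<close> of the first.\<close>

lemma motion_braid_mult:
  assumes mv: "corner_motion n mv" and mv': "corner_motion n mv'"
    and \<tau>: "\<And>i. i \<in> {1..n} \<Longrightarrow> mv i 1 = pt n (\<tau> i)" "\<tau> ` {1..n} = {1..n}"
  defines "cc \<equiv> \<lambda>i. path_concat (mv i) (mv' (\<tau> i))"
  shows "motion_braid n mv \<otimes>\<^bsub>braid_group n\<^esub> motion_braid n mv' = motion_braid n cc"
    and "corner_motion n cc"
proof -
  note m = corner_motionD[OF mv] and m' = corner_motionD[OF mv']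
  have \<tau>n: "\<tau> i \<in> {1..n}" if "i \<in> {1..n}" for i using \<tau>(2) that by blast
  have inj\<tau>: "inj_on \<tau> {1..n}" using \<tau>(2) by (intro eq_card_imp_inj_on) auto
  have path: "path_concat (motion_path n mv) (motion_path n mv') = motion_path n cc"
  proof
    fix t
    have "motion_path n mv' s = (\<lambda>i. mv' (\<tau> i) s) ` {1..n}" for s
      unfolding motion_path_def by (subst \<tau>(2)[symmetric]) (simp add: image_image)
    then show "path_concat (motion_path n mv) (motion_path n mv') t = motion_path n cc t"
      by (auto simp: path_concat_def cc_def motion_path_def)
  qed
  then show "motion_braid n mv \<otimes>\<^bsub>braid_group n\<^esub> motion_braid n mv' = motion_braid n cc"
    unfolding motion_braid_def braid_group_def mult_fundamental_group
    using pathin_motion_path[OF mv] pathin_motion_path[OF mv'] motion_path_ends[OF mv] motion_path_ends[OF mv']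
    by (simp add: class_mult_path_class)
  show "corner_motion n cc" unfolding corner_motion_def
  proof (intro conjI ballI)
    fix i assume i: "i \<in> {1..n}"
    show "continuous_on {0..1} (cc i)"
      using pathin_path_concat[of euclidean "mv i" "mv' (\<tau> i)"] m(1)[OF i] m'(1,2)[OF \<tau>n[OF i]] \<tau>(1)[OF i]
      by (simp add: cc_def pathin_def)
    show "cc i 0 = pt n i" using m(2)[OF i] by (simp add: cc_def)
    show "cc i t \<in> polygon n" if "t \<in> {0..1}" for t
      using m(3)[OF i, of "2 * t"] m'(3)[OF \<tau>n[OF i], of "2 * t - 1"] that
      by (auto simp: cc_def path_concat_def)
  next
    fix t :: real assume t: "t \<in> {0..1}"
    show "inj_on (\<lambda>i. cc i t) {1..n}"
    proof (cases "t \<le> 1/2")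
      case True
      then show ?thesis using m(4)[of "2 * t"] t by (simp add: cc_def path_concat_def)
    next
      case False
      then have "inj_on (\<lambda>i. mv' i (2 * t - 1)) (\<tau> ` {1..n})" using m'(4)[of "2 * t - 1"] t \<tau>(2) by simp
      then have "inj_on ((\<lambda>i. mv' i (2 * t - 1)) \<circ> \<tau>) {1..n}" using inj\<tau> by (rule comp_inj_on[rotated])
      then show ?thesis using False by (simp add: cc_def path_concat_def o_def)
    qed
  next
    have "(\<lambda>i. cc i 1) ` {1..n} = (\<lambda>i. mv' i 1) ` (\<tau> ` {1..n})" by (simp add: cc_def image_image)
    then show "(\<lambda>i. cc i 1) ` {1..n} = pt n ` {1..n}" using \<tau>(2) m'(5) by simp
  qed
qed

text \<open>Two clocks, one for \<open>A\<close> and one for the other corners, give a family over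
  the square. The two products follow its two boundary paths from \<open>(0, 0)\<close> to
  \<open>(1, 1)\<close>.\<close>

lemma motion_braid_commute:
  assumes mv: "corner_motion n mv" and mv': "corner_motion n mv'" and A: "A \<subseteq> {1..n}"
    and fixed: "\<And>i t. i \<in> {1..n} - A \<Longrightarrow> mv i t = pt n i" "\<And>i t. i \<in> A \<Longrightarrow> mv' i t = pt n i"
    and disj: "\<And>i j u v. i \<in> A \<Longrightarrow> j \<in> {1..n} - A \<Longrightarrow> u \<in> {0..1} \<Longrightarrow> v \<in> {0..1} \<Longrightarrow> mv i u \<noteq> mv' j v"
  shows "motion_braid n mv \<otimes>\<^bsub>braid_group n\<^esub> motion_braid n mv' =
    motion_braid n mv' \<otimes>\<^bsub>braid_group n\<^esub> motion_braid n mv"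
proof -
  note m = corner_motionD[OF mv] and m' = corner_motionD[OF mv']
  define F where "F i p = (if i \<in> A then mv i (fst p) else mv' i (snd p))" for i and p :: "real \<times> real"
  have cont: "continuous_map (top_of_set unit_square) (uconf n (polygon n)) (\<lambda>p. (\<lambda>i. F i p) ` {1..n})"
  proof (rule continuous_map_labelled)
    fix i assume i: "i \<in> {1..n}"
    have "continuous_on unit_square (\<lambda>p. mv i (fst p))" "continuous_on unit_square (\<lambda>p. mv' i (snd p))"
      by (rule continuous_on_compose2[OF m(1)[OF i]] continuous_on_compose2[OF m'(1)[OF i]];
          auto intro!: continuous_intros)+
    then show "continuous_on unit_square (F i)" unfolding F_def by (cases "i \<in> A") auto
    show "F i p \<in> polygon n" if "p \<in> unit_square" for p
      using m(3)[OF i, of "fst p"] m'(3)[OF i, of "snd p"] that by (auto simp: F_def)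
  next
    fix p :: "real \<times> real" assume p: "p \<in> unit_square"
    then have p': "fst p \<in> {0..1}" "snd p \<in> {0..1}" by auto
    show "inj_on (\<lambda>i. F i p) {1..n}"
    proof (rule inj_onI)
      fix i j assume ij: "i \<in> {1..n}" "j \<in> {1..n}" "F i p = F j p"
      show "i = j" using inj_onD[OF m(4)[OF p'(1)], of i j] inj_onD[OF m'(4)[OF p'(2)], of i j]
          disj[of i j "fst p" "snd p"] disj[of j i "fst p" "snd p"] ij p'
        unfolding F_def by (cases "i \<in> A"; cases "j \<in> A") force+
    qed
  qed
  have img: "g ` {1..n} = g ` A \<union> g ` ({1..n} - A)" for g :: "nat \<Rightarrow> complex" using A by blast
  have still: "(\<lambda>i. mv i u) ` ({1..n} - A) = pt n ` ({1..n} - A)" "(\<lambda>i. mv' i u) ` A = pt n ` A" for u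
    using fixed by (auto intro!: image_cong)
  \<comment> \<open>Each motion permutes its own corners, because by \<open>disj\<close> it cannot
    end at a corner of the other part.\<close>
  have sp: "(\<lambda>i. mv i 1) ` A = pt n ` A" and sp': "(\<lambda>i. mv' i 1) ` ({1..n} - A) = pt n ` ({1..n} - A)"
  proof -
    have ptd: "pt n ` A \<inter> pt n ` ({1..n} - A) = {}"
      using inj_on_image_Int[OF inj_on_pt, of A n "{1..n} - A"] A by auto
    have u: "(\<lambda>i. mv i 1) ` A \<union> pt n ` ({1..n} - A) = pt n ` A \<union> pt n ` ({1..n} - A)"
      "pt n ` A \<union> (\<lambda>i. mv' i 1) ` ({1..n} - A) = pt n ` A \<union> pt n ` ({1..n} - A)"
      using m(5) m'(5) unfolding img still by simp_all
    have "pt n i \<noteq> mv' j 1" "mv i 1 \<noteq> pt n j" if "i \<in> A" "j \<in> {1..n} - A" for i j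
      using disj[OF that, of 0 1] disj[OF that, of 1 0] m(2)[of i] m'(2)[of j] A that by auto
    then have d: "(\<lambda>i. mv i 1) ` A \<inter> pt n ` ({1..n} - A) = {}" "pt n ` A \<inter> (\<lambda>i. mv' i 1) ` ({1..n} - A) = {}"
      by blast+
    from u(1) d(1) ptd show "(\<lambda>i. mv i 1) ` A = pt n ` A" by blast
    from u(2) d(2) ptd show "(\<lambda>i. mv' i 1) ` ({1..n} - A) = pt n ` ({1..n} - A)" by blast
  qed
  define f f' where "f = motion_path n mv" and "f' = motion_path n mv'"
  have F: "(\<lambda>i. F i (u, v)) ` {1..n} = (\<lambda>i. mv i u) ` A \<union> (\<lambda>i. mv' i v) ` ({1..n} - A)" for u v
    using A by (auto simp: F_def image_iff)
  have fu: "f u = (\<lambda>i. mv i u) ` A \<union> pt n ` ({1..n} - A)" for u unfolding f_def motion_path_def img still ..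
  have fv: "f' v = pt n ` A \<union> (\<lambda>i. mv' i v) ` ({1..n} - A)" for v
    unfolding f'_def motion_path_def img still ..
  have s0: "(\<lambda>i. mv i 0) ` A = pt n ` A" "(\<lambda>i. mv' i 0) ` ({1..n} - A) = pt n ` ({1..n} - A)"
    using m(2) m'(2) A by (auto simp: image_iff subset_iff)
  have "path_homotopic (uconf n (polygon n)) (path_concat f f') (path_concat f' f)"
  proof (rule path_homotopic_factor[OF cont])
    show "continuous_on {0..1} (\<lambda>t::real. (min 1 (2 * t), max 0 (2 * t - 1)))"
      "continuous_on {0..1} (\<lambda>t::real. (max 0 (2 * t - 1), min 1 (2 * t)))"
      by (intro continuous_intros)+
    show "path_concat f f' t = (\<lambda>i. F i (min 1 (2 * t), max 0 (2 * t - 1))) ` {1..n}" if "t \<in> {0..1}" for t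
    proof (cases "t \<le> 1/2")
      case True
      then show ?thesis unfolding F path_concat_def fu fv using s0 by (simp add: min_absorb2 max_absorb1)
    next
      case False
      then show ?thesis unfolding F path_concat_def fu fv using sp by (simp add: min_absorb1 max_absorb2)
    qed
    show "path_concat f' f t = (\<lambda>i. F i (max 0 (2 * t - 1), min 1 (2 * t))) ` {1..n}" if "t \<in> {0..1}" for t
    proof (cases "t \<le> 1/2")
      case True
      then show ?thesis unfolding F path_concat_def fu fv using s0 by (simp add: min_absorb2 max_absorb1)
    next
      case False
      then show ?thesis unfolding F path_concat_def fu fv using sp' by (simp add: min_absorb1 max_absorb2)
    qed
  qed (auto intro: convex_Times)
  then show ?thesis unfolding motion_braid_def braid_group_def mult_fundamental_group
    using pathin_motion_path[OF mv] pathin_motion_path[OF mv'] motion_path_ends[OF mv] motion_path_ends[OF mv']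
    by (simp add: class_mult_path_class path_class_eqI f_def f'_def)
qed

section \<open>Rotation braids\<close>

text \<open>The number of cyclic steps to the next element of \<open>A\<close>, counted so that it
  is \<open>n\<close> if \<open>A\<close> has only one element.\<close>

definition next_gap :: "nat \<Rightarrow> nat set \<Rightarrow> nat \<Rightarrow> nat" where
  "next_gap n A i = (LEAST k. 0 < k \<and> residue_rep n (int i + int k) \<in> A)"

lemma cyc_succ_funpow:
  assumes "0 < n" "i \<in> {1..n}"
  shows "(cyc_succ n ^^ k) i = residue_rep n (int i + int k)"
proof (induction k)
  case (Suc k)
  then show ?case using cyc_succ_residue_rep[OF assms(1), of "int i + int k"] by (simp add: ac_simps)
qed (use assms in \<open>simp add: residue_rep_of_nat\<close>)

lemma residue_rep_add_n: "0 < n \<Longrightarrow> residue_rep n (a + int n) = residue_rep n a"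
  by (simp add: residue_rep_eq_iff)

lemma next_gap:
  assumes "0 < n" "A \<subseteq> {1..n}" "i \<in> A"
  shows "0 < next_gap n A i" "next_gap n A i \<le> n" "residue_rep n (int i + int (next_gap n A i)) \<in> A"
    and "\<And>k. 0 < k \<Longrightarrow> residue_rep n (int i + int k) \<in> A \<Longrightarrow> next_gap n A i \<le> k"
    and "next_in n A i = residue_rep n (int i + int (next_gap n A i))"
proof -
  have i: "i \<in> {1..n}" using assms by blast
  have P: "0 < n \<and> residue_rep n (int i + int n) \<in> A"
    using assms residue_rep_of_nat[OF i] by (simp add: residue_rep_add_n)
  show "0 < next_gap n A i" "residue_rep n (int i + int (next_gap n A i)) \<in> A"
    unfolding next_gap_def using LeastI[of "\<lambda>k. 0 < k \<and> residue_rep n (int i + int k) \<in> A", OF P] by auto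
  show "next_gap n A i \<le> k" if "0 < k" "residue_rep n (int i + int k) \<in> A" for k
    unfolding next_gap_def using that by (intro Least_le) auto
  show "next_gap n A i \<le> n" unfolding next_gap_def using P by (intro Least_le) auto
  show "next_in n A i = residue_rep n (int i + int (next_gap n A i))"
    unfolding next_in_def next_gap_def using cyc_succ_funpow[OF assms(1) i] by simp
qed

lemma next_in_mem: "0 < n \<Longrightarrow> A \<subseteq> {1..n} \<Longrightarrow> i \<in> A \<Longrightarrow> next_in n A i \<in> A"
  using next_gap by metis

text \<open>After unrolling the cycle at \<open>i\<close>, no element of \<open>A\<close> lies
  strictly between \<open>i\<close> and its successor, nor between \<open>j\<close> and its
  successor. This yields the two estimates with the gaps, from which all chord computations
  start.\<close>

lemma lift_pair:
  assumes n: "0 < n" and A: "A \<subseteq> {1..n}" and ij: "i \<in> A" "j \<in> A" "i \<noteq> j"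
  obtains b :: int where "int i < b" "b < int i + int n" "residue_rep n b = j"
    "int i + int (next_gap n A i) \<le> b" "b + int (next_gap n A j) \<le> int i + int n"
    "\<And>k. residue_rep n (b + k) = residue_rep n (int j + k)"
proof -
  have i: "i \<in> {1..n}" and j: "j \<in> {1..n}" using A ij by blast+
  define b where "b = (if i < j then int j else int j + int n)"
  have b: "int i < b" "b < int i + int n" using i j ij(3) by (auto simp: b_def)
  have eq: "residue_rep n (b + k) = residue_rep n (int j + k)" for k
    using residue_rep_add_n[OF n, of "int j + k"] by (simp add: b_def ac_simps)
  have rb: "residue_rep n b = j" using eq[of 0] residue_rep_of_nat[OF j] by simp
  have "next_gap n A i \<le> nat (b - int i)" using rb b ij by (intro next_gap(4)[OF n A ij(1)]) auto
  moreover have "next_gap n A j \<le> nat (int i + int n - b)"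
  proof (rule next_gap(4)[OF n A ij(2)])
    have "residue_rep n (int j + (int i + int n - b)) = residue_rep n (b + (int i + int n - b))"
      by (rule eq[symmetric])
    then show "residue_rep n (int j + int (nat (int i + int n - b))) \<in> A"
      using b residue_rep_of_nat[OF i] ij(1) by (simp add: residue_rep_add_n[OF n])
  qed (use b in auto)
  ultimately show thesis using that[OF b rb _ _ eq] b by linarith
qed

lemma inj_on_next_in:
  assumes n: "0 < n" and A: "A \<subseteq> {1..n}"
  shows "inj_on (next_in n A) A"
proof (rule inj_onI, rule ccontr)
  fix i j assume ij: "i \<in> A" "j \<in> A" "next_in n A i = next_in n A j" "i \<noteq> j"
  obtain b where b: "int i < b" "b < int i + int n" "residue_rep n b = j"
    "int i + int (next_gap n A i) \<le> b" "b + int (next_gap n A j) \<le> int i + int n"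
    "\<And>k. residue_rep n (b + k) = residue_rep n (int j + k)"
    using lift_pair[OF n A ij(1,2,4)] by metis
  have "residue_rep n (int i + int (next_gap n A i)) = residue_rep n (b + int (next_gap n A j))"
    using ij(3) next_gap(5)[OF n A ij(1)] next_gap(5)[OF n A ij(2)] b(6) by simp
  then have "int n dvd (b + int (next_gap n A j)) - (int i + int (next_gap n A i))"
    using n by (metis mod_eq_dvd_iff residue_rep_eq_iff)
  moreover have "0 < (b + int (next_gap n A j)) - (int i + int (next_gap n A i))"
    using b(4) next_gap(1)[OF n A ij(2)] by linarith
  moreover have "(b + int (next_gap n A j)) - (int i + int (next_gap n A i)) < int n"
    using b(5) next_gap(1)[OF n A ij(1)] by linarith
  ultimately show False using zdvd_not_zless by blast
qed

lemma next_in_image: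
  assumes "0 < n" "A \<subseteq> {1..n}"
  shows "next_in n A ` A = A"
  using assms finite_subset[OF assms(2)] next_in_mem[OF assms] inj_on_next_in[OF assms]
  by (intro endo_inj_surj) auto

text \<open>The bend of a two-element rotation is scaled by \<open>e\<close>. For
  \<open>e = 1\<close> this is the prescribed motion; for \<open>e = 0\<close> the points run on
  straight chords, which are convenient for estimates but let the two points collide.\<close>

definition thin_rotation :: "real \<Rightarrow> nat \<Rightarrow> nat set \<Rightarrow> nat \<Rightarrow> real \<Rightarrow> complex" where
  "thin_rotation e n A i t =
     (if i \<in> A then
        (1 - t) *\<^sub>R pt n i + t *\<^sub>R pt n (next_in n A i) +
        (if card A = 2
         then (e * (t * (1 - t))) *\<^sub>R (pt n (cyc_succ n i) - midpoint (pt n i) (pt n (next_in n A i)))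
         else 0)
      else pt n i)"

lemma thin_rotation_1: "thin_rotation 1 n A i t = rotation_motion n A i t"
  by (simp add: thin_rotation_def rotation_motion_def)

lemma lift_exists:
  assumes "0 < n" "k \<in> {1..n}"
  obtains m where "a \<le> m" "m < a + int n" "residue_rep n m = k"
proof
  show "a \<le> a + (int k - a) mod int n" "a + (int k - a) mod int n < a + int n" using assms(1) by auto
  have "(a + (int k - a) mod int n) mod int n = int k mod int n" by (simp add: mod_add_right_eq)
  then have "residue_rep n (a + (int k - a) mod int n) = residue_rep n (int k)"
    using assms(1) by (simp add: residue_rep_eq_iff)
  then show "residue_rep n (a + (int k - a) mod int n) = k" using residue_rep_of_nat[OF assms(2)] by simp
qed

text \<open>If the two gaps filled the whole cycle, no further element of \<open>A\<close> would
  have room.\<close>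

lemma next_gaps_less:
  assumes n: "0 < n" and A: "A \<subseteq> {1..n}" and ij: "i \<in> A" "j \<in> A" "i \<noteq> j" and "3 \<le> card A"
  shows "next_gap n A i + next_gap n A j < n"
proof (rule ccontr)
  obtain b where b: "int i < b" "b < int i + int n" "residue_rep n b = j"
    "int i + int (next_gap n A i) \<le> b" "b + int (next_gap n A j) \<le> int i + int n"
    "\<And>k. residue_rep n (b + k) = residue_rep n (int j + k)"
    using lift_pair[OF n A ij] by metis
  assume "\<not> next_gap n A i + next_gap n A j < n"
  then have eq: "b = int i + int (next_gap n A i)" "int i + int n = b + int (next_gap n A j)"
    using b(4,5) by linarith+
  have "A \<subseteq> {i, j}"
  proof
    fix k assume k: "k \<in> A"
    then obtain m where m: "int i \<le> m" "m < int i + int n" "residue_rep n m = k"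
      using lift_exists[OF n, of k "int i"] A by blast
    have "\<not> (int i < m \<and> m < b)" using next_gap(4)[OF n A ij(1), of "nat (m - int i)"] m k eq(1) by auto
    moreover have "\<not> (b < m)"
      using next_gap(4)[OF n A ij(2), of "nat (m - b)"] m k eq(2) b(6)[of "m - b"] by auto
    ultimately have "m = int i \<or> m = b" using m(1) by linarith
    then show "k \<in> {i, j}" using m(3) b(3) residue_rep_of_nat[of i n] A ij(1) by auto
  qed
  then have "card A \<le> card {i, j}" by (intro card_mono) auto
  also have "\<dots> \<le> 2" by (simp add: card_insert_if)
  finally show False using assms(6) by simp
qed

text \<open>The chord encloses the angle \<open>pi * (a + b - c) / n\<close> with
  \<open>chord_dir n c\<close>, which is less than a quarter turn.\<close>

lemma chord_pos:
  assumes "0 < n" "0 < b - a" "b - a < n" "\<bar>a + b - c\<bar> < n / 2"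
  shows "0 < Re ((circ n b - circ n a) * cnj (chord_dir n c))"
proof -
  have "chord_dir n (a + b) * cnj (chord_dir n c) = cis (pi * (a + b) / n - pi * c / n)"
    by (simp add: chord_dir_def complex_eq_iff cos_diff sin_diff algebra_simps)
  also have "pi * (a + b) / n - pi * c / n = pi * (a + b - c) / n"
    by (simp add: diff_divide_distrib right_diff_distrib)
  finally have "Re ((circ n b - circ n a) * cnj (chord_dir n c)) =
      2 * sin (pi * (b - a) / n) * cos (pi * (a + b - c) / n)"
    by (simp add: circ_diff_eq mult.assoc)
  moreover have "0 < sin (pi * (b - a) / n)"
  proof (rule sin_gt_zero)
    have "pi * (b - a) < pi * n" using assms by (intro mult_strict_left_mono) auto
    then show "pi * (b - a) / n < pi" using assms(1) by (simp add: divide_less_eq)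
  qed (use assms in simp)
  moreover have "0 < cos (pi * (a + b - c) / n)"
  proof (rule cos_gt_zero_pi)
    have "pi * (a + b - c) < pi * (n / 2)" "pi * - (n / 2) < pi * (a + b - c)"
    proof -
      have "a + b - c < n / 2" "- (n / 2) < a + b - c" using assms(4) by linarith+
      then show "pi * (a + b - c) < pi * (n / 2)" "pi * - (n / 2) < pi * (a + b - c)"
        by (simp_all only: mult_less_cancel_left_pos[OF pi_gt_zero])
    qed
    then show "pi * (a + b - c) / n < pi / 2" "- (pi / 2) < pi * (a + b - c) / n"
      using assms(1) by (simp_all add: field_simps)
  qed
  ultimately show ?thesis by simp
qed

lemma Re_combination_pos:
  assumes "0 \<le> t" "t \<le> 1" "0 < Re (v * w)" "0 < Re (v' * w)"
  shows "0 < Re (((1 - t) *\<^sub>R v + t *\<^sub>R v') * w)"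
proof -
  have "Re (((1 - t) *\<^sub>R v + t *\<^sub>R v') * w) = (1 - t) * Re (v * w) + t * Re (v' * w)"
    by (simp add: algebra_simps)
  also have "0 < \<dots>"
  proof (cases "t = 0")
    case False
    then have "0 < t * Re (v' * w)" using assms by simp
    moreover have "0 \<le> (1 - t) * Re (v * w)" using assms by simp
    ultimately show ?thesis by linarith
  qed (use assms in simp)
  finally show ?thesis .
qed

lemma pt_next_in:
  "0 < n \<Longrightarrow> A \<subseteq> {1..n} \<Longrightarrow> i \<in> A \<Longrightarrow> pt n (next_in n A i) = circ n (real i + real (next_gap n A i))"
  using next_gap(5)[of n A i] pt_residue_rep[of n "int i + int (next_gap n A i)"] by simp

lemma card_2_next_in:
  assumes n: "0 < n" and A: "A \<subseteq> {1..n}" "A = {i, j}" "i \<noteq> j"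
  shows "next_in n A i = j"
proof -
  have "next_in n A i \<noteq> i"
  proof
    assume eq: "next_in n A i = i"
    have "next_in n A j \<noteq> i" using inj_on_next_in[OF n A(1)] eq A(2,3) by (auto simp: inj_on_def)
    then have "next_in n A ` A \<noteq> A \<or> next_in n A j = j" using next_in_mem[OF n A(1), of j] A(2) by auto
    then have fixj: "next_in n A j = j" using next_in_image[OF n A(1)] by simp
    have g: "next_gap n A k = n" if "k \<in> A" for k
    proof -
      have "next_in n A k = k" using that eq fixj A(2) by auto
      then have "residue_rep n (int k + int (next_gap n A k)) = residue_rep n (int k)"
        using next_gap(5)[OF n A(1) that] residue_rep_of_nat[of k n] A(1) that by auto
      then have "int n dvd int (next_gap n A k)" using n by (simp add: residue_rep_eq_iff mod_eq_dvd_iff)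
      then show ?thesis using next_gap(1,2)[OF n A(1) that] by (auto simp: nat_dvd_not_less intro: dvd_antisym dest: dvd_imp_le)
    qed
    obtain b where "int i + int (next_gap n A i) \<le> b" "b < int i + int n"
      using lift_pair[OF n A(1), of i j] A(2,3) by blast
    then show False using g[of i] A(2) by simp
  qed
  then show ?thesis using next_in_mem[OF n A(1), of i] A(2) by auto
qed

lemma thin_rotation_2:
  assumes n: "0 < n" and A: "A \<subseteq> {1..n}" "A = {i, j}" "i \<noteq> j"
  shows "thin_rotation e n A i t = (1 - t) *\<^sub>R pt n i + t *\<^sub>R pt n j +
     (e * (t * (1 - t))) *\<^sub>R (pt n (cyc_succ n i) - midpoint (pt n i) (pt n j))"
  using card_2_next_in[OF assms] A by (simp add: thin_rotation_def)

text \<open>Written this way, and with the signs in \<open>bend_coefficients\<close>, a bent path is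
  a path of convex combinations of three corners, the third with weight at most
  \<open>1/4\<close>.\<close>

lemma bend_combination:
  fixes p q r :: "'a::real_vector"
  shows "(1 - t) *\<^sub>R p + t *\<^sub>R q + (e * (t * (1 - t))) *\<^sub>R (r - midpoint p q) =
    ((1 - t) * (1 - e * t / 2)) *\<^sub>R p + (t * (1 - e * (1 - t) / 2)) *\<^sub>R q + (e * (t * (1 - t))) *\<^sub>R r"
proof -
  have "(e * (t * (1 - t))) *\<^sub>R midpoint p q = (e * (t * (1 - t)) / 2) *\<^sub>R p + (e * (t * (1 - t)) / 2) *\<^sub>R q"
    by (simp add: midpoint_def scaleR_add_right)
  moreover have "(1 - t) * (1 - e * t / 2) = (1 - t) - e * (t * (1 - t)) / 2"
    "t * (1 - e * (1 - t) / 2) = t - e * (t * (1 - t)) / 2"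
    by (simp_all add: field_simps)
  ultimately show ?thesis by (simp only: scaleR_diff_right scaleR_diff_left) (simp add: algebra_simps)
qed

lemma bend_coefficients:
  fixes e t :: real
  assumes "0 \<le> e" "e \<le> 1" "0 \<le> t" "t \<le> 1"
  shows "0 \<le> (1 - t) * (1 - e * t / 2)" "0 \<le> t * (1 - e * (1 - t) / 2)" "0 \<le> e * (t * (1 - t))"
    "e * (t * (1 - t)) \<le> 1/4" "(1 - t) * (1 - e * t / 2) + t * (1 - e * (1 - t) / 2) + e * (t * (1 - t)) = 1"
proof -
  have et: "e * t \<le> 1" "e * (1 - t) \<le> 1" using assms by (auto intro: mult_le_one)
  then show "0 \<le> (1 - t) * (1 - e * t / 2)" "0 \<le> t * (1 - e * (1 - t) / 2)"
    using assms by (auto intro!: mult_nonneg_nonneg)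
  show "0 \<le> e * (t * (1 - t))" using assms by simp
  have "0 \<le> (t - 1/2)\<^sup>2" by simp
  then have "t * (1 - t) \<le> 1/4" by (simp add: power2_eq_square algebra_simps)
  moreover have "e * (t * (1 - t)) \<le> 1 * (t * (1 - t))" using assms by (intro mult_right_mono) auto
  ultimately show "e * (t * (1 - t)) \<le> 1/4" by linarith
  show "(1 - t) * (1 - e * t / 2) + t * (1 - e * (1 - t) / 2) + e * (t * (1 - t)) = 1"
    by (simp add: field_simps)
qed

lemma thin_rotation_motion:
  assumes n: "n \<ge> 3" and A: "A \<subseteq> {1..n}" "2 \<le> card A" and e: "0 < e" "e \<le> 1"
  shows "corner_motion n (thin_rotation e n A)"
proof -
  have n0: "0 < n" using n by simp
  have finA: "finite A" using A(1) finite_subset by blast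
  have two: "\<exists>j. A = {i, j} \<and> i \<noteq> j" if "i \<in> A" "card A = 2" for i using that by (auto simp: card_2_iff)
  have ni: "next_in n A i \<in> {1..n}" "next_in n A i \<in> A" if "i \<in> A" for i
    using next_in_mem[OF n0 A(1) that] A(1) by auto
  have hull3: "thin_rotation e n A i t \<in> convex hull (pt n ` A)" if "i \<in> A" "t \<in> {0..1}" "card A \<noteq> 2" for i t
  proof -
    have "(1 - t) *\<^sub>R pt n i + t *\<^sub>R pt n (next_in n A i) \<in> convex hull (pt n ` A)"
      using that ni[OF that(1)] by (intro convexD_alt convex_convex_hull hull_inc) auto
    then show ?thesis using that by (simp add: thin_rotation_def)
  qed
  have polygon: "thin_rotation e n A i t \<in> polygon n" if i: "i \<in> {1..n}" and t: "t \<in> {0..1}" for i t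
  proof (cases "i \<in> A")
    case True
    show ?thesis
    proof (cases "card A = 2")
      case c: True
      obtain j where j: "A = {i, j}" "i \<noteq> j" using two[OF True c] by blast
      have "pt n i \<in> polygon n" "pt n j \<in> polygon n" "pt n (cyc_succ n i) \<in> polygon n"
        using A(1) j(1) cyc_succ_mem[OF n0] by (auto intro!: pt_in_polygon)
      then show ?thesis unfolding thin_rotation_2[OF n0 A(1) j] bend_combination
        using bend_coefficients[of e t] e t by (intro convex_3 convex_polygon) auto
    next
      case c: False
      have "convex hull (pt n ` A) \<subseteq> polygon n" using A(1) unfolding polygon_def by (intro hull_mono) auto
      then show ?thesis using hull3[OF True t c] by blast
    qed
  qed (use i in \<open>simp add: thin_rotation_def pt_in_polygon\<close>)
  have stay: "thin_rotation e n A i t \<noteq> pt n k" if i: "i \<in> A" and t: "t \<in> {0..1}" and k: "k \<in> {1..n}" "k \<notin> A" for i k t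
  proof (cases "card A = 2")
    case False
    show ?thesis using hull3[OF i t False] pt_notin_hull[OF k A(1)] by auto
  next
    case True
    obtain j where j: "A = {i, j}" "i \<noteq> j" using two[OF i True] by blast
    have jn: "j \<in> {1..n}" "i \<in> {1..n}" using j A(1) by auto
    let ?l = "cyc_succ n i"
    note co = bend_coefficients[of e t]
    show ?thesis
    proof (cases "k = ?l")
      case False
      have "thin_rotation e n A i t \<in> convex hull (pt n ` {i, j, ?l})"
        unfolding thin_rotation_2[OF n0 A(1) j] bend_combination
        using co e t by (intro convex_3 convex_convex_hull hull_inc) auto
      moreover have "pt n k \<notin> convex hull (pt n ` {i, j, ?l})"
        using k False j jn cyc_succ_mem[OF n0] by (intro pt_notin_hull) auto
      ultimately show ?thesis by auto
    next
      case k_eq: True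
      \<comment> \<open>If \<open>k\<close> is the corner towards which the path bends, the point
        lies between some \<open>q\<close> in the hull of \<open>A\<close> and
        \<open>pt n k\<close>. As the weight \<open>g\<close> of \<open>pt n k\<close> is at most
        \<open>1/4\<close>, the corner is not reached.\<close>
      define g where "g = e * (t * (1 - t))"
      define q where "q = (((1 - t) * (1 - e * t / 2)) / (1 - g)) *\<^sub>R pt n i + ((t * (1 - e * (1 - t) / 2)) / (1 - g)) *\<^sub>R pt n j"
      have g: "0 \<le> g" "g \<le> 1/4" using co e t by (auto simp: g_def)
      have "q \<in> convex hull (pt n ` A)" unfolding q_def
      proof (rule convexD[OF convex_convex_hull])
        have "((1 - t) * (1 - e * t / 2)) + (t * (1 - e * (1 - t) / 2)) = 1 - g"
          using co(5) e t by (simp add: g_def)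
        then show "((1 - t) * (1 - e * t / 2)) / (1 - g) + (t * (1 - e * (1 - t) / 2)) / (1 - g) = 1"
          using g by (simp flip: add_divide_distrib)
        show "pt n i \<in> convex hull pt n ` A" "pt n j \<in> convex hull pt n ` A"
          using j by (auto intro!: hull_inc)
      qed (use co e t g in auto)
      then have "q \<noteq> pt n k" using pt_notin_hull[OF k A(1)] by auto
      moreover have "thin_rotation e n A i t = (1 - g) *\<^sub>R q + g *\<^sub>R pt n k"
        unfolding thin_rotation_2[OF n0 A(1) j] bend_combination q_def k_eq
        using g by (simp add: scaleR_add_right g_def)
      moreover have "(1 - g) *\<^sub>R q + g *\<^sub>R pt n k - pt n k = (1 - g) *\<^sub>R (q - pt n k)"
        by (simp add: algebra_simps)
      ultimately show ?thesis using g by auto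
    qed
  qed
  have inj_A: "thin_rotation e n A i t \<noteq> thin_rotation e n A j t"
    if ij: "i \<in> A" "j \<in> A" "i \<noteq> j" and t: "t \<in> {0..1}" for i j t
  proof -
    obtain b where b: "int i < b" "b < int i + int n" "residue_rep n b = j"
      "int i + int (next_gap n A i) \<le> b" "b + int (next_gap n A j) \<le> int i + int n"
      "\<And>k. residue_rep n (b + k) = residue_rep n (int j + k)"
      using lift_pair[OF n0 A(1) ij] by metis
    have pj: "pt n j = circ n (of_int b)" using pt_residue_rep[OF n0, of b] b(3) by simp
    show ?thesis
    proof (cases "card A = 2")
      case False
      then have c3: "3 \<le> card A" using A(2) by simp
      define gi gj where "gi = next_gap n A i" and "gj = next_gap n A j"
      have gij: "0 < gi" "0 < gj" "gi + gj < n"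
        using next_gap(1)[OF n0 A(1)] next_gaps_less[OF n0 A(1) ij c3] ij by (auto simp: gi_def gj_def)
      have pi': "pt n (next_in n A i) = circ n (real i + real gi)"
        using pt_next_in[OF n0 A(1) ij(1)] by (simp add: gi_def)
      have pj': "pt n (next_in n A j) = circ n (of_int b + real gj)"
        using next_gap(5)[OF n0 A(1) ij(2)] b(6)[of "int gj"] pt_residue_rep[OF n0, of "b + int gj"]
        by (simp add: gj_def)
      \<comment> \<open>The average of the parameter sums of the chords between the two points at
        the start and at the end. Each sum differs from it by half of \<open>gi + gj\<close>, which
        is less than \<open>n / 2\<close>, so both chords point into one half plane.\<close>
      define c where "c = real i + real_of_int b + (real gi + real gj) / 2"
      have bb: "real i < real_of_int b" "real_of_int b < real i + real n" "real i + real gi \<le> real_of_int b"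
        "real_of_int b + real gj \<le> real i + real n"
        using b by (simp_all add: gi_def gj_def)
      have "0 < Re ((circ n (of_int b) - circ n (real i)) * cnj (chord_dir n c))"
        using bb gij n0 by (intro chord_pos) (auto simp: c_def abs_less_iff field_simps)
      moreover have "0 < Re ((circ n (of_int b + real gj) - circ n (real i + real gi)) * cnj (chord_dir n c))"
        using bb gij n0 by (intro chord_pos) (auto simp: c_def abs_less_iff field_simps)
      ultimately have "0 < Re (((1 - t) *\<^sub>R (circ n (of_int b) - circ n (real i)) +
          t *\<^sub>R (circ n (of_int b + real gj) - circ n (real i + real gi))) * cnj (chord_dir n c))"
        using t by (intro Re_combination_pos) auto
      moreover have "thin_rotation e n A j t - thin_rotation e n A i t = (1 - t) *\<^sub>R (circ n (of_int b) - circ n (real i)) +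
          t *\<^sub>R (circ n (of_int b + real gj) - circ n (real i + real gi))"
        using False ij by (simp add: thin_rotation_def pi' pj' pj pt_def[of n i] algebra_simps)
      ultimately have "0 < Re ((thin_rotation e n A j t - thin_rotation e n A i t) * cnj (chord_dir n c))"
        by (simp only:)
      then show ?thesis by auto
    next
      case True
      then have Aij: "A = {i, j}" "A = {j, i}" using two[OF ij(1) True] ij by auto
      define k where "k = 2 * sin (pi * (real_of_int b - real i) / n)"
      define h where "h = e * (t * (1 - t))"
      have kpos: "0 < k"
      proof -
        have "0 < real_of_int b - real i" "real_of_int b - real i < real n" using b(1,2) by linarith+
        from sin_fraction_pos[OF n0 this]
        show ?thesis by (simp add: k_def)
      qed
      have d1: "pt n j - pt n i = of_real k * chord_dir n (real i + real_of_int b)"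
        unfolding pj using circ_diff_eq[of n "real_of_int b" "real i"] by (simp add: k_def pt_def)
      have d2: "pt n (cyc_succ n j) - pt n (cyc_succ n i) = of_real k * chord_dir n (real i + real_of_int b + 2)"
      proof -
        have "pt n (cyc_succ n j) = circ n (of_int b + 1)"
          using cyc_succ_residue_rep[OF n0, of b] pt_residue_rep[OF n0, of "b + 1"] b(3) by simp
        then show ?thesis using circ_diff_eq[of n "real_of_int b + 1" "real i + 1"] n0
          by (simp add: k_def pt_cyc_succ algebra_simps)
      qed
      have cd: "chord_dir n (x + 2) = chord_dir n x * cis (2 * pi / n)" for x
        by (simp add: chord_dir_def cis_mult algebra_simps add_divide_distrib)
      have "thin_rotation e n A j t - thin_rotation e n A i t =
          (1 - 2 * t) *\<^sub>R (pt n j - pt n i) + h *\<^sub>R (pt n (cyc_succ n j) - pt n (cyc_succ n i))"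
        unfolding thin_rotation_2[OF n0 A(1) Aij(1) ij(3)] thin_rotation_2[OF n0 A(1) Aij(2) ij(3)[symmetric]]
        by (simp add: h_def midpoint_sym[of "pt n j"] scaleR_conv_of_real algebra_simps)
      also have "\<dots> = of_real k * chord_dir n (real i + real_of_int b) * (of_real (1 - 2 * t) + of_real h * cis (2 * pi / n))"
        unfolding d1 d2 cd by (simp add: scaleR_conv_of_real algebra_simps)
      also have "\<dots> \<noteq> 0"
      proof -
        \<comment> \<open>For two exchanging points the bend turns the difference off the real
          multiples of the chord: the imaginary part vanishes only at the two ends, where the real
          part is not zero.\<close>
        have "of_real (1 - 2 * t) + of_real h * cis (2 * pi / n) \<noteq> 0"
        proof
          assume z: "of_real (1 - 2 * t) + of_real h * cis (2 * pi / n) = 0"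
          have "Im (of_real (1 - 2 * t) + of_real h * cis (2 * pi / n)) = h * sin (2 * pi / n)" by simp
          then have "h * sin (2 * pi / n) = 0" unfolding z by simp
          moreover have "0 < sin (2 * pi / n)" using n by (intro sin_gt_zero) (auto simp: field_simps)
          ultimately have "h = 0" by simp
          then have "t = 0 \<or> t = 1" using e by (auto simp: h_def)
          then show False using z \<open>h = 0\<close> by auto
        qed
        moreover have "chord_dir n (real i + real_of_int b) \<noteq> 0" by (simp add: chord_dir_def)
        ultimately show ?thesis using kpos by simp
      qed
      finally show ?thesis by auto
    qed
  qed
  have inj: "inj_on (\<lambda>i. thin_rotation e n A i t) {1..n}" if t: "t \<in> {0..1}" for t
  proof (rule inj_onI, rule ccontr)
    fix i j assume ij: "i \<in> {1..n}" "j \<in> {1..n}" "thin_rotation e n A i t = thin_rotation e n A j t" "i \<noteq> j"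
    have out: "thin_rotation e n A k t = pt n k" if "k \<notin> A" for k using that by (simp add: thin_rotation_def)
    show False
      using inj_A[of i j t] stay[of i t j] stay[of j t i] out[of i] out[of j] pt_eq_iff[of i n j] ij t
      by (cases "i \<in> A"; cases "j \<in> A") auto
  qed
  have fin: "(\<lambda>i. thin_rotation e n A i 1) ` {1..n} = pt n ` {1..n}"
  proof -
    have "(\<lambda>i. thin_rotation e n A i 1) ` {1..n} = (\<lambda>i. thin_rotation e n A i 1) ` A \<union> (\<lambda>i. thin_rotation e n A i 1) ` ({1..n} - A)"
      using A(1) by (metis image_Un Un_Diff_cancel sup.absorb2)
    also have "(\<lambda>i. thin_rotation e n A i 1) ` A = pt n ` (next_in n A ` A)"
      unfolding image_image by (intro image_cong) (auto simp: thin_rotation_def)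
    also have "(\<lambda>i. thin_rotation e n A i 1) ` ({1..n} - A) = pt n ` ({1..n} - A)"
      by (intro image_cong) (auto simp: thin_rotation_def)
    finally show ?thesis
      unfolding next_in_image[OF n0 A(1)] using A(1) by (metis image_Un Un_Diff_cancel sup.absorb2)
  qed
  show ?thesis unfolding corner_motion_def
  proof (intro conjI ballI)
    show "continuous_on {0..1} (thin_rotation e n A i)" for i
      unfolding thin_rotation_def by (cases "i \<in> A"; cases "card A = 2") (auto intro!: continuous_intros)
  qed (use polygon inj fin in \<open>auto simp: thin_rotation_def\<close>)
qed

text \<open>Every width between \<open>e\<close> and \<open>1\<close> gives a motion without
  collisions, so shrinking the bend is a homotopy. Hence the width may be chosen as small as an
  argument requires.\<close>

lemma rotation_braid_eq_thin:
  assumes n: "n \<ge> 3" and A: "A \<subseteq> {1..n}" "2 \<le> card A" and e: "0 < e" "e \<le> 1"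
  shows "rotation_braid n A = motion_braid n (thin_rotation e n A)"
proof -
  have "rotation_braid n A = motion_braid n (thin_rotation 1 n A)"
    using A(2) by (simp add: rotation_braid_def motion_braid_def motion_path_def[abs_def] thin_rotation_1)
  also have "\<dots> = motion_braid n (thin_rotation e n A)"
  proof (rule motion_braid_family)
    define G where "G i p = thin_rotation ((1 - fst p) + fst p * e) n A i (snd p)" for i p
    have co: "0 < (1 - s) + s * e" "(1 - s) + s * e \<le> 1" if "s \<in> {0..1}" for s
    proof -
      have "(1 - s) *\<^sub>R 1 + s *\<^sub>R e \<in> {0<..1}" using that e by (intro convexD_alt) auto
      then show "0 < (1 - s) + s * e" "(1 - s) + s * e \<le> 1" by auto
    qed
    note mot = corner_motionD[OF thin_rotation_motion[OF n A co]]
    show "continuous_on unit_square (G i)" for i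
      unfolding G_def thin_rotation_def by (cases "i \<in> A"; cases "card A = 2") (auto intro!: continuous_intros)
    show "G i p \<in> polygon n" if "i \<in> {1..n}" "p \<in> unit_square" for i p
      using mot(3)[of "fst p" i "snd p"] that by (auto simp: G_def)
    show "inj_on (\<lambda>i. G i p) {1..n}" if "p \<in> unit_square" for p
      using mot(4)[of "fst p" "snd p"] that by (auto simp: G_def)
  qed (auto simp: thin_rotation_def)
  finally show ?thesis .
qed

lemma rotation_braid_carrier:
  assumes "n \<ge> 3" "A \<subseteq> {1..n}"
  shows "rotation_braid n A \<in> carrier (braid_group n)"
proof (cases "card A \<le> 1")
  case True
  show ?thesis using True by (simp add: rotation_braid_def)
next
  case False
  then have "rotation_braid n A = motion_braid n (thin_rotation 1 n A)"
    using assms by (intro rotation_braid_eq_thin) auto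
  then show ?thesis using motion_braid_carrier[OF thin_rotation_motion[OF assms, of 1]] False by simp
qed

lemma norm_bend_le: "norm (pt n a - midpoint (pt n b) (pt n c)) \<le> 2"
proof -
  have "norm (midpoint (pt n b) (pt n c)) \<le> 1"
    using norm_triangle_ineq[of "pt n b" "pt n c"] by (simp add: midpoint_def pt_def)
  then show ?thesis using norm_triangle_ineq4[of "pt n a" "midpoint (pt n b) (pt n c)"] by (simp add: pt_def)
qed

lemma thin_rotation_near:
  assumes "0 \<le> e" "t \<in> {0..1}"
  shows "norm (thin_rotation e n A i t - thin_rotation 0 n A i t) \<le> e"
proof -
  let ?b = "pt n (cyc_succ n i) - midpoint (pt n i) (pt n (next_in n A i))"
  have "0 \<le> (t - 1/2)\<^sup>2" by simp
  then have t: "t * (1 - t) \<le> 1/4" by (simp add: power2_eq_square algebra_simps)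
  have "norm ((e * (t * (1 - t))) *\<^sub>R ?b) = e * (t * (1 - t)) * norm ?b" using assms by (simp add: abs_mult)
  also have "\<dots> \<le> e * (1/4) * 2"
    using assms t norm_bend_le[of n "cyc_succ n i" i "next_in n A i"] by (intro mult_mono) auto
  also have "\<dots> \<le> e" using assms by simp
  finally show ?thesis using assms(1) by (simp add: thin_rotation_def)
qed

lemma thin_rotation_0:
  "thin_rotation 0 n A i t = (1 - t) *\<^sub>R pt n i + t *\<^sub>R pt n (if i \<in> A then next_in n A i else i)"
  by (simp add: thin_rotation_def algebra_simps)

lemma thin_rotation_0_hull:
  assumes "0 < n" "A \<subseteq> {1..n}" "i \<in> A" "t \<in> {0..1}"
  shows "thin_rotation 0 n A i t \<in> convex hull (pt n ` A)"
  unfolding thin_rotation_0 using assms next_in_mem[OF assms(1,2,3)]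
  by (intro convexD_alt convex_convex_hull hull_inc) auto

lemma rotation_braid_commute:
  assumes n: "n \<ge> 3" and A: "A \<subseteq> {1..n}" and A': "A' \<subseteq> {1..n}"
    and disj: "convex hull (pt n ` A) \<inter> convex hull (pt n ` A') = {}"
  shows "rotation_braid n A \<otimes>\<^bsub>braid_group n\<^esub> rotation_braid n A' =
    rotation_braid n A' \<otimes>\<^bsub>braid_group n\<^esub> rotation_braid n A"
proof (cases "card A \<le> 1 \<or> card A' \<le> 1")
  case True
  have c: "rotation_braid n A \<in> carrier (braid_group n)" "rotation_braid n A' \<in> carrier (braid_group n)"
    using rotation_braid_carrier n A A' by auto
  have "rotation_braid n A = \<one>\<^bsub>braid_group n\<^esub> \<or> rotation_braid n A' = \<one>\<^bsub>braid_group n\<^esub>"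
    using True by (auto simp: rotation_braid_def)
  then show ?thesis using c by auto
next
  case False
  then have c2: "2 \<le> card A" "2 \<le> card A'" by auto
  have fin: "finite A" "finite A'" using A A' finite_subset by auto
  have "compact (convex hull (pt n ` A))" "compact (convex hull (pt n ` A'))"
    using fin by (auto intro!: finite_imp_compact_convex_hull)
  then obtain d where d: "0 < d" "\<And>x y. x \<in> convex hull (pt n ` A) \<Longrightarrow> y \<in> convex hull (pt n ` A') \<Longrightarrow> d \<le> dist x y"
    using separate_compact_closed[OF _ _ disj] compact_imp_closed by blast
  \<comment> \<open>A bend moves a point by at most \<open>e\<close> away from the hull of its
    block, so points of different blocks keep a distance of at least
    \<open>d - 2 * e > 0\<close>.\<close>
  define e where "e = min 1 (d / 4)"
  have e: "0 < e" "e \<le> 1" "4 * e \<le> d" using d(1) by (auto simp: e_def)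
  have "A \<inter> A' = {}"
  proof (rule ccontr)
    assume "A \<inter> A' \<noteq> {}"
    then obtain k where "k \<in> A" "k \<in> A'" by blast
    then have "pt n k \<in> convex hull (pt n ` A)" "pt n k \<in> convex hull (pt n ` A')" by (auto intro: hull_inc)
    then show False using disj by blast
  qed
  note m = thin_rotation_motion[OF n A c2(1) e(1,2)] and m' = thin_rotation_motion[OF n A' c2(2) e(1,2)]
  have "motion_braid n (thin_rotation e n A) \<otimes>\<^bsub>braid_group n\<^esub> motion_braid n (thin_rotation e n A') =
      motion_braid n (thin_rotation e n A') \<otimes>\<^bsub>braid_group n\<^esub> motion_braid n (thin_rotation e n A)"
  proof (rule motion_braid_commute[OF m m' A])
    show "thin_rotation e n A i t = pt n i" if "i \<in> {1..n} - A" for i t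
      using that by (simp add: thin_rotation_def)
    show "thin_rotation e n A' i t = pt n i" if "i \<in> A" for i t
      using that \<open>A \<inter> A' = {}\<close> by (auto simp: thin_rotation_def)
    fix i j :: nat and u v :: real
    assume ij: "i \<in> A" "j \<in> {1..n} - A" and uv: "u \<in> {0..1}" "v \<in> {0..1}"
    show "thin_rotation e n A i u \<noteq> thin_rotation e n A' j v"
    proof (cases "j \<in> A'")
      case True
      have "d \<le> dist (thin_rotation 0 n A i u) (thin_rotation 0 n A' j v)"
        using thin_rotation_0_hull ij True uv n A A' by (intro d(2)) auto
      moreover have "dist (thin_rotation e n A i u) (thin_rotation 0 n A i u) \<le> e"
        "dist (thin_rotation e n A' j v) (thin_rotation 0 n A' j v) \<le> e"
        using thin_rotation_near[of e u n A i] thin_rotation_near[of e v n A' j] e uv by (auto simp: dist_norm)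
      ultimately show ?thesis
        using e dist_triangle[of "thin_rotation 0 n A i u" "thin_rotation 0 n A' j v" "thin_rotation e n A i u"]
        by (auto simp: dist_commute)
    next
      case False
      then have "thin_rotation e n A' j v = thin_rotation e n A j u" using ij by (simp add: thin_rotation_def)
      moreover have "i \<in> {1..n}" "j \<in> {1..n}" "i \<noteq> j" using ij A by auto
      ultimately show ?thesis using inj_onD[OF corner_motionD(4)[OF m uv(1)], of i j] by auto
    qed
  qed
  then show ?thesis
    using rotation_braid_eq_thin[OF n A c2(1) e(1,2)] rotation_braid_eq_thin[OF n A' c2(2) e(1,2)] by simp
qed

subsection \<open>The relation between neighbouring corners\<close>

text \<open>The segment from \<open>a\<close> to \<open>b\<close> then avoids \<open>0\<close>,
  provided \<open>b\<close> itself is not zero. Strict positivity is asked only for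
  \<open>a\<close>, since in the delicate cases \<open>b\<close> runs along the border of the half
  plane.\<close>

definition common_half_plane :: "complex \<Rightarrow> complex \<Rightarrow> bool" where
  "common_half_plane a b \<longleftrightarrow> a = b \<or> (\<exists>v. 0 < Re (a * v) \<and> 0 \<le> Re (b * v))"

lemma common_half_plane_minus:
  assumes "common_half_plane (a - b) (c - d)"
  shows "common_half_plane (b - a) (d - c)"
  using assms unfolding common_half_plane_def
proof (elim disjE exE)
  assume "a - b = c - d"
  then show "b - a = d - c \<or> (\<exists>v. 0 < Re ((b - a) * v) \<and> 0 \<le> Re ((d - c) * v))" by (metis minus_diff_eq)
next
  fix v assume "0 < Re ((a - b) * v) \<and> 0 \<le> Re ((c - d) * v)"
  then show "b - a = d - c \<or> (\<exists>v. 0 < Re ((b - a) * v) \<and> 0 \<le> Re ((d - c) * v))"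
    by (intro disjI2 exI[of _ "- v"]) (simp add: algebra_simps)
qed

lemma motion_braid_half_planes:
  assumes f: "corner_motion n f" and g: "corner_motion n g"
    and "\<And>i. i \<in> {1..n} \<Longrightarrow> f i 1 = g i 1"
    and hp: "\<And>i j t. i \<in> {1..n} \<Longrightarrow> j \<in> {1..n} \<Longrightarrow> i \<noteq> j \<Longrightarrow> t \<in> {0..1} \<Longrightarrow>
      common_half_plane (f j t - f i t) (g j t - g i t)"
  shows "motion_braid n f = motion_braid n g"
proof (rule motion_braid_linear[OF f g])
  show "f i 1 = g i 1" if "i \<in> {1..n}" for i by (rule assms(3)[OF that])
  fix i j and s t :: real assume ij: "i \<in> {1..n}" "j \<in> {1..n}" "i \<noteq> j" and st: "s \<in> {0..1}" "t \<in> {0..1}"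
  have fne: "f j t - f i t \<noteq> 0" and gne: "g j t - g i t \<noteq> 0"
    using inj_onD[OF corner_motionD(4)[OF f st(2)], of j i] inj_onD[OF corner_motionD(4)[OF g st(2)], of j i] ij by auto
  consider "f j t - f i t = g j t - g i t" | v where "0 < Re ((f j t - f i t) * v)" "0 \<le> Re ((g j t - g i t) * v)"
    using hp[OF ij st(2)] unfolding common_half_plane_def by blast
  then show "(1 - s) *\<^sub>R (f j t - f i t) + s *\<^sub>R (g j t - g i t) \<noteq> 0"
  proof cases
    case 1
    then show ?thesis using gne by (simp flip: scaleR_add_left)
  next
    case 2
    show ?thesis
    proof (cases "s = 1")
      case False
      have "Re (((1 - s) *\<^sub>R (f j t - f i t) + s *\<^sub>R (g j t - g i t)) * v) =
          (1 - s) * Re ((f j t - f i t) * v) + s * Re ((g j t - g i t) * v)"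
        by (simp add: algebra_simps)
      moreover have "0 < (1 - s) * Re ((f j t - f i t) * v)" "0 \<le> s * Re ((g j t - g i t) * v)"
        using 2 st False by auto
      ultimately have "0 < Re (((1 - s) *\<^sub>R (f j t - f i t) + s *\<^sub>R (g j t - g i t)) * v)" by linarith
      then show ?thesis by force
    qed (use gne in simp)
  qed
qed

lemma chord_eval:
  "Re ((circ n b - circ n a) * cnj (chord_dir n c)) = 2 * sin (pi * (b - a) / n) * cos (pi * (a + b - c) / n)"
proof -
  have "chord_dir n (a + b) * cnj (chord_dir n c) = cis (pi * (a + b) / n - pi * c / n)"
    by (simp add: chord_dir_def complex_eq_iff cos_diff sin_diff algebra_simps)
  also have "pi * (a + b) / n - pi * c / n = pi * (a + b - c) / n"
    by (simp add: diff_divide_distrib right_diff_distrib)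
  finally show ?thesis by (simp add: circ_diff_eq mult.assoc)
qed

text \<open>The direction of the chord from \<open>a\<close> to \<open>b\<close> is determined by \<open>a + b\<close>, so the last three
  assumptions keep the directions of the three chords within a half turn.\<close>

lemma robust_chords:
  fixes a0 a1 a2 b0 b1 b2 :: int
  assumes n: "0 < n"
    and pos: "0 < b0 - a0" "0 < b1 - a1" "0 < b2 - a2"
      "b0 - a0 < int n" "b1 - a1 < int n" "b2 - a2 < int n"
    and "\<bar>(a0 + b0) - (a1 + b1)\<bar> < int n" "\<bar>(a0 + b0) - (a2 + b2)\<bar> < int n" "\<bar>(a1 + b1) - (a2 + b2)\<bar> < int n"
  obtains v where "norm v = 1" "0 < Re ((circ n b0 - circ n a0) * v)"
    "0 < Re ((circ n b1 - circ n a1) * v)" "0 < Re ((circ n b2 - circ n a2) * v)"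
proof -
  have "\<exists>lo hi. lo \<le> a0 + b0 \<and> lo \<le> a1 + b1 \<and> lo \<le> a2 + b2 \<and> a0 + b0 \<le> hi \<and> a1 + b1 \<le> hi \<and> a2 + b2 \<le> hi \<and> hi - lo < int n"
    using assms(8-10)
    by (intro exI[of _ "min (min (a0 + b0) (a1 + b1)) (a2 + b2)"] exI[of _ "max (max (a0 + b0) (a1 + b1)) (a2 + b2)"])
      (auto simp: min_def max_def n)
  then obtain lo hi where lh: "lo \<le> a0 + b0" "lo \<le> a1 + b1" "lo \<le> a2 + b2" "a0 + b0 \<le> hi" "a1 + b1 \<le> hi" "a2 + b2 \<le> hi" "hi - lo < int n"
    by blast
  define c where "c = (real_of_int lo + real_of_int hi) / 2"
  have k: "\<bar>real_of_int s - c\<bar> < n / 2" if "lo \<le> s" "s \<le> hi" for s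
  proof -
    have "real_of_int lo \<le> real_of_int s" "real_of_int s \<le> real_of_int hi" "real_of_int hi - real_of_int lo < real n"
      using that lh(7) by linarith+
    then show ?thesis by (auto simp: c_def abs_less_iff field_simps)
  qed
  have k: "\<bar>real_of_int a0 + real_of_int b0 - c\<bar> < n / 2" "\<bar>real_of_int a1 + real_of_int b1 - c\<bar> < n / 2" "\<bar>real_of_int a2 + real_of_int b2 - c\<bar> < n / 2"
    using k[OF lh(1,4)] k[OF lh(2,5)] k[OF lh(3,6)] by simp_all
  show thesis
  proof (rule that[of "cnj (chord_dir n c)"])
    show "norm (cnj (chord_dir n c)) = 1" by (simp add: chord_dir_def norm_mult)
  qed (intro chord_pos; use n pos k in \<open>simp; linarith?\<close>)+
qed

text \<open>\<open>F\<close> goes straight from \<open>P0\<close> to \<open>P2\<close>, while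
  \<open>G0\<close> makes a stop at \<open>P1\<close>. If all three points are at depth at least
  \<open>m\<close> in the half plane, then so is \<open>G0\<close>, and a perturbation by
  \<open>m\<close> cannot leave the closed half plane.\<close>

lemma two_stage_half_plane:
  fixes P0 P1 P2 v F G G0 :: complex
  assumes v: "norm v = 1" "0 < Re (P0 * v)" "0 < Re (P1 * v)" "0 < Re (P2 * v)"
    and m: "m \<le> Re (P0 * v)" "m \<le> Re (P1 * v)" "m \<le> Re (P2 * v)"
    and t: "0 \<le> t" "t \<le> (1::real)"
    and F: "F = (1 - t) *\<^sub>R P0 + t *\<^sub>R P2"
    and G: "G0 = (if t \<le> 1/2 then (1 - 2 * t) *\<^sub>R P0 + (2 * t) *\<^sub>R P1
       else (1 - (2 * t - 1)) *\<^sub>R P1 + (2 * t - 1) *\<^sub>R P2)" "norm (G - G0) \<le> m"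
  shows "0 < Re (F * v)" "0 \<le> Re (G * v)"
proof -
  have comb: "m \<le> Re (((1 - s) *\<^sub>R P + s *\<^sub>R Q) * v)" if "0 \<le> s" "s \<le> 1" "m \<le> Re (P * v)" "m \<le> Re (Q * v)" for s P Q
  proof -
    have "Re (((1 - s) *\<^sub>R P + s *\<^sub>R Q) * v) = (1 - s) * Re (P * v) + s * Re (Q * v)"
      by (simp add: algebra_simps)
    moreover have "(1 - s) * m \<le> (1 - s) * Re (P * v)" "s * m \<le> s * Re (Q * v)"
      using that by (auto intro: mult_left_mono)
    ultimately show ?thesis by (simp add: algebra_simps)
  qed
  show "0 < Re (F * v)" unfolding F using t v by (intro Re_combination_pos) auto
  have "m \<le> Re (G0 * v)"
  proof (cases "t \<le> 1/2")
    case True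
    then show ?thesis using comb[of "2 * t" P0 P1] t m by (simp only: G(1) if_True; simp)
  next
    case False
    then show ?thesis using comb[of "2 * t - 1" P1 P2] t m by (simp only: G(1) if_False; simp)
  qed
  moreover have "\<bar>Re ((G - G0) * v)\<bar> \<le> m"
    using abs_Re_le_cmod[of "(G - G0) * v"] G(2) v(1) by (simp add: norm_mult)
  moreover have "Re (G * v) = Re (G0 * v) + Re ((G - G0) * v)" by (simp add: algebra_simps)
  ultimately show "0 \<le> Re (G * v)" by linarith
qed

text \<open>Both sides are joined by straight lines. This does not create collisions if, for every pair of
  corners and at every time, the differences of their positions in the two motions lie in a common
  half plane. For most pairs this is so without bends, with room to spare, hence also with thin
  bends (\<open>robust\<close>). The exceptions are \<open>x\<close> and its predecessor \<open>w\<close> in \<open>A\<close>, which exchange the places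
  \<open>x\<close> and \<open>y\<close> in the second stage, and \<open>w\<close> and \<open>y\<close> if \<open>A - {x} = {w, y}\<close>.\<close>

lemma rotation_braid_split:
  assumes n: "n \<ge> 3" and A: "A \<subseteq> {1..n}" "3 \<le> card A" and x: "x \<in> A" "cyc_succ n x \<in> A"
  shows "rotation_braid n A =
    rotation_braid n (A - {x}) \<otimes>\<^bsub>braid_group n\<^esub> rotation_braid n {x, cyc_succ n x}"
proof -
  have n0: "0 < n" using n by simp
  have finA: "finite A" using A(1) finite_subset by blast
  define y where "y = cyc_succ n x"
  have yA: "y \<in> A" using x by (simp add: y_def)
  obtain w where w: "w \<in> A" "next_in n A w = x"
  proof -
    have "x \<in> next_in n A ` A" using next_in_image[OF n0 A(1)] x(1) by simp
    then show thesis using that by blast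
  qed
  \<comment> \<open>The cycle is unrolled at \<open>w\<close>: the lifts satisfy
    \<open>W < X < X + 1 < W + n\<close>, with \<open>X\<close> over \<open>x\<close> and
    \<open>X + 1\<close> over \<open>y\<close>.\<close>
  define W where "W = int w"
  define X where "X = W + int (next_gap n A w)"
  have xn: "x \<in> {1..n}" "w \<in> {1..n}" "y \<in> {1..n}" using A(1) x w yA by auto
  have resW: "residue_rep n W = w" using residue_rep_of_nat[OF xn(2)] by (simp add: W_def)
  have resX: "residue_rep n X = x" using next_gap(5)[OF n0 A(1) w(1)] w(2) by (simp add: X_def W_def)
  have resX1: "residue_rep n (X + 1) = y" using cyc_succ_residue_rep[OF n0, of X] resX by (simp add: y_def)
  have rne: "residue_rep n a \<noteq> residue_rep n b" if "a < b" "b < a + int n" for a b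
  proof
    assume "residue_rep n a = residue_rep n b"
    then have "int n dvd b - a" using n0 by (metis mod_eq_dvd_iff residue_rep_eq_iff)
    then show False using that zdvd_not_zless[of "b - a" "int n"] by auto
  qed
  have xy: "x \<noteq> y" using rne[of X "X + 1"] resX resX1 n by auto
  have gx: "next_gap n A x = 1"
  proof -
    have "residue_rep n (int x + int 1) = y"
      using cyc_succ_residue_rep[OF n0, of "int x"] residue_rep_of_nat[OF xn(1)] by (simp add: y_def)
    then have "next_gap n A x \<le> 1" using next_gap(4)[OF n0 A(1) x(1), of 1] yA by simp
    then show ?thesis using next_gap(1)[OF n0 A(1) x(1)] by simp
  qed
  have nx: "next_in n A x = y"
    using next_gap(5)[OF n0 A(1) x(1)] gx cyc_succ_residue_rep[OF n0, of "int x"] residue_rep_of_nat[OF xn(1)]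
    by (simp add: y_def)
  have wx: "w \<noteq> x" using w(2) nx xy by auto
  have gw: "0 < next_gap n A w" by (rule next_gap(1)[OF n0 A(1) w(1)])
  have WX: "W < X" "X + 1 < W + int n"
    using gw next_gaps_less[OF n0 A(1) w(1) x(1) wx A(2)] gx by (auto simp: X_def)
  have wy: "w \<noteq> y" using rne[of W "X + 1"] WX resW resX1 by auto
  define A1 where "A1 = A - {x}"
  define A2 where "A2 = {x, y}"
  have A1: "A1 \<subseteq> {1..n}" "2 \<le> card A1" "w \<in> A1" "y \<in> A1" and A2: "A2 \<subseteq> {1..n}" "2 \<le> card A2"
    using A x(1) finA wx w(1) yA xy xn by (auto simp: A1_def A2_def)
  have next2: "next_in n A2 x = y" "next_in n A2 y = x"
    using card_2_next_in[OF n0 A2(1), of x y] card_2_next_in[OF n0 A2(1), of y x] xy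
    by (auto simp: A2_def insert_commute)
  have next1w: "next_in n A1 w = y"
  proof -
    have rX: "residue_rep n (int w + int (next_gap n A w)) = x" using resX by (simp add: X_def W_def)
    have "next_gap n A1 w \<le> next_gap n A w + 1"
      using resX1 A1 by (intro next_gap(4)[OF n0 A1(1,3)]) (auto simp: X_def W_def ac_simps)
    moreover have "next_gap n A w \<le> next_gap n A1 w"
      using next_gap(1,3)[OF n0 A1(1,3)] by (intro next_gap(4)[OF n0 A(1) w(1)]) (auto simp: A1_def)
    moreover have "next_gap n A1 w \<noteq> next_gap n A w"
      using next_gap(3)[OF n0 A1(1,3)] rX by (auto simp: A1_def)
    ultimately have "next_gap n A1 w = next_gap n A w + 1" by linarith
    then show ?thesis using next_gap(5)[OF n0 A1(1,3)] resX1 by (simp add: X_def W_def ac_simps)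
  qed
  have gap1: "next_gap n A1 i = next_gap n A i" "next_in n A i \<noteq> x" "next_in n A i \<noteq> y"
    "next_in n A1 i = next_in n A i" if i: "i \<in> A" "i \<noteq> w" "i \<noteq> x" for i
  proof -
    have iA1: "i \<in> A1" using i by (simp add: A1_def)
    show nix: "next_in n A i \<noteq> x" "next_in n A i \<noteq> y"
      using inj_onD[OF inj_on_next_in[OF n0 A(1)], of i w] inj_onD[OF inj_on_next_in[OF n0 A(1)], of i x] i w x nx by auto
    have "next_gap n A1 i \<le> next_gap n A i"
      using next_gap(1,3,5)[OF n0 A(1) i(1)] nix(1) by (intro next_gap(4)[OF n0 A1(1) iA1]) (auto simp: A1_def)
    moreover have "next_gap n A i \<le> next_gap n A1 i"
      using next_gap(1,3)[OF n0 A1(1) iA1] by (intro next_gap(4)[OF n0 A(1) i(1)]) (auto simp: A1_def)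
    ultimately show g: "next_gap n A1 i = next_gap n A i" by simp
    show "next_in n A1 i = next_in n A i"
      using next_gap(5)[OF n0 A(1) i(1)] next_gap(5)[OF n0 A1(1) iA1] g by simp
  qed
  \<comment> \<open>\<open>s1\<close> gives the places after the first stage, that is after the
    rotation of \<open>A - {x}\<close>, and \<open>s\<close> the final places.\<close>
  define s1 where "s1 i = (if i \<in> A1 then next_in n A1 i else i)" for i
  define s where "s i = (if i \<in> A then next_in n A i else i)" for i
  have s_w: "s1 w = y" "s w = x" and s_x: "s1 x = x" "s x = y" and s_out: "\<And>k. k \<notin> A \<Longrightarrow> s1 k = k \<and> s k = k"
    and s_i: "\<And>i. i \<in> A \<Longrightarrow> i \<noteq> w \<Longrightarrow> i \<noteq> x \<Longrightarrow> s1 i = next_in n A i \<and> s i = next_in n A i"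
    using A1 next1w w x nx gap1 by (auto simp: s1_def s_def A1_def)
  have s2: "(if s1 i \<in> A2 then next_in n A2 (s1 i) else s1 i) = s i" for i
  proof -
    consider "i = w" | "i = x" | "i \<notin> A" | "i \<in> A" "i \<noteq> w" "i \<noteq> x" by blast
    then show ?thesis
    proof cases
      case 3
      then show ?thesis using s_out[OF 3] x(1) yA by (auto simp: A2_def)
    next
      case 4
      then show ?thesis using s_i[OF 4] gap1(2,3)[OF 4] by (auto simp: A2_def)
    qed (auto simp: s_w s_x next2, auto simp: A2_def)
  qed
  have s1n: "s1 ` {1..n} = {1..n}"
  proof -
    have "s1 ` {1..n} = s1 ` A1 \<union> s1 ` ({1..n} - A1)" using A1(1) by (metis image_Un Un_Diff_cancel sup.absorb2)
    also have "s1 ` A1 = A1" using next_in_image[OF n0 A1(1)] by (simp add: s1_def cong: image_cong)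
    also have "s1 ` ({1..n} - A1) = {1..n} - A1" by (auto simp: s1_def image_iff)
    finally show ?thesis using A1(1) by blast
  qed
  define f where "f = thin_rotation 1 n A"
  define g where "g e i = path_concat (thin_rotation e n A1 i) (thin_rotation e n A2 (s1 i))" for e i
  have f: "corner_motion n f" "rotation_braid n A = motion_braid n f"
    unfolding f_def using thin_rotation_motion[OF n A(1), of 1] rotation_braid_eq_thin[OF n A(1), of 1] A(2) by auto
  have end1: "thin_rotation e n A1 i 1 = pt n (s1 i)" for e i by (simp add: thin_rotation_def s1_def)
  have g: "corner_motion n (g e)" "rotation_braid n A1 \<otimes>\<^bsub>braid_group n\<^esub> rotation_braid n A2 = motion_braid n (g e)"
    if e: "0 < e" "e \<le> 1" for e
    using motion_braid_mult[OF thin_rotation_motion[OF n A1(1,2) e] thin_rotation_motion[OF n A2 e] end1 s1n]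
      rotation_braid_eq_thin[OF n A1(1,2) e] rotation_braid_eq_thin[OF n A2 e] unfolding g_def[abs_def] by auto
  have f_eq: "f i t = (1 - t) *\<^sub>R pt n i + t *\<^sub>R pt n (s i)" for i t
    using A(2) by (simp add: f_def thin_rotation_def s_def algebra_simps)
  have g0_eq: "g 0 i t = (if t \<le> 1/2 then (1 - 2 * t) *\<^sub>R pt n i + (2 * t) *\<^sub>R pt n (s1 i)
       else (1 - (2 * t - 1)) *\<^sub>R pt n (s1 i) + (2 * t - 1) *\<^sub>R pt n (s i))" for i t
    unfolding g_def path_concat_def thin_rotation_0 s2 by (simp add: s1_def)
  have g_near: "norm (g e i t - g 0 i t) \<le> e" if "0 \<le> e" "t \<in> {0..1}" for e i t
    unfolding g_def path_concat_def
    using thin_rotation_near[of e "2 * t" n A1 i] thin_rotation_near[of e "2 * t - 1" n A2 "s1 i"] that by auto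
  have g_end: "g e i 1 = pt n (s i)" for e i
    using s2[of i] by (auto simp: g_def thin_rotation_def split: if_splits)
  define good where "good e i j \<longleftrightarrow> (\<forall>t\<in>{0..1}. common_half_plane (f j t - f i t) (g e j t - g e i t))" for e i j
  have good_sym: "good e j i" if "good e i j" for e i j
    using that common_half_plane_minus unfolding good_def by fast
  let ?ev = "\<lambda>i j. \<exists>e0>0. \<forall>e. 0 < e \<and> e \<le> e0 \<longrightarrow> good e i j"
  \<comment> \<open>The lifts \<open>a0\<close>, \<open>a1\<close>, \<open>a2\<close> record the
    three places of \<open>i\<close>, and \<open>b0\<close>, \<open>b1\<close>, \<open>b2\<close>
    those of \<open>j\<close>. They may be chosen for each pair separately, in such a way that
    \<open>j\<close> is always ahead of \<open>i\<close> by less than a full turn.\<close>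
  have robust: "?ev i j" if r: "residue_rep n a0 = i" "residue_rep n a1 = s1 i" "residue_rep n a2 = s i"
      "residue_rep n b0 = j" "residue_rep n b1 = s1 j" "residue_rep n b2 = s j"
      and c: "0 < b0 - a0" "0 < b1 - a1" "0 < b2 - a2"
      "b0 - a0 < int n" "b1 - a1 < int n" "b2 - a2 < int n"
      "\<bar>(a0 + b0) - (a1 + b1)\<bar> < int n" "\<bar>(a0 + b0) - (a2 + b2)\<bar> < int n" "\<bar>(a1 + b1) - (a2 + b2)\<bar> < int n"
    for i j and a0 a1 a2 b0 b1 b2 :: int
  proof -
    have p: "pt n i = circ n a0" "pt n (s1 i) = circ n a1" "pt n (s i) = circ n a2"
      "pt n j = circ n b0" "pt n (s1 j) = circ n b1" "pt n (s j) = circ n b2"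
      using r pt_residue_rep[OF n0] by metis+
    obtain v where v: "norm v = 1" "0 < Re ((pt n j - pt n i) * v)" "0 < Re ((pt n (s1 j) - pt n (s1 i)) * v)"
      "0 < Re ((pt n (s j) - pt n (s i)) * v)"
      unfolding p using robust_chords[OF n0 c] by blast
    \<comment> \<open>The depth of the three chords in the half plane. Each of the two bends costs
      at most \<open>e\<close>, hence the bound \<open>m / 2\<close>.\<close>
    define m where "m = min (Re ((pt n j - pt n i) * v)) (min (Re ((pt n (s1 j) - pt n (s1 i)) * v)) (Re ((pt n (s j) - pt n (s i)) * v)))"
    have "good e i j" if e: "0 < e" "e \<le> m / 2" for e unfolding good_def common_half_plane_def
    proof (intro ballI disjI2 exI conjI)
      fix t :: real assume t: "t \<in> {0..1}"
      have "norm ((g e j t - g e i t) - (g 0 j t - g 0 i t)) \<le> norm (g e j t - g 0 j t) + norm (g e i t - g 0 i t)"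
        using norm_triangle_ineq4[of "g e j t - g 0 j t" "g e i t - g 0 i t"] by (simp add: algebra_simps)
      also have "\<dots> \<le> m" using g_near[of e t j] g_near[of e t i] e t by simp
      finally have near: "norm ((g e j t - g e i t) - (g 0 j t - g 0 i t)) \<le> m" .
      have feq: "f j t - f i t = (1 - t) *\<^sub>R (pt n j - pt n i) + t *\<^sub>R (pt n (s j) - pt n (s i))"
        by (simp add: f_eq algebra_simps)
      have geq: "g 0 j t - g 0 i t = (if t \<le> 1/2 then (1 - 2 * t) *\<^sub>R (pt n j - pt n i) + (2 * t) *\<^sub>R (pt n (s1 j) - pt n (s1 i))
         else (1 - (2 * t - 1)) *\<^sub>R (pt n (s1 j) - pt n (s1 i)) + (2 * t - 1) *\<^sub>R (pt n (s j) - pt n (s i)))"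
        by (simp add: g0_eq algebra_simps)
      have t01: "0 \<le> t" "t \<le> 1" using t by auto
      have mm: "m \<le> Re ((pt n j - pt n i) * v)" "m \<le> Re ((pt n (s1 j) - pt n (s1 i)) * v)" "m \<le> Re ((pt n (s j) - pt n (s i)) * v)"
        unfolding m_def by linarith+
      show "0 < Re ((f j t - f i t) * v)" "0 \<le> Re ((g e j t - g e i t) * v)"
        using two_stage_half_plane[OF v mm t01 feq geq near] by auto
    qed
    moreover have "0 < m / 2" using v by (simp add: m_def)
    ultimately show ?thesis by blast
  qed
  \<comment> \<open>All elements of \<open>A\<close> other than \<open>w\<close> and
    \<open>x\<close> have lifts between \<open>X + 1\<close> and \<open>W + n\<close>, and their
    successors do not pass \<open>W + n\<close>.\<close>
  define above where "above i L \<longleftrightarrow> residue_rep n L = i \<and> X + 1 \<le> L \<and> L < W + int n \<and>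
      L + int (next_gap n A i) \<le> W + int n \<and> residue_rep n (L + int (next_gap n A i)) = next_in n A i \<and>
      0 < next_gap n A i" for i L
  have aboveD: "residue_rep n L = i" "X + 1 \<le> L" "L < W + int n" "L + int (next_gap n A i) \<le> W + int n"
    "residue_rep n (L + int (next_gap n A i)) = next_in n A i" "0 < next_gap n A i" if "above i L" for i L
    using that by (auto simp: above_def)
  have lift: "\<exists>L. above i L" if i: "i \<in> A" "i \<noteq> w" "i \<noteq> x" for i
  proof -
    obtain b where b: "int w < b" "b < int w + int n" "residue_rep n b = i"
      "int w + int (next_gap n A w) \<le> b" "b + int (next_gap n A i) \<le> int w + int n"
      "\<And>k. residue_rep n (b + k) = residue_rep n (int i + k)"
      using lift_pair[OF n0 A(1) w(1) i(1)] i(2) by metis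
    have "b \<noteq> X" using b(3) resX i(3) by auto
    then have "X + 1 \<le> b" using b(4) by (simp add: X_def W_def)
    then show ?thesis
      using b next_gap(5)[OF n0 A(1) i(1)] next_gap(1)[OF n0 A(1) i(1)] by (intro exI[of _ b]) (simp add: W_def above_def)
  qed
  have shift: "residue_rep n (a + k) = residue_rep n (b + k)" if "residue_rep n a = residue_rep n b" for a b k
    using that n0 by (auto simp: residue_rep_eq_iff intro: mod_add_cong)
  have minus_n: "residue_rep n (a - int n) = residue_rep n a" for a
    using residue_rep_add_n[OF n0, of "a - int n"] by simp
  have p_w: "pt n w = circ n (of_int W)" "pt n w = circ n (of_int (W + int n))"
    "pt n (cyc_succ n w) = circ n (of_int (W + 1))"
    using pt_residue_rep[OF n0, of W] pt_residue_rep[OF n0, of "W + int n"] resW residue_rep_add_n[OF n0, of W]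
      pt_residue_rep[OF n0, of "W + 1"] cyc_succ_residue_rep[OF n0, of W] by simp_all
  have p_x: "pt n x = circ n (of_int X)" "pt n y = circ n (of_int (X + 1))"
    "pt n (cyc_succ n y) = circ n (of_int (X + 2))"
  proof -
    have "X + 1 + 1 = X + 2" by simp
    then have "cyc_succ n y = residue_rep n (X + 2)"
      using cyc_succ_residue_rep[OF n0, of "X + 1"] resX1 by (simp only:)
    then show "pt n (cyc_succ n y) = circ n (of_int (X + 2))"
      using pt_residue_rep[OF n0, of "X + 2"] by (simp only:)
  qed (use pt_residue_rep[OF n0, of X] pt_residue_rep[OF n0, of "X + 1"] resX resX1 in simp_all)
  define xi where "xi = real_of_int (X - W)"
  have xi: "1 \<le> xi" "xi \<le> real n - 2" using WX by (auto simp: xi_def)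
  note sin_nn = sin_fraction_nonneg[OF n0] and sin_pos = sin_fraction_pos[OF n0]
  have cos_shift: "cos (pi * (n / 2 - a) / n) = sin (pi * a / n)" "cos (pi * (n / 2 + a) / n) = - sin (pi * a / n)" for a :: real
  proof -
    have "pi * (n / 2 - a) / n = pi / 2 - pi * a / n" "pi * (n / 2 + a) / n = pi / 2 + pi * a / n"
      using n0 by (simp_all add: field_simps)
    then show "cos (pi * (n / 2 - a) / n) = sin (pi * a / n)" "cos (pi * (n / 2 + a) / n) = - sin (pi * a / n)"
      by (simp_all add: cos_diff cos_add)
  qed
  have x2: "thin_rotation e n A2 x t = (1 - t) *\<^sub>R pt n x + t *\<^sub>R pt n y + (e * (t * (1 - t))) *\<^sub>R (pt n y - midpoint (pt n x) (pt n y))"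
    "thin_rotation e n A2 y t = (1 - t) *\<^sub>R pt n y + t *\<^sub>R pt n x + (e * (t * (1 - t))) *\<^sub>R (pt n (cyc_succ n y) - midpoint (pt n y) (pt n x))"
    for e t
    using thin_rotation_2[OF n0 A2(1), of x y e t] thin_rotation_2[OF n0 A2(1), of y x e t] xy
    by (auto simp: A2_def y_def[symmetric] insert_commute)
  define Lam where "Lam c z = Re (z * cnj (chord_dir n c))" for c z
  have lin: "Lam c (a *\<^sub>R z) = a * Lam c z" "Lam c (z + z') = Lam c z + Lam c z'" for a c z z'
    by (simp_all add: Lam_def algebra_simps)
  have pair_wx: "good e w x" if e: "0 < e" "e \<le> 1" for e unfolding good_def
  proof
    \<comment> \<open>The parameters of \<open>x\<close> and \<open>y\<close> add up to
      \<open>2 * X + 1\<close>; the offset by \<open>n / 2\<close> makes the functional vanish on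
      the chord along which \<open>w\<close> and \<open>x\<close> exchange their places. So only the
      bends decide about the sign.\<close>
    define c where "c = 2 * real_of_int X + 1 - n / 2"
    let ?Lam = "Lam c"
    have L1: "0 < ?Lam (pt n x - pt n w)"
    proof -
      have "?Lam (pt n x - pt n w) = 2 * sin (pi * xi / n) * cos (pi * (n / 2 - (xi + 1)) / n)"
        unfolding Lam_def p_w(1) p_x(1) chord_eval by (simp add: c_def xi_def algebra_simps)
      then show ?thesis unfolding cos_shift using sin_pos[of xi] sin_pos[of "xi + 1"] xi by simp
    qed
    have L2: "?Lam (pt n y - pt n x) = 0"
    proof -
      have "?Lam (pt n y - pt n x) = 2 * sin (pi * 1 / n) * cos (pi * (n / 2 - 0) / n)"
        unfolding Lam_def p_x chord_eval by (simp add: c_def algebra_simps)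
      then show ?thesis unfolding cos_shift by simp
    qed
    have L3: "0 \<le> ?Lam (pt n x - pt n (cyc_succ n w))"
    proof -
      have "?Lam (pt n x - pt n (cyc_succ n w)) = 2 * sin (pi * (xi - 1) / n) * cos (pi * (n / 2 - xi) / n)"
        unfolding Lam_def p_x p_w chord_eval by (simp add: c_def xi_def algebra_simps)
      then show ?thesis unfolding cos_shift using sin_nn[of "xi - 1"] sin_nn[of xi] xi by simp
    qed
    have L4: "?Lam (pt n (cyc_succ n y) - pt n y) \<le> 0"
    proof -
      have "?Lam (pt n (cyc_succ n y) - pt n y) = 2 * sin (pi * 1 / n) * cos (pi * (n / 2 + 2) / n)"
        unfolding Lam_def p_x chord_eval by (simp add: c_def algebra_simps)
      then show ?thesis unfolding cos_shift using sin_nn[of 1] sin_nn[of 2] n by simp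
    qed
    fix t :: real assume t: "t \<in> {0..1}"
    show "common_half_plane (f x t - f w t) (g e x t - g e w t)"
    proof (cases "t = 1")
      case True
      then show ?thesis by (simp add: f_eq g_end common_half_plane_def)
    next
      case t1: False
      have "f x t - f w t = (1 - t) *\<^sub>R (pt n x - pt n w) + t *\<^sub>R (pt n y - pt n x)"
        by (simp add: f_eq s_w s_x algebra_simps)
      then have "?Lam (f x t - f w t) = (1 - t) * ?Lam (pt n x - pt n w)" by (simp only: lin(1,2) L2; simp)
      then have fpos: "0 < ?Lam (f x t - f w t)" using L1 t t1 by simp
      have "0 \<le> ?Lam (g e x t - g e w t)"
      proof (cases "t \<le> 1/2")
        case True
        define \<tau> where "\<tau> = 2 * t"
        define e' where "e' = (if card A1 = 2 then e else 0)"
        have \<tau>: "0 \<le> \<tau>" "\<tau> \<le> 1" using t True by (auto simp: \<tau>_def)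
        have e': "0 \<le> e'" "e' \<le> 1" using e by (auto simp: e'_def)
        note co = bend_coefficients[OF e' \<tau>]
        define \<alpha> \<beta> \<gamma> where abc: "\<alpha> = (1 - \<tau>) * (1 - e' * \<tau> / 2)" "\<beta> = \<tau> * (1 - e' * (1 - \<tau>) / 2)" "\<gamma> = e' * (\<tau> * (1 - \<tau>))"
        have "g e x t = pt n x" using True by (simp add: g_def path_concat_def thin_rotation_def A1_def)
        moreover have "g e w t = (1 - \<tau>) *\<^sub>R pt n w + \<tau> *\<^sub>R pt n y + (e' * (\<tau> * (1 - \<tau>))) *\<^sub>R (pt n (cyc_succ n w) - midpoint (pt n w) (pt n y))"
          using True A1(3) next1w by (simp add: g_def path_concat_def thin_rotation_def e'_def \<tau>_def)
        ultimately have "g e x t - g e w t = pt n x - (\<alpha> *\<^sub>R pt n w + \<beta> *\<^sub>R pt n y + \<gamma> *\<^sub>R pt n (cyc_succ n w))"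
          unfolding bend_combination abc by simp
        also have "\<dots> = \<alpha> *\<^sub>R (pt n x - pt n w) + \<gamma> *\<^sub>R (pt n x - pt n (cyc_succ n w)) + (- \<beta>) *\<^sub>R (pt n y - pt n x)"
        proof -
          have "pt n x = (\<alpha> + \<beta> + \<gamma>) *\<^sub>R pt n x" using co(5) by (simp add: abc)
          then show ?thesis by (simp add: algebra_simps)
        qed
        finally have "?Lam (g e x t - g e w t) = \<alpha> * ?Lam (pt n x - pt n w) + \<gamma> * ?Lam (pt n x - pt n (cyc_succ n w))"
          by (simp only: lin(1,2) L2; simp)
        then show ?thesis using co(1,3) L1 L3 by (simp add: abc)
      next
        case False
        define \<tau> where "\<tau> = 2 * t - 1"
        have \<tau>: "0 \<le> \<tau>" "\<tau> \<le> 1" using t False by (auto simp: \<tau>_def)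
        have "g e x t - g e w t = (2 * \<tau> - 1) *\<^sub>R (pt n y - pt n x) + (- (e * (\<tau> * (1 - \<tau>)))) *\<^sub>R (pt n (cyc_succ n y) - pt n y)"
        proof -
          have eqs: "g e x t = thin_rotation e n A2 x \<tau>" "g e w t = thin_rotation e n A2 y \<tau>"
            using False by (simp_all add: g_def path_concat_def s_x s_w \<tau>_def)
          show ?thesis unfolding eqs x2
            by (simp add: midpoint_sym[of "pt n y"] scaleR_conv_of_real algebra_simps)
        qed
        then have "?Lam (g e x t - g e w t) = - (e * (\<tau> * (1 - \<tau>))) * ?Lam (pt n (cyc_succ n y) - pt n y)"
          by (simp only: lin(1,2) L2; simp)
        moreover have "0 \<le> e * (\<tau> * (1 - \<tau>))" using e \<tau> by simp
        ultimately show ?thesis using L4 by (simp add: mult_nonneg_nonpos)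
      qed
      with fpos show ?thesis unfolding common_half_plane_def Lam_def by blast
    qed
  qed
  have pair_wy: "?ev w y" if gy: "X + 1 + int (next_gap n A y) = W + int n"
  proof -
    have "A1 \<subseteq> {w, y}"
    proof
      fix k assume k: "k \<in> A1"
      show "k \<in> {w, y}"
      proof (rule ccontr)
        assume "k \<notin> {w, y}"
        then obtain L where L: "residue_rep n L = k" "X + 1 \<le> L" "L < W + int n"
          using lift[of k] k aboveD(1-3) by (fastforce simp: A1_def)
        have "L \<noteq> X + 1" using L(1) resX1 \<open>k \<notin> {w, y}\<close> by auto
        moreover have "residue_rep n (int y + (L - (X + 1))) = residue_rep n (X + 1 + (L - (X + 1)))"
          using resX1 residue_rep_of_nat[OF xn(3)] by (intro shift) simp
        ultimately have "next_gap n A y \<le> nat (L - (X + 1))"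
          using L k by (intro next_gap(4)[OF n0 A(1) yA]) (auto simp: A1_def)
        then show False using gy L by linarith
      qed
    qed
    then have A1eq: "A1 = {w, y}" "A1 = {y, w}" using A1(3,4) by auto
    have next_y: "next_in n A1 y = w" using card_2_next_in[OF n0 A1(1) A1eq(2)] wy by simp
    have sy: "s1 y = w" "s y = w" using s_i[OF yA] wy xy next_y A1(4) gap1(4)[OF yA] by (auto simp: s1_def)
    define \<kappa> where "\<kappa> = 2 * sin (pi * (n - xi) / n)"
    have \<kappa>: "0 < \<kappa>" unfolding \<kappa>_def using sin_pos[of "n - xi"] xi by simp
    \<comment> \<open>Again the functional is perpendicular to the chord of an exchange, now the one
      of \<open>w\<close> and \<open>y\<close> in the first stage, whose parameters add up to
      \<open>W + X + 1\<close>.\<close>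
    define c where "c = real_of_int W + real_of_int X + 1 + n / 2"
    let ?Lam = "Lam c"
    have cm: "cos (pi * (a - n / 2) / n) = sin (pi * a / n)" for a
    proof -
      have "pi * (a - n / 2) / n = - (pi * (n / 2 - a) / n)" by (simp add: algebra_simps minus_divide_left)
      then show ?thesis using cos_shift(1)[of a] by (simp only: cos_minus)
    qed
    have L1: "?Lam (pt n y - pt n w) = 0"
    proof -
      have "?Lam (pt n y - pt n w) = 2 * sin (pi * (xi + 1) / n) * cos (pi * (0 - n / 2) / n)"
        unfolding Lam_def p_w(1) p_x(2) chord_eval by (simp add: c_def xi_def algebra_simps)
      then show ?thesis unfolding cm by simp
    qed
    have L2: "?Lam (pt n w - pt n x) = \<kappa> * sin (pi / n)"
    proof -
      have "?Lam (pt n w - pt n x) = \<kappa> * cos (pi * (n / 2 - 1) / n)"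
        unfolding Lam_def p_w(2) p_x(1) chord_eval by (simp add: c_def xi_def \<kappa>_def algebra_simps)
      then show ?thesis unfolding cos_shift by simp
    qed
    have L3: "0 \<le> ?Lam (pt n (cyc_succ n y) - pt n (cyc_succ n w))"
    proof -
      have "?Lam (pt n (cyc_succ n y) - pt n (cyc_succ n w)) = 2 * sin (pi * (xi + 1) / n) * cos (pi * (2 - n / 2) / n)"
        unfolding Lam_def p_x p_w(3) chord_eval by (simp add: c_def xi_def algebra_simps)
      then show ?thesis unfolding cm using sin_nn[of "xi + 1"] sin_nn[of 2] xi n by simp
    qed
    have sn: "0 < sin (pi / n)" using sin_pos[of 1] n by simp
    have L4: "- 2 * sin (pi / n) \<le> ?Lam (pt n w - pt n (cyc_succ n y))"
    proof -
      have "?Lam (pt n w - pt n (cyc_succ n y)) = 2 * sin (pi * (n - xi - 2) / n) * cos (pi * (n / 2 + 1) / n)"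
        unfolding Lam_def p_w(2) p_x(3) chord_eval by (simp add: c_def xi_def algebra_simps)
      then have "?Lam (pt n w - pt n (cyc_succ n y)) = - 2 * (sin (pi * (n - xi - 2) / n) * sin (pi / n))"
        unfolding cos_shift by simp
      moreover have "sin (pi * (n - xi - 2) / n) * sin (pi / n) \<le> 1 * sin (pi / n)"
        using sn by (intro mult_right_mono) auto
      ultimately show ?thesis by simp
    qed
    \<comment> \<open>In the second stage the bend contributes at least
      \<open>- 2 * \<gamma> * sin (pi / n)\<close>, and the motion itself
      \<open>\<beta> * \<kappa> * sin (pi / n)\<close>. Since \<open>\<gamma>\<close> is at most
      \<open>e * \<tau>\<close> and \<open>\<beta>\<close> at least \<open>\<tau> / 2\<close>, the
      bound \<open>4 * e \<le> \<kappa>\<close> suffices.\<close>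
    have "good e w y" if e: "0 < e" "e \<le> min 1 (\<kappa> / 4)" for e unfolding good_def
    proof
      fix t :: real assume t: "t \<in> {0..1}"
      have e1: "0 \<le> e" "e \<le> 1" "4 * e \<le> \<kappa>" using e by auto
      show "common_half_plane (f y t - f w t) (g e y t - g e w t)"
      proof (cases "t = 0")
        case True
        then show ?thesis by (simp add: f_eq g_def path_concat_def thin_rotation_def common_half_plane_def)
      next
        case t0: False
        have "f y t - f w t = (1 - t) *\<^sub>R (pt n y - pt n w) + t *\<^sub>R (pt n w - pt n x)"
          by (simp add: f_eq s_w sy algebra_simps)
        then have "?Lam (f y t - f w t) = t * (\<kappa> * sin (pi / n))" by (simp only: lin(1,2) L1 L2; simp)
        then have fpos: "0 < ?Lam (f y t - f w t)" using \<kappa> sn t t0 by simp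
        have "0 \<le> ?Lam (g e y t - g e w t)"
        proof (cases "t \<le> 1/2")
          case True
          define \<tau> where "\<tau> = 2 * t"
          have \<tau>: "0 \<le> \<tau>" "\<tau> \<le> 1" using t True by (auto simp: \<tau>_def)
          have "g e y t - g e w t = (1 - 2 * \<tau>) *\<^sub>R (pt n y - pt n w) + (e * (\<tau> * (1 - \<tau>))) *\<^sub>R (pt n (cyc_succ n y) - pt n (cyc_succ n w))"
          proof -
            have eqs: "g e y t = thin_rotation e n A1 y \<tau>" "g e w t = thin_rotation e n A1 w \<tau>"
              using True by (simp_all add: g_def path_concat_def \<tau>_def)
            show ?thesis
              unfolding eqs thin_rotation_2[OF n0 A1(1) A1eq(1) wy] thin_rotation_2[OF n0 A1(1) A1eq(2) wy[symmetric]]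
              by (simp add: midpoint_sym[of "pt n y"] scaleR_conv_of_real algebra_simps)
          qed
          then have "?Lam (g e y t - g e w t) = (e * (\<tau> * (1 - \<tau>))) * ?Lam (pt n (cyc_succ n y) - pt n (cyc_succ n w))"
            by (simp only: lin(1,2) L1; simp)
          then show ?thesis using L3 e1 \<tau> by simp
        next
          case False
          define \<tau> where "\<tau> = 2 * t - 1"
          have \<tau>: "0 \<le> \<tau>" "\<tau> \<le> 1" using t False by (auto simp: \<tau>_def)
          note co = bend_coefficients[OF e1(1,2) \<tau>]
          define \<alpha> \<beta> \<gamma> where abc: "\<alpha> = (1 - \<tau>) * (1 - e * \<tau> / 2)" "\<beta> = \<tau> * (1 - e * (1 - \<tau>) / 2)" "\<gamma> = e * (\<tau> * (1 - \<tau>))"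
          have "g e y t = pt n w" using False wx wy by (simp add: g_def path_concat_def sy thin_rotation_def A2_def)
          moreover have "g e w t = \<alpha> *\<^sub>R pt n y + \<beta> *\<^sub>R pt n x + \<gamma> *\<^sub>R pt n (cyc_succ n y)"
            using False unfolding g_def path_concat_def s_w x2 bend_combination abc \<tau>_def by simp
          ultimately have "g e y t - g e w t = pt n w - (\<alpha> *\<^sub>R pt n y + \<beta> *\<^sub>R pt n x + \<gamma> *\<^sub>R pt n (cyc_succ n y))"
            by simp
          also have "\<dots> = \<beta> *\<^sub>R (pt n w - pt n x) + \<gamma> *\<^sub>R (pt n w - pt n (cyc_succ n y)) + (- \<alpha>) *\<^sub>R (pt n y - pt n w)"
          proof -
            have "pt n w = (\<alpha> + \<beta> + \<gamma>) *\<^sub>R pt n w" using co(5) by (simp add: abc)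
            then show ?thesis by (simp add: algebra_simps)
          qed
          finally have Lg: "?Lam (g e y t - g e w t) = \<beta> * (\<kappa> * sin (pi / n)) + \<gamma> * ?Lam (pt n w - pt n (cyc_succ n y))"
            by (simp only: lin(1,2) L1 L2; simp)
          have "\<gamma> * (- 2 * sin (pi / n)) \<le> \<gamma> * ?Lam (pt n w - pt n (cyc_succ n y))"
            using co(3) L4 by (intro mult_left_mono) (auto simp: abc)
          moreover have "\<gamma> * 2 \<le> \<beta> * \<kappa>"
          proof -
            have "\<gamma> \<le> e * \<tau>" unfolding abc using e1 \<tau> by (intro mult_left_mono) (auto intro: mult_left_le)
            moreover have "\<tau> * (1/2) \<le> \<beta>"
            proof -
              have "e * (1 - \<tau>) \<le> 1" using e1 \<tau> by (intro mult_le_one) auto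
              then show ?thesis unfolding abc using \<tau> by (intro mult_left_mono) auto
            qed
            moreover have "e * \<tau> * 2 \<le> \<tau> * (1/2) * \<kappa>"
              using mult_left_mono[OF e1(3) \<tau>(1)] by (simp add: algebra_simps)
            moreover have "\<tau> * (1/2) * \<kappa> \<le> \<beta> * \<kappa>" using calculation(2) \<kappa> by (intro mult_right_mono) auto
            ultimately show ?thesis by linarith
          qed
          then have "\<gamma> * 2 * sin (pi / n) \<le> \<beta> * \<kappa> * sin (pi / n)" using sn by (intro mult_right_mono) auto
          ultimately show ?thesis unfolding Lg by (simp add: algebra_simps)
        qed
        with fpos show ?thesis unfolding common_half_plane_def Lam_def by blast
      qed
    qed
    then show ?thesis using \<kappa> by (intro exI[of _ "min 1 (\<kappa> / 4)"]) auto
  qed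
  have out_lift: "\<exists>K. residue_rep n K = k \<and> W < K \<and> K < W + int n \<and> K \<noteq> X \<and> K \<noteq> X + 1" if k: "k \<in> {1..n}" "k \<notin> A" for k
  proof -
    obtain K where K: "W \<le> K" "K < W + int n" "residue_rep n K = k" using lift_exists[OF n0 k(1)] .
    have "K \<noteq> W" "K \<noteq> X" "K \<noteq> X + 1" using K(3) resW resX resX1 k(2) w(1) x(1) yA by auto
    with K show ?thesis by force
  qed
  \<comment> \<open>Every unordered pair occurs here in at least one order; \<open>good_sym\<close>
    supplies the other.\<close>
  have ord: "?ev i j" if ij: "i \<in> {1..n}" "j \<in> {1..n}" "i \<noteq> j"
      and cases: "(i \<notin> A \<and> j \<notin> A) \<or> (i = w \<and> j \<notin> A) \<or> (i = x \<and> j \<notin> A) \<or> (i \<in> A - {w, x} \<and> j \<notin> A) \<or>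
       (i = w \<and> j = x) \<or> (i = w \<and> j \<in> A - {w, x}) \<or> (i = x \<and> j \<in> A - {w, x}) \<or> (i \<in> A - {w, x} \<and> j \<in> A - {w, x})"
    for i j
    using cases
  proof (elim disjE conjE)
    assume "i \<notin> A" "j \<notin> A"
    then have "good e i j" for e
      using x(1) yA by (auto simp: good_def common_half_plane_def f_def g_def path_concat_def thin_rotation_def s1_def A1_def A2_def)
    then show ?thesis by (intro exI[of _ 1]) auto
  next
    assume "i = w" "j = x"
    then show ?thesis using pair_wx by (intro exI[of _ 1]) auto
  next
    assume i: "i = w" and j: "j \<notin> A"
    obtain K where K: "residue_rep n K = j" "W < K" "K < W + int n" "K \<noteq> X" "K \<noteq> X + 1" using out_lift[OF ij(2) j] by blast
    show ?thesis
    proof (cases "K < X")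
      case True
      \<comment> \<open>The corner lies between \<open>w\<close> and \<open>x\<close>, so
        \<open>w\<close> overtakes it. Lowering the later lifts of \<open>w\<close> by
        \<open>n\<close> keeps the corner ahead by less than a full turn.\<close>
      show ?thesis unfolding i by (rule robust[of W _ "X + 1 - int n" "X - int n" K _ K K])
          (use True K WX s_w s_out[OF j] resW resX resX1 in \<open>auto simp: minus_n\<close>)
    next
      case False
      show ?thesis unfolding i by (rule robust[of W _ "X + 1" X K _ K K])
          (use False K WX s_w s_out[OF j] resW resX resX1 in auto)
    qed
  next
    assume i: "i = x" and j: "j \<notin> A"
    obtain K where K: "residue_rep n K = j" "W < K" "K < W + int n" "K \<noteq> X" "K \<noteq> X + 1" using out_lift[OF ij(2) j] by blast
    show ?thesis
    proof (cases "K < X")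
      case True
      show ?thesis unfolding i by (rule robust[of X _ X "X + 1" "K + int n" _ "K + int n" "K + int n"])
          (use True K WX s_x s_out[OF j] resX resX1 n in \<open>auto simp: residue_rep_add_n\<close>)
    next
      case False
      show ?thesis unfolding i by (rule robust[of X _ X "X + 1" K _ K K])
          (use False K WX s_x s_out[OF j] resX resX1 n in auto)
    qed
  next
    assume i: "i \<in> A - {w, x}" and j: "j \<notin> A"
    obtain K where K: "residue_rep n K = j" "W < K" "K < W + int n" "K \<noteq> X" "K \<noteq> X + 1" using out_lift[OF ij(2) j] by blast
    obtain L where "above i L" using lift[of i] i by auto
    note L = aboveD[OF this]
    define L' where "L' = L + int (next_gap n A i)"
    have si: "s1 i = next_in n A i" "s i = next_in n A i" using s_i i by auto
    have KL: "K \<noteq> L" "K \<noteq> L'" using K(1) L(1,5) j i next_in_mem[OF n0 A(1), of i] by (auto simp: L'_def)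
    consider "K < L" | "L < K" "K < L'" | "L' < K" using KL by linarith
    then show ?thesis
    proof cases
      case 1
      have "?ev j i" by (rule robust[of K _ K K L _ L' L'])
          (use 1 K L WX si s_out[OF j] n in \<open>auto simp: L'_def\<close>)
      then show ?thesis using good_sym by blast
    next
      case 2
      show ?thesis by (rule robust[of L _ "L' - int n" "L' - int n" K _ K K])
          (use 2 K L WX si s_out[OF j] n in \<open>auto simp: L'_def minus_n\<close>)
    next
      case 3
      show ?thesis by (rule robust[of L _ L' L' K _ K K])
          (use 3 K L WX si s_out[OF j] n in \<open>auto simp: L'_def\<close>)
    qed
  next
    assume i: "i = w" and j: "j \<in> A - {w, x}"
    obtain L where "above j L" using lift[of j] j by auto
    note L = aboveD[OF this]
    have sj: "s1 j = next_in n A j" "s j = next_in n A j" using s_i j by auto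
    show ?thesis
    proof (cases "L = X + 1 \<and> L + int (next_gap n A j) = W + int n")
      case True
      then have "j = y" using L(1) resX1 by simp
      then show ?thesis using pair_wy True i by auto
    next
      case False
      show ?thesis unfolding i
        by (rule robust[of W _ "X + 1" X L _ "L + int (next_gap n A j)" "L + int (next_gap n A j)"])
          (use False L WX s_w sj resW resX resX1 in auto)
    qed
  next
    assume i: "i = x" and j: "j \<in> A - {w, x}"
    obtain L where "above j L" using lift[of j] j by auto
    note L = aboveD[OF this]
    have sj: "s1 j = next_in n A j" "s j = next_in n A j" using s_i j by auto
    show ?thesis unfolding i
      by (rule robust[of X _ X "X + 1" L _ "L + int (next_gap n A j)" "L + int (next_gap n A j)"])
        (use L WX s_x sj resX resX1 in auto)
  next
    assume i: "i \<in> A - {w, x}" and j: "j \<in> A - {w, x}"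
    have two: "?ev i j" if i: "i \<in> A - {w, x}" and j: "j \<in> A - {w, x}" and ne: "i \<noteq> j"
        and ab: "above i L" "above j M" and LM: "L < M" for i j L M
    proof -
      note L = aboveD[OF ab(1)] and M = aboveD[OF ab(2)]
      have si: "s1 i = next_in n A i" "s i = next_in n A i" "s1 j = next_in n A j" "s j = next_in n A j" using s_i i j by auto
      have ia: "i \<in> A" "j \<in> A" "i \<in> {1..n}" using i j A(1) by auto
      have "residue_rep n (int i + (M - L)) = residue_rep n (L + (M - L))"
        using L(1) residue_rep_of_nat[OF ia(3)] by (intro shift) simp
      then have "next_gap n A i \<le> nat (M - L)" using M(1) LM ia by (intro next_gap(4)[OF n0 A(1) ia(1)]) auto
      then have "L + int (next_gap n A i) \<le> M" using LM by linarith
      moreover have "next_gap n A i + next_gap n A j < n" by (rule next_gaps_less[OF n0 A(1) ia(1,2) ne A(2)])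
      ultimately show ?thesis
        by (intro robust[of L _ "L + int (next_gap n A i)" "L + int (next_gap n A i)" M _ "M + int (next_gap n A j)" "M + int (next_gap n A j)"])
          (use L M LM si WX in auto)
    qed
    obtain L M where ab: "above i L" "above j M" using lift[of i] lift[of j] i j by auto
    have "L \<noteq> M" using aboveD(1)[OF ab(1)] aboveD(1)[OF ab(2)] ij(3) by auto
    then consider "L < M" | "M < L" by linarith
    then show ?thesis
    proof cases
      case 1
      show ?thesis by (rule two[OF i j ij(3) ab 1])
    next
      case 2
      have "?ev j i" by (rule two[OF j i ij(3)[symmetric] ab(2,1) 2])
      then show ?thesis using good_sym by blast
    qed
  qed
  have pair: "?ev i j" if ij: "i \<in> {1..n}" "j \<in> {1..n}" "i \<noteq> j" for i j
  proof -
    have "(i \<in> A - {w, x} \<or> i = w \<or> i = x \<or> i \<notin> A)" "(j \<in> A - {w, x} \<or> j = w \<or> j = x \<or> j \<notin> A)" by blast+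
    then have "?ev i j \<or> ?ev j i" using ord[OF ij] ord[OF ij(2,1) ij(3)[symmetric]] ij(3) by metis
    then show ?thesis using good_sym by blast
  qed
  let ?P = "{p \<in> {1..n} \<times> {1..n}. fst p \<noteq> snd p}"
  \<comment> \<open>Each pair allows all sufficiently small widths and there are finitely many
    pairs, so one width serves them all.\<close>
  have "\<forall>p\<in>?P. \<forall>\<^sub>F e in at_right 0. good e (fst p) (snd p)"
  proof
    fix p assume "p \<in> ?P"
    then obtain e0 where "e0 > 0" "\<forall>e. 0 < e \<and> e \<le> e0 \<longrightarrow> good e (fst p) (snd p)"
      using pair[of "fst p" "snd p"] by auto
    then show "\<forall>\<^sub>F e in at_right 0. good e (fst p) (snd p)"
      unfolding eventually_at_right_field by (intro exI[of _ e0]) auto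
  qed
  then have "\<forall>\<^sub>F e in at_right 0. \<forall>p\<in>?P. good e (fst p) (snd p)"
    by (rule eventually_ball_finite[rotated]) auto
  then obtain e1 where e1: "e1 > 0" "\<forall>e>0. e < e1 \<longrightarrow> (\<forall>p\<in>?P. good e (fst p) (snd p))"
    unfolding eventually_at_right_field by blast
  define e where "e = min 1 (e1 / 2)"
  have e: "0 < e" "e \<le> 1" "e < e1" using e1(1) by (auto simp: e_def)
  have "motion_braid n f = motion_braid n (g e)"
  proof (rule motion_braid_half_planes[OF f(1) g(1)[OF e(1,2)]])
    show "f i 1 = g e i 1" for i by (simp add: f_eq g_end)
    show "common_half_plane (f j t - f i t) (g e j t - g e i t)"
      if "i \<in> {1..n}" "j \<in> {1..n}" "i \<noteq> j" "t \<in> {0..1}" for i j t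
    proof -
      have "(i, j) \<in> ?P" using that by simp
      then have "good e (fst (i, j)) (snd (i, j))" using e1(2) e(1,3) by blast
      then show ?thesis using that(4) unfolding good_def fst_conv snd_conv by blast
    qed
  qed
  then show ?thesis using f(2) g(2)[OF e(1,2)] by (simp add: A1_def A2_def y_def)
qed

lemma cyc_succ_neq:
  assumes "n \<ge> 2" "i \<in> {1..n}"
  shows "cyc_succ n i \<noteq> i"
proof
  assume "cyc_succ n i = i"
  then have "residue_rep n (int i + 1) = residue_rep n (int i)"
    using cyc_succ_residue_rep[of n "int i"] residue_rep_of_nat[OF assms(2)] assms(1) by simp
  then have "int n dvd 1" using assms(1) by (simp add: residue_rep_eq_iff mod_eq_dvd_iff)
  then show False using assms(1) by simp
qed

text \<open>Removes the bound on the size of \<open>A\<close>: a block consisting of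
  \<open>x\<close> and its successor only leaves a trivial first factor.\<close>

lemma rotation_braid_split_corner:
  assumes n: "n \<ge> 3" and A: "A \<subseteq> {1..n}" and x: "x \<in> A" "cyc_succ n x \<in> A"
  shows "rotation_braid n A =
    rotation_braid n (A - {x}) \<otimes>\<^bsub>braid_group n\<^esub> rotation_braid n {x, cyc_succ n x}"
proof (cases "3 \<le> card A")
  case True
  then show ?thesis using rotation_braid_split assms by blast
next
  case False
  have finA: "finite A" using A finite_subset by blast
  have ne: "cyc_succ n x \<noteq> x" using cyc_succ_neq[of n x] n A x by auto
  have "{x, cyc_succ n x} = A" by (rule card_seteq[OF finA]) (use x False ne in auto)
  moreover have "card (A - {x}) \<le> 1" using False finA x by (simp add: card_Diff_singleton)
  moreover have "rotation_braid n A \<in> carrier (braid_group n)" by (rule rotation_braid_carrier[OF n A])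
  ultimately show ?thesis by (simp add: rotation_braid_def[of n "A - {x}"])
qed

section \<open>Products over the blocks of a partition\<close>

text \<open>The fold from \<open>dual_simple\<close> for an explicit list, so that the arbitrary
  order of the blocks can be replaced by a convenient one.\<close>

definition rotation_prod :: "nat \<Rightarrow> nat set list \<Rightarrow> (real \<Rightarrow> complex set) set" where
  "rotation_prod n As = foldr (\<lambda>A x. rotation_braid n A \<otimes>\<^bsub>braid_group n\<^esub> x) As \<one>\<^bsub>braid_group n\<^esub>"

text \<open>What remains of a noncrossing partition when the covering condition is dropped. Unlike
  partitions, these families are closed under removing blocks, as inductions require.\<close>

definition hull_disjoint :: "nat \<Rightarrow> nat set set \<Rightarrow> bool" where
  "hull_disjoint n \<A> \<longleftrightarrow> \<A> \<subseteq> Pow {1..n} \<and>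
     (\<forall>A\<in>\<A>. \<forall>A'\<in>\<A>. A \<noteq> A' \<longrightarrow> convex hull (pt n ` A) \<inter> convex hull (pt n ` A') = {})"

lemma hull_disjoint_subset: "hull_disjoint n \<A> \<Longrightarrow> \<B> \<subseteq> \<A> \<Longrightarrow> hull_disjoint n \<B>"
  unfolding hull_disjoint_def by (meson subset_trans subsetD)

lemma hull_disjoint_finite: "hull_disjoint n \<A> \<Longrightarrow> finite \<A>"
  unfolding hull_disjoint_def by (elim conjE, erule finite_subset, simp)

lemma noncrossing_hull_disjoint: "\<pi> \<in> noncrossing n \<Longrightarrow> hull_disjoint n \<pi>"
  unfolding noncrossing_def hull_disjoint_def using partition_onD1 by blast

lemma rotation_prod_simps [simp]:
  "rotation_prod n [] = \<one>\<^bsub>braid_group n\<^esub>"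
  "rotation_prod n (A # As) = rotation_braid n A \<otimes>\<^bsub>braid_group n\<^esub> rotation_prod n As"
  by (simp_all add: rotation_prod_def)

lemma rotation_prod_carrier:
  assumes "n \<ge> 3" "set As \<subseteq> Pow {1..n}"
  shows "rotation_prod n As \<in> carrier (braid_group n)"
  using assms(2) by (induction As) (simp_all add: rotation_braid_carrier[OF assms(1)])

lemma rotation_prod_remove1:
  assumes n: "n \<ge> 3" and "distinct As" "A \<in> set As" "hull_disjoint n (set As)"
  shows "rotation_prod n As = rotation_braid n A \<otimes>\<^bsub>braid_group n\<^esub> rotation_prod n (remove1 A As)"
  using assms(2-4)
proof (induction As)
  case (Cons C As)
  have sub: "set (C # As) \<subseteq> Pow {1..n}" using Cons.prems(3) by (simp add: hull_disjoint_def)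
  show ?case
  proof (cases "A = C")
    case False
    have "A \<in> set As" using Cons.prems False by simp
    then have IH: "rotation_prod n As = rotation_braid n A \<otimes>\<^bsub>braid_group n\<^esub> rotation_prod n (remove1 A As)"
      using Cons.prems by (intro Cons.IH) (auto intro: hull_disjoint_subset)
    have c: "rotation_braid n A \<in> carrier (braid_group n)" "rotation_braid n C \<in> carrier (braid_group n)"
      "rotation_prod n (remove1 A As) \<in> carrier (braid_group n)"
    proof -
      have "A \<subseteq> {1..n}" "C \<subseteq> {1..n}" "set (remove1 A As) \<subseteq> Pow {1..n}"
        using sub \<open>A \<in> set As\<close> set_remove1_subset[of A As] unfolding list.set by blast+
      then show "rotation_braid n A \<in> carrier (braid_group n)" "rotation_braid n C \<in> carrier (braid_group n)"
        "rotation_prod n (remove1 A As) \<in> carrier (braid_group n)"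
        by (simp_all add: rotation_braid_carrier[OF n] rotation_prod_carrier[OF n])
    qed
    have "rotation_braid n C \<otimes>\<^bsub>braid_group n\<^esub> rotation_braid n A =
        rotation_braid n A \<otimes>\<^bsub>braid_group n\<^esub> rotation_braid n C"
      using Cons.prems(3) \<open>A \<in> set As\<close> False sub unfolding hull_disjoint_def
      by (intro rotation_braid_commute[OF n]) auto
    then show ?thesis using IH False c by (simp add: m_assoc[symmetric])
  qed simp
qed simp

lemma rotation_prod_cong_set:
  assumes n: "n \<ge> 3" and "distinct As" "distinct Bs" "set As = set Bs" "hull_disjoint n (set As)"
  shows "rotation_prod n As = rotation_prod n Bs"
  using assms(2-5)
proof (induction As arbitrary: Bs)
  case (Cons A As)
  have "rotation_prod n Bs = rotation_braid n A \<otimes>\<^bsub>braid_group n\<^esub> rotation_prod n (remove1 A Bs)"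
    using Cons.prems by (intro rotation_prod_remove1[OF n]) auto
  moreover have "rotation_prod n As = rotation_prod n (remove1 A Bs)"
    using Cons.prems by (intro Cons.IH) (auto intro: hull_disjoint_subset)
  ultimately show ?case by simp
qed simp

lemma dual_simple_eq:
  assumes "n \<ge> 3" "distinct As" "hull_disjoint n (set As)"
  shows "dual_simple n (set As) = rotation_prod n As"
proof -
  define Bs where "Bs = (SOME Bs. distinct Bs \<and> set Bs = set As)"
  have "distinct Bs \<and> set Bs = set As" unfolding Bs_def by (rule someI[of _ As]) (simp add: assms)
  then have "rotation_prod n Bs = rotation_prod n As" using assms by (intro rotation_prod_cong_set) auto
  then show ?thesis by (simp add: dual_simple_def rotation_prod_def Bs_def)
qed

lemma dual_simple_list:
  assumes "n \<ge> 3" "hull_disjoint n \<A>"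
  obtains As where "distinct As" "set As = \<A>" "dual_simple n \<A> = rotation_prod n As"
  using finite_distinct_list[OF hull_disjoint_finite[OF assms(2)]] dual_simple_eq[OF assms(1)] assms(2) by metis

lemma dual_simple_carrier:
  assumes "n \<ge> 3" "hull_disjoint n \<A>"
  shows "dual_simple n \<A> \<in> carrier (braid_group n)"
proof -
  obtain As where "set As = \<A>" "dual_simple n \<A> = rotation_prod n As" using dual_simple_list[OF assms] by metis
  then show ?thesis using rotation_prod_carrier[OF assms(1), of As] assms(2) by (simp add: hull_disjoint_def)
qed

lemma dual_simple_insert:
  assumes "n \<ge> 3" "A \<notin> \<A>" "hull_disjoint n (insert A \<A>)"
  shows "dual_simple n (insert A \<A>) = rotation_braid n A \<otimes>\<^bsub>braid_group n\<^esub> dual_simple n \<A>"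
proof -
  have hd: "hull_disjoint n \<A>" using assms(3) by (rule hull_disjoint_subset) blast
  obtain As where As: "distinct As" "set As = \<A>" "dual_simple n \<A> = rotation_prod n As"
    using dual_simple_list[OF assms(1) hd] .
  have "dual_simple n (set (A # As)) = rotation_prod n (A # As)" using As assms by (intro dual_simple_eq) auto
  then show ?thesis using As by simp
qed

lemma dual_simple_trivial:
  assumes "n \<ge> 3" "hull_disjoint n \<A>" "\<And>A. A \<in> \<A> \<Longrightarrow> card A \<le> 1"
  shows "dual_simple n \<A> = \<one>\<^bsub>braid_group n\<^esub>"
proof -
  obtain As where As: "set As = \<A>" "dual_simple n \<A> = rotation_prod n As"
    using dual_simple_list[OF assms(1,2)] by metis
  have "rotation_prod n As = \<one>\<^bsub>braid_group n\<^esub>" if "\<forall>A\<in>set As. card A \<le> 1" for As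
    using that by (induction As) (auto simp: rotation_braid_def)
  then show ?thesis using As assms(3) by simp
qed

lemma dual_simple_commute:
  assumes n: "n \<ge> 3" and hd: "hull_disjoint n \<A>" and A: "A \<subseteq> {1..n}"
    and disj: "\<And>A'. A' \<in> \<A> \<Longrightarrow> convex hull (pt n ` A) \<inter> convex hull (pt n ` A') = {}"
  shows "rotation_braid n A \<otimes>\<^bsub>braid_group n\<^esub> dual_simple n \<A> = dual_simple n \<A> \<otimes>\<^bsub>braid_group n\<^esub> rotation_braid n A"
proof -
  note cA = rotation_braid_carrier[OF n A]
  obtain As where As: "set As = \<A>" "dual_simple n \<A> = rotation_prod n As"
    using dual_simple_list[OF n hd] by metis
  have "rotation_braid n A \<otimes>\<^bsub>braid_group n\<^esub> rotation_prod n As = rotation_prod n As \<otimes>\<^bsub>braid_group n\<^esub> rotation_braid n A"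
    if "set As \<subseteq> \<A>" for As
    using that
  proof (induction As)
    case (Cons C As)
    have sub: "C \<subseteq> {1..n}" "set As \<subseteq> Pow {1..n}" using Cons.prems hd by (auto simp: hull_disjoint_def)
    note c = rotation_braid_carrier[OF n sub(1)] rotation_prod_carrier[OF n sub(2)] cA
    have "rotation_braid n A \<otimes>\<^bsub>braid_group n\<^esub> rotation_braid n C = rotation_braid n C \<otimes>\<^bsub>braid_group n\<^esub> rotation_braid n A"
      using Cons.prems disj sub by (intro rotation_braid_commute[OF n A]) auto
    then have "rotation_braid n A \<otimes>\<^bsub>braid_group n\<^esub> rotation_prod n (C # As) =
        rotation_braid n C \<otimes>\<^bsub>braid_group n\<^esub> (rotation_braid n A \<otimes>\<^bsub>braid_group n\<^esub> rotation_prod n As)"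
      using c by (simp add: m_assoc[symmetric])
    then show ?case using Cons c by (simp add: m_assoc)
  qed (use cA in simp)
  then show ?thesis using As by simp
qed

section \<open>Cutting a corner off a block\<close>

definition split_corner :: "nat set \<Rightarrow> nat \<Rightarrow> nat set set \<Rightarrow> nat set set" where
  "split_corner A b \<pi> = insert {b} (insert (A - {b}) (\<pi> - {A}))"

text \<open>Both new blocks lie in the hull of \<open>A\<close>, hence away from the other blocks,
  and they avoid each other because the corner \<open>b\<close> is extreme.\<close>

lemma split_corner_noncrossing:
  assumes "\<pi> \<in> noncrossing n" "A \<in> \<pi>" "b \<in> A" "A \<noteq> {b}"
  shows "split_corner A b \<pi> \<in> noncrossing n"
proof -
  have p: "partition_on {1..n} \<pi>" and
    h: "\<And>C C'. C \<in> \<pi> \<Longrightarrow> C' \<in> \<pi> \<Longrightarrow> C \<noteq> C' \<Longrightarrow> convex hull (pt n ` C) \<inter> convex hull (pt n ` C') = {}"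
    using assms(1) by (auto simp: noncrossing_def)
  have An: "A \<subseteq> {1..n}" using p assms(2) partition_onD1 by blast
  have dis: "C \<inter> A = {}" if "C \<in> \<pi> - {A}" for C
    using partition_onD2[OF p] assms(2) that by (auto simp: disjoint_def)
  have "partition_on {1..n} (split_corner A b \<pi>)"
  proof (rule partition_onI)
    show "\<Union> (split_corner A b \<pi>) = {1..n}"
      using partition_onD1[OF p] assms(2,3) by (auto simp: split_corner_def)
    show "{} \<notin> split_corner A b \<pi>" using assms(3,4) partition_onD3[OF p] by (auto simp: split_corner_def)
    fix C C' assume "C \<in> split_corner A b \<pi>" "C' \<in> split_corner A b \<pi>" "C \<noteq> C'"
    then show "disjnt C C'"
      using dis[of C] dis[of C'] partition_onD2[OF p] assms(3) unfolding split_corner_def disjnt_def disjoint_def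
      by fast
  qed
  moreover have "convex hull (pt n ` C) \<inter> convex hull (pt n ` C') = {}"
    if C: "C \<in> split_corner A b \<pi>" "C' \<in> split_corner A b \<pi>" "C \<noteq> C'" for C C'
  proof -
    have sub: "convex hull (pt n ` {b}) \<subseteq> convex hull (pt n ` A)" "convex hull (pt n ` (A - {b})) \<subseteq> convex hull (pt n ` A)"
      using assms(3) by (intro hull_mono; auto)+
    have b: "convex hull (pt n ` {b}) \<inter> convex hull (pt n ` (A - {b})) = {}"
    proof -
      have "b \<in> {1..n}" "A - {b} \<subseteq> {1..n}" using An assms(3) by blast+
      then show ?thesis using pt_notin_hull[of b n "A - {b}"] by simp
    qed
    have other: "convex hull (pt n ` D) \<inter> convex hull (pt n ` A) = {}" if "D \<in> \<pi> - {A}" for D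
      using h[of D A] that assms(2) by auto
    have corner: "D = {b} \<or> D = A - {b}" "convex hull (pt n ` D) \<subseteq> convex hull (pt n ` A)"
      if "D \<in> split_corner A b \<pi>" "D \<notin> \<pi> - {A}" for D
      using that sub unfolding split_corner_def by auto
    show ?thesis
    proof (cases "C \<in> \<pi> - {A}")
      case True
      show ?thesis
      proof (cases "C' \<in> \<pi> - {A}")
        case False
        then show ?thesis using other[OF True] corner(2)[OF C(2)] by blast
      qed (use h[of C C'] C(3) True in simp)
    next
      case False
      show ?thesis
      proof (cases "C' \<in> \<pi> - {A}")
        case True
        then show ?thesis using other[OF True] corner(2)[OF C(1) False] by blast
      next
        case F': False
        from corner(1)[OF C(1) False] corner(1)[OF C(2) F'] C(3)
        have "C = {b} \<and> C' = A - {b} \<or> C = A - {b} \<and> C' = {b}" by metis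
        then show ?thesis using b by (metis Int_commute)
      qed
    qed
  qed
  ultimately show ?thesis by (simp add: noncrossing_def)
qed

text \<open>The relation is applied to the block \<open>A\<close>. The new factor belongs to an edge
  inside the hull of \<open>A\<close>, so it commutes past all other blocks to the right
  end.\<close>

lemma dual_simple_split_corner:
  assumes n: "n \<ge> 3" and \<pi>: "\<pi> \<in> noncrossing n" and A: "A \<in> \<pi>" "b \<in> A" "cyc_succ n b \<in> A"
  shows "dual_simple n \<pi> = dual_simple n (split_corner A b \<pi>) \<otimes>\<^bsub>braid_group n\<^esub> rotation_braid n {b, cyc_succ n b}"
proof -
  have p: "partition_on {1..n} \<pi>" using \<pi> by (simp add: noncrossing_def)
  have An: "A \<subseteq> {1..n}" using p A(1) partition_onD1 by blast
  have ne: "A \<noteq> {b}" using cyc_succ_neq[of n b] n An A by auto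
  note hd = noncrossing_hull_disjoint[OF \<pi>] and hd' = noncrossing_hull_disjoint[OF split_corner_noncrossing[OF \<pi> A(1,2) ne]]
  define \<rho> where "\<rho> = \<pi> - {A}"
  have ins: "\<pi> = insert A \<rho>" "A \<notin> \<rho>" using A(1) by (auto simp: \<rho>_def)
  have hd\<rho>: "hull_disjoint n \<rho>" using hd by (rule hull_disjoint_subset) (simp add: \<rho>_def)
  have disA: "C \<inter> A = {}" if "C \<in> \<rho>" for C
    using partition_onD2[OF p] A(1) that by (auto simp: disjoint_def \<rho>_def)
  have n1: "{b} \<notin> insert (A - {b}) \<rho>" and n2: "A - {b} \<notin> \<rho>"
    using disA[of "{b}"] disA[of "A - {b}"] A(2) ne by auto
  have sc: "split_corner A b \<pi> = insert {b} (insert (A - {b}) \<rho>)" by (simp add: split_corner_def \<rho>_def)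
  have hd2: "hull_disjoint n (insert (A - {b}) \<rho>)" using hd' unfolding sc by (rule hull_disjoint_subset) blast
  have bn: "{b, cyc_succ n b} \<subseteq> {1..n}" using A An by auto
  have comm: "rotation_braid n {b, cyc_succ n b} \<otimes>\<^bsub>braid_group n\<^esub> dual_simple n \<rho> =
      dual_simple n \<rho> \<otimes>\<^bsub>braid_group n\<^esub> rotation_braid n {b, cyc_succ n b}"
  proof (rule dual_simple_commute[OF n hd\<rho> bn])
    fix C assume C: "C \<in> \<rho>"
    have "convex hull (pt n ` {b, cyc_succ n b}) \<subseteq> convex hull (pt n ` A)" using A by (intro hull_mono) auto
    moreover have "convex hull (pt n ` A) \<inter> convex hull (pt n ` C) = {}"
      using hd C ins A(1) unfolding hull_disjoint_def by (metis insertCI)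
    ultimately show "convex hull (pt n ` {b, cyc_succ n b}) \<inter> convex hull (pt n ` C) = {}" by blast
  qed
  have c: "rotation_braid n {b, cyc_succ n b} \<in> carrier (braid_group n)" "dual_simple n \<rho> \<in> carrier (braid_group n)"
    "rotation_braid n (A - {b}) \<in> carrier (braid_group n)"
    using rotation_braid_carrier[OF n bn] dual_simple_carrier[OF n hd\<rho>] rotation_braid_carrier[OF n, of "A - {b}"] An by auto
  have "dual_simple n \<pi> = rotation_braid n A \<otimes>\<^bsub>braid_group n\<^esub> dual_simple n \<rho>"
    using dual_simple_insert[OF n ins(2)] hd ins(1) by simp
  also have "\<dots> = rotation_braid n (A - {b}) \<otimes>\<^bsub>braid_group n\<^esub> dual_simple n \<rho> \<otimes>\<^bsub>braid_group n\<^esub> rotation_braid n {b, cyc_succ n b}"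
    unfolding rotation_braid_split_corner[OF n An A(2,3)] using c comm by (simp add: m_assoc)
  also have "rotation_braid n (A - {b}) \<otimes>\<^bsub>braid_group n\<^esub> dual_simple n \<rho> = dual_simple n (insert (A - {b}) \<rho>)"
    by (rule dual_simple_insert[OF n n2 hd2, symmetric])
  also have "dual_simple n (insert (A - {b}) \<rho>) = dual_simple n (split_corner A b \<pi>)"
    using dual_simple_insert[OF n n1] hd' dual_simple_carrier[OF n hd2] unfolding sc
    by (simp add: rotation_braid_def)
  finally show ?thesis .
qed

section \<open>The permutation of a braid\<close>

text \<open>A relation between corners rather than a permutation: one strand in one representative
  is enough to establish it, and homotopy invariance makes it single-valued.\<close>

definition braid_sends :: "nat \<Rightarrow> (real \<Rightarrow> complex set) set \<Rightarrow> nat \<Rightarrow> nat \<Rightarrow> bool" where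
  "braid_sends n \<beta> i j \<longleftrightarrow> (\<exists>f\<in>\<beta>. \<exists>g. continuous_on {0..1} g \<and> (\<forall>t\<in>{0..1}. g t \<in> f t) \<and>
     g 0 = pt n i \<and> g 1 = pt n j)"

lemma braid_sends_unique:
  assumes "\<beta> \<in> carrier (braid_group n)" "braid_sends n \<beta> i j" "braid_sends n \<beta> i k" "j \<in> {1..n}" "k \<in> {1..n}"
  shows "j = k"
proof -
  obtain f g where f: "f \<in> \<beta>" "continuous_on {0..1} g" "\<And>t. t \<in> {0..1} \<Longrightarrow> g t \<in> f t" "g 0 = pt n i" "g 1 = pt n j"
    using assms(2) unfolding braid_sends_def by blast
  obtain f' g' where f': "f' \<in> \<beta>" "continuous_on {0..1} g'" "\<And>t. t \<in> {0..1} \<Longrightarrow> g' t \<in> f' t" "g' 0 = pt n i" "g' 1 = pt n k"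
    using assms(3) unfolding braid_sends_def by blast
  have "g 1 = g' 1"
    by (rule homotopic_strands_end[OF braid_homotopic[OF assms(1) f(1) f'(1)] f(2,3) f'(2,3)]) (simp_all add: f f')
  then show ?thesis using f(5) f'(5) pt_eq_iff assms(4,5) by simp
qed

lemma braid_sends_mult:
  assumes "\<beta> \<in> carrier (braid_group n)" "\<gamma> \<in> carrier (braid_group n)" "braid_sends n \<beta> i j" "braid_sends n \<gamma> j k"
  shows "braid_sends n (\<beta> \<otimes>\<^bsub>braid_group n\<^esub> \<gamma>) i k"
proof -
  obtain f g where f: "f \<in> \<beta>" "continuous_on {0..1} g" "\<And>t. t \<in> {0..1} \<Longrightarrow> g t \<in> f t" "g 0 = pt n i" "g 1 = pt n j"
    using assms(3) unfolding braid_sends_def by blast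
  obtain f' g' where f': "f' \<in> \<gamma>" "continuous_on {0..1} g'" "\<And>t. t \<in> {0..1} \<Longrightarrow> g' t \<in> f' t" "g' 0 = pt n j" "g' 1 = pt n k"
    using assms(4) unfolding braid_sends_def by blast
  show ?thesis unfolding braid_sends_def
  proof (intro bexI exI conjI ballI)
    show "path_concat f f' \<in> \<beta> \<otimes>\<^bsub>braid_group n\<^esub> \<gamma>" using mult_mem_braid assms(1,2) f(1) f'(1) by blast
    show "continuous_on {0..1} (path_concat g g')"
      using pathin_path_concat[of euclidean g g'] f f' by (simp add: pathin_def)
    show "path_concat g g' t \<in> path_concat f f' t" if "t \<in> {0..1}" for t
      using f(3)[of "2 * t"] f'(3)[of "2 * t - 1"] that by (auto simp: path_concat_def)
  qed (use f f' in auto)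
qed

lemma braid_sends_one:
  assumes "i \<in> {1..n}"
  shows "braid_sends n \<one>\<^bsub>braid_group n\<^esub> i i"
  unfolding braid_sends_def using assms by (intro bexI[OF _ one_braid_mem] exI[of _ "\<lambda>_. pt n i"]) auto

lemma braid_sends_rotation:
  assumes n: "n \<ge> 3" and A: "A \<subseteq> {1..n}" and i: "i \<in> {1..n}"
  shows "braid_sends n (rotation_braid n A) i (if i \<in> A then next_in n A i else i)"
proof (cases "card A \<le> 1")
  case True
  have "next_in n A i = i" if "i \<in> A"
  proof -
    have "finite A" using A finite_subset by blast
    then have "A = {i}" using True that by (metis card_le_Suc0_iff_eq One_nat_def singletonI subsetI subset_antisym insert_subset empty_subsetI subset_singletonD singletonD)
    then show ?thesis using next_in_mem[of n A i] n A by auto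
  qed
  then show ?thesis using braid_sends_one[OF i] True by (simp add: rotation_braid_def)
next
  case False
  have mot: "corner_motion n (thin_rotation 1 n A)" using thin_rotation_motion[OF n A, of 1] False by simp
  have eq: "rotation_braid n A = motion_braid n (thin_rotation 1 n A)"
    using rotation_braid_eq_thin[OF n A, of 1] False by simp
  show ?thesis unfolding braid_sends_def eq
  proof (intro bexI[OF _ motion_path_mem[OF mot]] exI[of _ "thin_rotation 1 n A i"] conjI ballI)
    show "continuous_on {0..1} (thin_rotation 1 n A i)" by (rule corner_motionD(1)[OF mot i])
    show "thin_rotation 1 n A i t \<in> motion_path n (thin_rotation 1 n A) t" for t
      using i by (auto simp: motion_path_def)
  qed (auto simp: thin_rotation_def)
qed

lemma braid_sends_rotation_prod:
  assumes n: "n \<ge> 3" and "set As \<subseteq> Pow {1..n}" "distinct As" "disjoint (set As)" and i: "i \<in> {1..n}"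
  shows "(\<forall>A\<in>set As. i \<in> A \<longrightarrow> braid_sends n (rotation_prod n As) i (next_in n A i)) \<and>
    (i \<notin> \<Union> (set As) \<longrightarrow> braid_sends n (rotation_prod n As) i i)"
  using assms(2-4) i
proof (induction As arbitrary: i)
  case (Cons C As)
  have C: "C \<subseteq> {1..n}" "set As \<subseteq> Pow {1..n}" using Cons.prems by auto
  note c = rotation_braid_carrier[OF n C(1)] rotation_prod_carrier[OF n C(2)]
  have IH: "A \<in> set As \<Longrightarrow> i \<in> A \<Longrightarrow> braid_sends n (rotation_prod n As) i (next_in n A i)"
    "i \<notin> \<Union> (set As) \<Longrightarrow> braid_sends n (rotation_prod n As) i i" if "i \<in> {1..n}" for i A
    using Cons.IH[OF C(2) _ _ that] Cons.prems(2,3) by (auto simp: disjoint_def)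
  have disC: "A \<inter> C = {}" if "A \<in> set As" for A using Cons.prems(2,3) that by (auto simp: disjoint_def)
  note S = braid_sends_rotation[OF n C(1) Cons.prems(4)]
  have inC: "braid_sends n (rotation_prod n (C # As)) i (next_in n C i)" if iC: "i \<in> C"
  proof -
    have ni: "next_in n C i \<in> C" using next_in_mem[OF _ C(1) iC] n by auto
    then have "next_in n C i \<notin> \<Union> (set As)" using disC by blast
    then have "braid_sends n (rotation_prod n As) (next_in n C i) (next_in n C i)"
      using IH(2)[of "next_in n C i"] ni C(1) by blast
    then show ?thesis using braid_sends_mult[OF c] S iC by simp
  qed
  have outC: "braid_sends n (rotation_prod n (C # As)) i j" if "i \<notin> C" "braid_sends n (rotation_prod n As) i j" for j
    using braid_sends_mult[OF c _ that(2)] S that(1) by simp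
  show ?case
  proof (intro conjI ballI impI)
    fix A assume A: "A \<in> set (C # As)" "i \<in> A"
    show "braid_sends n (rotation_prod n (C # As)) i (next_in n A i)"
    proof (cases "A = C")
      case False
      then have "A \<in> set As" using A by simp
      then show ?thesis using outC[OF _ IH(1)[OF Cons.prems(4) _ A(2)]] disC[of A] A(2) by blast
    qed (use inC A in simp)
  next
    assume "i \<notin> \<Union> (set (C # As))"
    then show "braid_sends n (rotation_prod n (C # As)) i i" using outC[OF _ IH(2)[OF Cons.prems(4)]] by simp
  qed
qed (use braid_sends_one in simp)

lemma braid_sends_dual_simple:
  assumes n: "n \<ge> 3" and \<pi>: "\<pi> \<in> noncrossing n" and A: "A \<in> \<pi>" "i \<in> A"
  shows "braid_sends n (dual_simple n \<pi>) i (next_in n A i)"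
proof -
  note hd = noncrossing_hull_disjoint[OF \<pi>]
  have p: "partition_on {1..n} \<pi>" using \<pi> by (simp add: noncrossing_def)
  obtain As where As: "distinct As" "set As = \<pi>" "dual_simple n \<pi> = rotation_prod n As"
    using dual_simple_list[OF n hd] .
  have "i \<in> {1..n}" using p A partition_onD1 by blast
  then show ?thesis
    using braid_sends_rotation_prod[OF n, of As i] As A hd partition_onD2[OF p] by (auto simp: hull_disjoint_def)
qed

text \<open>Passing to the next element visits all of \<open>A\<close>; the induction is on the
  lifted distance still to be covered.\<close>

lemma next_in_orbit:
  assumes n: "0 < n" and A: "A \<subseteq> {1..n}" and closed: "\<And>x. x \<in> A \<Longrightarrow> x \<in> S \<Longrightarrow> next_in n A x \<in> S"
    and i: "i \<in> A" "i \<in> S"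
  shows "A \<subseteq> S"
proof -
  have *: "residue_rep n m \<in> S" if "i \<in> A" "i \<in> S" "int i \<le> m" "residue_rep n m \<in> A" for i m using that
  proof (induction "nat (m - int i)" arbitrary: i m rule: less_induct)
    case less
    have i: "i \<in> {1..n}" using less.prems(1) A by blast
    show ?case
    proof (cases "m = int i")
      case True
      then show ?thesis using less.prems(2) residue_rep_of_nat[OF i] by simp
    next
      case False
      define g where "g = next_gap n A i"
      define i' where "i' = next_in n A i"
      have g: "0 < g" "g \<le> nat (m - int i)" "residue_rep n (int i + int g) = i'"
        using next_gap[OF n A less.prems(1)] False less.prems(3,4) by (auto simp: g_def i'_def)
      have i': "i' \<in> A" "i' \<in> S" "i' \<in> {1..n}"
        using next_in_mem[OF n A less.prems(1)] closed[OF less.prems(1,2)] A by (auto simp: i'_def)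
      define m' where "m' = int i' + (m - (int i + int g))"
      have "residue_rep n m' = residue_rep n m"
      proof -
        have "residue_rep n (int i + int g) = residue_rep n (int i')" using g(3) residue_rep_of_nat[OF i'(3)] by simp
        then have "(int i + int g) mod int n = int i' mod int n" using n by (simp add: residue_rep_eq_iff)
        then have "(int i' + (m - (int i + int g))) mod int n = (int i + int g + (m - (int i + int g))) mod int n"
          by (intro mod_add_cong) auto
        then show ?thesis using n by (simp add: residue_rep_eq_iff m'_def)
      qed
      moreover have "residue_rep n m' \<in> S"
        using less.hyps[of m' i'] i' g False less.prems(3,4) calculation by (auto simp: m'_def)
      ultimately show ?thesis by simp
    qed
  qed
  show ?thesis
  proof
    fix k assume k: "k \<in> A"
    then obtain m where "int i \<le> m" "residue_rep n m = k" using lift_exists[OF n, of k "int i"] A by blast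
    then show "k \<in> S" using *[OF i] k by blast
  qed
qed

text \<open>The blocks are the cycles of the permutation of \<open>dual_simple n \<pi>\<close>, so
  already the permutation determines the partition.\<close>

lemma dual_simple_inj:
  assumes n: "n \<ge> 3" and \<pi>: "\<pi> \<in> noncrossing n" and \<pi>': "\<pi>' \<in> noncrossing n" and eq: "dual_simple n \<pi> = dual_simple n \<pi>'"
  shows "\<pi> = \<pi>'"
proof -
  have sub: "A \<subseteq> A'" if \<pi>: "\<pi> \<in> noncrossing n" and \<pi>': "\<pi>' \<in> noncrossing n" and eq: "dual_simple n \<pi> = dual_simple n \<pi>'"
    and A: "A \<in> \<pi>" "i \<in> A" "A' \<in> \<pi>'" "i \<in> A'" for \<pi> \<pi>' A A' i
  proof -
    have An: "A \<subseteq> {1..n}" "A' \<subseteq> {1..n}" using A \<pi> \<pi>' partition_onD1 by (auto simp: noncrossing_def)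
    show ?thesis
    proof (rule next_in_orbit[OF _ An(1) _ A(2,4)])
      fix x assume x: "x \<in> A" "x \<in> A'"
      have m: "next_in n A x \<in> {1..n}" "next_in n A' x \<in> A'" "next_in n A' x \<in> {1..n}"
        using next_in_mem[of n A x] next_in_mem[of n A' x] An x n by auto
      have "next_in n A x = next_in n A' x"
        by (rule braid_sends_unique[OF dual_simple_carrier[OF n noncrossing_hull_disjoint[OF \<pi>]]
            braid_sends_dual_simple[OF n \<pi> A(1) x(1)] _ m(1,3)])
          (simp add: eq braid_sends_dual_simple[OF n \<pi>' A(3) x(2)])
      then show "next_in n A x \<in> A'" using m(2) by simp
    qed (use n in simp)
  qed
  have "\<pi> \<subseteq> \<pi>'" if \<pi>: "\<pi> \<in> noncrossing n" and \<pi>': "\<pi>' \<in> noncrossing n" and eq: "dual_simple n \<pi> = dual_simple n \<pi>'"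
    for \<pi> \<pi>'
  proof
    fix A assume A: "A \<in> \<pi>"
    have p: "partition_on {1..n} \<pi>" "partition_on {1..n} \<pi>'" using \<pi> \<pi>' by (auto simp: noncrossing_def)
    have "A \<noteq> {}" using partition_onD3[OF p(1)] A by auto
    then obtain i where i: "i \<in> A" by blast
    then have "i \<in> {1..n}" using partition_onD1[OF p(1)] A by blast
    then obtain A' where A': "A' \<in> \<pi>'" "i \<in> A'" using partition_onD1[OF p(2)] by blast
    have "A \<subseteq> A'" "A' \<subseteq> A" using sub[OF \<pi> \<pi>' eq A i A'] sub[OF \<pi>' \<pi> eq[symmetric] A' A i] by auto
    then show "A \<in> \<pi>'" using A' by simp
  qed
  from this[OF \<pi> \<pi>' eq] this[OF \<pi>' \<pi> eq[symmetric]] show ?thesis by simp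
qed

section \<open>Runs\<close>

text \<open>Zero steps are allowed, so an element outside \<open>C\<close> is its own run end. If
  \<open>C\<close> is the whole cycle there is no run end, hence the special case in the partition
  below.\<close>

definition run_end :: "nat \<Rightarrow> nat set \<Rightarrow> nat \<Rightarrow> nat" where
  "run_end n C x = (cyc_succ n ^^ (LEAST k. (cyc_succ n ^^ k) x \<notin> C)) x"

text \<open>The partition whose blocks are the runs of consecutive elements of \<open>C\<close>, each together with the
  element following it.\<close>

definition runs :: "nat \<Rightarrow> nat set \<Rightarrow> nat set set" where
  "runs n C = (if C = {1..n} then {{1..n}} else (\<lambda>a. {x \<in> {1..n}. run_end n C x = a}) ` ({1..n} - C))"

lemma run_end_eqI:
  assumes "(cyc_succ n ^^ k) x \<notin> C" "\<And>j. j < k \<Longrightarrow> (cyc_succ n ^^ j) x \<in> C"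
  shows "run_end n C x = (cyc_succ n ^^ k) x"
proof -
  have "(LEAST k. (cyc_succ n ^^ k) x \<notin> C) = k"
    using assms by (intro Least_equality) (auto simp: not_less[symmetric])
  then show ?thesis by (simp add: run_end_def)
qed

lemma funpow_cyc_succ_mem: "0 < n \<Longrightarrow> x \<in> {1..n} \<Longrightarrow> (cyc_succ n ^^ k) x \<in> {1..n}"
  using residue_rep_mem[of n "int x + int k"] by (simp add: cyc_succ_funpow)

lemma funpow_cyc_succ_reach:
  assumes "0 < n" "x \<in> {1..n}" "a \<in> {1..n}"
  obtains k where "(cyc_succ n ^^ k) x = a" "k < n"
proof -
  obtain m where m: "int x \<le> m" "m < int x + int n" "residue_rep n m = a" using lift_exists[OF assms(1,3)] .
  then have "(cyc_succ n ^^ nat (m - int x)) x = a" using cyc_succ_funpow[OF assms(1,2)] by simp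
  then show thesis using that[of "nat (m - int x)"] m by auto
qed

lemma run_end_steps:
  assumes n: "0 < n" and C: "C \<subseteq> {1..n}" "C \<noteq> {1..n}" and x: "x \<in> {1..n}"
  obtains k where "run_end n C x = (cyc_succ n ^^ k) x" "(cyc_succ n ^^ k) x \<in> {1..n} - C"
    "\<And>j. j < k \<Longrightarrow> (cyc_succ n ^^ j) x \<in> C"
proof -
  obtain a where a: "a \<in> {1..n}" "a \<notin> C" using C by blast
  obtain k0 where "(cyc_succ n ^^ k0) x = a" using funpow_cyc_succ_reach[OF n x a(1)] by metis
  then have ex: "(cyc_succ n ^^ k0) x \<notin> C" using a by simp
  define k where "k = (LEAST k. (cyc_succ n ^^ k) x \<notin> C)"
  have "(cyc_succ n ^^ k) x \<notin> C" unfolding k_def using ex by (rule LeastI)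
  moreover have "(cyc_succ n ^^ j) x \<in> C" if "j < k" for j using not_less_Least[of j "\<lambda>k. (cyc_succ n ^^ k) x \<notin> C"] that by (auto simp: k_def)
  moreover have "run_end n C x = (cyc_succ n ^^ k) x" by (simp add: run_end_def k_def)
  ultimately show thesis using that funpow_cyc_succ_mem[OF n x] by blast
qed

lemma run_end_notin: "x \<notin> C \<Longrightarrow> run_end n C x = x"
  using run_end_eqI[of 0 n x C] by simp

lemma run_end_in:
  assumes "0 < n" "C \<subseteq> {1..n}" "C \<noteq> {1..n}" "x \<in> C"
  shows "run_end n C x = run_end n C (cyc_succ n x)"
proof -
  have x: "cyc_succ n x \<in> {1..n}" using cyc_succ_mem[OF assms(1)] .
  obtain k where k: "run_end n C (cyc_succ n x) = (cyc_succ n ^^ k) (cyc_succ n x)"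
    "(cyc_succ n ^^ k) (cyc_succ n x) \<in> {1..n} - C" "\<And>j. j < k \<Longrightarrow> (cyc_succ n ^^ j) (cyc_succ n x) \<in> C"
    using run_end_steps[OF assms(1-3) x] by metis
  have "run_end n C x = (cyc_succ n ^^ Suc k) x"
  proof (rule run_end_eqI)
    show "(cyc_succ n ^^ Suc k) x \<notin> C" using k(2) by (simp add: funpow_swap1)
    show "(cyc_succ n ^^ j) x \<in> C" if "j < Suc k" for j
      using k(3)[of "j - 1"] assms(4) that by (cases j) (auto simp: funpow_swap1)
  qed
  then show ?thesis using k(1) by (simp add: funpow_swap1)
qed

text \<open>The block with end \<open>a\<close> consists of \<open>a\<close> and the maximal
  sequence of elements of \<open>C\<close> directly before it, hence is a cyclic interval.\<close>

lemma runs_fiber_interval: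
  assumes n: "0 < n" and C: "C \<subseteq> {1..n}" and a: "a \<in> {1..n} - C"
  obtains m where "m \<ge> 0" "{x \<in> {1..n}. run_end n C x = a} = residue_rep n ` {int a - m..int a}"
proof -
  have Cn: "C \<noteq> {1..n}" using a by blast
  \<comment> \<open>\<open>P m\<close> says that the predecessor at distance \<open>m + 1\<close> is
    outside \<open>C\<close>; so the least such \<open>m\<close> is the length of the run before
    \<open>a\<close>.\<close>
  define P where "P = (\<lambda>m::nat. residue_rep n (int a - int (Suc m)) \<notin> C)"
  have an: "a \<in> {1..n}" using a by simp
  have "residue_rep n (int a - int n) = a"
    using residue_rep_add_n[OF n, of "int a - int n"] residue_rep_of_nat[OF an] by simp
  then have "P (n - 1)" using a n by (simp add: P_def)
  define m where "m = (LEAST m. P m)"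
  have m: "P m" "m \<le> n - 1" unfolding m_def using \<open>P (n - 1)\<close> by (auto intro: LeastI Least_le)
  have inC: "residue_rep n (int a - int j) \<in> C" if "0 < j" "j \<le> m" for j
    using not_less_Least[of "j - 1" P] that by (auto simp: m_def P_def)
  have up: "(cyc_succ n ^^ k) (residue_rep n z) = residue_rep n (z + int k)" for k z
  proof (induction k)
    case (Suc k)
    then show ?case using cyc_succ_residue_rep[OF n, of "z + int k"] by (simp add: ac_simps)
  qed simp
  have "{x \<in> {1..n}. run_end n C x = a} = residue_rep n ` {int a - int m..int a}"
  proof
    show "residue_rep n ` {int a - int m..int a} \<subseteq> {x \<in> {1..n}. run_end n C x = a}"
    proof
      fix x assume "x \<in> residue_rep n ` {int a - int m..int a}"
      then obtain z where z: "int a - int m \<le> z" "z \<le> int a" "x = residue_rep n z" by auto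
      define j where "j = nat (int a - z)"
      have j: "z = int a - int j" "j \<le> m" using z by (auto simp: j_def)
      have "run_end n C x = (cyc_succ n ^^ j) x"
      proof (rule run_end_eqI)
        show "(cyc_succ n ^^ j) x \<notin> C" using residue_rep_of_nat[OF an] a by (simp add: z(3) up j)
        fix i assume "i < j"
        then have "residue_rep n (int a - int (j - i)) \<in> C" using j by (intro inC) auto
        then show "(cyc_succ n ^^ i) x \<in> C" using \<open>i < j\<close> by (simp add: z(3) up j of_nat_diff algebra_simps)
      qed
      then show "x \<in> {x \<in> {1..n}. run_end n C x = a}"
        using residue_rep_of_nat[OF an] residue_rep_mem[OF n, of z] by (simp add: z(3) up j)
    qed
    show "{x \<in> {1..n}. run_end n C x = a} \<subseteq> residue_rep n ` {int a - int m..int a}"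
    proof
      fix x assume x: "x \<in> {x \<in> {1..n}. run_end n C x = a}"
      then have xn: "x \<in> {1..n}" by simp
      obtain z where z: "int a - int n + 1 \<le> z" "z < int a - int n + 1 + int n" "residue_rep n z = x"
        using lift_exists[OF n xn] .
      show "x \<in> residue_rep n ` {int a - int m..int a}"
      proof (cases "int a - int m \<le> z")
        case False
        obtain k where k: "run_end n C x = (cyc_succ n ^^ k) x" "\<And>j. j < k \<Longrightarrow> (cyc_succ n ^^ j) x \<in> C"
          using run_end_steps[OF n C Cn xn] by metis
        define q where "q = nat (int a - int (Suc m) - z)"
        have q: "z + int q = int a - int (Suc m)" using False by (simp add: q_def)
        have "(cyc_succ n ^^ q) x \<notin> C" using m(1) by (simp add: z(3)[symmetric] up q P_def)
        then have "k \<le> q" using k(2)[of q] by (meson not_le)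
        have "residue_rep n (z + int k) = residue_rep n (int a)"
          using k(1) x residue_rep_of_nat[OF an] by (simp add: z(3)[symmetric] up)
        then have "int n dvd int a - (z + int k)" using n by (metis mod_eq_dvd_iff residue_rep_eq_iff)
        moreover have "0 < int a - (z + int k)" "int a - (z + int k) < int n"
          using \<open>k \<le> q\<close> q z(1) by linarith+
        ultimately show ?thesis using zdvd_not_zless by blast
      qed (use z in \<open>auto intro!: image_eqI[of _ _ z]\<close>)
    qed
  qed
  then show thesis using that[of "int m"] by simp
qed

text \<open>Each block is a cyclic interval, and the hull of a cyclic interval is disjoint from the
  hull of all other corners.\<close>

lemma runs_noncrossing:
  assumes n: "0 < n" and C: "C \<subseteq> {1..n}"
  shows "runs n C \<in> noncrossing n"
proof (cases "C = {1..n}")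
  case True
  then show ?thesis using n by (auto simp: runs_def noncrossing_def partition_on_def disjoint_def)
next
  case False
  define F where "F a = {x \<in> {1..n}. run_end n C x = a}" for a
  have runs: "runs n C = F ` ({1..n} - C)" using False by (simp add: runs_def F_def)
  have re: "run_end n C x \<in> {1..n} - C" if "x \<in> {1..n}" for x using run_end_steps[OF n C False that] by metis
  have "partition_on {1..n} (F ` ({1..n} - C))"
  proof (rule partition_onI)
    show "\<Union> (F ` ({1..n} - C)) = {1..n}"
    proof
      show "\<Union> (F ` ({1..n} - C)) \<subseteq> {1..n}" unfolding F_def by blast
      show "{1..n} \<subseteq> \<Union> (F ` ({1..n} - C))" using re unfolding F_def by fast
    qed
    show "{} \<notin> F ` ({1..n} - C)"
    proof
      assume "{} \<in> F ` ({1..n} - C)"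
      then obtain a where a: "a \<in> {1..n} - C" "{} = F a" by (rule imageE) simp
      then have "a \<in> F a" using run_end_notin[of a C n] by (simp add: F_def)
      then show False using a by blast
    qed
  qed (auto simp: F_def disjnt_def)
  moreover have "convex hull (pt n ` A) \<inter> convex hull (pt n ` A') = {}"
    if A: "A \<in> F ` ({1..n} - C)" "A' \<in> F ` ({1..n} - C)" "A \<noteq> A'" for A A'
  proof -
    obtain a a' where a: "a \<in> {1..n} - C" "A = F a" "A' = F a'" using A by blast
    obtain m where m: "m \<ge> 0" "A = residue_rep n ` {int a - m..int a}"
      using runs_fiber_interval[OF n C a(1)] a(2) unfolding F_def by metis
    have "A' \<subseteq> {1..n} - A" using a A(3) by (auto simp: F_def)
    then have "convex hull (pt n ` A') \<subseteq> convex hull (pt n ` ({1..n} - A))" by (intro hull_mono) auto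
    moreover have "convex hull (pt n ` A) \<inter> convex hull (pt n ` ({1..n} - A)) = {}"
      using interval_hulls_disjoint[OF n, of "int a - m" "int a"] m(1) unfolding m(2)[symmetric] by simp
    ultimately show ?thesis unfolding disjoint_iff subset_iff by metis
  qed
  ultimately show ?thesis unfolding runs by (simp add: noncrossing_def)
qed

lemma runs_neighbours:
  assumes n: "0 < n" and C: "C \<subseteq> {1..n}" and c: "c \<in> C" "A \<in> runs n C" "c \<in> A"
  shows "cyc_succ n c \<in> A"
proof (cases "C = {1..n}")
  case True
  then show ?thesis using c(2) cyc_succ_mem[OF n] by (simp add: runs_def)
next
  case False
  then obtain a where "A = {x \<in> {1..n}. run_end n C x = a}" using c(2) by (auto simp: runs_def)
  then show ?thesis using c(3) run_end_in[OF n C False c(1)] cyc_succ_mem[OF n, of c] by simp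
qed

lemma runs_singleton_iff:
  assumes n: "2 \<le> n" and C: "C \<subseteq> {1..n}" and b: "b \<in> {1..n}"
  shows "{b} \<in> runs n C \<longleftrightarrow> b \<notin> C \<and> b \<notin> cyc_succ n ` C"
proof
  assume "{b} \<in> runs n C"
  show "b \<notin> C \<and> b \<notin> cyc_succ n ` C"
  proof
    show "b \<notin> C"
    proof
      assume "b \<in> C"
      then have "cyc_succ n b \<in> {b}" using runs_neighbours[OF _ C _ \<open>{b} \<in> runs n C\<close>] n by auto
      then show False using cyc_succ_neq[OF n b] by simp
    qed
    show "b \<notin> cyc_succ n ` C"
    proof
      assume "b \<in> cyc_succ n ` C"
      then obtain c where c: "c \<in> C" "b = cyc_succ n c" by blast
      have p: "partition_on {1..n} (runs n C)" using runs_noncrossing[OF _ C] n by (auto simp: noncrossing_def)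
      then obtain A where A: "A \<in> runs n C" "c \<in> A" using c(1) C partition_onD1 by blast
      then have "b \<in> A" using runs_neighbours[OF _ C c(1) A] c(2) n by simp
      then have "A = {b}" using partition_onD2[OF p] A(1) \<open>{b} \<in> runs n C\<close> unfolding disjoint_def by (metis disjoint_iff insertI1)
      then show False using A(2) c(1) \<open>b \<notin> C\<close> by simp
    qed
  qed
next
  assume nb: "b \<notin> C \<and> b \<notin> cyc_succ n ` C"
  then have Cn: "C \<noteq> {1..n}" using b by blast
  have "x = b" if x: "x \<in> {1..n}" "run_end n C x = b" for x
  proof -
    obtain k where k: "run_end n C x = (cyc_succ n ^^ k) x" "\<And>j. j < k \<Longrightarrow> (cyc_succ n ^^ j) x \<in> C"
      using run_end_steps[OF _ C Cn x(1)] n by (metis gr0I not_numeral_le_zero)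
    show ?thesis
    proof (cases k)
      case (Suc j)
      then have "b = cyc_succ n ((cyc_succ n ^^ j) x)" using k(1) x(2) by simp
      then show ?thesis using nb k(2)[of j] Suc by blast
    qed (use k x in simp)
  qed
  moreover have "run_end n C b = b" using nb run_end_notin by blast
  ultimately have "{x \<in> {1..n}. run_end n C x = b} = {b}" using b by auto
  then show "{b} \<in> runs n C" using Cn nb b by (auto simp: runs_def image_iff)
qed

text \<open>As \<open>c\<close> is the first element of its run, no other element passes through
  \<open>c\<close> on its way to its run end. So only \<open>c\<close> changes its block.\<close>

lemma runs_split_corner:
  assumes n: "2 \<le> n" and C: "C \<subseteq> {1..n}" and c: "c \<in> C" "c \<notin> cyc_succ n ` C" and A: "A \<in> runs n C" "c \<in> A"
  shows "runs n (C - {c}) = split_corner A c (runs n C)"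
proof -
  have n0: "0 < n" using n by simp
  have cn: "c \<in> {1..n}" using c C by blast
  have Cn: "C \<noteq> {1..n}"
  proof
    assume "C = {1..n}"
    have "residue_rep n (int c - 1) \<in> C" using \<open>C = {1..n}\<close> residue_rep_mem[OF n0] by simp
    moreover have "cyc_succ n (residue_rep n (int c - 1)) = c"
      using cyc_succ_residue_rep[OF n0, of "int c - 1"] residue_rep_of_nat[OF cn] by simp
    ultimately show False using c(2) by (metis image_eqI)
  qed
  have C': "C - {c} \<subseteq> {1..n}" "C - {c} \<noteq> {1..n}" using C cn by auto
  define F where "F a = {x \<in> {1..n}. run_end n C x = a}" for a
  have rc: "run_end n (C - {c}) c = c" by (rule run_end_notin) simp
  have rx: "run_end n (C - {c}) x = run_end n C x" if x: "x \<in> {1..n}" "x \<noteq> c" for x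
  proof -
    obtain k where k: "run_end n C x = (cyc_succ n ^^ k) x" "(cyc_succ n ^^ k) x \<in> {1..n} - C"
      "\<And>j. j < k \<Longrightarrow> (cyc_succ n ^^ j) x \<in> C"
      using run_end_steps[OF n0 C Cn x(1)] by metis
    have "run_end n (C - {c}) x = (cyc_succ n ^^ k) x"
    proof (rule run_end_eqI)
      show "(cyc_succ n ^^ k) x \<notin> C - {c}" using k(2) by blast
      fix j assume j: "j < k"
      have "(cyc_succ n ^^ j) x \<noteq> c"
      proof (cases j)
        case (Suc i)
        then have "(cyc_succ n ^^ j) x = cyc_succ n ((cyc_succ n ^^ i) x)" "(cyc_succ n ^^ i) x \<in> C" using k(3)[of i] j by auto
        then show ?thesis using c(2) by (metis image_eqI)
      qed (use x in simp)
      then show "(cyc_succ n ^^ j) x \<in> C - {c}" using k(3)[OF j] by simp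
    qed
    then show ?thesis using k(1) by simp
  qed
  have re: "run_end n C x \<in> {1..n} - C" if "x \<in> {1..n}" for x using run_end_steps[OF n0 C Cn that] by metis
  have Fc: "{x \<in> {1..n}. run_end n (C - {c}) x = c} = {c}"
  proof
    show "{x \<in> {1..n}. run_end n (C - {c}) x = c} \<subseteq> {c}"
    proof (rule subsetI, rule ccontr)
      fix x assume x: "x \<in> {x \<in> {1..n}. run_end n (C - {c}) x = c}" "x \<notin> {c}"
      then have "run_end n C x = c" using rx[of x] by simp
      then show False using re[of x] x c(1) by simp
    qed
  qed (use rc cn in simp)
  have Fa: "{x \<in> {1..n}. run_end n (C - {c}) x = a} = F a - {c}" if "a \<noteq> c" for a unfolding set_eq_iff
  proof
    show "x \<in> {x \<in> {1..n}. run_end n (C - {c}) x = a} \<longleftrightarrow> x \<in> F a - {c}" for x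
      using rc rx[of x] that by (cases "x = c") (auto simp: F_def)
  qed
  define a0 where "a0 = run_end n C c"
  have a0: "a0 \<in> {1..n} - C" unfolding a0_def by (rule re[OF cn])
  have runsC: "runs n C = F ` ({1..n} - C)" using Cn by (simp add: runs_def F_def)
  have AF: "A = F a0" using A unfolding runsC by (auto simp: F_def a0_def)
  have inj: "F a = F a0 \<Longrightarrow> a = a0" if "a \<in> {1..n} - C" for a
  proof -
    assume eq: "F a = F a0"
    have "a \<in> F a" using run_end_notin[of a C n] that by (simp add: F_def)
    then have "run_end n C a = a0" unfolding eq by (simp add: F_def)
    then show "a = a0" using run_end_notin[of a C n] that by simp
  qed
  have cF: "c \<notin> F a" if "a \<noteq> a0" for a using that by (simp add: F_def a0_def)
  have dec: "{1..n} - (C - {c}) = insert c (insert a0 ({1..n} - C - {a0}))" using a0 c(1) cn by blast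
  define F' where "F' a = {x \<in> {1..n}. run_end n (C - {c}) x = a}" for a
  have "runs n (C - {c}) = F' ` ({1..n} - (C - {c}))" using C'(2) by (simp add: runs_def F'_def)
  moreover have "a0 \<noteq> c" using a0 c(1) by blast
  then have "F' a0 = F a0 - {c}" unfolding F'_def by (rule Fa)
  moreover have "F' c = {c}" unfolding F'_def by (rule Fc)
  ultimately have "runs n (C - {c}) = insert {c} (insert (F a0 - {c}) (F' ` ({1..n} - C - {a0})))"
    unfolding dec image_insert by simp
  also have "F' ` ({1..n} - C - {a0}) = (\<lambda>a. F a - {c}) ` ({1..n} - C - {a0})"
  proof (intro image_cong refl)
    fix a assume "a \<in> {1..n} - C - {a0}"
    then have "a \<noteq> c" using c(1) by blast
    then show "F' a = F a - {c}" unfolding F'_def by (rule Fa)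
  qed
  also have "(\<lambda>a. F a - {c}) ` ({1..n} - C - {a0}) = F ` ({1..n} - C - {a0})"
    using cF by (intro image_cong) auto
  also have "F ` ({1..n} - C - {a0}) = runs n C - {A}" unfolding runsC AF using inj by auto
  finally show ?thesis by (simp add: split_corner_def AF)
qed

lemma runs_empty: "n \<ge> 1 \<Longrightarrow> runs n {} = (\<lambda>i. {i}) ` {1..n}"
  using run_end_notin[of _ "{}" n] by (auto simp: runs_def image_iff)

text \<open>Otherwise every element of \<open>C\<close> has its predecessor in \<open>C\<close>; by
  counting, \<open>C\<close> is then closed under successors and fills the cycle.\<close>

lemma exists_run_start:
  assumes n: "0 < n" and C: "C \<subseteq> {1..n}" "C \<noteq> {}" "C \<noteq> {1..n}"
  obtains b where "b \<in> C" "b \<notin> cyc_succ n ` C"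
proof (rule ccontr)
  assume "\<not> thesis"
  then have "C \<subseteq> cyc_succ n ` C" using that by blast
  moreover have fin: "finite C" using C finite_subset by blast
  ultimately have eq: "cyc_succ n ` C = C"
    using card_seteq[of "cyc_succ n ` C" C] card_image_le[OF fin, of "cyc_succ n"] by simp
  obtain c where c: "c \<in> C" using C by blast
  have *: "(cyc_succ n ^^ k) c \<in> C" for k by (induction k) (use c eq in auto)
  have "{1..n} \<subseteq> C"
  proof
    fix a assume "a \<in> {1..n}"
    then obtain k where "(cyc_succ n ^^ k) c = a" using funpow_cyc_succ_reach[OF n, of c a] c C(1) by blast
    then show "a \<in> C" using *[of k] by simp
  qed
  then show False using C by blast
qed

section \<open>Move parts\<close>

text \<open>Cutting off a run start \<open>b\<close> removes the same right factor from
  \<open>\<pi>\<close> and from the run partition, and does not change the fix part. The induction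
  ends when nothing in \<open>B'\<close> moves; a full cycle has no run start and is treated
  directly.\<close>

lemma dual_simple_fix_move:
  assumes n: "n \<ge> 3" and B': "B' \<subseteq> {1..n}" and "\<pi> \<in> noncrossing_boundary n B'"
  shows "dual_simple n \<pi> = dual_simple n (fix_part B' \<pi>) \<otimes>\<^bsub>braid_group n\<^esub> dual_simple n (runs n {b \<in> B'. {b} \<notin> \<pi>})
    \<and> dual_simple n (fix_part B' \<pi>) \<in> carrier (braid_group n)"
  using assms(3)
proof (induction "card {b \<in> B'. {b} \<notin> \<pi>}" arbitrary: \<pi> rule: less_induct)
  case less
  have n0: "0 < n" using n by simp
  define C where "C = {b \<in> B'. {b} \<notin> \<pi>}"
  have C: "C \<subseteq> {1..n}" "finite C" using B' finite_subset[OF B'] by (auto simp: C_def)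
  have \<pi>: "\<pi> \<in> noncrossing n" using less.prems by (simp add: noncrossing_boundary_def)
  then have p: "partition_on {1..n} \<pi>" by (simp add: noncrossing_def)
  note hd = noncrossing_hull_disjoint[OF \<pi>]
  have same: "X = Y" if "X \<in> \<pi>" "Y \<in> \<pi>" "z \<in> X" "z \<in> Y" for X Y z
    using partition_onD2[OF p] that by (auto simp: disjoint_def)
  have nonsing: "\<exists>A\<in>\<pi>. b \<in> A \<and> cyc_succ n b \<in> A" if "b \<in> C" for b
    using less.prems that by (auto simp: noncrossing_boundary_def C_def)
  have disc: "dual_simple n ((\<lambda>i. {i}) ` {1..n}) = \<one>\<^bsub>braid_group n\<^esub>"
  proof (rule dual_simple_trivial[OF n])
    show "hull_disjoint n ((\<lambda>i. {i}) ` {1..n})"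
      using noncrossing_hull_disjoint[OF runs_noncrossing[OF n0, of "{}"]] runs_empty[of n] n by simp
  qed auto
  consider "C = {}" | "C = {1..n}" | "C \<noteq> {}" "C \<noteq> {1..n}" by blast
  then show ?case
  proof cases
    case 1
    have sing: "{b} \<in> \<pi>" if "b \<in> B'" for b using 1 that by (auto simp: C_def)
    have cases: "(\<exists>b\<in>B'. A = {b}) \<or> A \<inter> B' = {}" if "A \<in> \<pi>" for A using sing same[OF that] by blast
    have "fix_part B' \<pi> = \<pi>"
    proof
      show "fix_part B' \<pi> \<subseteq> \<pi>"
      proof
        fix X assume "X \<in> fix_part B' \<pi>"
        then consider A where "A \<in> \<pi>" "X = A - B'" "X \<noteq> {}" | b where "b \<in> B'" "X = {b}"
          unfolding fix_part_def by blast
        then show "X \<in> \<pi>"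
        proof cases
          case (1 A)
          then have "A \<inter> B' = {}" using cases[of A] by auto
          then have "X = A" using 1 by blast
          then show ?thesis using 1 by simp
        qed (use sing in auto)
      qed
      show "\<pi> \<subseteq> fix_part B' \<pi>"
      proof
        fix A assume A: "A \<in> \<pi>"
        show "A \<in> fix_part B' \<pi>"
        proof (cases "A \<inter> B' = {}")
          case True
          then have "A - B' = A" by blast
          moreover have "A \<noteq> {}" using partition_onD3[OF p] A by auto
          ultimately have "A \<in> (\<lambda>A. A - B') ` \<pi> - {{}}" using A by force
          then show ?thesis unfolding fix_part_def by blast
        qed (use cases[OF A] in \<open>auto simp: fix_part_def\<close>)
      qed
    qed
    then show ?thesis
      using 1 disc dual_simple_carrier[OF n hd] runs_empty[of n] n by (simp add: C_def[symmetric])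
  next
    case 2
    then have B'n: "B' = {1..n}" using B' by (auto simp: C_def)
    obtain A where A: "A \<in> \<pi>" "1 \<in> A" using partition_onD1[OF p] n by (metis UnionE atLeastAtMost_iff le_numeral_extra(4) order_trans one_le_numeral)
    have An: "A \<subseteq> {1..n}" using partition_onD1[OF p] A by blast
    have step: "cyc_succ n x \<in> A" if "x \<in> A" for x
    proof -
      have "x \<in> C" using 2 An that by blast
      then obtain A' where "A' \<in> \<pi>" "x \<in> A'" "cyc_succ n x \<in> A'" using nonsing by blast
      then show ?thesis using same[OF A(1) _ that] by blast
    qed
    have "(cyc_succ n ^^ k) 1 \<in> A" for k by (induction k) (use A step in auto)
    then have "{1..n} \<subseteq> A" using funpow_cyc_succ_reach[OF n0, of 1] n by (metis atLeastAtMost_iff le_refl le_trans one_le_numeral subsetI)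
    then have An': "A = {1..n}" using An by blast
    have "\<pi> = {{1..n}}"
    proof -
      have "X = {1..n}" if "X \<in> \<pi>" for X
      proof -
        have "X \<noteq> {}" using that partition_onD3[OF p] by metis
        then obtain z where "z \<in> X" by blast
        then show ?thesis using same[OF that A(1)] An' partition_onD1[OF p] that by blast
      qed
      then show ?thesis using A(1) An' by blast
    qed
    then have "fix_part B' \<pi> = (\<lambda>i. {i}) ` {1..n}" by (simp add: fix_part_def B'n)
    moreover have "runs n C = \<pi>" using 2 \<open>\<pi> = {{1..n}}\<close> by (simp add: runs_def)
    ultimately show ?thesis using disc dual_simple_carrier[OF n hd] by (simp add: C_def[symmetric])
  next
    case 3
    \<comment> \<open>Because \<open>b\<close> is not the successor of another moving element, every
      remaining moving element still shares a block with its successor after the cut.\<close>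
    obtain b where b: "b \<in> C" "b \<notin> cyc_succ n ` C" using exists_run_start[OF n0 C(1) 3] .
    have bB: "b \<in> B'" using b(1) by (simp add: C_def)
    obtain A where A: "A \<in> \<pi>" "b \<in> A" "cyc_succ n b \<in> A" using nonsing[OF b(1)] by blast
    have An: "A \<subseteq> {1..n}" using partition_onD1[OF p] A by blast
    have sb: "cyc_succ n b \<noteq> b" using cyc_succ_neq[of n b] n b(1) C(1) by auto
    have Ab: "A \<noteq> {b'}" for b' using A sb by auto
    define \<pi>' where "\<pi>' = split_corner A b \<pi>"
    have \<pi>': "\<pi>' \<in> noncrossing n" unfolding \<pi>'_def by (rule split_corner_noncrossing[OF \<pi> A(1,2) Ab])
    have succ_ne: "cyc_succ n b' \<noteq> b" and succ_in: "cyc_succ n b' \<in> A" if b': "b' \<in> B'" "b' \<in> A" for b'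
    proof -
      have "{b'} \<notin> \<pi>" using same[of "{b'}" A b'] A(1) b'(2) Ab by auto
      then have C': "b' \<in> C" using b'(1) by (simp add: C_def)
      then show "cyc_succ n b' \<noteq> b" using b(2) by blast
      obtain A' where "A' \<in> \<pi>" "b' \<in> A'" "cyc_succ n b' \<in> A'" using nonsing[OF C'] by blast
      then show "cyc_succ n b' \<in> A" using same[OF A(1) _ b'(2)] by blast
    qed
    have mem': "{b'} \<in> \<pi>' \<longleftrightarrow> b' = b \<or> {b'} \<in> \<pi>" if b': "b' \<in> B'" for b'
    proof -
      have "{b'} \<noteq> A - {b}"
      proof
        assume eq: "{b'} = A - {b}"
        then have "b' \<in> A" "b' \<noteq> b" by auto
        then have "cyc_succ n b' \<in> A - {b}" using succ_in[OF b'] succ_ne[OF b'] by simp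
        then have "cyc_succ n b' = b'" using eq by auto
        then show False using cyc_succ_neq[of n b'] n \<open>b' \<in> A\<close> An by auto
      qed
      then show ?thesis using Ab[of b'] by (auto simp: \<pi>'_def split_corner_def)
    qed
    have C': "{b \<in> B'. {b} \<notin> \<pi>'} = C - {b}" using mem' by (auto simp: C_def)
    have "\<pi>' \<in> noncrossing_boundary n B'" unfolding noncrossing_boundary_def
    proof (intro CollectI conjI \<pi>' ballI)
      fix b' assume b': "b' \<in> B'"
      show "{b'} \<in> \<pi>' \<or> (\<exists>A\<in>\<pi>'. b' \<in> A \<and> cyc_succ n b' \<in> A)"
      proof (cases "b' = b \<or> {b'} \<in> \<pi>")
        case False
        then obtain A' where A': "A' \<in> \<pi>" "b' \<in> A'" "cyc_succ n b' \<in> A'" using nonsing[of b'] b' by (auto simp: C_def)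
        show ?thesis
        proof (cases "A' = A")
          case True
          then have "b' \<in> A - {b}" "cyc_succ n b' \<in> A - {b}" using A' False succ_ne[OF b'] by auto
          then show ?thesis unfolding \<pi>'_def split_corner_def by (intro disjI2 bexI[of _ "A - {b}"]) simp_all
        next
          case False
          then show ?thesis using A' unfolding \<pi>'_def split_corner_def by (intro disjI2 bexI[of _ A']) simp_all
        qed
      qed (use mem'[OF b'] in simp)
    qed
    moreover have "card {b \<in> B'. {b} \<notin> \<pi>'} < card {b \<in> B'. {b} \<notin> \<pi>}"
      unfolding C' C_def[symmetric] using b(1) C(2) by (rule card_Diff1_less[rotated])
    ultimately have IH: "dual_simple n \<pi>' = dual_simple n (fix_part B' \<pi>') \<otimes>\<^bsub>braid_group n\<^esub> dual_simple n (runs n (C - {b}))"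
      "dual_simple n (fix_part B' \<pi>') \<in> carrier (braid_group n)"
      using less.hyps[of \<pi>'] C' by auto
    have fixeq: "fix_part B' \<pi>' = fix_part B' \<pi>"
    proof -
      have "(\<lambda>A. A - B') ` \<pi>' = insert {} (insert (A - B') ((\<lambda>A. A - B') ` (\<pi> - {A})))"
        using bB by (auto simp: \<pi>'_def split_corner_def)
      moreover have "(\<lambda>A. A - B') ` \<pi> = insert (A - B') ((\<lambda>A. A - B') ` (\<pi> - {A}))" using A(1) by blast
      ultimately show ?thesis by (simp add: fix_part_def)
    qed
    define \<sigma> where "\<sigma> = rotation_braid n {b, cyc_succ n b}"
    have \<sigma>c: "\<sigma> \<in> carrier (braid_group n)" unfolding \<sigma>_def using A An by (intro rotation_braid_carrier[OF n]) auto
    have "dual_simple n \<pi> = dual_simple n \<pi>' \<otimes>\<^bsub>braid_group n\<^esub> \<sigma>"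
      unfolding \<pi>'_def \<sigma>_def by (rule dual_simple_split_corner[OF n \<pi> A])
    moreover have "dual_simple n (runs n C) = dual_simple n (runs n (C - {b})) \<otimes>\<^bsub>braid_group n\<^esub> \<sigma>"
    proof -
      note rn = runs_noncrossing[OF n0 C(1)]
      then have "{1..n} = \<Union> (runs n C)" unfolding noncrossing_def by (auto dest: partition_onD1)
      then obtain R where R: "R \<in> runs n C" "b \<in> R" using b(1) C(1) by blast
      have "runs n (C - {b}) = split_corner R b (runs n C)" using runs_split_corner[OF _ C(1) b R] n by simp
      then show ?thesis
        using dual_simple_split_corner[OF n rn R runs_neighbours[OF n0 C(1) b(1) R]] by (simp add: \<sigma>_def)
    qed
    moreover have "dual_simple n (runs n (C - {b})) \<in> carrier (braid_group n)"
      using C(1) by (intro dual_simple_carrier[OF n] noncrossing_hull_disjoint runs_noncrossing[OF n0]) auto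
    ultimately show ?thesis using IH \<sigma>c unfolding fixeq C_def[symmetric] by (simp add: m_assoc)
  qed
qed

text \<open>The factor found above solves the defining equation of the move part, and injectivity of
  \<open>dual_simple\<close> makes it the only solution.\<close>

lemma move_part_eq:
  assumes n: "n \<ge> 3" and B': "B' \<subseteq> {1..n}" and \<pi>: "\<pi> \<in> noncrossing_boundary n B'"
  shows "move_part n B' \<pi> = runs n {b \<in> B'. {b} \<notin> \<pi>}"
proof -
  define C where "C = {b \<in> B'. {b} \<notin> \<pi>}"
  have C: "C \<subseteq> {1..n}" using B' by (auto simp: C_def)
  have rn: "runs n C \<in> noncrossing n" using runs_noncrossing[OF _ C] n by simp
  note c = dual_simple_carrier[OF n noncrossing_hull_disjoint[OF rn]]
  have *: "inv\<^bsub>braid_group n\<^esub> (dual_simple n (fix_part B' \<pi>)) \<otimes>\<^bsub>braid_group n\<^esub> dual_simple n \<pi> = dual_simple n (runs n C)"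
    using dual_simple_fix_move[OF n B' \<pi>] c unfolding C_def[symmetric] by (simp add: m_assoc[symmetric])
  show ?thesis unfolding move_part_def * C_def[symmetric]
    by (rule the_equality) (use rn dual_simple_inj[OF n] in auto)
qed

lemma out_edges_runs:
  assumes n: "n \<ge> 3" and B': "B' \<subseteq> {1..n}" and C: "C \<in> out_edges n B'"
  shows "{b \<in> B'. {b} \<notin> runs n C} = C" "runs n C \<in> noncrossing_boundary n B'" "runs n C \<in> noncrossing_proper n"
    "move_part n B' (runs n C) = runs n C"
proof -
  have C': "C \<subseteq> {1..n}" "C \<subseteq> B'" "C \<noteq> {}" "cyc_succ n ` C \<inter> (B' - C) = {}" using C B' by (auto simp: out_edges_def)
  have sing: "{b} \<in> runs n C \<longleftrightarrow> b \<notin> C" if "b \<in> B'" for b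
  proof -
    have "b \<in> {1..n}" "b \<in> C \<or> b \<notin> cyc_succ n ` C" using C'(4) B' that by blast+
    then show ?thesis using runs_singleton_iff[of n C b] n C'(1) by auto
  qed
  show eq: "{b \<in> B'. {b} \<notin> runs n C} = C" using sing C'(2) by blast
  have rn: "runs n C \<in> noncrossing n" using runs_noncrossing[OF _ C'(1)] n by simp
  then have p: "partition_on {1..n} (runs n C)" by (simp add: noncrossing_def)
  show nb: "runs n C \<in> noncrossing_boundary n B'" unfolding noncrossing_boundary_def
  proof (intro CollectI conjI rn ballI)
    fix b assume b: "b \<in> B'"
    show "{b} \<in> runs n C \<or> (\<exists>A\<in>runs n C. b \<in> A \<and> cyc_succ n b \<in> A)"
    proof (cases "b \<in> C")
      case True
      then obtain A where "A \<in> runs n C" "b \<in> A" using C'(1) partition_onD1[OF p] by blast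
      then show ?thesis using runs_neighbours[OF _ C'(1) True] n by auto
    qed (use sing[OF b] in simp)
  qed
  show "runs n C \<in> noncrossing_proper n"
  proof -
    obtain c where c: "c \<in> C" using C'(3) by blast
    then have "{c} \<notin> runs n C" using sing C'(2) by blast
    moreover have "{c} \<in> (\<lambda>i. {i}) ` {1..n}" using c C'(1) by blast
    ultimately show ?thesis using rn unfolding noncrossing_proper_def by auto
  qed
  show "move_part n B' (runs n C) = runs n C" using move_part_eq[OF n B' nb] eq by simp
qed

text \<open>So an admissible label of an edge of the splitting is determined by the set of points
  that the edge moves.\<close>

lemma move_part_self:
  assumes n: "n \<ge> 3" and B': "B' \<subseteq> {1..n}" and "\<pi> \<in> noncrossing_boundary n B'" "move_part n B' \<pi> = \<pi>"
  shows "\<pi> = runs n {b \<in> B'. {b} \<notin> \<pi>}"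
  using move_part_eq[OF assms(1-3)] assms(4) by simp

lemma dual_simple_runs_step:
  assumes n: "n \<ge> 3" and C: "C \<subseteq> {1..n}" and c: "c \<in> C" "c \<notin> cyc_succ n ` C"
  shows "dual_simple n (runs n C) = dual_simple n (runs n (C - {c})) \<otimes>\<^bsub>braid_group n\<^esub> rotation_braid n {c, cyc_succ n c}"
proof -
  have n0: "0 < n" using n by simp
  note rn = runs_noncrossing[OF n0 C]
  then have "{1..n} = \<Union> (runs n C)" unfolding noncrossing_def by (auto dest: partition_onD1)
  then obtain R where R: "R \<in> runs n C" "c \<in> R" using c(1) C by blast
  have "runs n (C - {c}) = split_corner R c (runs n C)" using runs_split_corner[OF _ C c R] n by simp
  then show ?thesis using dual_simple_split_corner[OF n rn R runs_neighbours[OF n0 C c(1) R]] by simp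
qed

section \<open>The configuration space of the cycle\<close>

text \<open>The metric form of avoiding the thick diagonal: on the cycle of length \<open>n\<close>
  distinct points keep distance at least one. The next lemmas show that this describes the union of
  the admissible simplices.\<close>

definition apart :: "nat \<Rightarrow> nat set \<Rightarrow> (nat \<Rightarrow> real) \<Rightarrow> bool" where
  "apart n I x \<longleftrightarrow> (\<forall>i\<in>I. \<forall>j\<in>I. i \<noteq> j \<longrightarrow> (\<forall>m::int. 1 \<le> \<bar>x i - x j - of_int m * real n\<bar>))"

text \<open>The layer cake decomposition. Subtracting the least positive value from all positive
  entries splits off the largest set of the chain; the remaining weights have the bound
  \<open>M - m\<close>.\<close>

lemma superlevel_chain:
  fixes \<xi> :: "nat \<Rightarrow> real"
  assumes "finite I" "\<forall>i\<in>I. 0 \<le> \<xi> i \<and> \<xi> i \<le> M" "0 \<le> M"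
  shows "\<exists>Cs w. sorted_wrt (\<subset>) Cs \<and>
    (\<forall>C\<in>set Cs. C \<noteq> {} \<and> C \<subseteq> {i \<in> I. 0 < \<xi> i} \<and> (\<forall>i\<in>C. \<forall>j\<in>I. \<xi> i \<le> \<xi> j \<longrightarrow> j \<in> C)) \<and>
    (\<forall>l<length Cs. (0::real) \<le> w l) \<and> (\<Sum>l<length Cs. w l) \<le> M \<and>
    (\<forall>i\<in>I. \<xi> i = (\<Sum>l<length Cs. w l * indicator (Cs ! l) i))"
  using assms(2,3)
proof (induction "card {i \<in> I. 0 < \<xi> i}" arbitrary: \<xi> M rule: less_induct)
  case less
  define S where "S = {i \<in> I. 0 < \<xi> i}"
  show ?case
  proof (cases "S = {}")
    case True
    then have "\<forall>i\<in>I. \<xi> i = 0" using less.prems(1) by (force simp: S_def)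
    then show ?thesis using less.prems(2) by (intro exI[of _ "[]"]) simp
  next
    case False
    have finS: "finite S" using assms(1) by (simp add: S_def)
    define m where "m = Min (\<xi> ` S)"
    have "m \<in> \<xi> ` S" unfolding m_def using finS False by (intro Min_in) auto
    then obtain s0 where s0: "s0 \<in> S" "\<xi> s0 = m" by blast
    have m_le: "m \<le> \<xi> i" if "i \<in> S" for i unfolding m_def using finS that by (intro Min_le) auto
    have m0: "0 < m" "m \<le> M" using s0 less.prems(1) by (auto simp: S_def)
    have out: "\<xi> i = 0" if "i \<in> I" "i \<notin> S" for i using that less.prems(1) by (force simp: S_def)
    define \<xi>' where "\<xi>' i = (if i \<in> S then \<xi> i - m else \<xi> i)" for i
    define S' where "S' = {i \<in> I. 0 < \<xi>' i}"
    have S'sub: "S' \<subseteq> S"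
    proof
      fix x assume "x \<in> S'"
      then show "x \<in> S" using out[of x] by (cases "x \<in> S") (simp_all add: S'_def \<xi>'_def)
    qed
    moreover have "s0 \<notin> S'" using s0 by (simp add: S'_def \<xi>'_def)
    ultimately have S': "S' \<subseteq> S" "S' \<subset> S" using s0(1) by blast+
    then have "card S' < card S" using finS by (intro psubset_card_mono)
    moreover have "\<forall>i\<in>I. 0 \<le> \<xi>' i \<and> \<xi>' i \<le> M - m" using m_le m0 out less.prems(1) by (auto simp: \<xi>'_def)
    ultimately have "\<exists>Cs w. sorted_wrt (\<subset>) Cs \<and>
        (\<forall>C\<in>set Cs. C \<noteq> {} \<and> C \<subseteq> S' \<and> (\<forall>i\<in>C. \<forall>j\<in>I. \<xi>' i \<le> \<xi>' j \<longrightarrow> j \<in> C)) \<and>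
        (\<forall>l<length Cs. (0::real) \<le> w l) \<and> (\<Sum>l<length Cs. w l) \<le> M - m \<and>
        (\<forall>i\<in>I. \<xi>' i = (\<Sum>l<length Cs. w l * indicator (Cs ! l) i))"
      unfolding S'_def by (intro less.hyps) (use m0 in \<open>simp_all add: S_def\<close>)
    then obtain Cs w where Cs: "sorted_wrt (\<subset>) Cs"
      and up0: "\<forall>C\<in>set Cs. C \<noteq> {} \<and> C \<subseteq> S' \<and> (\<forall>i\<in>C. \<forall>j\<in>I. \<xi>' i \<le> \<xi>' j \<longrightarrow> j \<in> C)"
      and w0: "\<forall>l<length Cs. (0::real) \<le> w l" "(\<Sum>l<length Cs. w l) \<le> M - m"
        "\<forall>i\<in>I. \<xi>' i = (\<Sum>l<length Cs. w l * indicator (Cs ! l) i)"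
      by (elim exE conjE) (rule that)
    note up = bspec[OF up0] and w = w0(1)[rule_format] w0(2) bspec[OF w0(3)]
    show ?thesis
    proof (intro exI conjI ballI allI impI)
      show "sorted_wrt (\<subset>) (Cs @ [S])" using Cs up S'(2) by (auto simp: sorted_wrt_append)
      show "0 \<le> (w(length Cs := m)) l" if "l < length (Cs @ [S])" for l
        using w(1) m0 that by (cases "l = length Cs") auto
      have "(\<Sum>l<length Cs. (w(length Cs := m)) l) = (\<Sum>l<length Cs. w l)" by (intro sum.cong) auto
      then show "(\<Sum>l<length (Cs @ [S]). (w(length Cs := m)) l) \<le> M" using w(2) by simp
      show "\<xi> i = (\<Sum>l<length (Cs @ [S]). (w(length Cs := m)) l * indicator ((Cs @ [S]) ! l) i)" if "i \<in> I" for i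
      proof -
        have "(\<Sum>l<length Cs. (w(length Cs := m)) l * indicator ((Cs @ [S]) ! l) i) =
            (\<Sum>l<length Cs. w l * indicator (Cs ! l) i)"
          by (intro sum.cong) (auto simp: nth_append)
        then show ?thesis using w(3)[OF that] by (auto simp: \<xi>'_def indicator_def)
      qed
      fix C assume C: "C \<in> set (Cs @ [S])"
      show "C \<noteq> {}" using C up False by auto
      show "C \<subseteq> {i \<in> I. 0 < \<xi> i}" using C up S'(1) unfolding S_def[symmetric] by auto
      fix i j assume ij: "i \<in> C" "j \<in> I" "\<xi> i \<le> \<xi> j"
      show "j \<in> C"
      proof (cases "C = S")
        case True
        then show ?thesis using ij by (auto simp: S_def)
      next
        case False
        then have "C \<in> set Cs" using C by simp
        moreover have "i \<in> S" using up[OF calculation] ij(1) S'(1) by blast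
        moreover have "j \<in> S" using \<open>i \<in> S\<close> ij by (auto simp: S_def)
        ultimately show ?thesis using up[of C] ij by (simp add: \<xi>'_def)
      qed
    qed
  qed
qed

text \<open>As the sets of the chain are nested, one of any two indices, say \<open>i\<close>, is in
  every set that contains the other. Then the difference is an integer \<open>e\<close> plus a
  weight \<open>s\<close> between \<open>0\<close> and \<open>1\<close>. The first vertex excludes
  \<open>e = 0\<close>, and a vertex that raises only \<open>i\<close> excludes
  \<open>e = -1\<close> unless \<open>s = 0\<close>.\<close>

lemma orthoscheme_apart:
  assumes n: "0 < n" and chain: "orthoscheme_chain k Cs"
    and inj: "\<forall>x\<in>orthoscheme k z Cs. inj_on (\<lambda>i. circ n (x i)) {1..k}" and y: "y \<in> orthoscheme k z Cs"
  shows "apart n {1..k} y"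
proof -
  define L where "L = length Cs"
  obtain w where w: "\<And>l. l < L \<Longrightarrow> 0 \<le> w l" "(\<Sum>l<L. w l) \<le> 1"
    "y = (\<lambda>i\<in>{1..k}. real_of_int (z i) + (\<Sum>l<L. w l * indicator (Cs ! l) i))"
    using y unfolding orthoscheme_def L_def by blast
  have v0: "(\<lambda>i\<in>{1..k}. real_of_int (z i)) \<in> orthoscheme k z Cs"
    unfolding orthoscheme_def by (intro CollectI exI[of _ "\<lambda>_. 0"]) simp
  have vl: "(\<lambda>i\<in>{1..k}. real_of_int (z i) + indicator (Cs ! l) i) \<in> orthoscheme k z Cs" if "l < L" for l
    unfolding orthoscheme_def L_def[symmetric]
    using that by (intro CollectI exI[of _ "\<lambda>j. if j = l then 1 else 0"]) (auto simp: if_distrib[where f = "\<lambda>x. x * _"] sum.delta' cong: if_cong)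
  have ne: "x i - x j - of_int m * real n \<noteq> 0"
    if "x \<in> orthoscheme k z Cs" "i \<in> {1..k}" "j \<in> {1..k}" "i \<noteq> j" for x i j and m :: int
  proof
    assume "x i - x j - of_int m * real n = 0"
    then have "circ n (x i) = circ n (x j)" using circ_eq_iff[OF n, of "x i" "x j"] by (metis eq_iff_diff_eq_0 add.commute diff_add_eq add_diff_cancel_left' diff_diff_add)
    then show False using inj that by (meson inj_onD)
  qed
  have dir: "1 \<le> \<bar>y i - y j - of_int m * real n\<bar>"
    if ij: "i \<in> {1..k}" "j \<in> {1..k}" "i \<noteq> j" and sub: "\<And>l. l < L \<Longrightarrow> j \<in> Cs ! l \<Longrightarrow> i \<in> Cs ! l" for i j and m :: int
  proof -
    define u where "u l = w l * (indicator (Cs ! l) i - indicator (Cs ! l) j)" for l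
    define s where "s = (\<Sum>l<L. u l)"
    have u: "0 \<le> u l" "u l \<le> w l" if "l < L" for l
      using w(1)[OF that] sub[OF that] by (auto simp: u_def indicator_def)
    have s: "0 \<le> s" "s \<le> 1"
      using u w(2) sum_nonneg[of "{..<L}" u] sum_mono[of "{..<L}" u w] by (auto simp: s_def)
    define e where "e = z i - z j - m * int n"
    have yij: "y i - y j - of_int m * real n = real_of_int e + s"
      using ij by (simp add: w(3) e_def s_def u_def algebra_simps sum_subtractf)
    have "e \<noteq> 0"
    proof
      assume "e = 0"
      then have "real_of_int (z i) - real_of_int (z j) - of_int m * real n = 0"
        unfolding e_def by (metis of_int_0 of_int_diff of_int_mult of_int_of_nat_eq)
      then show False using ne[OF v0 ij, of m] ij by simp
    qed
    moreover have "s = 0" if "e = -1"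
    proof (rule ccontr)
      assume "s \<noteq> 0"
      then obtain l where l: "l < L" "u l \<noteq> 0" unfolding s_def by (metis lessThan_iff sum.neutral)
      then have il: "i \<in> Cs ! l" "j \<notin> Cs ! l" using sub[OF l(1)] unfolding u_def indicator_def by (cases "i \<in> Cs ! l"; cases "j \<in> Cs ! l"; simp)+
      have "real_of_int (z i) + 1 - real_of_int (z j) - of_int m * real n = real_of_int (e + 1)"
        by (simp add: e_def)
      then have "real_of_int (z i) + 1 - real_of_int (z j) - of_int m * real n = 0" using that by simp
      then show False using ne[OF vl[OF l(1)] ij, of m] ij il by simp
    qed
    moreover have "e = -1 \<or> e = 0 \<or> e \<ge> 1 \<or> e \<le> -2" by linarith
    moreover have "1 \<le> \<bar>real_of_int e + s\<bar>" if "e \<ge> 1" using that s by simp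
    moreover have "1 \<le> \<bar>real_of_int e + s\<bar>" if "e \<le> -2"
    proof -
      have "real_of_int e \<le> -2" using that by linarith
      then show ?thesis using s by simp
    qed
    ultimately show ?thesis unfolding yij by fastforce
  qed
  show ?thesis unfolding apart_def
  proof (intro ballI impI allI)
    fix i j and m :: int assume ij: "i \<in> {1..k}" "j \<in> {1..k}" "i \<noteq> j"
    show "1 \<le> \<bar>y i - y j - of_int m * real n\<bar>"
    proof (cases "\<forall>l<L. j \<in> Cs ! l \<longrightarrow> i \<in> Cs ! l")
      case False
      then obtain l where l: "l < L" "j \<in> Cs ! l" "i \<notin> Cs ! l" by blast
      have nested: "Cs ! a \<subseteq> Cs ! b \<or> Cs ! b \<subseteq> Cs ! a" if "a < L" "b < L" for a b
        using chain that unfolding orthoscheme_chain_def sorted_wrt_iff_nth_less L_def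
        by (metis linorder_neqE_nat psubsetE subset_refl)
      have "j \<in> Cs ! l'" if "l' < L" "i \<in> Cs ! l'" for l' using nested[OF l(1) that(1)] l that(2) by blast
      then have "1 \<le> \<bar>y j - y i - real_of_int (- m) * real n\<bar>" using dir[of j i "- m"] ij by blast
      then show ?thesis by (simp add: abs_le_iff)
    qed (use dir ij in blast)
  qed
qed

text \<open>The simplex is spanned by the integer parts and the superlevel sets of the fractional
  parts. Hence the fractional weights of any of its points are ordered as those of \<open>y\<close>,
  and the distance of at least one in \<open>y\<close> leaves no room for equal points anywhere in
  the simplex.\<close>

lemma apart_orthoscheme:
  assumes n: "0 < n" and y: "apart n {1..k} y"
  obtains z Cs where "orthoscheme_chain k Cs" "\<forall>x\<in>orthoscheme k z Cs. inj_on (\<lambda>i. circ n (x i)) {1..k}"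
    "restrict y {1..k} \<in> orthoscheme k z Cs"
proof -
  define z where "z i = \<lfloor>y i\<rfloor>" for i
  define \<xi> where "\<xi> i = y i - real_of_int (z i)" for i
  have \<xi>: "0 \<le> \<xi> i" "\<xi> i < 1" for i using floor_correct[of "y i"] unfolding \<xi>_def z_def by linarith+
  have yz: "y i = real_of_int (z i) + \<xi> i" for i by (simp add: \<xi>_def)
  obtain Cs w where Cs: "sorted_wrt (\<subset>) Cs"
    and up: "\<forall>C\<in>set Cs. C \<noteq> {} \<and> C \<subseteq> {i \<in> {1..k}. 0 < \<xi> i} \<and> (\<forall>i\<in>C. \<forall>j\<in>{1..k}. \<xi> i \<le> \<xi> j \<longrightarrow> j \<in> C)"
    and w: "\<forall>l<length Cs. (0::real) \<le> w l" "(\<Sum>l<length Cs. w l) \<le> 1"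
      "\<forall>i\<in>{1..k}. \<xi> i = (\<Sum>l<length Cs. w l * indicator (Cs ! l) i)"
  proof -
    have "\<forall>i\<in>{1..k}. 0 \<le> \<xi> i \<and> \<xi> i \<le> 1" using \<xi> less_imp_le by metis
    from superlevel_chain[OF finite_atLeastAtMost this zero_le_one] show thesis by (elim exE conjE) (rule that)
  qed
  show thesis
  proof (rule that)
    show "orthoscheme_chain k Cs" using Cs up unfolding orthoscheme_chain_def by blast
    show "restrict y {1..k} \<in> orthoscheme k z Cs"
      unfolding orthoscheme_def using w by (intro CollectI exI[of _ w] conjI restrict_ext) (auto simp: yz)
    show "\<forall>x\<in>orthoscheme k z Cs. inj_on (\<lambda>i. circ n (x i)) {1..k}"
    proof (intro ballI inj_onI)
      fix x i j assume x: "x \<in> orthoscheme k z Cs" and ij: "i \<in> {1..k}" "j \<in> {1..k}" "circ n (x i) = circ n (x j)"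
      obtain v where v: "\<And>l. l < length Cs \<Longrightarrow> 0 \<le> v l" "(\<Sum>l<length Cs. v l) \<le> 1"
        "x = (\<lambda>i\<in>{1..k}. real_of_int (z i) + (\<Sum>l<length Cs. v l * indicator (Cs ! l) i))"
        using x unfolding orthoscheme_def by blast
      define S where "S i = (\<Sum>l<length Cs. v l * indicator (Cs ! l) i)" for i
      have S: "0 \<le> S i" "S i \<le> 1" for i
      proof -
        show "0 \<le> S i" unfolding S_def using v(1) by (intro sum_nonneg) (auto simp: indicator_def)
        have "S i \<le> (\<Sum>l<length Cs. v l)" unfolding S_def using v(1) by (intro sum_mono) (auto simp: indicator_def)
        then show "S i \<le> 1" using v(2) by simp
      qed
      have Smono: "S i \<le> S j" if "j \<in> {1..k}" "\<xi> i \<le> \<xi> j" for i j unfolding S_def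
      proof (rule sum_mono)
        fix l assume "l \<in> {..<length Cs}"
        then have l: "l < length Cs" "Cs ! l \<in> set Cs" by auto
        then have "i \<in> Cs ! l \<Longrightarrow> j \<in> Cs ! l" using up that by blast
        then show "v l * indicator (Cs ! l) i \<le> v l * indicator (Cs ! l) j"
          using v(1)[OF l(1)] by (auto simp: indicator_def)
      qed
      have main: "x i - x j - of_int m * real n \<noteq> 0"
        if ij: "i \<in> {1..k}" "j \<in> {1..k}" "i \<noteq> j" "\<xi> i \<le> \<xi> j" for i j and m :: int
      proof -
        define e where "e = z i - z j - m * int n"
        have "1 \<le> \<bar>y i - y j - of_int m * real n\<bar>" using y ij unfolding apart_def by blast
        also have "y i - y j - of_int m * real n = real_of_int e + \<xi> i - \<xi> j" by (simp add: yz e_def)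
        finally have ey: "1 \<le> \<bar>real_of_int e + \<xi> i - \<xi> j\<bar>" .
        have ex: "x i - x j - of_int m * real n = real_of_int e + S i - S j"
          using ij by (simp add: v(3) S_def[symmetric] e_def)
        have ss: "S i \<le> S j" by (rule Smono[OF ij(2,4)])
        consider "e \<le> -1" | "e = 0" | "e = 1" | "e \<ge> 2" by linarith
        then show ?thesis
        proof cases
          case 1
          then have "real_of_int e \<le> -1" by linarith
          then show ?thesis using ss unfolding ex by linarith
        next
          case 2
          then show ?thesis using ey \<xi>(1)[of i] \<xi>(2)[of j] ij(4) by simp
        next
          case 3
          then have "\<xi> j \<le> \<xi> i" using ey \<xi>(1)[of i] \<xi>(2)[of j] by (simp add: abs_if split: if_splits)
          then have "S i = S j" using Smono[OF ij(1)] ss by (metis order_antisym)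
          then show ?thesis unfolding ex using 3 by simp
        next
          case 4
          then have "real_of_int e \<ge> 2" by linarith
          then show ?thesis using S(1)[of i] S(2)[of j] unfolding ex by linarith
        qed
      qed
      obtain m :: int where m: "x i = x j + of_int m * real n" using circ_eq_iff[OF n] ij(3) by metis
      show "i = j"
      proof (rule ccontr)
        assume "i \<noteq> j"
        then show False using main[of i j m] main[of j i "- m"] m ij by (cases "\<xi> i \<le> \<xi> j") auto
      qed
    qed
  qed
qed

lemma apart_inj_on:
  assumes "0 < n" "apart n I x"
  shows "inj_on (\<lambda>i. circ n (x i)) I"
proof (rule inj_onI, rule ccontr)
  fix i j assume ij: "i \<in> I" "j \<in> I" "circ n (x i) = circ n (x j)" "i \<noteq> j"
  obtain m :: int where "x i = x j + of_int m * real n" using circ_eq_iff[OF assms(1)] ij(3) by metis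
  moreover have "1 \<le> \<bar>x i - x j - of_int m * real n\<bar>" using assms(2) ij unfolding apart_def by blast
  ultimately show False by simp
qed

lemma topspace_cycle_uconf:
  assumes n: "0 < n"
  shows "A \<in> topspace (cycle_uconf n k) \<longleftrightarrow> (\<exists>y. apart n {1..k} y \<and> A = (\<lambda>i. circ n (y i)) ` {1..k})"
proof
  assume "A \<in> topspace (cycle_uconf n k)"
  then obtain y z Cs where "A = (\<lambda>i. circ n (y i)) ` {1..k}" "orthoscheme_chain k Cs"
    "\<forall>x\<in>orthoscheme k z Cs. inj_on (\<lambda>i. circ n (x i)) {1..k}" "y \<in> orthoscheme k z Cs"
    unfolding cycle_uconf_def topspace_subtopology by blast
  then show "\<exists>y. apart n {1..k} y \<and> A = (\<lambda>i. circ n (y i)) ` {1..k}" using orthoscheme_apart[OF n] by blast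
next
  assume "\<exists>y. apart n {1..k} y \<and> A = (\<lambda>i. circ n (y i)) ` {1..k}"
  then obtain y where y: "apart n {1..k} y" "A = (\<lambda>i. circ n (y i)) ` {1..k}" by blast
  obtain z Cs where zC: "orthoscheme_chain k Cs" "\<forall>x\<in>orthoscheme k z Cs. inj_on (\<lambda>i. circ n (x i)) {1..k}"
    "restrict y {1..k} \<in> orthoscheme k z Cs" using apart_orthoscheme[OF n y(1)] .
  have "A = (\<lambda>i. circ n (restrict y {1..k} i)) ` {1..k}" unfolding y(2) by (intro image_cong) auto
  moreover have "A \<in> topspace (uconf k (sphere 0 1))"
    unfolding topspace_uconf y(2) using card_image[OF apart_inj_on[OF n y(1)]] by auto
  ultimately show "A \<in> topspace (cycle_uconf n k)"
    unfolding cycle_uconf_def topspace_subtopology using zC by blast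
qed

lemma cycle_uconf_gaps:
  fixes x x' :: real
  assumes n: "0 < n" and A: "A \<in> topspace (cycle_uconf n k)" and x: "circ n x \<in> A" "circ n x' \<in> A" "circ n x \<noteq> circ n x'"
  shows "1 \<le> \<bar>x - x' - of_int m * real n\<bar>"
proof -
  obtain y where y: "apart n {1..k} y" "A = (\<lambda>i. circ n (y i)) ` {1..k}"
    using A topspace_cycle_uconf[OF n] by blast
  obtain i j where ij: "i \<in> {1..k}" "j \<in> {1..k}" "circ n x = circ n (y i)" "circ n x' = circ n (y j)"
    using x(1,2) unfolding y(2) by blast
  obtain p q :: int where pq: "x = y i + of_int p * real n" "x' = y j + of_int q * real n"
    using ij(3,4) circ_eq_iff[OF n] by metis
  have "i \<noteq> j" using ij x(3) by auto
  then have "1 \<le> \<bar>y i - y j - real_of_int (m + q - p) * real n\<bar>" using y(1) ij(1,2) unfolding apart_def by blast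
  moreover have "y i - y j - real_of_int (m + q - p) * real n = x - x' - of_int m * real n"
    by (simp add: pq algebra_simps)
  ultimately show ?thesis by simp
qed

lemma spaced_apart:
  assumes n: "0 < n" and d: "spaced n B d"
  shows "apart n B (\<lambda>b. real b + d b)"
proof -
  have *: "1 \<le> \<bar>(real b' + d b') - (real b + d b) - of_int m * real n\<bar>" if b: "b \<in> B" "b' \<in> B" "b < b'" for b b' and m :: int
  proof -
    define D where "D = (real b' + d b') - (real b + d b)"
    have D: "1 \<le> D" "D \<le> real n - 1" using d b by (auto simp: spaced_def D_def)
    show ?thesis
    proof (cases "m \<le> 0")
      case True
      then have "of_int m * real n \<le> 0" by (simp add: mult_nonpos_nonneg)
      then show ?thesis using D unfolding D_def[symmetric] by linarith
    next
      case False
      then have "1 * real n \<le> of_int m * real n" by (intro mult_right_mono) auto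
      then show ?thesis using D unfolding D_def[symmetric] by linarith
    qed
  qed
  show ?thesis unfolding apart_def
  proof (intro ballI impI allI)
    fix b b' and m :: int assume b: "b \<in> B" "b' \<in> B" "b \<noteq> b'"
    show "1 \<le> \<bar>real b + d b - (real b' + d b') - of_int m * real n\<bar>"
    proof (cases "b < b'")
      case True
      then show ?thesis using *[OF b(1,2) True, of "- m"] by (simp add: abs_le_iff)
    qed (use *[of b' b m] b in auto)
  qed
qed

section \<open>Lifting paths in the cycle space to spaced displacements\<close>

lemma continuous_map_cycle_uconf:
  fixes Y :: "nat \<Rightarrow> 'q::topological_space \<Rightarrow> real"
  assumes n: "0 < n" and B: "finite B" and Y: "\<And>b. b \<in> B \<Longrightarrow> continuous_on Q (Y b)"
    and sp: "\<And>q. q \<in> Q \<Longrightarrow> spaced n B (\<lambda>b. Y b q - real b)"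
  shows "continuous_map (top_of_set Q) (cycle_uconf n (card B)) (\<lambda>q. (\<lambda>b. circ n (Y b q)) ` B)"
proof -
  have ap: "apart n B (\<lambda>b. Y b q)" if "q \<in> Q" for q using spaced_apart[OF n sp[OF that]] by simp
  have cm: "continuous_map (top_of_set Q) (uconf (card B) (sphere 0 1)) (\<lambda>q. (\<lambda>b. circ n (Y b q)) ` B)"
  proof (rule continuous_map_uconf_image)
    show "continuous_map (top_of_set Q) (top_of_set (sphere 0 1)) (\<lambda>q. circ n (Y b q))" if "b \<in> B" for b
      using Y[OF that] by (auto simp: continuous_map_in_subtopology intro!: continuous_intros)
    show "inj_on (\<lambda>b. circ n (Y b q)) B" if "q \<in> topspace (top_of_set Q)" for q
      using apart_inj_on[OF n ap] that by simp
  qed (use B in auto)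
  have "(\<lambda>b. circ n (Y b q)) ` B \<in> topspace (cycle_uconf n (card B))" if q: "q \<in> Q" for q
  proof -
    obtain h where h: "bij_betw h {1..card B} B" using B finite_same_card_bij[of "{1..card B}" B] by auto
    have "apart n {1..card B} (\<lambda>i. Y (h i) q)"
      using ap[OF q] h unfolding apart_def bij_betw_def inj_on_def by (metis imageI)
    moreover have "(\<lambda>b. circ n (Y b q)) ` B = (\<lambda>i. circ n (Y (h i) q)) ` {1..card B}"
      using h unfolding bij_betw_def by (metis (no_types, lifting) image_cong image_image)
    ultimately show ?thesis using topspace_cycle_uconf[OF n] by blast
  qed
  then show ?thesis using cm unfolding cycle_uconf_def by (auto simp: continuous_map_in_subtopology topspace_subtopology)
qed

text \<open>This convexity is the reason why spaced displacements form a simply connected cover of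
  the configuration space of the cycle.\<close>

lemma spaced_affine:
  assumes "spaced n B d" "spaced n B d'" "0 \<le> s" "s \<le> 1"
  shows "spaced n B (\<lambda>b. (1 - s) * d b + s * d' b)"
  unfolding spaced_def
proof (intro ballI impI)
  fix b b' assume b: "b \<in> B" "b' \<in> B" "b < b'"
  define D where "D = (real b' + d b') - (real b + d b)"
  define D' where "D' = (real b' + d' b') - (real b + d' b)"
  have D: "1 \<le> D" "D \<le> real n - 1" "1 \<le> D'" "D' \<le> real n - 1" using assms b by (auto simp: spaced_def D_def D'_def)
  have eq: "real b' + ((1 - s) * d b' + s * d' b') - (real b + ((1 - s) * d b + s * d' b)) = (1 - s) * D + s * D'"
    by (simp add: D_def D'_def algebra_simps)
  have "(1 - s) * 1 + s * 1 \<le> (1 - s) * D + s * D'" using D assms by (intro add_mono mult_left_mono) auto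
  moreover have "(1 - s) * D + s * D' \<le> (1 - s) * (real n - 1) + s * (real n - 1)"
    using D assms by (intro add_mono mult_left_mono) auto
  ultimately show "1 \<le> real b' + ((1 - s) * d b' + s * d' b') - (real b + ((1 - s) * d b + s * d' b)) \<and>
      real b' + ((1 - s) * d b' + s * d' b') - (real b + ((1 - s) * d b + s * d' b)) \<le> real n - 1"
    unfolding eq by (simp add: algebra_simps)
qed

text \<open>Lifts with the same ends are joined by straight lines within the convex set of spaced
  displacements.\<close>

lemma lifted_paths_homotopic:
  assumes n: "0 < n" and B: "finite B"
    and y: "\<And>b. b \<in> B \<Longrightarrow> continuous_on {0..1} (y b)" "\<And>t. t \<in> {0..1} \<Longrightarrow> spaced n B (\<lambda>b. y b t - real b)"
    and y': "\<And>b. b \<in> B \<Longrightarrow> continuous_on {0..1} (y' b)" "\<And>t. t \<in> {0..1} \<Longrightarrow> spaced n B (\<lambda>b. y' b t - real b)"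
    and ends: "\<And>b. b \<in> B \<Longrightarrow> y b 0 = y' b 0" "\<And>b. b \<in> B \<Longrightarrow> y b 1 = y' b 1"
    and f: "\<And>t. t \<in> {0..1} \<Longrightarrow> f t = (\<lambda>b. circ n (y b t)) ` B" "\<And>t. t \<in> {0..1} \<Longrightarrow> f' t = (\<lambda>b. circ n (y' b t)) ` B"
  shows "path_homotopic (cycle_uconf n (card B)) f f'"
proof (rule path_homotopicI)
  define Y where "Y b p = (1 - fst p) * y b (snd p) + fst p * y' b (snd p)" for b and p :: "real \<times> real"
  show "continuous_map (top_of_set unit_square) (cycle_uconf n (card B)) (\<lambda>p. (\<lambda>b. circ n (Y b p)) ` B)"
  proof (rule continuous_map_cycle_uconf[OF n B])
    show "continuous_on unit_square (Y b)" if "b \<in> B" for b unfolding Y_def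
      by (intro continuous_intros continuous_on_compose2[OF y(1)[OF that]] continuous_on_compose2[OF y'(1)[OF that]]) auto
    show "spaced n B (\<lambda>b. Y b p - real b)" if "p \<in> unit_square" for p
    proof -
      have p: "0 \<le> fst p" "fst p \<le> 1" "snd p \<in> {0..1}" using that by (auto simp: mem_Times_iff)
      have "(\<lambda>b. Y b p - real b) = (\<lambda>b. (1 - fst p) * (y b (snd p) - real b) + fst p * (y' b (snd p) - real b))"
        by (auto simp: Y_def algebra_simps)
      then show ?thesis using spaced_affine[OF y(2)[OF p(3)] y'(2)[OF p(3)] p(1,2)] by simp
    qed
  qed
  show "(\<lambda>b. circ n (Y b (0, t))) ` B = f t" if "t \<in> {0..1}" for t using f(1)[OF that] by (simp add: Y_def)
  show "(\<lambda>b. circ n (Y b (1, t))) ` B = f' t" if "t \<in> {0..1}" for t using f(2)[OF that] by (simp add: Y_def)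
  show "(\<lambda>b. circ n (Y b (s, 0))) ` B = f 0" for s
    using f(1)[of 0] ends(1) by (auto simp: Y_def algebra_simps intro!: image_cong)
  show "(\<lambda>b. circ n (Y b (s, 1))) ` B = f 1" for s
    using f(1)[of 1] ends(2) by (auto simp: Y_def algebra_simps intro!: image_cong)
qed

text \<open>Each strand is lifted separately. The difference of two lifts stays between
  \<open>0\<close> and \<open>n\<close>, and the distance of at least one from both values gives the
  bounds \<open>1\<close> and \<open>n - 1\<close>.\<close>

lemma cycle_path_lift:
  assumes n: "0 < n" and B: "B \<subseteq> {1..n}" and f: "pathin (cycle_uconf n (card B)) f" "f 0 = pt n ` B"
  obtains y where "\<And>b. b \<in> B \<Longrightarrow> continuous_on {0..1} (y b)" "\<And>b. b \<in> B \<Longrightarrow> y b 0 = real b"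
    "\<And>t. t \<in> {0..1} \<Longrightarrow> f t = (\<lambda>b. circ n (y b t)) ` B" "\<And>t. t \<in> {0..1} \<Longrightarrow> spaced n B (\<lambda>b. y b t - real b)"
proof -
  have finB: "finite B" using B finite_subset by blast
  have f': "pathin (uconf (card B) (sphere 0 1)) f" using f(1) unfolding cycle_uconf_def by (simp add: pathin_subtopology)
  have ftop: "f t \<in> topspace (cycle_uconf n (card B))" if "t \<in> {0..1}" for t
    using f(1) that unfolding pathin_def continuous_map_def by auto
  have "\<exists>y. continuous_on {0..1} y \<and> y 0 = real b \<and> (\<forall>t\<in>{0..1}. circ n (y t) \<in> f t)" if b: "b \<in> B" for b
  proof -
    have "pt n b \<in> f 0" using f(2) b by simp
    then obtain g where g: "continuous_on {0..1} g" "\<And>t. t \<in> {0..1} \<Longrightarrow> g t \<in> f t" "g 0 = pt n b"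
      using strand_exists[OF f'] by metis
    have ng: "norm (g t) = 1" if "t \<in> {0..1}" for t using braid_config(1)[OF f' that] g(2)[OF that] by auto
    have "contractible {0..1::real}" by (simp add: convex_imp_contractible)
    moreover have "g t \<noteq> 0" if "t \<in> {0..1}" for t using ng[OF that] by auto
    moreover have "g 0 = of_real (norm (g 0)) * circ n (real b)" using ng[of 0] g(3) by (simp add: pt_def)
    ultimately obtain y where y: "continuous_on {0..1} y" "y 0 = real b"
      "\<And>t. t \<in> {0..1} \<Longrightarrow> g t = of_real (norm (g t)) * circ n (y t)"
      using circ_lift[OF _ g(1) _ _ _ n, of 0 "real b"] by (metis atLeastAtMost_iff order_refl zero_le_one)
    have "circ n (y t) \<in> f t" if "t \<in> {0..1}" for t using y(3)[OF that] ng[OF that] g(2)[OF that] by simp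
    then show ?thesis using y(1,2) by blast
  qed
  then obtain y where y: "\<And>b. b \<in> B \<Longrightarrow> continuous_on {0..1} (y b)" "\<And>b. b \<in> B \<Longrightarrow> y b 0 = real b"
    "\<And>b t. b \<in> B \<Longrightarrow> t \<in> {0..1} \<Longrightarrow> circ n (y b t) \<in> f t"
    by metis
  have dist: "circ n (y b t) \<noteq> circ n (y b' t)" if b: "b \<in> B" "b' \<in> B" "b \<noteq> b'" "t \<in> {0..1}" for b b' t
  proof (rule strands_distinct[OF f', where g = "\<lambda>t. circ n (y b t)" and h = "\<lambda>t. circ n (y b' t)"])
    show "continuous_on {0..1} (\<lambda>t. circ n (y b t))" "continuous_on {0..1} (\<lambda>t. circ n (y b' t))"
      by (rule continuous_on_circ[OF y(1)[OF b(1)]], rule continuous_on_circ[OF y(1)[OF b(2)]])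
    show "circ n (y b 0) \<noteq> circ n (y b' 0)"
      using pt_eq_iff[OF subsetD[OF B b(1)] subsetD[OF B b(2)]] b(3) by (simp add: y(2)[OF b(1)] y(2)[OF b(2)] pt_def)
  qed (use y(3) b in auto)
  have sp: "spaced n B (\<lambda>b. y b t - real b)" if t: "t \<in> {0..1}" for t unfolding spaced_def
  proof (intro ballI impI)
    fix b b' assume b: "b \<in> B" "b' \<in> B" "b < b'"
    have bn: "0 < y b' 0 - y b 0" "y b' 0 - y b 0 < real n" using y(2)[OF b(1)] y(2)[OF b(2)] subsetD[OF B b(1)] subsetD[OF B b(2)] b(3) by auto
    have "\<And>t. t \<in> {0..1} \<Longrightarrow> circ n (y b t) \<noteq> circ n (y b' t)" using dist b by blast
    note between = circ_paths_between[OF n y(1)[OF b(1)] y(1)[OF b(2)] this bn t]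
    have gap: "1 \<le> \<bar>y b' t - y b t - of_int m * real n\<bar>" for m
      by (rule cycle_uconf_gaps[OF n ftop[OF t] y(3)[OF b(2) t] y(3)[OF b(1) t]]) (use dist[of b' b t] b t in simp)
    show "1 \<le> real b' + (y b' t - real b') - (real b + (y b t - real b)) \<and>
        real b' + (y b' t - real b') - (real b + (y b t - real b)) \<le> real n - 1"
      using between gap[of 0] gap[of 1] by simp
  qed
  have "f t = (\<lambda>b. circ n (y b t)) ` B" if t: "t \<in> {0..1}" for t
  proof (rule card_subset_eq[symmetric])
    show "finite (f t)" "(\<lambda>b. circ n (y b t)) ` B \<subseteq> f t" using braid_config(2)[OF f' t] y(3) t by auto
    have "inj_on (\<lambda>b. circ n (y b t)) B" using dist t by (intro inj_onI) metis
    then show "card ((\<lambda>b. circ n (y b t)) ` B) = card (f t)" using braid_config(3)[OF f' t] by (simp add: card_image)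
  qed
  then show thesis using that y(1,2) sp by blast
qed

text \<open>A point on the circle never meets the origin, so here the winding of a strand is defined
  without reference to a second strand.\<close>

lemma homotopic_lifts_end:
  assumes n: "0 < n" and "path_homotopic (cycle_uconf n (card B)) f f'"
    and y: "\<And>b. b \<in> B \<Longrightarrow> continuous_on {0..1} (y b)" "\<And>t. t \<in> {0..1} \<Longrightarrow> f t = (\<lambda>b. circ n (y b t)) ` B"
    and y': "\<And>b. b \<in> B \<Longrightarrow> continuous_on {0..1} (y' b)" "\<And>t. t \<in> {0..1} \<Longrightarrow> f' t = (\<lambda>b. circ n (y' b t)) ` B"
    and eq: "\<And>b. b \<in> B \<Longrightarrow> y b 0 = y' b 0" and b: "b \<in> B"
  shows "y b 1 = y' b 1"
proof -
  obtain H where H: "continuous_map (top_of_set unit_square) (cycle_uconf n (card B)) H"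
    "\<And>t. t \<in> {0..1} \<Longrightarrow> H (0, t) = f t" "\<And>t. t \<in> {0..1} \<Longrightarrow> H (1, t) = f' t"
    "\<And>s. s \<in> {0..1} \<Longrightarrow> H (s, 0) = f 0" "\<And>s. s \<in> {0..1} \<Longrightarrow> H (s, 1) = f 1"
    using assms(2) by (rule path_homotopicE) blast
  have H': "continuous_map (top_of_set unit_square) (uconf (card B) (sphere 0 1)) H"
    using H(1) unfolding cycle_uconf_def by (simp add: continuous_map_in_subtopology)
  obtain G where G: "continuous_on unit_square G" "\<And>p. p \<in> unit_square \<Longrightarrow> G p \<in> H p"
    "\<And>t. t \<in> {0..1} \<Longrightarrow> G (0, t) = circ n (y b t)" "\<And>t. t \<in> {0..1} \<Longrightarrow> G (1, t) = circ n (y' b t)"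
    "\<And>s. s \<in> {0..1} \<Longrightarrow> G (s, 0) = circ n (y b 0)" "\<And>s. s \<in> {0..1} \<Longrightarrow> G (s, 1) = circ n (y b 1)"
  proof (rule selection_square[OF H' H(2-5), where g = "\<lambda>t. circ n (y b t)" and g' = "\<lambda>t. circ n (y' b t)"])
    show "continuous_on {0..1} (\<lambda>t. circ n (y b t))" "continuous_on {0..1} (\<lambda>t. circ n (y' b t))"
      by (rule continuous_on_circ[OF y(1)[OF b]], rule continuous_on_circ[OF y'(1)[OF b]])
    show "circ n (y b t) \<in> f t" "circ n (y' b t) \<in> f' t" if "t \<in> {0..1}" for t
      using y(2)[OF that] y'(2)[OF that] b by auto
    show "circ n (y b 0) = circ n (y' b 0)" using eq[OF b] by simp
  qed blast+
  have nz: "G p \<noteq> 0" if p: "p \<in> unit_square" for p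
  proof -
    have "H p \<in> topspace (uconf (card B) (sphere 0 1))" using H' p unfolding continuous_map_def by auto
    then show ?thesis using G(2)[OF p] unfolding topspace_uconf by auto
  qed
  define L where "L x = \<i> * of_real (2 * pi * x / real n)" for x :: real
  have "L (y b 1) - L (y b 0) = L (y' b 1) - L (y' b 0)"
  proof (rule homotopic_log_increment[OF G(1) nz])
    show "G (s, 0) = G (0, 0)" "G (s, 1) = G (0, 1)" if "s \<in> {0..1}" for s
      using G(5,6)[OF that] G(5,6)[of 0] by simp_all
    show "continuous_on {0..1} (\<lambda>t. L (y b t))" "continuous_on {0..1} (\<lambda>t. L (y' b t))"
      unfolding L_def using y(1)[OF b] y'(1)[OF b] n by (auto intro!: continuous_intros)
    show "exp (L (y b t)) = G (0, t)" "exp (L (y' b t)) = G (1, t)" if "t \<in> {0..1}" for t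
      using G(3,4)[OF that] by (simp_all add: L_def circ_eq_exp)
  qed
  then have "of_real (2 * pi * y b 1 / real n) = (of_real (2 * pi * y' b 1 / real n) :: complex)"
    unfolding L_def eq[OF b] by simp
  then have "2 * pi * y b 1 / real n = 2 * pi * y' b 1 / real n" using of_real_eq_iff by blast
  then show ?thesis using n by simp
qed

section \<open>Vertices of the universal cover\<close>

definition straight_path :: "nat \<Rightarrow> nat set \<Rightarrow> (nat \<Rightarrow> int) \<Rightarrow> real \<Rightarrow> complex set" where
  "straight_path n B z t = (\<lambda>b. circ n (real b + t * real_of_int (z b))) ` B"

text \<open>The normal form of a vertex of the universal cover: by convexity the straight path to
  \<open>z\<close> is admissible, and every path with the same lifted end is homotopic to
  it.\<close>

definition vertex :: "nat \<Rightarrow> nat set \<Rightarrow> (nat \<Rightarrow> int) \<Rightarrow> (real \<Rightarrow> complex set) set" where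
  "vertex n B z = path_class (cycle_uconf n (card B)) (straight_path n B z)"

lemma spaced_const:
  assumes "B \<subseteq> {1..n}"
  shows "spaced n B (\<lambda>_. c)"
  unfolding spaced_def
proof (intro ballI impI)
  fix b b' assume "b \<in> B" "b' \<in> B" "b < b'"
  then have "1 \<le> b" "b + 1 \<le> b'" "b' \<le> n" using assms by auto
  then show "1 \<le> real b' + c - (real b + c) \<and> real b' + c - (real b + c) \<le> real n - 1"
    by (simp add: algebra_simps)
qed

lemma straight_path_lift:
  assumes B: "B \<subseteq> {1..n}" and z: "spaced_int n B z"
  shows "continuous_on {0..1} (\<lambda>t. real b + t * real_of_int (z b))"
    and "t \<in> {0..1} \<Longrightarrow> spaced n B (\<lambda>b. real b + t * real_of_int (z b) - real b)"
  using spaced_affine[OF spaced_const[OF B, of 0] z, of t] by (auto intro!: continuous_intros)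

lemma pathin_straight_path:
  assumes n: "0 < n" and B: "B \<subseteq> {1..n}" and z: "spaced_int n B z"
  shows "pathin (cycle_uconf n (card B)) (straight_path n B z)"
  unfolding pathin_def straight_path_def
  by (rule continuous_map_cycle_uconf[OF n finite_subset[OF B]]) (use straight_path_lift[OF B z] in auto)

lemma circ_displaced:
  fixes t :: real
  assumes "0 < n"
  shows "circ n (real (residue_rep n (int b + m)) + t) = circ n (real b + of_int m + t)"
  using pt_residue_rep[OF assms, of "int b + m"] by (simp add: circ_add pt_def)

lemma pt_displaced:
  assumes "0 < n"
  shows "pt n ` displaced n B z = (\<lambda>b. circ n (real b + of_int (z b))) ` B"
  using circ_displaced[OF assms, where t = 0] by (simp add: displaced_def image_image pt_def)

lemma displaced_subset: "0 < n \<Longrightarrow> displaced n B z \<subseteq> {1..n}"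
  unfolding displaced_def using residue_rep_mem[of n] by blast

lemma straight_path_ends:
  assumes "0 < n"
  shows "straight_path n B z 0 = pt n ` B" "straight_path n B z 1 = pt n ` displaced n B z"
  using pt_displaced[OF assms, of B z] by (simp_all add: straight_path_def pt_def)

lemma vertex_mem_cover:
  assumes n: "0 < n" and B: "B \<subseteq> {1..n}" and z: "spaced_int n B z"
  shows "vertex n B z \<in> cover_vertices n B"
  unfolding cover_vertices_def vertex_def
  using pathin_straight_path[OF assms] straight_path_ends[OF n, of B z] displaced_subset[OF n, of B z] by blast

lemma cover_vertexE:
  assumes n: "0 < n" and B: "B \<subseteq> {1..n}" and "V \<in> cover_vertices n B"
  obtains z where "spaced_int n B z" "V = vertex n B z"
proof -
  obtain f B' where f: "V = path_class (cycle_uconf n (card B)) f" "pathin (cycle_uconf n (card B)) f" "f 0 = pt n ` B"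
    "B' \<subseteq> {1..n}" "f 1 = pt n ` B'"
    using assms(3) unfolding cover_vertices_def by blast
  obtain y where y: "\<And>b. b \<in> B \<Longrightarrow> continuous_on {0..1} (y b)" "\<And>b. b \<in> B \<Longrightarrow> y b 0 = real b"
    "\<And>t. t \<in> {0..1} \<Longrightarrow> f t = (\<lambda>b. circ n (y b t)) ` B" "\<And>t. t \<in> {0..1} \<Longrightarrow> spaced n B (\<lambda>b. y b t - real b)"
    using cycle_path_lift[OF n B f(2,3)] by blast
  have "\<exists>m::int. y b 1 = real b + of_int m" if b: "b \<in> B" for b
  proof -
    have "circ n (y b 1) \<in> pt n ` B'" using y(3)[of 1] f(5) b by auto
    then obtain c where "c \<in> B'" "circ n (y b 1) = circ n (real c)" unfolding pt_def by blast
    then obtain q :: int where "y b 1 = real c + of_int q * real n" using circ_eq_iff[OF n] by blast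
    then have "y b 1 = real b + of_int (int c + q * int n - int b)" by simp
    then show ?thesis by blast
  qed
  then obtain z where z: "\<And>b. b \<in> B \<Longrightarrow> y b 1 = real b + of_int (z b)" by metis
  have sp: "spaced_int n B z" using y(4)[of 1] z by (simp add: spaced_def)
  have "path_homotopic (cycle_uconf n (card B)) f (straight_path n B z)"
    by (rule lifted_paths_homotopic[OF n finite_subset[OF B] y(1,4) straight_path_lift(1,2)[OF B sp]])
      (use y(2,3) z in \<open>auto simp: straight_path_def\<close>)
  then have "V = vertex n B z" unfolding f(1) vertex_def by (rule path_class_eqI)
  then show thesis using that sp by blast
qed

lemma vertex_cong: "(\<And>b. b \<in> B \<Longrightarrow> z b = z' b) \<Longrightarrow> vertex n B z = vertex n B z'"
  by (simp add: vertex_def straight_path_def[abs_def] cong: image_cong)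

lemma vertex_inj:
  assumes n: "0 < n" and B: "B \<subseteq> {1..n}" and z: "spaced_int n B z"
    and "vertex n B z = vertex n B z'" "b \<in> B"
  shows "z b = z' b"
proof -
  have "path_homotopic (cycle_uconf n (card B)) (straight_path n B z) (straight_path n B z')"
    using assms(4) path_class_eq_iff[OF pathin_straight_path[OF n B z]] by (simp add: vertex_def)
  then have "real b + 1 * real_of_int (z b) = real b + 1 * real_of_int (z' b)"
    by (rule homotopic_lifts_end[OF n]) (auto simp: straight_path_def assms(5) intro!: continuous_intros)
  then show ?thesis by simp
qed

lemma cov_vertex:
  assumes n: "0 < n" and B: "B \<subseteq> {1..n}" and z: "spaced_int n B z"
  shows "cov n (vertex n B z) = displaced n B z"
  unfolding cov_def
proof (rule the_equality)
  have ends: "f 1 = pt n ` displaced n B z" if "f \<in> vertex n B z" for f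
    using path_homotopic_ends(2)[of "cycle_uconf n (card B)" "straight_path n B z" f] that straight_path_ends(2)[OF n]
    by (simp add: vertex_def mem_path_class)
  then show "displaced n B z \<subseteq> {1..n} \<and> (\<forall>f\<in>vertex n B z. f 1 = pt n ` displaced n B z)"
    using displaced_subset[OF n] by blast
  fix B' assume B': "B' \<subseteq> {1..n} \<and> (\<forall>f\<in>vertex n B z. f 1 = pt n ` B')"
  have "straight_path n B z \<in> vertex n B z"
    unfolding vertex_def by (rule mem_path_class_self[OF pathin_straight_path[OF n B z]])
  then have "pt n ` B' = pt n ` displaced n B z" using B' ends by metis
  then show "B' = displaced n B z" using pt_image_eq_iff B' displaced_subset[OF n] by metis
qed

lemma cover_base_eq: "cover_base n B = vertex n B (\<lambda>_. 0)"
  by (simp add: cover_base_def vertex_def straight_path_def[abs_def] pt_def)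

definition step :: "(nat \<Rightarrow> int) \<Rightarrow> nat set \<Rightarrow> nat \<Rightarrow> int" where
  "step z S b = z b + (if b \<in> S then 1 else 0)"

text \<open>Only a gap that is already as small as possible could close, and then the moved point
  has an occupied place directly ahead. The condition on \<open>C\<close> forces that point to move
  as well; this includes the gap across the turn by \<open>n\<close>.\<close>

lemma spaced_step:
  assumes n: "0 < n" and z: "spaced_int n B z" and C: "cyc_succ n ` C \<inter> (displaced n B z - C) = {}"
  shows "spaced_int n B (step z {b \<in> B. residue_rep n (int b + z b) \<in> C})"
  unfolding spaced_int_iff
proof (intro ballI impI)
  fix b b' assume b: "b \<in> B" "b' \<in> B" "b < b'"
  define S where "S = {b \<in> B. residue_rep n (int b + z b) \<in> C}"
  have out: "c' \<in> S" if "c \<in> S" "c' \<in> B" "residue_rep n (int c' + z c') = residue_rep n (int c + z c + 1)" for c c'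
  proof -
    have "residue_rep n (int c' + z c') \<in> cyc_succ n ` C"
      unfolding that(3) cyc_succ_residue_rep[OF n, symmetric] using that(1) by (intro imageI) (simp add: S_def)
    moreover have "residue_rep n (int c' + z c') \<in> displaced n B z"
      unfolding displaced_def using that(2) by (rule imageI)
    ultimately have "residue_rep n (int c' + z c') \<in> C" using C by blast
    then show ?thesis using that(2) by (simp add: S_def)
  qed
  have lt: "int b + z b < int b' + z b'" "int b' + z b' < int b + z b + int n"
    using z b unfolding spaced_int_iff by blast+
  moreover have "int b' + z b' \<noteq> int b + z b + 1" if "b \<in> S" "b' \<notin> S"
    using out[OF that(1) b(2)] that(2) by auto
  moreover have "int b + z b + int n \<noteq> int b' + z b' + 1" if "b' \<in> S" "b \<notin> S"
    using out[OF that(1) b(1)] that(2) residue_rep_add_n[OF n, of "int b + z b"] by auto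
  ultimately show "int b + step z {b \<in> B. residue_rep n (int b + z b) \<in> C} b < int b' + step z {b \<in> B. residue_rep n (int b + z b) \<in> C} b' \<and>
      int b' + step z {b \<in> B. residue_rep n (int b + z b) \<in> C} b' < int b + step z {b \<in> B. residue_rep n (int b + z b) \<in> C} b + int n"
    unfolding S_def[symmetric] step_def by auto
qed

text \<open>The straight path followed by the edge and the straight path to the new displacement
  have spaced lifts with equal ends.\<close>

lemma cover_step_vertex:
  assumes n: "0 < n" and B: "B \<subseteq> {1..n}" and z: "spaced_int n B z" and S: "S \<subseteq> B" and sp: "spaced_int n B (step z S)"
  shows "cover_step n B (vertex n B z) ((\<lambda>b. residue_rep n (int b + z b)) ` S) = vertex n B (step z S)"
proof -
  define X where "X = cycle_uconf n (card B)"
  define C where "C = (\<lambda>b. residue_rep n (int b + z b)) ` S"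
  define e where "e b t = real b + of_int (z b) + (if b \<in> S then t else 0)" for b and t :: real
  define l where "l b t = real b + t * real_of_int (z b)" for b and t :: real
  note inj = inj_on_displaced[OF n z]
  have compl: "displaced n B z - C = (\<lambda>b. residue_rep n (int b + z b)) ` (B - S)"
    unfolding displaced_def C_def using inj S by (simp add: inj_on_image_set_diff)
  have e: "edge_path n (displaced n B z) C t = (\<lambda>b. circ n (e b t)) ` B" for t
  proof -
    have "pt n ` (displaced n B z - C) = (\<lambda>b. circ n (e b t)) ` (B - S)"
      unfolding compl image_image using circ_displaced[OF n, where t = 0] by (intro image_cong) (auto simp: e_def pt_def)
    moreover have "(\<lambda>c. circ n (real c + t)) ` C = (\<lambda>b. circ n (e b t)) ` S"
      unfolding C_def image_image using circ_displaced[OF n] by (intro image_cong) (auto simp: e_def)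
    ultimately show ?thesis unfolding edge_path_def using S by (metis Un_Diff_cancel2 Un_absorb2 image_Un)
  qed
  have econt: "continuous_on {0..1} (e b)" for b unfolding e_def by (cases "b \<in> S") (auto intro!: continuous_intros)
  have esp: "spaced n B (\<lambda>b. e b t - real b)" if t: "t \<in> {0..1}" for t
  proof -
    have "(\<lambda>b. e b t - real b) = (\<lambda>b. (1 - t) * real_of_int (z b) + t * real_of_int (step z S b))"
      by (auto simp: e_def step_def algebra_simps)
    then show ?thesis using spaced_affine[OF z sp, of t] t by simp
  qed
  note lc = straight_path_lift[OF B z, folded l_def]
  have pe: "pathin X (edge_path n (displaced n B z) C)"
    unfolding X_def pathin_def e by (rule continuous_map_cycle_uconf[OF n finite_subset[OF B]]) (use econt esp in auto)
  have ps: "pathin X (straight_path n B z)" unfolding X_def by (rule pathin_straight_path[OF n B z])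
  have join: "straight_path n B z 1 = edge_path n (displaced n B z) C 0"
    by (simp add: e straight_path_def e_def)
  have "cover_step n B (vertex n B z) C = path_class X (path_concat (straight_path n B z) (edge_path n (displaced n B z) C))"
    unfolding cover_step_def cov_vertex[OF n B z] unfolding vertex_def X_def[symmetric] by (rule class_mult_path_class[OF ps pe join])
  also have "\<dots> = vertex n B (step z S)" unfolding vertex_def X_def
  proof (rule path_class_eqI, rule lifted_paths_homotopic[OF n finite_subset[OF B], where y = "\<lambda>b. path_concat (l b) (e b)"])
    show "continuous_on {0..1} (path_concat (l b) (e b))" for b
      using pathin_path_concat[of euclidean "l b" "e b"] lc(1) econt by (simp add: pathin_def l_def e_def)
    show "spaced n B (\<lambda>b. path_concat (l b) (e b) t - real b)" if "t \<in> {0..1}" for t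
      using lc(2)[of "2 * t"] esp[of "2 * t - 1"] that unfolding path_concat_def by (cases "t \<le> 1 / 2") simp_all
    show "path_concat (straight_path n B z) (edge_path n (displaced n B z) C) t = (\<lambda>b. circ n (path_concat (l b) (e b) t)) ` B" for t
      by (simp add: path_concat_def e straight_path_def l_def)
  qed (use straight_path_lift[OF B sp] in \<open>auto simp: straight_path_def l_def e_def step_def\<close>)
  finally show ?thesis unfolding C_def .
qed

section \<open>Braids of elementary steps\<close>

lemma dual_simple_runs_empty:
  assumes "n \<ge> 3"
  shows "dual_simple n (runs n {}) = \<one>\<^bsub>braid_group n\<^esub>"
proof (rule dual_simple_trivial[OF assms noncrossing_hull_disjoint[OF runs_noncrossing]])
  show "card A \<le> 1" if "A \<in> runs n {}" for A using that assms by (auto simp: runs_empty)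
qed (use assms in auto)

lemma dual_simple_runs_carrier:
  assumes "n \<ge> 3" "C \<subseteq> {1..n}"
  shows "dual_simple n (runs n C) \<in> carrier (braid_group n)"
  using assms by (intro dual_simple_carrier noncrossing_hull_disjoint runs_noncrossing) auto

text \<open>A run start of \<open>C - C1\<close> is also one of \<open>C\<close>, since no element
  of \<open>C1\<close> precedes it directly. Both sides therefore lose the same right factor when it
  is removed.\<close>

lemma dual_simple_runs_split:
  assumes n: "n \<ge> 3" and "C \<subseteq> {1..n}" "C1 \<subseteq> C" "cyc_succ n ` C1 \<inter> (C - C1) = {}"
  shows "dual_simple n (runs n C) = dual_simple n (runs n C1) \<otimes>\<^bsub>braid_group n\<^esub> dual_simple n (runs n (C - C1))"
  using assms(2-4)
proof (induction "card (C - C1)" arbitrary: C rule: less_induct)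
  case less
  have n0: "0 < n" using n by simp
  define D where "D = C - C1"
  have D: "D \<subseteq> {1..n}" "finite D" using less.prems(1) finite_subset[of D "{1..n}"] by (auto simp: D_def)
  note car = dual_simple_runs_carrier[OF n]
  consider "D = {}" | "D = {1..n}" | "D \<noteq> {}" "D \<noteq> {1..n}" by blast
  then show ?case
  proof cases
    case 1
    then have "C = C1" using less.prems(2) by (auto simp: D_def)
    then show ?thesis using dual_simple_runs_empty[OF n] car[OF less.prems(1)] by simp
  next
    case 2
    then have "C1 = {}" "C = {1..n}" using less.prems by (auto simp: D_def)
    then show ?thesis using dual_simple_runs_empty[OF n] car[of "{1..n}"] by simp
  next
    case 3
    obtain c where c: "c \<in> D" "c \<notin> cyc_succ n ` D" using exists_run_start[OF n0 D(1) 3] .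
    have cC: "c \<in> C" "c \<notin> cyc_succ n ` C" using c less.prems(2,3) by (auto simp: D_def)
    have "card (C - {c} - C1) < card (C - C1)"
      using c(1) D(2) unfolding D_def by (intro psubset_card_mono) auto
    moreover have sub: "C - {c} \<subseteq> {1..n}" "C1 \<subseteq> C - {c}" "cyc_succ n ` C1 \<inter> (C - {c} - C1) = {}"
      using less.prems c(1) by (auto simp: D_def)
    ultimately have IH: "dual_simple n (runs n (C - {c})) = dual_simple n (runs n C1) \<otimes>\<^bsub>braid_group n\<^esub> dual_simple n (runs n (C - {c} - C1))"
      using less.hyps by blast
    have eq: "C - {c} - C1 = D - {c}" by (auto simp: D_def)
    have cs: "{c, cyc_succ n c} \<subseteq> {1..n}" using c(1) D(1) cyc_succ_mem[OF n0, of c] by blast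
    have car': "dual_simple n (runs n C1) \<in> carrier (braid_group n)" "dual_simple n (runs n (D - {c})) \<in> carrier (braid_group n)"
      using less.prems D(1) by (auto intro!: car)
    show ?thesis using dual_simple_runs_step[OF n less.prems(1) cC] dual_simple_runs_step[OF n D(1) c] IH car'
        rotation_braid_carrier[OF n cs]
      unfolding eq D_def[symmetric] by (simp add: m_assoc)
  qed
qed

definition step_braid :: "nat \<Rightarrow> (nat \<Rightarrow> int) \<Rightarrow> nat set \<Rightarrow> (real \<Rightarrow> complex set) set" where
  "step_braid n z S = dual_simple n (runs n (displaced n S z))"

lemma step_braid_carrier: "n \<ge> 3 \<Longrightarrow> step_braid n z S \<in> carrier (braid_group n)"
  unfolding step_braid_def by (rule dual_simple_runs_carrier[OF _ displaced_subset]) auto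

lemma step_braid_empty: "n \<ge> 3 \<Longrightarrow> step_braid n z {} = \<one>\<^bsub>braid_group n\<^esub>"
  by (simp add: step_braid_def displaced_def dual_simple_runs_empty)

lemma displaced_cong: "(\<And>b. b \<in> S \<Longrightarrow> z b = z' b) \<Longrightarrow> displaced n S z = displaced n S z'"
  by (simp add: displaced_def cong: image_cong)

lemma step_braid_cong: "(\<And>b. b \<in> S \<Longrightarrow> z b = z' b) \<Longrightarrow> step_braid n z S = step_braid n z' S"
  by (simp add: step_braid_def cong: displaced_cong)

lemma displaced_diff:
  assumes "0 < n" "spaced_int n B z" "S \<subseteq> B" "T \<subseteq> B"
  shows "displaced n (T - S) z = displaced n T z - displaced n S z"
  unfolding displaced_def by (rule inj_on_image_set_diff[OF inj_on_displaced[OF assms(1,2)]]) (use assms in auto)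

text \<open>The converse of \<open>spaced_step\<close>: if the step stays spaced, no moved point
  enters an occupied place.\<close>

lemma step_blocked:
  assumes n: "0 < n" and S: "S \<subseteq> B" and sp: "spaced_int n B (step z S)"
  shows "cyc_succ n ` displaced n S z \<inter> displaced n (B - S) z = {}"
proof (rule ccontr)
  assume "\<not> ?thesis"
  then obtain b b' where b: "b \<in> S" "b' \<in> B - S" "cyc_succ n (residue_rep n (int b + z b)) = residue_rep n (int b' + z b')"
    unfolding displaced_def by fast
  then have "residue_rep n (int b + step z S b) = residue_rep n (int b' + step z S b')"
    by (simp add: cyc_succ_residue_rep[OF n] step_def add.assoc)
  then have "b = b'" using inj_on_displaced[OF n sp] b S by (meson DiffD1 inj_onD subsetD)
  then show False using b by simp
qed

lemma step_braid_split:
  assumes n: "n \<ge> 3" and z: "spaced_int n B z" and S: "S \<subseteq> T" "T \<subseteq> B" and sp: "spaced_int n B (step z S)"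
  shows "step_braid n z T = step_braid n z S \<otimes>\<^bsub>braid_group n\<^esub> step_braid n (step z S) (T - S)"
proof -
  have n0: "0 < n" using n by simp
  have SB: "S \<subseteq> B" using S by blast
  have diff: "displaced n (T - S) z = displaced n T z - displaced n S z"
    by (rule displaced_diff[OF n0 z SB S(2)])
  have "displaced n (T - S) z \<subseteq> displaced n (B - S) z" using S(2) by (auto simp: displaced_def)
  then have "cyc_succ n ` displaced n S z \<inter> (displaced n T z - displaced n S z) = {}"
    using step_blocked[OF n0 SB sp] diff by blast
  moreover have "displaced n S z \<subseteq> displaced n T z" using S(1) by (auto simp: displaced_def)
  moreover have "displaced n (T - S) (step z S) = displaced n (T - S) z"
    by (rule displaced_cong) (simp add: step_def)
  ultimately show ?thesis
    using dual_simple_runs_split[OF n displaced_subset[OF n0]] diff by (simp add: step_braid_def)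
qed

section \<open>Ascending paths of displacements\<close>

definition rising :: "nat set \<Rightarrow> (nat \<Rightarrow> int) \<Rightarrow> (nat \<Rightarrow> int) \<Rightarrow> nat set" where
  "rising B w z = {b \<in> B. w b < z b}"

lemma rising_subset: "rising B w z \<subseteq> B"
  by (auto simp: rising_def)

text \<open>A collision could only arise if one point rises towards another that has already reached
  its target. The rising point has at least one more step to go, so \<open>z\<close> itself would
  violate the spacing.\<close>

lemma spaced_rising:
  assumes w: "spaced_int n B w" and z: "spaced_int n B z" and le: "\<And>b. b \<in> B \<Longrightarrow> w b \<le> z b"
  shows "spaced_int n B (step w (rising B w z))"
  unfolding spaced_int_iff
proof (intro ballI impI)
  fix b b' assume b: "b \<in> B" "b' \<in> B" "b < b'"
  have "int b + w b < int b' + w b'" "int b' + w b' < int b + w b + int n"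
    "int b + z b < int b' + z b'" "int b' + z b' < int b + z b + int n"
    using w z b unfolding spaced_int_iff by blast+
  then show "int b + step w (rising B w z) b < int b' + step w (rising B w z) b' \<and>
      int b' + step w (rising B w z) b' < int b + step w (rising B w z) b + int n"
    using le[OF b(1)] le[OF b(2)] b by (auto simp: step_def rising_def)
qed

lemma abs_le_displacement_sum:
  fixes z :: "nat \<Rightarrow> int"
  assumes "finite B" "b \<in> B"
  shows "\<bar>z b\<bar> \<le> int (nat (\<Sum>b\<in>B. \<bar>z b\<bar>))"
  using assms member_le_sum[of b B "\<lambda>b. \<bar>z b\<bar>"] by (simp add: sum_nonneg)

lemma spaced_cong: "(\<And>b. b \<in> B \<Longrightarrow> d b = d' b) \<Longrightarrow> spaced n B d \<longleftrightarrow> spaced n B d'"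
  by (simp add: spaced_def)

text \<open>An induction principle over the cover: from \<open>0\<close> the property is carried
  down to a constant \<open>- K\<close> below \<open>z\<close>, and then up to \<open>z\<close> by
  raising at each stage all points below their targets. The descent is why the step is an
  equivalence.\<close>

lemma spaced_connected:
  assumes B: "B \<subseteq> {1..n}" and z: "spaced_int n B z" and P0: "P (\<lambda>_. 0)"
    and cong: "\<And>z z'. P z \<Longrightarrow> (\<And>b. b \<in> B \<Longrightarrow> z b = z' b) \<Longrightarrow> P z'"
    and step: "\<And>z S. spaced_int n B z \<Longrightarrow> S \<subseteq> B \<Longrightarrow> S \<noteq> {} \<Longrightarrow> spaced_int n B (step z S) \<Longrightarrow> P z \<longleftrightarrow> P (step z S)"
  shows "P z"
proof -
  have low: "P (\<lambda>_. - int K)" for K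
  proof (induction K)
    case (Suc K)
    show ?case
    proof (cases "B = {}")
      case True
      then show ?thesis using cong[OF P0] by blast
    next
      case False
      have "P (step (\<lambda>_. - int (Suc K)) B)" by (rule cong[OF Suc]) (simp add: step_def)
      moreover have "spaced_int n B (step (\<lambda>_. - int (Suc K)) B)"
        using spaced_const[OF B, of "- real K"] spaced_cong[of B "\<lambda>b. real_of_int (step (\<lambda>_. - int (Suc K)) B b)" "\<lambda>_. - real K" n]
        by (simp add: step_def)
      moreover have "spaced_int n B (\<lambda>_. - int (Suc K))" by (rule spaced_const[OF B])
      ultimately show ?thesis using step[OF _ subset_refl False, of "\<lambda>_. - int (Suc K)"] by blast
    qed
  qed (use P0 in simp)
  have up: "P z" if "P w" "spaced_int n B w" "\<And>b. b \<in> B \<Longrightarrow> w b \<le> z b \<and> z b \<le> w b + int N" for w N using that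
  proof (induction N arbitrary: w)
    case 0
    then show ?case using cong[of w z] by force
  next
    case (Suc N)
    define M where "M = rising B w z"
    have sp: "spaced_int n B (step w M)" unfolding M_def using Suc.prems z by (intro spaced_rising) auto
    show ?case
    proof (rule Suc.IH[OF _ sp])
      show "P (step w M)"
      proof (cases "M = {}")
        case True
        then show ?thesis using Suc.prems(1) by (simp add: step_def[abs_def])
      next
        case False
        then show ?thesis using step[OF Suc.prems(2) _ False sp] Suc.prems(1) rising_subset by (simp add: M_def)
      qed
      show "step w M b \<le> z b \<and> z b \<le> step w M b + int N" if "b \<in> B" for b
        using Suc.prems(3)[OF that] that by (auto simp: step_def M_def rising_def)
    qed
  qed
  define K where "K = nat (\<Sum>b\<in>B. \<bar>z b\<bar>)"
  have "\<bar>z b\<bar> \<le> int K" if "b \<in> B" for b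
    unfolding K_def using finite_subset[OF B] that by (intro abs_le_displacement_sum) auto
  then show ?thesis using up[OF low spaced_const[OF B], of K "2 * K"] by (force simp: abs_le_iff)
qed

text \<open>The greedy ascent from \<open>w\<close> to \<open>z\<close>, where each factor raises
  all points below their targets. \<open>N\<close> bounds the number of factors; once
  \<open>z\<close> is reached, the remaining ones are trivial.\<close>

primrec climb :: "nat \<Rightarrow> nat set \<Rightarrow> nat \<Rightarrow> (nat \<Rightarrow> int) \<Rightarrow> (nat \<Rightarrow> int) \<Rightarrow> (real \<Rightarrow> complex set) set" where
  "climb n B 0 w z = \<one>\<^bsub>braid_group n\<^esub>"
| "climb n B (Suc N) w z = step_braid n w (rising B w z) \<otimes>\<^bsub>braid_group n\<^esub> climb n B N (step w (rising B w z)) z"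

lemma climb_carrier:
  assumes "n \<ge> 3"
  shows "climb n B N w z \<in> carrier (braid_group n)"
  by (induction N arbitrary: w) (simp_all add: step_braid_carrier[OF assms])

lemma climb_cong:
  assumes "\<And>b. b \<in> B \<Longrightarrow> w b = w' b" "\<And>b. b \<in> B \<Longrightarrow> z b = z' b"
  shows "climb n B N w z = climb n B N w' z'"
  using assms(1)
proof (induction N arbitrary: w w')
  case (Suc N)
  have r: "rising B w' z' = rising B w z" using Suc.prems assms(2) by (auto simp: rising_def)
  have "step_braid n w (rising B w z) = step_braid n w' (rising B w z)"
    by (rule step_braid_cong) (use Suc.prems in \<open>auto simp: rising_def\<close>)
  moreover have "climb n B N (step w (rising B w z)) z = climb n B N (step w' (rising B w z)) z'"
    by (rule Suc.IH) (simp add: step_def Suc.prems)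
  ultimately show ?case by (simp add: r)
qed simp

lemma step_empty [simp]: "step z {} = z"
  by (simp add: step_def fun_eq_iff)

lemma climb_trivial:
  assumes "n \<ge> 3" "\<And>b. b \<in> B \<Longrightarrow> w b = z b"
  shows "climb n B N w z = \<one>\<^bsub>braid_group n\<^esub>"
proof -
  have "rising B w z = {}" using assms(2) by (auto simp: rising_def)
  then show ?thesis by (induction N) (simp_all add: step_braid_empty[OF assms(1)])
qed

lemma climb_Suc:
  assumes "n \<ge> 3" "\<And>b. b \<in> B \<Longrightarrow> w b \<le> z b \<and> z b \<le> w b + int N"
  shows "climb n B (Suc N) w z = climb n B N w z"
  using assms(2)
proof (induction N arbitrary: w)
  case 0
  then have "\<And>b. b \<in> B \<Longrightarrow> w b = z b" by force
  then show ?case using climb_trivial[OF assms(1)] by (simp del: climb.simps)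
next
  case (Suc N)
  define M where "M = rising B w z"
  have "climb n B (Suc N) (step w M) z = climb n B N (step w M) z"
  proof (rule Suc.IH)
    show "step w M b \<le> z b \<and> z b \<le> step w M b + int N" if "b \<in> B" for b
      using Suc.prems[OF that] that by (auto simp: step_def M_def rising_def)
  qed
  then show ?case unfolding climb.simps(2)[of n B "Suc N" w] climb.simps(2)[of n B N w] M_def by simp
qed

text \<open>By induction on \<open>N\<close>: after the steps \<open>S\<close> and \<open>rising B w z\<close>, the two paths are joined again by
  \<open>step_braid_split\<close>.\<close>

lemma climb_step:
  assumes n: "n \<ge> 3" and z: "spaced_int n B z" and w: "spaced_int n B w" and le: "\<And>b. b \<in> B \<Longrightarrow> w b \<le> z b \<and> z b \<le> w b + int N"
    and S: "S \<subseteq> rising B w z" and sp: "spaced_int n B (step w S)"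
  shows "climb n B N w z = step_braid n w S \<otimes>\<^bsub>braid_group n\<^esub> climb n B N (step w S) z"
  using w le S sp
proof (induction N arbitrary: w S)
  case 0
  have "rising B w z = {}" using 0(2) by (force simp: rising_def)
  then have "S = {}" using 0(3) by simp
  then show ?case by (simp add: step_braid_empty[OF n])
next
  case (Suc N)
  define M where "M = rising B w z"
  define M' where "M' = rising B (step w S) z"
  \<comment> \<open>The points of \<open>S\<close> that must rise again. After the step
    \<open>S\<close>, the next greedy step raises these together with the points of
    \<open>M - S\<close>, which are late by one.\<close>
  define T where "T = {b \<in> S. w b + 1 < z b}"
  have M: "M \<subseteq> B" "S \<subseteq> M" "M' \<subseteq> B" using Suc.prems(3) rising_subset unfolding M_def M'_def by auto
  have M': "M' = (M - S) \<union> T" using M by (auto simp: M'_def M_def T_def rising_def step_def)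
  have T: "T \<subseteq> S" by (auto simp: T_def)
  have spM: "spaced_int n B (step w M)" unfolding M_def using Suc.prems z by (intro spaced_rising) auto
  have leS: "step w S b \<le> z b" if "b \<in> B" for b
    using Suc.prems(2)[OF that] Suc.prems(3) by (auto simp: step_def rising_def)
  have spM': "spaced_int n B (step (step w S) M')" unfolding M'_def using Suc.prems(4) z leS by (rule spaced_rising)
  have f1: "step (step w S) M' = step (step w M) T" and f2: "step (step w S) (M - S) = step w M"
    using M T unfolding M' by (auto simp: step_def fun_eq_iff)
  have d: "M' - (M - S) = T" using T unfolding M' by blast
  have le': "step w M b \<le> z b \<and> z b \<le> step w M b + int N" if "b \<in> B" for b
    using Suc.prems(2)[OF that] that by (auto simp: step_def M_def rising_def)
  have TM: "T \<subseteq> rising B (step w M) z" using M by (auto simp: T_def rising_def step_def)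
  have IH: "climb n B N (step w M) z = step_braid n (step w M) T \<otimes>\<^bsub>braid_group n\<^esub> climb n B N (step (step w M) T) z"
    by (rule Suc.IH[OF spM le' TM]) (use spM' f1 in simp_all)
  have K1: "step_braid n w M = step_braid n w S \<otimes>\<^bsub>braid_group n\<^esub> step_braid n (step w S) (M - S)"
    by (rule step_braid_split[OF n Suc.prems(1) M(2,1) Suc.prems(4)])
  have K2: "step_braid n (step w S) M' = step_braid n (step w S) (M - S) \<otimes>\<^bsub>braid_group n\<^esub> step_braid n (step w M) T"
    using step_braid_split[OF n Suc.prems(4), of "M - S" M'] M(3) spM unfolding f2 d by (simp add: M')
  show ?case unfolding climb.simps(2) M_def[symmetric] M'_def[symmetric] f1 IH K1 K2
    by (simp add: m_assoc step_braid_carrier[OF n] climb_carrier[OF n])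
qed

text \<open>Appends a step at the upper end, by induction on the distance \<open>q\<close> to
  \<open>z\<close>. The condition \<open>q < N\<close> leaves one factor for the additional
  step.\<close>

lemma climb_extend:
  assumes n: "n \<ge> 3" and z: "spaced_int n B z" and S: "S \<subseteq> B" and sp: "spaced_int n B (step z S)" and q: "q < N"
    and w: "spaced_int n B w" and le: "\<And>b. b \<in> B \<Longrightarrow> w b \<le> z b \<and> z b \<le> w b + int q"
  shows "climb n B N w (step z S) = climb n B N w z \<otimes>\<^bsub>braid_group n\<^esub> step_braid n z S"
  using q w le
proof (induction q arbitrary: w)
  case 0
  have wz: "w b = z b" if "b \<in> B" for b using 0(3)[OF that] by simp
  have eqB: "step w S b = step z S b" if "b \<in> B" for b using wz[OF that] by (simp add: step_def)
  have "spaced_int n B (step w S)" using sp spaced_cong[of B "\<lambda>b. real_of_int (step w S b)" "\<lambda>b. real_of_int (step z S b)" n] eqB by simp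
  then have "climb n B N w (step z S) = step_braid n w S \<otimes>\<^bsub>braid_group n\<^esub> climb n B N (step w S) (step z S)"
    using S 0(1) wz by (intro climb_step[OF n sp 0(2)]) (auto simp: step_def rising_def)
  moreover have "climb n B N (step w S) (step z S) = \<one>\<^bsub>braid_group n\<^esub>" by (rule climb_trivial[OF n eqB])
  moreover have "climb n B N w z = \<one>\<^bsub>braid_group n\<^esub>" by (rule climb_trivial[OF n wz])
  moreover have "step_braid n w S = step_braid n z S" using wz S by (intro step_braid_cong) auto
  ultimately show ?case by (simp add: step_braid_carrier[OF n])
next
  case (Suc q)
  define M where "M = rising B w z"
  have spM: "spaced_int n B (step w M)" unfolding M_def using Suc.prems z by (intro spaced_rising) auto
  have le: "w b \<le> z b \<and> z b \<le> w b + int N" "w b \<le> step z S b \<and> step z S b \<le> w b + int N" if "b \<in> B" for b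
    using Suc.prems(3)[OF that] Suc.prems(1) by (auto simp: step_def)
  have MS: "M \<subseteq> rising B w (step z S)" by (auto simp: M_def rising_def step_def)
  have 1: "climb n B N w (step z S) = step_braid n w M \<otimes>\<^bsub>braid_group n\<^esub> climb n B N (step w M) (step z S)"
    by (rule climb_step[OF n sp Suc.prems(2) le(2) MS spM])
  have 2: "climb n B N w z = step_braid n w M \<otimes>\<^bsub>braid_group n\<^esub> climb n B N (step w M) z"
    by (rule climb_step[OF n z Suc.prems(2) le(1) _ spM]) (simp_all add: M_def)
  have "climb n B N (step w M) (step z S) = climb n B N (step w M) z \<otimes>\<^bsub>braid_group n\<^esub> step_braid n z S"
  proof (rule Suc.IH[OF _ spM])
    show "step w M b \<le> z b \<and> z b \<le> step w M b + int q" if "b \<in> B" for b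
      using Suc.prems(3)[OF that] that by (auto simp: step_def M_def rising_def)
  qed (use Suc.prems in simp)
  then show ?case unfolding 1 2 by (simp add: m_assoc step_braid_carrier[OF n] climb_carrier[OF n])
qed

section \<open>The move braid of a displacement\<close>

text \<open>The constant displacement \<open>- K\<close> serves as a common lower bound of \<open>0\<close> and \<open>z\<close>; the choice of \<open>K\<close>
  does not matter by \<open>move_braid_eq\<close> below.\<close>

definition climb_from :: "nat \<Rightarrow> nat set \<Rightarrow> nat \<Rightarrow> (nat \<Rightarrow> int) \<Rightarrow> (real \<Rightarrow> complex set) set" where
  "climb_from n B K z = climb n B (2 * K + 1) (\<lambda>_. - int K) z"

definition move_braid :: "nat \<Rightarrow> nat set \<Rightarrow> (nat \<Rightarrow> int) \<Rightarrow> (real \<Rightarrow> complex set) set" where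
  "move_braid n B z = (let K = nat (\<Sum>b\<in>B. \<bar>z b\<bar>) in
     inv\<^bsub>braid_group n\<^esub> (climb_from n B K (\<lambda>_. 0)) \<otimes>\<^bsub>braid_group n\<^esub> climb_from n B K z)"

lemma climb_from_carrier: "n \<ge> 3 \<Longrightarrow> climb_from n B K z \<in> carrier (braid_group n)"
  by (simp add: climb_from_def climb_carrier del: climb.simps)

text \<open>Starting one level lower prepends the simultaneous step of all of \<open>B\<close>. The
  bound \<open>2 * K + 1\<close> grows by two, and both surplus factors are trivial for targets of
  size at most \<open>K\<close>.\<close>

lemma climb_from_Suc:
  assumes n: "n \<ge> 3" and B: "B \<subseteq> {1..n}" and z: "spaced_int n B z" and le: "\<And>b. b \<in> B \<Longrightarrow> \<bar>z b\<bar> \<le> int K"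
  shows "climb_from n B (Suc K) z = step_braid n (\<lambda>_. - int (Suc K)) B \<otimes>\<^bsub>braid_group n\<^esub> climb_from n B K z"
proof -
  define w where "w = (\<lambda>_::nat. - int (Suc K))"
  define N where "N = 2 * K + 1"
  have w: "spaced_int n B w" unfolding w_def by (rule spaced_const[OF B])
  have stepw: "step w B b = - int K" if "b \<in> B" for b using that by (simp add: w_def step_def)
  have "climb n B (Suc (Suc N)) w z = step_braid n w B \<otimes>\<^bsub>braid_group n\<^esub> climb n B (Suc (Suc N)) (step w B) z"
  proof (rule climb_step[OF n z w])
    show "w b \<le> z b \<and> z b \<le> w b + int (Suc (Suc N))" if "b \<in> B" for b using le[OF that] by (auto simp: w_def N_def)
    show "B \<subseteq> rising B w z" using le by (force simp: rising_def w_def)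
    show "spaced_int n B (step w B)"
      using spaced_const[OF B, of "- real K"] spaced_cong[of B "\<lambda>b. real_of_int (step w B b)" "\<lambda>_. - real K" n] stepw by simp
  qed
  also have "climb n B (Suc (Suc N)) (step w B) z = climb n B (Suc (Suc N)) (\<lambda>_. - int K) z"
    by (rule climb_cong) (simp_all add: stepw)
  also have "\<dots> = climb n B (Suc N) (\<lambda>_. - int K) z" by (rule climb_Suc[OF n]) (use le in \<open>force simp: N_def\<close>)
  also have "\<dots> = climb n B N (\<lambda>_. - int K) z" by (rule climb_Suc[OF n]) (use le in \<open>force simp: N_def\<close>)
  finally show ?thesis by (simp add: climb_from_def w_def N_def del: climb.simps)
qed

text \<open>The prepended step is the same for the targets \<open>0\<close> and \<open>z\<close>, so
  it cancels in the quotient.\<close>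

lemma move_braid_eq:
  assumes n: "n \<ge> 3" and B: "B \<subseteq> {1..n}" and z: "spaced_int n B z" and le: "\<And>b. b \<in> B \<Longrightarrow> \<bar>z b\<bar> \<le> int K"
  shows "move_braid n B z = inv\<^bsub>braid_group n\<^esub> (climb_from n B K (\<lambda>_. 0)) \<otimes>\<^bsub>braid_group n\<^esub> climb_from n B K z"
proof -
  define L where "L K = inv\<^bsub>braid_group n\<^esub> (climb_from n B K (\<lambda>_. 0)) \<otimes>\<^bsub>braid_group n\<^esub> climb_from n B K z" for K
  note car = climb_from_carrier[OF n] step_braid_carrier[OF n]
  have level: "L (Suc K) = L K" if "\<And>b. b \<in> B \<Longrightarrow> \<bar>z b\<bar> \<le> int K" for K
  proof -
    define D where "D = step_braid n (\<lambda>_. - int (Suc K)) B"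
    have D: "D \<in> carrier (braid_group n)" unfolding D_def by (rule car(2))
    have eq: "climb_from n B (Suc K) z = D \<otimes>\<^bsub>braid_group n\<^esub> climb_from n B K z"
      unfolding D_def by (rule climb_from_Suc[OF n B z that])
    have eq0: "climb_from n B (Suc K) (\<lambda>_. 0) = D \<otimes>\<^bsub>braid_group n\<^esub> climb_from n B K (\<lambda>_. 0)"
      unfolding D_def by (rule climb_from_Suc[OF n B]) (use spaced_const[OF B, of 0] in simp_all)
    have "inv\<^bsub>braid_group n\<^esub> D \<otimes>\<^bsub>braid_group n\<^esub> (D \<otimes>\<^bsub>braid_group n\<^esub> climb_from n B K z) = climb_from n B K z"
      using D by (simp add: m_assoc[symmetric] car)
    then show ?thesis unfolding L_def eq eq0 using D by (simp add: inv_mult_group m_assoc car)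
  qed
  have add: "L (K + j) = L K" if "\<And>b. b \<in> B \<Longrightarrow> \<bar>z b\<bar> \<le> int K" for K j
  proof (induction j)
    case (Suc j)
    have "L (Suc (K + j)) = L (K + j)" by (rule level) (use that in force)
    then show ?case using Suc by simp
  qed simp
  define K' where "K' = nat (\<Sum>b\<in>B. \<bar>z b\<bar>)"
  have le': "\<bar>z b\<bar> \<le> int K'" if "b \<in> B" for b
    unfolding K'_def using finite_subset[OF B] that by (intro abs_le_displacement_sum) auto
  have "L K = L K'" using add[OF le, of K'] add[OF le', of K] by (simp add: add.commute)
  then show ?thesis by (simp add: move_braid_def L_def K'_def Let_def)
qed

lemma move_braid_carrier: "n \<ge> 3 \<Longrightarrow> move_braid n B z \<in> carrier (braid_group n)"
  by (simp add: move_braid_def climb_from_carrier Let_def)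

lemma move_braid_zero:
  assumes n: "n \<ge> 3"
  shows "move_braid n B (\<lambda>_. 0) = \<one>\<^bsub>braid_group n\<^esub>"
  by (simp add: move_braid_def climb_from_carrier[OF n] Let_def)

lemma move_braid_cong:
  assumes "\<And>b. b \<in> B \<Longrightarrow> z b = z' b"
  shows "move_braid n B z = move_braid n B z'"
proof -
  have "climb_from n B K z = climb_from n B K z'" for K
    unfolding climb_from_def by (rule climb_cong) (use assms in auto)
  moreover have "(\<Sum>b\<in>B. \<bar>z b\<bar>) = (\<Sum>b\<in>B. \<bar>z' b\<bar>)" using assms by (intro sum.cong) auto
  ultimately show ?thesis by (simp add: move_braid_def)
qed

lemma move_braid_step:
  assumes n: "n \<ge> 3" and B: "B \<subseteq> {1..n}" and z: "spaced_int n B z" and S: "S \<subseteq> B" and sp: "spaced_int n B (step z S)"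
  shows "move_braid n B (step z S) = move_braid n B z \<otimes>\<^bsub>braid_group n\<^esub> step_braid n z S"
proof -
  define K0 where "K0 = nat (\<Sum>b\<in>B. \<bar>z b\<bar>)"
  have le: "\<bar>z b\<bar> \<le> int K0" if "b \<in> B" for b
    unfolding K0_def using finite_subset[OF B] that by (intro abs_le_displacement_sum) auto
  \<comment> \<open>One level more than needed for \<open>z\<close>, so that the same lower bound
    also serves \<open>step z S\<close>.\<close>
  have le1: "\<bar>z b\<bar> \<le> int (Suc K0)" "\<bar>step z S b\<bar> \<le> int (Suc K0)" if "b \<in> B" for b
    using le[OF that] by (auto simp: step_def)
  have "climb_from n B (Suc K0) (step z S) = climb_from n B (Suc K0) z \<otimes>\<^bsub>braid_group n\<^esub> step_braid n z S"
    unfolding climb_from_def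
    by (rule climb_extend[OF n z S sp _ spaced_const[OF B], where q = "2 * Suc K0"]) (use le in force)+
  moreover have "move_braid n B z = inv\<^bsub>braid_group n\<^esub> (climb_from n B (Suc K0) (\<lambda>_. 0)) \<otimes>\<^bsub>braid_group n\<^esub> climb_from n B (Suc K0) z"
    using le1(1) by (rule move_braid_eq[OF n B z])
  moreover have "move_braid n B (step z S) = inv\<^bsub>braid_group n\<^esub> (climb_from n B (Suc K0) (\<lambda>_. 0)) \<otimes>\<^bsub>braid_group n\<^esub>
      climb_from n B (Suc K0) (step z S)"
    using le1(2) by (rule move_braid_eq[OF n B sp])
  ultimately show ?thesis by (simp add: m_assoc climb_from_carrier[OF n] step_braid_carrier[OF n])
qed

section \<open>Move braids as boundary motions\<close>

text \<open>On an edge the direction deviates from that of the midpoint by less than a quarter turn.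
  So the lift cannot make additional turns and rises by exactly one.\<close>

lemma edge_lift:
  fixes g :: "real \<Rightarrow> complex"
  assumes n: "n \<ge> 3" and g: "continuous_on {0..1} g" and i: "i = residue_rep n m"
    and ends: "g 0 = pt n i" "g 1 = pt n (cyc_succ n i)"
    and edge: "\<And>t. t \<in> {0..1} \<Longrightarrow> \<exists>r\<in>{0..1}. g t = (1 - r) *\<^sub>R pt n i + r *\<^sub>R pt n (cyc_succ n i)"
  obtains y where "continuous_on {0..1} y" "y 0 = real_of_int m" "y 1 = real_of_int m + 1"
    "\<And>t. t \<in> {0..1} \<Longrightarrow> radial n (circ n (y t)) = g t"
proof -
  have n0: "0 < n" using n by simp
  have pi: "pt n i = circ n (of_int m)" "pt n (cyc_succ n i) = circ n (of_int m + 1)"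
    using pt_residue_rep[OF n0, of m] pt_residue_rep[OF n0, of "m + 1"] by (simp_all add: i cyc_succ_residue_rep[OF n0])
  have fr: "g t \<in> frontier (polygon n)" if t: "t \<in> {0..1}" for t
  proof -
    obtain r where "r \<in> {0..1}" "g t = (1 - r) *\<^sub>R pt n i + r *\<^sub>R pt n (cyc_succ n i)" using edge[OF t] by blast
    then show ?thesis using edge_in_frontier[OF n, of i r] residue_rep_mem[OF n0, of m] i by simp
  qed
  note rad = radial_frontier[OF n fr]
  have "contractible {0..1::real}" by (simp add: convex_imp_contractible)
  moreover have "g 0 = of_real (norm (g 0)) * circ n (of_int m)" using ends(1) pi(1) by simp
  ultimately obtain y where y: "continuous_on {0..1} y" "y 0 = real_of_int m"
    "\<And>t. t \<in> {0..1} \<Longrightarrow> g t = of_real (norm (g t)) * circ n (y t)"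
    using circ_lift[OF _ g rad(2) _ _ n0, of 0 "real_of_int m"] by (metis atLeastAtMost_iff order_refl zero_le_one)
  have lift: "radial n (circ n (y t)) = g t" if t: "t \<in> {0..1}" for t
    using radial_scale[OF n, of "circ n (y t)" "norm (g t)"] y(3)[OF t] rad[OF t] by simp
  \<comment> \<open>The deviation of the lift from the midpoint of the edge. The component of
    \<open>g t\<close> along the normal of the edge is \<open>cos (pi / n)\<close>, hence the cosine
    of the deviation is positive and the values \<open>n / 4\<close> and \<open>- n / 4\<close> are
    avoided.\<close>
  define \<phi> where "\<phi> t = y t - real_of_int m - 1/2" for t
  have pos: "0 < cos (2 * pi * \<phi> t / n)" if t: "t \<in> {0..1}" for t
  proof -
    obtain r where r: "g t = (1 - r) *\<^sub>R pt n i + r *\<^sub>R pt n (cyc_succ n i)" using edge[OF t] by blast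
    define w where "w = circ n (of_int m + 1/2)"
    have a: "pt n i * cnj w = circ n (- (1/2))" "pt n (cyc_succ n i) * cnj w = circ n (1/2)"
      unfolding pi w_def circ_mult_cnj by (simp_all add: algebra_simps)
    have "g t * cnj w = (1 - r) *\<^sub>R circ n (- (1/2)) + r *\<^sub>R circ n (1/2)"
      unfolding r a[symmetric] by (simp add: algebra_simps)
    then have "Re (g t * cnj w) = (1 - r) * cos (pi / n) + r * cos (pi / n)" by (simp add: Re_circ)
    then have "Re (g t * cnj w) = cos (pi / n)" by (simp add: algebra_simps)
    moreover have "g t * cnj w = of_real (norm (g t)) * circ n (\<phi> t)"
      using y(3)[OF t] circ_mult_cnj[of n "y t" "real_of_int m + 1/2"]
      by (simp add: w_def \<phi>_def mult.assoc diff_diff_eq) (metis mult.assoc)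
    ultimately have "norm (g t) * cos (2 * pi * \<phi> t / n) = cos (pi / n)" by (simp add: Re_circ)
    then have "0 < norm (g t) * cos (2 * pi * \<phi> t / n)" using cos_pi_div_pos[OF n] by simp
    then show ?thesis using norm_ge_zero[of "g t"] by (metis zero_less_mult_pos mult.commute rad(2)[OF t] zero_less_norm_iff)
  qed
  have cont: "continuous_on {0..1} \<phi>" unfolding \<phi>_def using y(1) by (intro continuous_intros)
  have avoid: "\<phi> t \<noteq> - (real n / 4) \<and> \<phi> t \<noteq> real n / 4" if "t \<in> {0..1}" for t
  proof -
    have "2 * pi * (real n / 4) / n = pi / 2" "2 * pi * (- (real n / 4)) / n = - (pi / 2)" using n by auto
    then show ?thesis using pos[OF that] by (metis cos_minus cos_pi_half less_irrefl)
  qed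
  have "\<phi> 0 = - (1/2)" by (simp add: \<phi>_def y(2))
  then have start: "- (real n / 4) < \<phi> 0" "\<phi> 0 < real n / 4" using n by simp_all
  have "- (real n / 4) < \<phi> 1" "\<phi> 1 < real n / 4" using stays_between[OF cont avoid start, of 1] by simp_all
  then have "\<bar>y 1 - (real_of_int m + 1)\<bar> < n" using n unfolding \<phi>_def by linarith
  moreover have "circ n (y 1) = circ n (of_int m + 1)" using y(3)[of 1] ends(2) pi(2) by simp
  ultimately have "y 1 = real_of_int m + 1" using circ_eq_imp_eq[OF n0] by blast
  then show thesis using that y(1,2) lift by blast
qed

lemma boundary_motion_edges:
  assumes n: "n \<ge> 3" and mv: "corner_motion n mv"
    and edge: "\<And>b i. b \<in> B \<Longrightarrow> i = residue_rep n (int b + u b) \<Longrightarrow>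
      (\<forall>t\<in>{0..1}. mv i t = pt n i) \<and> z b = u b \<or>
      (\<forall>t\<in>{0..1}. \<exists>r\<in>{0..1}. mv i t = (1 - r) *\<^sub>R pt n i + r *\<^sub>R pt n (cyc_succ n i)) \<and>
      mv i 1 = pt n (cyc_succ n i) \<and> z b = u b + 1"
  shows "boundary_motion n B (motion_braid n mv) u z"
proof -
  have n0: "0 < n" using n by simp
  have "\<exists>y. continuous_on {0..1} y \<and> y 0 = real b + of_int (u b) \<and> y 1 = real b + of_int (z b) \<and>
      (\<forall>t\<in>{0..1}. radial n (circ n (y t)) = mv (residue_rep n (int b + u b)) t)" if b: "b \<in> B" for b
  proof -
    define i where "i = residue_rep n (int b + u b)"
    have i: "i \<in> {1..n}" unfolding i_def by (rule residue_rep_mem[OF n0])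
    note D = corner_motionD(1,2)[OF mv i]
    consider "\<forall>t\<in>{0..1}. mv i t = pt n i" "z b = u b"
      | "\<forall>t\<in>{0..1}. \<exists>r\<in>{0..1}. mv i t = (1 - r) *\<^sub>R pt n i + r *\<^sub>R pt n (cyc_succ n i)"
        "mv i 1 = pt n (cyc_succ n i)" "z b = u b + 1"
      using edge[OF b i_def] by blast
    then show ?thesis
    proof cases
      case 1
      then show ?thesis using radial_circ_displaced[OF n, of b "u b"] unfolding i_def[symmetric]
        by (intro exI[of _ "\<lambda>_. real b + of_int (u b)"]) simp
    next
      case 2
      obtain y where "continuous_on {0..1} y" "y 0 = real_of_int (int b + u b)" "y 1 = real_of_int (int b + u b) + 1"
        "\<And>t. t \<in> {0..1} \<Longrightarrow> radial n (circ n (y t)) = mv i t"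
        using edge_lift[OF n D(1) i_def D(2) 2(2) bspec[OF 2(1)]] by blast
      then show ?thesis using 2(3) unfolding i_def[symmetric] by (intro exI[of _ y]) simp
    qed
  qed
  then obtain y where y: "\<forall>b\<in>B. continuous_on {0..1} (y b) \<and> y b 0 = real b + of_int (u b) \<and> y b 1 = real b + of_int (z b) \<and>
      (\<forall>t\<in>{0..1}. radial n (circ n (y b t)) = mv (residue_rep n (int b + u b)) t)"
    by metis
  show ?thesis
  proof (rule boundary_motionI[OF motion_path_mem[OF mv], of B y])
    show "radial n (circ n (y b t)) \<in> motion_path n mv t" if "b \<in> B" "t \<in> {0..1}" for b t
      using y that residue_rep_mem[OF n0, of "int b + u b"] unfolding motion_path_def by force
  qed (use y in auto)
qed

lemma next_in_succ:
  assumes "cyc_succ n i \<in> A"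
  shows "next_in n A i = cyc_succ n i"
proof -
  have "(LEAST k. 0 < k \<and> (cyc_succ n ^^ k) i \<in> A) = 1" using assms by (intro Least_equality) auto
  then show ?thesis by (simp add: next_in_def)
qed

lemma thin_rotation_edge:
  assumes "cyc_succ n i \<in> A" "i \<in> A" "t \<in> {0..1}"
  shows "\<exists>r\<in>{0..1}. thin_rotation 1 n A i t = (1 - r) *\<^sub>R pt n i + r *\<^sub>R pt n (cyc_succ n i)"
proof (cases "card A = 2")
  case True
  \<comment> \<open>The bend goes towards the successor corner, which here is the end of the edge;
    it therefore amounts to an extra \<open>t * (1 - t) / 2\<close> along the edge.\<close>
  define r where "r = t + t * (1 - t) / 2"
  have "t * (1 - t) \<le> 1 * (1 - t)" "0 \<le> t * (1 - t)" using assms(3) mult_right_mono[of t 1 "1 - t"] by auto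
  then have "r \<in> {0..1}" using assms(3) by (auto simp: r_def)
  moreover have "thin_rotation 1 n A i t = (1 - r) *\<^sub>R pt n i + r *\<^sub>R pt n (cyc_succ n i)"
    using True assms(2) by (simp add: thin_rotation_def next_in_succ[OF assms(1)] r_def midpoint_def scaleR_conv_of_real field_simps)
  ultimately show ?thesis by blast
next
  case False
  then show ?thesis using assms by (intro bexI[of _ t]) (auto simp: thin_rotation_def next_in_succ[OF assms(1)])
qed

lemma thin_rotation_end:
  assumes "cyc_succ n i \<in> A" "i \<in> A"
  shows "thin_rotation e n A i 1 = pt n (cyc_succ n i)"
  using assms(2) by (simp add: thin_rotation_def next_in_succ[OF assms(1)])

text \<open>Removing a run start splits off the rotation of a single edge as last factor, and the
  induction handles the rest. If all corners move, there is no run start and the braid is the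
  rotation of the whole polygon.\<close>

lemma step_braid_motion:
  assumes n: "n \<ge> 3" and B: "B \<subseteq> {1..n}" and z: "spaced_int n B z" and "S \<subseteq> B" "spaced_int n B (step z S)"
  shows "boundary_motion n B (step_braid n z S) z (step z S)"
  using assms(4,5)
proof (induction "card S" arbitrary: S rule: less_induct)
  case less
  have n0: "0 < n" using n by simp
  note S = less.prems(1)
  define C where "C = displaced n S z"
  have C: "C \<subseteq> {1..n}" unfolding C_def by (rule displaced_subset[OF n0])
  define p where "p b = residue_rep n (int b + z b)" for b
  note inj = inj_on_displaced[OF n0 z, folded p_def]
  have CS: "C = p ` S" by (simp add: C_def displaced_def p_def)
  have finS: "finite S" using finite_subset[OF S] finite_subset[OF B] by simp
  consider "S = {}" | "C = {1..n}" | "S \<noteq> {}" "C \<noteq> {1..n}" by blast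
  then show ?case
  proof cases
    case 1
    then show ?thesis using boundary_motion_one[OF n] by (simp add: step_braid_empty[OF n])
  next
    case 2
    have "card S = n" using card_image[OF inj_on_subset[OF inj S]] 2 CS by simp
    then have Sn: "S = {1..n}" "B = S" using S B card_subset_eq[of "{1..n}" S] by auto
    have all: "2 \<le> card {1..n}" using n by simp
    have hd: "hull_disjoint n (insert {1..n} {})" by (simp add: hull_disjoint_def)
    have "dual_simple n {} = \<one>\<^bsub>braid_group n\<^esub>" by (rule dual_simple_trivial[OF n]) (auto simp: hull_disjoint_def)
    then have "step_braid n z S = rotation_braid n {1..n}"
      using dual_simple_insert[OF n _ hd] rotation_braid_carrier[OF n, of "{1..n}"] 2
      by (simp add: step_braid_def C_def[symmetric] runs_def)
    also have "\<dots> = motion_braid n (thin_rotation 1 n {1..n})"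
      by (rule rotation_braid_eq_thin[OF n _ all]) auto
    finally have eq: "step_braid n z S = motion_braid n (thin_rotation 1 n {1..n})" .
    show ?thesis unfolding eq
    proof (rule boundary_motion_edges[OF n thin_rotation_motion[OF n _ all]], goal_cases)
      case (4 b i)
      have pb: "i = p b" using 4 by (simp add: p_def)
      have m: "cyc_succ n (p b) \<in> {1..n}" "p b \<in> {1..n}" unfolding p_def by (rule cyc_succ_mem[OF n0], rule residue_rep_mem[OF n0])
      have "thin_rotation 1 n {1..n} (p b) 1 = pt n (cyc_succ n (p b))" by (rule thin_rotation_end[OF m])
      then show ?case using thin_rotation_edge[OF m] 4(1) Sn(2) unfolding pb by (simp add: step_def)
    qed auto
  next
    case 3
    have "C \<noteq> {}" using 3(1) CS by simp
    then obtain c where c: "c \<in> C" "c \<notin> cyc_succ n ` C" using exists_run_start[OF n0 C _ 3(2)] by blast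
    then obtain b0 where b0: "b0 \<in> S" "c = p b0" unfolding CS by blast
    define S' where "S' = S - {b0}"
    have S': "S' \<subseteq> B" "card S' < card S" using S card_Diff1_less[OF finS b0(1)] by (auto simp: S'_def)
    have C': "displaced n S' z = C - {c}"
      using displaced_diff[OF n0 z, of "{b0}" S] S b0 by (auto simp: S'_def C_def displaced_def p_def)
    have S'eq: "{b \<in> B. residue_rep n (int b + z b) \<in> C - {c}} = S'"
      unfolding C'[symmetric] displaced_def using inj_onD[OF inj] S'(1) unfolding p_def by blast
    have "cyc_succ n ` (C - {c}) \<inter> (displaced n B z - (C - {c})) = {}"
    proof -
      have "displaced n B z - C = displaced n (B - S) z" using displaced_diff[OF n0 z S subset_refl] by (simp add: C_def)
      then show ?thesis using step_blocked[OF n0 less.prems] c(2) unfolding C_def[symmetric] by blast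
    qed
    then have spS': "spaced_int n B (step z S')" using spaced_step[OF n0 z, of "C - {c}"] unfolding S'eq by blast
    have IH: "boundary_motion n B (step_braid n z S') z (step z S')" by (rule less.hyps[OF S'(2,1) spS'])
    \<comment> \<open>After the other points of \<open>S\<close> have moved, only \<open>b0\<close>
      stands at \<open>c\<close>, because \<open>step z S'\<close> is spaced, and nothing stands at
      the successor of \<open>c\<close>, because \<open>step z S\<close> is spaced.\<close>
    define A where "A = {c, cyc_succ n c}"
    have cn: "c \<in> {1..n}" using c(1) C by blast
    have A: "A \<subseteq> {1..n}" "card A = 2"
      using cn cyc_succ_mem[OF n0, of c] cyc_succ_neq[of n c] n by (auto simp: A_def)
    have dec: "step_braid n z S = step_braid n z S' \<otimes>\<^bsub>braid_group n\<^esub> rotation_braid n A"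
      using dual_simple_runs_step[OF n C c] unfolding step_braid_def C' C_def[symmetric] A_def .
    have eq: "rotation_braid n A = motion_braid n (thin_rotation 1 n A)"
      using A by (intro rotation_braid_eq_thin[OF n]) auto
    have "boundary_motion n B (rotation_braid n A) (step z S') (step z S)" unfolding eq
    proof (rule boundary_motion_edges[OF n thin_rotation_motion[OF n A(1)]], goal_cases)
      case (4 b q)
      note q_def = 4(2)
      show ?case
      proof (cases "b = b0")
        case True
        have q: "q = c" unfolding q_def b0(2) p_def by (simp add: True step_def S'_def)
        have m: "cyc_succ n c \<in> A" "c \<in> A" by (auto simp: A_def)
        have "thin_rotation 1 n A c 1 = pt n (cyc_succ n c)" by (rule thin_rotation_end[OF m])
        then show ?thesis using thin_rotation_edge[OF m] True b0(1) unfolding q by (simp add: step_def S'_def)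
      next
        case False
        have same: "step z S b = step z S' b" using False by (simp add: step_def S'_def)
        have "q \<noteq> c"
        proof
          assume "q = c"
          then have "residue_rep n (int b + step z S' b) = residue_rep n (int b0 + step z S' b0)"
            unfolding q_def b0(2) p_def by (simp add: step_def S'_def)
          then show False using inj_onD[OF inj_on_displaced[OF n0 spS']] 4(1) b0(1) S False by blast
        qed
        moreover have "q \<noteq> cyc_succ n c"
        proof
          assume "q = cyc_succ n c"
          then have "residue_rep n (int b + step z S b) = residue_rep n (int b0 + step z S b0)"
            unfolding q_def same b0(2) p_def cyc_succ_residue_rep[OF n0] using b0(1) by (simp add: step_def add.assoc)
          then show False using inj_onD[OF inj_on_displaced[OF n0 less.prems(2)]] 4(1) b0(1) S False by blast
        qed
        ultimately show ?thesis using same by (simp add: thin_rotation_def A_def)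
      qed
    qed (use A in auto)
    then show ?thesis
      unfolding dec by (rule boundary_motion_mult[OF step_braid_carrier[OF n] rotation_braid_carrier[OF n A(1)] IH])
  qed
qed

lemma boundary_motion_cong:
  "(\<And>b. b \<in> B \<Longrightarrow> u b = u' b) \<Longrightarrow> (\<And>b. b \<in> B \<Longrightarrow> z b = z' b) \<Longrightarrow> boundary_motion n B \<beta> u z = boundary_motion n B \<beta> u' z'"
  by (simp add: boundary_motion_def)

lemma move_braid_motion:
  assumes n: "n \<ge> 3" and B: "B \<subseteq> {1..n}" and z: "spaced_int n B z"
  shows "boundary_motion n B (move_braid n B z) (\<lambda>_. 0) z"
proof (rule spaced_connected[OF B z])
  show "boundary_motion n B (move_braid n B (\<lambda>_. 0)) (\<lambda>_. 0) (\<lambda>_. 0)"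
    unfolding move_braid_zero[OF n] by (rule boundary_motion_one[OF n])
  show "boundary_motion n B (move_braid n B z') (\<lambda>_. 0) z'"
    if "boundary_motion n B (move_braid n B z) (\<lambda>_. 0) z" "\<And>b. b \<in> B \<Longrightarrow> z b = z' b" for z z'
    using that move_braid_cong[OF that(2)] boundary_motion_cong[of B "\<lambda>_. 0" "\<lambda>_. 0" z z'] by simp
  fix z S assume z: "spaced_int n B z" and S: "S \<subseteq> B" and sp: "spaced_int n B (step z S)"
  note mb = move_braid_carrier[OF n] and sb = step_braid_carrier[OF n]
  note mot = step_braid_motion[OF n B z S sp] and eq = move_braid_step[OF n B z S sp]
  show "boundary_motion n B (move_braid n B z) (\<lambda>_. 0) z \<longleftrightarrow> boundary_motion n B (move_braid n B (step z S)) (\<lambda>_. 0) (step z S)"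
  proof
    assume "boundary_motion n B (move_braid n B z) (\<lambda>_. 0) z"
    then show "boundary_motion n B (move_braid n B (step z S)) (\<lambda>_. 0) (step z S)"
      unfolding eq using boundary_motion_mult[OF mb sb] mot by blast
  next
    assume a: "boundary_motion n B (move_braid n B (step z S)) (\<lambda>_. 0) (step z S)"
    have "move_braid n B z = move_braid n B (step z S) \<otimes>\<^bsub>braid_group n\<^esub> inv\<^bsub>braid_group n\<^esub> step_braid n z S"
      unfolding eq by (simp add: m_assoc mb sb)
    then show "boundary_motion n B (move_braid n B z) (\<lambda>_. 0) z"
      using boundary_motion_mult[OF mb inv_closed[OF sb] a boundary_motion_inv[OF sb mot]] by simp
  qed
qed

section \<open>The splitting\<close>

lemma out_edge_step:
  assumes n: "0 < n" and B: "B \<subseteq> {1..n}" and z: "spaced_int n B z" and C: "C \<in> out_edges n (displaced n B z)"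
  defines "S \<equiv> {b \<in> B. residue_rep n (int b + z b) \<in> C}"
  shows "S \<subseteq> B" "S \<noteq> {}" "displaced n S z = C" "spaced_int n B (step z S)"
    "cover_step n B (vertex n B z) C = vertex n B (step z S)"
proof -
  have C': "C \<noteq> {}" "C \<subseteq> displaced n B z" "cyc_succ n ` C \<inter> (displaced n B z - C) = {}" using C by (auto simp: out_edges_def)
  show S: "S \<subseteq> B" by (auto simp: S_def)
  show eq: "displaced n S z = C" using C'(2) by (auto simp: S_def displaced_def)
  then show "S \<noteq> {}" using C'(1) by (auto simp: displaced_def)
  show sp: "spaced_int n B (step z S)" unfolding S_def by (rule spaced_step[OF n z C'(3)])
  show "cover_step n B (vertex n B z) C = vertex n B (step z S)"
    using cover_step_vertex[OF n B z S sp] eq by (simp add: displaced_def)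
qed

lemma step_out_edge:
  assumes n: "0 < n" and z: "spaced_int n B z" and S: "S \<subseteq> B" "S \<noteq> {}" and sp: "spaced_int n B (step z S)"
  shows "displaced n S z \<in> out_edges n (displaced n B z)"
  unfolding out_edges_def
proof (intro CollectI conjI)
  show "displaced n S z \<noteq> {}" using S(2) by (simp add: displaced_def)
  show "displaced n S z \<subseteq> displaced n B z" using S(1) by (auto simp: displaced_def)
  show "cyc_succ n ` displaced n S z \<inter> (displaced n B z - displaced n S z) = {}"
    using step_blocked[OF n S(1) sp] displaced_diff[OF n z S(1) subset_refl] by simp
qed

lemma move_braid_cayley_edge:
  assumes n: "n \<ge> 3" and B: "B \<subseteq> {1..n}" and z: "spaced_int n B z" and S: "S \<subseteq> B" "S \<noteq> {}" and sp: "spaced_int n B (step z S)"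
  shows "cayley_edge n (move_braid n B z) (runs n (displaced n S z)) (move_braid n B (step z S))"
proof -
  have n0: "0 < n" using n by simp
  have "runs n (displaced n S z) \<in> noncrossing_proper n"
    by (rule out_edges_runs(3)[OF n displaced_subset[OF n0] step_out_edge[OF n0 z S sp]])
  then show ?thesis
    unfolding cayley_edge_def using move_braid_carrier[OF n] move_braid_step[OF n B z S(1) sp] by (simp add: step_braid_def)
qed

lemma move_braid_boundary:
  assumes n: "n \<ge> 3" and B: "B \<subseteq> {1..n}" and z: "spaced_int n B z"
  shows "move_braid n B z \<in> boundary_braids n B (displaced n B z)" "bdry n B (move_braid n B z) = displaced n B z"
  using boundary_motion_imp_boundary_braid[OF n move_braid_carrier[OF n] B move_braid_motion[OF assms]] bdry_eq[OF n] by auto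

text \<open>The restriction meets the extensionality demanded by \<open>is_split\<close>. The choice
  of \<open>z\<close> is harmless, since a vertex determines its displacement on
  \<open>B\<close>.\<close>

definition vertex_braid :: "nat \<Rightarrow> nat set \<Rightarrow> (real \<Rightarrow> complex set) set \<Rightarrow> (real \<Rightarrow> complex set) set" where
  "vertex_braid n B = (\<lambda>V\<in>cover_vertices n B. move_braid n B (SOME z. spaced_int n B z \<and> V = vertex n B z))"

lemma vertex_braid_vertex:
  assumes n: "n \<ge> 3" and B: "B \<subseteq> {1..n}" and z: "spaced_int n B z"
  shows "vertex_braid n B (vertex n B z) = move_braid n B z"
proof -
  have n0: "0 < n" using n by simp
  define z' where "z' = (SOME z'. spaced_int n B z' \<and> vertex n B z = vertex n B z')"
  have "spaced_int n B z' \<and> vertex n B z = vertex n B z'" unfolding z'_def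
    by (rule someI[of "\<lambda>z'. spaced_int n B z' \<and> vertex n B z = vertex n B z'" z]) (simp add: z)
  then have "move_braid n B z = move_braid n B z'" using vertex_inj[OF n0 B z, of z'] by (intro move_braid_cong) simp
  then show ?thesis using vertex_mem_cover[OF n0 B z] by (simp add: vertex_braid_def z'_def)
qed

lemma is_split_vertex_braid:
  assumes n: "n \<ge> 3" and B: "B \<subseteq> {1..n}"
  shows "is_split n B (vertex_braid n B)"
proof -
  have n0: "0 < n" using n by simp
  note vb = vertex_braid_vertex[OF n B] and mb = move_braid_carrier[OF n]
  have simplices: "vertex_braid n B ` X \<in> boundary_complex n B" if X: "X \<in> cover_complex n B" for X
  proof -
    obtain V K where VK: "X = insert V (cover_step n B V ` K)" "V \<in> cover_vertices n B" "K \<subseteq> out_edges n (cov n V)"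
      "\<forall>C\<in>K. \<forall>C'\<in>K. C \<subseteq> C' \<or> C' \<subseteq> C"
      using X unfolding cover_complex_def mem_Collect_eq by (elim exE conjE) (rule that)
    obtain z where z: "spaced_int n B z" "V = vertex n B z" using cover_vertexE[OF n0 B VK(2)] .
    have K: "K \<subseteq> out_edges n (displaced n B z)" using VK(3) unfolding z(2) cov_vertex[OF n0 B z(1)] .
    have "out_edges n (displaced n B z) \<subseteq> Pow {1..n}"
      using displaced_subset[OF n0, of B z] by (auto simp: out_edges_def)
    then have finK: "finite K" using K finite_subset by (metis finite_Pow_iff finite_atLeastAtMost subset_trans)
    define s where "s C = {b \<in> B. residue_rep n (int b + z b) \<in> C}" for C
    note oe = out_edge_step[OF n0 B z(1), folded s_def]
    \<comment> \<open>The vertices of the simplex as nested sets of moved points, the empty set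
      standing for the first vertex. Any two of them differ by a single step, which is an edge of
      the Cayley graph.\<close>
    define \<S> where "\<S> = insert {} (s ` K)"
    have \<S>: "T \<subseteq> B" "spaced_int n B (step z T)" if "T \<in> \<S>" for T
      using that oe(1,4) K z(1) by (auto simp: \<S>_def)
    have nested: "T \<subseteq> T' \<or> T' \<subseteq> T" if "T \<in> \<S>" "T' \<in> \<S>" for T T'
    proof -
      have "s C \<subseteq> s C' \<or> s C' \<subseteq> s C" if "C \<in> K" "C' \<in> K" for C C' using VK(4) that by (auto simp: s_def)
      then show ?thesis using that by (auto simp: \<S>_def)
    qed
    have im: "vertex_braid n B ` X = (\<lambda>T. move_braid n B (step z T)) ` \<S>"
    proof -
      have "vertex_braid n B (cover_step n B V C) = move_braid n B (step z (s C))" if "C \<in> K" for C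
        using oe(4,5)[of C] K that vb unfolding z(2) by auto
      then have "vertex_braid n B ` cover_step n B V ` K = (\<lambda>T. move_braid n B (step z T)) ` s ` K"
        by (simp add: image_image)
      then show ?thesis unfolding VK(1) \<S>_def image_insert using vb[OF z(1)] z(2) by simp
    qed
    have edge: "\<exists>\<pi>. cayley_edge n (move_braid n B (step z T)) \<pi> (move_braid n B (step z T'))"
      if T: "T \<in> \<S>" "T' \<in> \<S>" "T \<subseteq> T'" "T \<noteq> T'" for T T'
    proof -
      have eq: "step (step z T) (T' - T) = step z T'" using T(3) by (auto simp: step_def fun_eq_iff)
      have "T' - T \<subseteq> B" "T' - T \<noteq> {}" using \<S>(1)[OF T(2)] T(3,4) by auto
      then show ?thesis using move_braid_cayley_edge[OF n B \<S>(2)[OF T(1)], of "T' - T"] \<S>(2)[OF T(2)] unfolding eq by blast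
    qed
    show ?thesis unfolding boundary_complex_def braid_complex_def im
    proof (intro CollectI conjI ballI impI)
      show "finite ((\<lambda>T. move_braid n B (step z T)) ` \<S>)" using finK by (simp add: \<S>_def)
      show "(\<lambda>T. move_braid n B (step z T)) ` \<S> \<noteq> {}" by (simp add: \<S>_def)
      show "(\<lambda>T. move_braid n B (step z T)) ` \<S> \<subseteq> carrier (braid_group n)" using mb by blast
      show "(\<lambda>T. move_braid n B (step z T)) ` \<S> \<subseteq> boundary_braids_from n B"
        using move_braid_boundary(1)[OF n B \<S>(2)] unfolding boundary_braids_from_def by blast
      fix \<beta> \<gamma> assume "\<beta> \<in> (\<lambda>T. move_braid n B (step z T)) ` \<S>" "\<gamma> \<in> (\<lambda>T. move_braid n B (step z T)) ` \<S>" and ne: "\<beta> \<noteq> \<gamma>"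
      then obtain T T' where T: "T \<in> \<S>" "T' \<in> \<S>" "\<beta> = move_braid n B (step z T)" "\<gamma> = move_braid n B (step z T')" by blast
      have "T \<noteq> T'" using ne T by auto
      then show "\<exists>\<pi>. cayley_edge n \<beta> \<pi> \<gamma> \<or> cayley_edge n \<gamma> \<pi> \<beta>"
        using nested[OF T(1,2)] edge[OF T(1,2)] edge[OF T(2,1)] unfolding T(3,4) by blast
    qed
  qed
  have labels: "cayley_edge n (vertex_braid n B V) (runs n C) (vertex_braid n B (cover_step n B V C)) \<and>
      runs n C \<in> noncrossing n \<and> bdry n B (vertex_braid n B V) = cov n V \<and> cov n V \<subseteq> {1..n}"
    if V: "V \<in> cover_vertices n B" and C: "C \<in> out_edges n (cov n V)" for V C
  proof -
    obtain z where z: "spaced_int n B z" "V = vertex n B z" using cover_vertexE[OF n0 B V] .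
    have cov: "cov n V = displaced n B z" unfolding z(2) by (rule cov_vertex[OF n0 B z(1)])
    have sub: "displaced n B z \<subseteq> {1..n}" by (rule displaced_subset[OF n0])
    note oe = out_edge_step[OF n0 B z(1) C[unfolded cov]]
    have "runs n C \<in> noncrossing n"
      using out_edges_runs(2)[OF n sub C[unfolded cov]] by (simp add: noncrossing_boundary_def)
    then show ?thesis
      using move_braid_cayley_edge[OF n B z(1) oe(1,2,4)] move_braid_boundary(2)[OF n B z(1)] vb[OF z(1)] vb[OF oe(4)] sub
      unfolding cov unfolding z(2) oe(3,5) by simp
  qed
  show ?thesis unfolding is_split_def
  proof (intro conjI ballI allI impI)
    show "vertex_braid n B \<in> extensional (cover_vertices n B)" by (simp add: vertex_braid_def)
    show "vertex_braid n B ` X \<in> boundary_complex n B" if "X \<in> cover_complex n B" for X by (rule simplices[OF that])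
    show "bdry n B (vertex_braid n B V) = cov n V" if V: "V \<in> cover_vertices n B" for V
    proof -
      obtain z where z: "spaced_int n B z" "V = vertex n B z" using cover_vertexE[OF n0 B V] .
      show ?thesis unfolding z(2) vb[OF z(1)] cov_vertex[OF n0 B z(1)] by (rule move_braid_boundary(2)[OF n B z(1)])
    qed
    show "vertex_braid n B (cover_base n B) = \<one>\<^bsub>braid_group n\<^esub>"
      unfolding cover_base_eq using vb[of "\<lambda>_. 0"] spaced_const[OF B, of 0] move_braid_zero[OF n] by simp
    fix V C assume V: "V \<in> cover_vertices n B" and C: "C \<in> out_edges n (cov n V)"
    note L = labels[OF V C]
    then have sub: "cov n V \<subseteq> {1..n}" by blast
    note R = out_edges_runs[OF n sub C]
    show "\<exists>\<pi>. cayley_edge n (vertex_braid n B V) \<pi> (vertex_braid n B (cover_step n B V C)) \<and> bdry_edge n B (vertex_braid n B V) \<pi> = C"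
      using L R(1) by (intro exI[of _ "runs n C"]) (simp add: bdry_edge_def)
    fix \<pi> assume \<pi>: "cayley_edge n (vertex_braid n B V) \<pi> (vertex_braid n B (cover_step n B V C))"
    have nc: "\<pi> \<in> noncrossing n" "runs n C \<in> noncrossing n" using \<pi> L by (auto simp: cayley_edge_def noncrossing_proper_def)
    \<comment> \<open>The last condition concerns every label of the edge; cancelling the starting
      vertex and using injectivity shows that there is only one.\<close>
    have "dual_simple n \<pi> = dual_simple n (runs n C)"
    proof -
      have "vertex_braid n B V \<otimes>\<^bsub>braid_group n\<^esub> dual_simple n \<pi> = vertex_braid n B V \<otimes>\<^bsub>braid_group n\<^esub> dual_simple n (runs n C)"
        and "vertex_braid n B V \<in> carrier (braid_group n)"
        using \<pi> L unfolding cayley_edge_def by auto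
      then show ?thesis using nc dual_simple_carrier[OF n noncrossing_hull_disjoint] by (simp add: Units_eq)
    qed
    then have "\<pi> = runs n C" using dual_simple_inj[OF n] nc by blast
    then show "\<pi> \<in> noncrossing_boundary n (bdry n B (vertex_braid n B V))" "move_part n (bdry n B (vertex_braid n B V)) \<pi> = \<pi>"
      using R(2,4) L by auto
  qed
qed

text \<open>Each edge label of a splitting is forced to be the run partition of the moved points, so
  the value at one end determines the value at the other, and all vertices are connected to the base
  vertex.\<close>

lemma is_split_unique:
  assumes n: "n \<ge> 3" and B: "B \<subseteq> {1..n}" and \<psi>: "is_split n B \<psi>"
  shows "\<psi> = vertex_braid n B"
proof -
  have n0: "0 < n" using n by simp
  have ext: "\<psi> \<in> extensional (cover_vertices n B)" using \<psi> by (simp add: is_split_def)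
  have edge: "\<psi> (vertex n B (step z S)) = \<psi> (vertex n B z) \<otimes>\<^bsub>braid_group n\<^esub> step_braid n z S \<and>
      \<psi> (vertex n B z) \<in> carrier (braid_group n)"
    if z: "spaced_int n B z" and S: "S \<subseteq> B" "S \<noteq> {}" and sp: "spaced_int n B (step z S)" for z S
  proof -
    define C where "C = displaced n S z"
    define V where "V = vertex n B z"
    have V: "V \<in> cover_vertices n B" unfolding V_def by (rule vertex_mem_cover[OF n0 B z])
    have cov: "cov n V = displaced n B z" unfolding V_def by (rule cov_vertex[OF n0 B z])
    have C: "C \<in> out_edges n (cov n V)" unfolding C_def cov by (rule step_out_edge[OF n0 z S sp])
    have cs: "cover_step n B V C = vertex n B (step z S)"
      using cover_step_vertex[OF n0 B z S(1) sp] by (simp add: C_def V_def displaced_def)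
    have bd: "bdry n B (\<psi> V) = displaced n B z" using \<psi> V cov unfolding is_split_def by simp
    note C1 = \<psi>[unfolded is_split_def, THEN conjunct2, THEN conjunct2, THEN conjunct2]
    obtain \<pi> where \<pi>: "cayley_edge n (\<psi> V) \<pi> (\<psi> (cover_step n B V C))" "bdry_edge n B (\<psi> V) \<pi> = C"
      using bspec[OF bspec[OF C1[THEN conjunct1] V] C] by (elim exE conjE) (rule that)
    have nb: "\<pi> \<in> noncrossing_boundary n (displaced n B z)" "move_part n (displaced n B z) \<pi> = \<pi>"
      using mp[OF spec[OF bspec[OF bspec[OF C1[THEN conjunct2, THEN conjunct2] V] C]] \<pi>(1)] unfolding bd by simp_all
    have "\<pi> = runs n {b \<in> displaced n B z. {b} \<notin> \<pi>}" by (rule move_part_self[OF n displaced_subset[OF n0] nb])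
    then have "\<pi> = runs n C" using \<pi>(2) unfolding bdry_edge_def bd by simp
    then show ?thesis using \<pi>(1) unfolding cs by (simp add: cayley_edge_def step_braid_def C_def V_def)
  qed
  have "\<psi> (vertex n B z) = move_braid n B z" if z: "spaced_int n B z" for z
  proof (rule spaced_connected[OF B z])
    show "\<psi> (vertex n B (\<lambda>_. 0)) = move_braid n B (\<lambda>_. 0)"
      using \<psi> unfolding is_split_def cover_base_eq move_braid_zero[OF n] by blast
    show "\<psi> (vertex n B z') = move_braid n B z'" if "\<psi> (vertex n B z) = move_braid n B z" "\<And>b. b \<in> B \<Longrightarrow> z b = z' b" for z z'
      using that vertex_cong[OF that(2)] move_braid_cong[OF that(2)] by simp
    show "\<psi> (vertex n B z) = move_braid n B z \<longleftrightarrow> \<psi> (vertex n B (step z S)) = move_braid n B (step z S)"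
      if "spaced_int n B z" "S \<subseteq> B" "S \<noteq> {}" "spaced_int n B (step z S)" for z S
      using edge[OF that] move_braid_step[OF n B that(1,2,4)] move_braid_carrier[OF n] step_braid_carrier[OF n]
      by (metis right_cancel)
  qed
  then have "\<psi> V = vertex_braid n B V" if "V \<in> cover_vertices n B" for V
    using cover_vertexE[OF n0 B that] vertex_braid_vertex[OF n B] by metis
  then show ?thesis using ext by (intro extensionalityI[of _ "cover_vertices n B"]) (auto simp: vertex_braid_def)
qed

lemma move_braids_eq:
  assumes n: "n \<ge> 3" and B: "B \<subseteq> {1..n}"
  shows "move_braids n B = {move_braid n B z | z. spaced_int n B z}"
proof -
  have n0: "0 < n" using n by simp
  have "split_map n B = vertex_braid n B"
    unfolding split_map_def using is_split_vertex_braid[OF assms] is_split_unique[OF assms] by (rule the_equality)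
  moreover have "\<mu> \<in> vertex_braid n B ` cover_vertices n B \<longleftrightarrow> (\<exists>z. \<mu> = move_braid n B z \<and> spaced_int n B z)" for \<mu>
  proof
    assume "\<mu> \<in> vertex_braid n B ` cover_vertices n B"
    then obtain V where V: "V \<in> cover_vertices n B" "\<mu> = vertex_braid n B V" by (rule imageE)
    obtain z where z: "spaced_int n B z" "V = vertex n B z" using cover_vertexE[OF n0 B V(1)] .
    then show "\<exists>z. \<mu> = move_braid n B z \<and> spaced_int n B z" using V(2) vertex_braid_vertex[OF n B z(1)] by auto
  next
    assume "\<exists>z. \<mu> = move_braid n B z \<and> spaced_int n B z"
    then obtain z where z: "\<mu> = move_braid n B z" "spaced_int n B z" by (elim exE conjE)
    show "\<mu> \<in> vertex_braid n B ` cover_vertices n B"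
      using vertex_mem_cover[OF n0 B z(2)] vertex_braid_vertex[OF n B z(2)] z(1) by (intro image_eqI[of _ _ "vertex n B z"]) auto
  qed
  ultimately show ?thesis unfolding move_braids_def set_eq_iff by simp
qed

section \<open>The factorisation\<close>

theorem theorem1:
  fixes n :: nat and B :: "nat set" and \<beta> :: "(real \<Rightarrow> complex set) set"
  assumes "n \<ge> 3"
    and "B \<subseteq> {1..n}"
    and "\<beta> \<in> boundary_braids_from n B"
  shows "\<exists>!(\<phi>, \<mu>). \<phi> \<in> fix_braids n B \<and> \<mu> \<in> move_braids n B \<and> \<beta> = \<phi> \<otimes>\<^bsub>braid_group n\<^esub> \<mu>"
proof -
  note n = assms(1) and B = assms(2)
  note mb = move_braid_carrier[OF n]
  obtain B' where bb: "\<beta> \<in> boundary_braids n B B'" using assms(3) by (auto simp: boundary_braids_from_def)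
  then have \<beta>: "\<beta> \<in> carrier (braid_group n)" by (simp add: boundary_braids_def)
  obtain z where bm: "boundary_motion n B \<beta> (\<lambda>_. 0) z" using boundary_braid_imp_boundary_motion[OF n bb] .
  have z: "spaced_int n B z" by (rule boundary_motion_spaced[OF n \<beta> B bm])
  define \<mu> where "\<mu> = move_braid n B z"
  \<comment> \<open>The inverse of \<open>\<mu>\<close> takes the boundary points back from the
    displacement \<open>z\<close> to \<open>0\<close>, so the total displacement of
    \<open>\<phi>\<close> is zero and the straightening applies.\<close>
  define \<phi> where "\<phi> = \<beta> \<otimes>\<^bsub>braid_group n\<^esub> inv\<^bsub>braid_group n\<^esub> \<mu>"
  have \<mu>: "\<mu> \<in> carrier (braid_group n)" by (simp add: \<mu>_def mb)
  have \<phi>: "\<phi> \<in> carrier (braid_group n)" using \<beta> \<mu> by (simp add: \<phi>_def)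
  have "boundary_motion n B \<phi> (\<lambda>_. 0) (\<lambda>_. 0)" unfolding \<phi>_def
    by (rule boundary_motion_mult[OF \<beta> inv_closed[OF \<mu>] bm boundary_motion_inv[OF \<mu>]])
      (simp add: \<mu>_def move_braid_motion[OF n B z])
  then have fix\<phi>: "\<phi> \<in> fix_braids n B" by (rule boundary_motion_zero_imp_fix[OF n \<phi> B])
  have eq: "\<beta> = \<phi> \<otimes>\<^bsub>braid_group n\<^esub> \<mu>" using \<beta> \<mu> by (simp add: \<phi>_def m_assoc)
  have uniq: "\<phi>' = \<phi> \<and> \<mu>' = \<mu>"
    if h: "\<phi>' \<in> fix_braids n B" "\<mu>' \<in> move_braids n B" "\<beta> = \<phi>' \<otimes>\<^bsub>braid_group n\<^esub> \<mu>'" for \<phi>' \<mu>'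
  proof -
    have \<phi>': "\<phi>' \<in> carrier (braid_group n)" using h(1) by (simp add: fix_braids_def)
    obtain z' where z': "\<mu>' = move_braid n B z'" "spaced_int n B z'" using h(2) move_braids_eq[OF n B] by auto
    have "boundary_motion n B \<beta> (\<lambda>_. 0) z'" unfolding h(3) z'(1)
      by (rule boundary_motion_mult[OF \<phi>' mb fix_braid_boundary_motion[OF n B h(1)] move_braid_motion[OF n B z'(2)]])
    then have "z' b = z b" if "b \<in> B" for b using boundary_motion_unique[OF n \<beta> _ bm that] by blast
    then have "\<mu>' = \<mu>" unfolding \<mu>_def z'(1) by (rule move_braid_cong)
    moreover have "\<phi>' \<otimes>\<^bsub>braid_group n\<^esub> \<mu> = \<phi> \<otimes>\<^bsub>braid_group n\<^esub> \<mu>" using h(3) eq calculation by simp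
    then have "\<phi>' = \<phi>" using \<mu> \<phi> \<phi>' by simp
    ultimately show ?thesis by simp
  qed
  have "\<mu> \<in> move_braids n B" using z unfolding \<mu>_def move_braids_eq[OF n B] by blast
  then have "case (\<phi>, \<mu>) of (\<phi>, \<mu>) \<Rightarrow> \<phi> \<in> fix_braids n B \<and> \<mu> \<in> move_braids n B \<and> \<beta> = \<phi> \<otimes>\<^bsub>braid_group n\<^esub> \<mu>"
    using fix\<phi> eq by simp
  then show ?thesis
  proof (rule ex1I)
    fix p assume p: "case p of (\<phi>, \<mu>) \<Rightarrow> \<phi> \<in> fix_braids n B \<and> \<mu> \<in> move_braids n B \<and> \<beta> = \<phi> \<otimes>\<^bsub>braid_group n\<^esub> \<mu>"
    show "p = (\<phi>, \<mu>)"
    proof (cases p)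
      case (Pair \<phi>' \<mu>')
      then show ?thesis using p uniq[of \<phi>' \<mu>'] by simp
    qed
  qed
qed

end
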